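(* Let $\mathcal Q\in\{\mathcal Q[\bigcirc,\Diamond],\mathcal Q[\Diamond],\mathcal Q_p[\bigcirc,\Diamond],\mathcal Q_p[\Diamond]\}$. Then $\mathsf{QBE}(\textsl{LTL}_{horn}^{\Box\bigcirc},\mathcal Q)$ and $\mathsf{QBE}^{\mathsf b+}_{\mathsf b-}(\textsl{LTL}_{horn}^{\Box\bigcirc},\mathcal Q)$ are both PSPACE-complete for combined complexity.
   Context: LTL strict semantics over $\mathbb N$: $\mathcal I,n\models\varphi\,\mathcal U\,\psi$ iff there is $m>n$ with $\mathcal I,m\models\psi$ and $\mathcal I,k\models\varphi$ for all $n<k<m$; $\bigcirc\varphi\equiv\bot\,\mathcal U\,\varphi$, $\Diamond\varphi\equiv\top\,\mathcal U\,\varphi$, $\Box\varphi\equiv\neg\Diamond\neg\varphi$. An $\textsl{LTL}_{horn}^{\Box\bigcirc}$-ontology is a finite set of axioms $C_1\wedge\dots\wedge C_k\to C_{k+1}$ where $C::=A\mid\bot\mid\Box C\mid\bigcirc C$ ($A$ an atom); a model of an ontology is an interpretation in which every axiom holds at every $n\in\mathbb N$. A data instance $\mathcal D$ is a finite set of facts $A(\ell)$, $\ell\in\mathbb N$; $\mathcal O,\mathcal D\models\varkappa(0)$ means $\mathcal I,0\models\varkappa$ in every model $\mathcal I$ of $\mathcal O$ in which all facts of $\mathcal D$ hold. Queries: built from atoms, $\top,\bot$ with $\wedge$ and temporal operators; $\mathcal Q[\Phi]$ uses only operators in $\Phi$. $\mathcal Q_p[\bigcirc,\Diamond]$: queries $\rho_0\wedge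 o_1(\rho_1\wedge o_2(\dots\wedge o_n\rho_n))$ with $o_i\in\{\bigcirc,\Diamond\}$ and $\rho_i$ (possibly empty) conjunctions of atoms; $\mathcal Q_p[\Diamond]$: all $o_i=\Diamond$. An example set $E=(E^+,E^-)$ of finite sets of data instances is $\mathcal Q$-separable under $\mathcal O$ if some $\varkappa\in\mathcal Q$ has $\mathcal O,\mathcal D\models\varkappa(0)$ for all $\mathcal D\in E^+$ and $\mathcal O,\mathcal D\not\models\varkappa(0)$ for all $\mathcal D\in E^-$. $\mathsf{QBE}(\mathcal L,\mathcal Q)$: given an $\mathcal L$-ontology and an example set, decide $\mathcal Q$-separability; $\mathsf{QBE}^{\mathsf b+}_{\mathsf b-}$ restricts to inputs where the numbers of positive and negative examples are bounded by fixed constants. Combined complexity: ontology and examples are both input; sizes count symbols, timestamps in unary. *)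

theory Defs
  imports "HOL-Computational_Algebra.Polynomial"
begin

section \<open>Linear temporal logic over the natural numbers\<close>

datatype ltl =
    Atom nat
  | Top
  | Bot
  | Neg ltl
  | And ltl ltl
  | Until ltl ltl

abbreviation Imp :: "ltl \<Rightarrow> ltl \<Rightarrow> ltl" where
  "Imp \<phi> \<psi> \<equiv> Neg (And \<phi> (Neg \<psi>))"

abbreviation Next :: "ltl \<Rightarrow> ltl" where
  "Next \<phi> \<equiv> Until Bot \<phi>"

abbreviation Eventually :: "ltl \<Rightarrow> ltl" where
  "Eventually \<phi> \<equiv> Until Top \<phi>"

abbreviation Always :: "ltl \<Rightarrow> ltl" where
  "Always \<phi> \<equiv> Neg (Eventually (Neg \<phi>))"

fun Conj :: "ltl list \<Rightarrow> ltl" where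
  "Conj [] = Top"
| "Conj (\<phi> # \<phi>s) = And \<phi> (Conj \<phi>s)"

type_synonym interp = "nat \<Rightarrow> nat set" \<comment> \<open>the atoms true at each time point\<close>

text \<open>The semantics of \<^const>\<open>Until\<close> is strict: the current time point is not taken into account.\<close>

fun sat :: "interp \<Rightarrow> nat \<Rightarrow> ltl \<Rightarrow> bool" where
  "sat I n (Atom a) \<longleftrightarrow> a \<in> I n"
| "sat I n Top \<longleftrightarrow> True"
| "sat I n Bot \<longleftrightarrow> False"
| "sat I n (Neg \<phi>) \<longleftrightarrow> \<not> sat I n \<phi>"
| "sat I n (And \<phi> \<psi>) \<longleftrightarrow> sat I n \<phi> \<and> sat I n \<psi>"
| "sat I n (Until \<phi> \<psi>) \<longleftrightarrow> (\<exists>m>n. sat I m \<psi> \<and> (\<forall>k. n < k \<and> k < m \<longrightarrow> sat I k \<phi>))"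

lemma sat_Next: "sat I n (Next \<phi>) \<longleftrightarrow> sat I (Suc n) \<phi>"
proof
  assume "sat I n (Next \<phi>)"
  then obtain m where m: "m > n" "sat I m \<phi>" "\<And>k. \<not> (n < k \<and> k < m)"
    by auto
  from m(1) m(3)[of "Suc n"] have "m = Suc n"
    by auto
  with m(2) show "sat I (Suc n) \<phi>"
    by simp
next
  assume "sat I (Suc n) \<phi>"
  then show "sat I n (Next \<phi>)"
    by (auto intro!: exI[of _ "Suc n"])
qed

lemma sat_Eventually: "sat I n (Eventually \<phi>) \<longleftrightarrow> (\<exists>m>n. sat I m \<phi>)"
  by simp

lemma sat_Always: "sat I n (Always \<phi>) \<longleftrightarrow> (\<forall>m>n. sat I m \<phi>)"
  by simp

lemma sat_Imp: "sat I n (Imp \<phi> \<psi>) \<longleftrightarrow> (sat I n \<phi> \<longrightarrow> sat I n \<psi>)"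
  by simp

lemma sat_Conj: "sat I n (Conj \<phi>s) \<longleftrightarrow> (\<forall>\<phi>\<in>set \<phi>s. sat I n \<phi>)"
  by (induction \<phi>s) auto


section \<open>Ontologies, data instances and entailment\<close>

type_synonym ontology = "ltl set"

type_synonym data_instance = "(nat \<times> nat) set" \<comment> \<open>\<open>(a, l)\<close> is the fact that atom \<open>a\<close> holds at time \<open>l\<close>\<close>

definition model :: "interp \<Rightarrow> ontology \<Rightarrow> bool" where
  "model I Ont \<longleftrightarrow> (\<forall>\<alpha>\<in>Ont. \<forall>n. sat I n \<alpha>)"

definition satisfies_data :: "interp \<Rightarrow> data_instance \<Rightarrow> bool" where
  "satisfies_data I D \<longleftrightarrow> (\<forall>(a, l)\<in>D. a \<in> I l)"

definition entails :: "ontology \<Rightarrow> data_instance \<Rightarrow> ltl \<Rightarrow> bool" where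
  "entails Ont D \<kappa> \<longleftrightarrow> (\<forall>I. model I Ont \<and> satisfies_data I D \<longrightarrow> sat I 0 \<kappa>)"

inductive_set horn_literals :: "ltl set" where
  "Atom a \<in> horn_literals"
| "Bot \<in> horn_literals"
| "C \<in> horn_literals \<Longrightarrow> Always C \<in> horn_literals"
| "C \<in> horn_literals \<Longrightarrow> Next C \<in> horn_literals"

text \<open>The body of an axiom may be empty, in which case it is \<^const>\<open>Top\<close>.\<close>

definition horn_axioms :: "ltl set" where
  "horn_axioms = {Imp (Conj Cs) C | Cs C. set Cs \<subseteq> horn_literals \<and> C \<in> horn_literals}"

definition LTL_horn :: "ontology set" where
  "LTL_horn = {Ont. finite Ont \<and> Ont \<subseteq> horn_axioms}"


section \<open>Queries and separability\<close>

text \<open>The parameter \<open>\<Phi>\<close> is the set of admitted unary temporal operators, such as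
  \<open>{Next, Eventually}\<close> or \<open>{Eventually}\<close>.\<close>

inductive_set queries :: "(ltl \<Rightarrow> ltl) set \<Rightarrow> ltl set" for \<Phi> where
  "Atom a \<in> queries \<Phi>"
| "Top \<in> queries \<Phi>"
| "Bot \<in> queries \<Phi>"
| "\<lbrakk>\<kappa> \<in> queries \<Phi>; \<kappa>' \<in> queries \<Phi>\<rbrakk> \<Longrightarrow> And \<kappa> \<kappa>' \<in> queries \<Phi>"
| "\<lbrakk>op \<in> \<Phi>; \<kappa> \<in> queries \<Phi>\<rbrakk> \<Longrightarrow> op \<kappa> \<in> queries \<Phi>"

inductive_set path_queries :: "(ltl \<Rightarrow> ltl) set \<Rightarrow> ltl set" for \<Phi> where
  "Conj (map Atom As) \<in> path_queries \<Phi>"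
| "\<lbrakk>op \<in> \<Phi>; \<kappa> \<in> path_queries \<Phi>\<rbrakk> \<Longrightarrow> And (Conj (map Atom As)) (op \<kappa>) \<in> path_queries \<Phi>"

definition separable ::
  "ltl set \<Rightarrow> ontology \<Rightarrow> data_instance set \<Rightarrow> data_instance set \<Rightarrow> bool" where
  "separable Q Ont Epos Eneg \<longleftrightarrow>
     (\<exists>\<kappa>\<in>Q. (\<forall>D\<in>Epos. entails Ont D \<kappa>) \<and> (\<forall>D\<in>Eneg. \<not> entails Ont D \<kappa>))"


section \<open>Encoding of inputs as bit strings\<close>

text \<open>Every encoding below is prefix-free, so encodings can be concatenated without separators.
  Names of atoms are in binary (each bit is preceded by \<^const>\<open>True\<close>, and \<^const>\<open>False\<close> marks
  the end), timestamps are in unary.\<close>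

fun enc_name :: "nat \<Rightarrow> bool list" where
  "enc_name n = (if n = 0 then [False] else True # odd n # enc_name (n div 2))"

declare enc_name.simps [simp del]

definition enc_unary :: "nat \<Rightarrow> bool list" where
  "enc_unary n = replicate n True @ [False]"

fun enc_ltl :: "ltl \<Rightarrow> bool list" where
  "enc_ltl (Atom a) = [False, False, False] @ enc_name a"
| "enc_ltl Top = [False, False, True]"
| "enc_ltl Bot = [False, True, False]"
| "enc_ltl (Neg \<phi>) = [False, True, True] @ enc_ltl \<phi>"
| "enc_ltl (And \<phi> \<psi>) = [True, False, False] @ enc_ltl \<phi> @ enc_ltl \<psi>"
| "enc_ltl (Until \<phi> \<psi>) = [True, False, True] @ enc_ltl \<phi> @ enc_ltl \<psi>"

definition enc_fact :: "nat \<times> nat \<Rightarrow> bool list" where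
  "enc_fact f = enc_name (fst f) @ enc_unary (snd f)"

fun enc_list :: "('a \<Rightarrow> bool list) \<Rightarrow> 'a list \<Rightarrow> bool list" where
  "enc_list enc [] = [False]"
| "enc_list enc (x # xs) = True # enc x @ enc_list enc xs"

text \<open>Finite sets are presented by listing their elements.\<close>

definition enc_input ::
  "ltl list \<Rightarrow> (nat \<times> nat) list list \<Rightarrow> (nat \<times> nat) list list \<Rightarrow> bool list" where
  "enc_input Os Ps Ns =
     enc_list enc_ltl Os @ enc_list (enc_list enc_fact) Ps @ enc_list (enc_list enc_fact) Ns"

lemma enc_name_prefix_free: "enc_name a @ u = enc_name b @ v \<Longrightarrow> a = b \<and> u = v"
proof (induction a arbitrary: b rule: less_induct)
  case (less a)
  show ?case
  proof (cases "a = 0 \<or> b = 0")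
    case True
    with less.prems show ?thesis
      by (auto simp: enc_name.simps[of a] enc_name.simps[of b] split: if_splits)
  next
    case False
    with less.prems have par: "odd a = odd b"
      and tails: "enc_name (a div 2) @ u = enc_name (b div 2) @ v"
      by (auto simp: enc_name.simps[of a] enc_name.simps[of b])
    have "a div 2 = b div 2 \<and> u = v"
      by (rule less.IH[OF _ tails]) (use False in auto)
    with par show ?thesis
      by (metis bit_eq_rec)
  qed
qed

lemma enc_unary_prefix_free: "enc_unary a @ u = enc_unary b @ v \<Longrightarrow> a = b \<and> u = v"
proof (induction a arbitrary: b)
  case 0
  then show ?case by (cases b) (auto simp: enc_unary_def)
next
  case (Suc a)
  then show ?case by (cases b) (auto simp: enc_unary_def)
qed

lemma enc_ltl_prefix_free: "enc_ltl \<phi> @ u = enc_ltl \<psi> @ v \<Longrightarrow> \<phi> = \<psi> \<and> u = v"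
proof (induction \<phi> arbitrary: \<psi> u v)
  case (Atom a)
  then show ?case by (cases \<psi>) (auto dest: enc_name_prefix_free)
next
  case Top
  then show ?case by (cases \<psi>) auto
next
  case Bot
  then show ?case by (cases \<psi>) auto
next
  case (Neg \<phi>)
  from Neg.prems show ?case by (cases \<psi>) (auto dest: Neg.IH)
next
  case (And \<phi>1 \<phi>2)
  from And.prems show ?case by (cases \<psi>) (auto dest!: And.IH)
next
  case (Until \<phi>1 \<phi>2)
  from Until.prems show ?case by (cases \<psi>) (auto dest!: Until.IH)
qed

lemma enc_fact_prefix_free: "enc_fact f @ u = enc_fact g @ v \<Longrightarrow> f = g \<and> u = v"
  by (auto simp: enc_fact_def prod_eq_iff dest!: enc_name_prefix_free enc_unary_prefix_free)

lemma enc_list_prefix_free: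
  assumes "\<And>x y u v. enc x @ u = enc y @ v \<Longrightarrow> x = y \<and> u = v"
  shows "enc_list enc xs @ u = enc_list enc ys @ v \<Longrightarrow> xs = ys \<and> u = v"
proof (induction xs arbitrary: ys)
  case Nil
  then show ?case by (cases ys) auto
next
  case (Cons x xs)
  from Cons.prems show ?case by (cases ys) (auto dest!: assms Cons.IH)
qed

lemma enc_input_inject:
  assumes "enc_input Os Ps Ns = enc_input Os' Ps' Ns'"
  shows "Os = Os' \<and> Ps = Ps' \<and> Ns = Ns'"
proof -
  have ont: "xs = ys \<and> u = v"
    if "enc_list enc_ltl xs @ u = enc_list enc_ltl ys @ v" for xs ys u v
    using enc_list_prefix_free[of enc_ltl, OF _ that] enc_ltl_prefix_free by blast
  have dat: "xs = ys \<and> u = v"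
    if "enc_list enc_fact xs @ u = enc_list enc_fact ys @ v" for xs ys u v
    using enc_list_prefix_free[of enc_fact, OF _ that] enc_fact_prefix_free by blast
  have exs: "xs = ys \<and> u = v"
    if "enc_list (enc_list enc_fact) xs @ u = enc_list (enc_list enc_fact) ys @ v" for xs ys u v
    using enc_list_prefix_free[of "enc_list enc_fact", OF _ that] dat by blast
  from assms show ?thesis
    unfolding enc_input_def using exs[of Ns "[]" Ns' "[]"] by (auto dest!: ont exs)
qed


section \<open>Query by example as a decision problem\<close>

definition QBE :: "ontology set \<Rightarrow> ltl set \<Rightarrow> bool list set" where
  "QBE L Q =
     {enc_input Os Ps Ns | Os Ps Ns.
        set Os \<in> L \<and> separable Q (set Os) (set ` set Ps) (set ` set Ns)}"

definition QBE_bounded :: "nat \<Rightarrow> nat \<Rightarrow> ontology set \<Rightarrow> ltl set \<Rightarrow> bool list set" where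
  "QBE_bounded bpos bneg L Q =
     {enc_input Os Ps Ns | Os Ps Ns.
        set Os \<in> L \<and> separable Q (set Os) (set ` set Ps) (set ` set Ns) \<and>
        card (set ` set Ps) \<le> bpos \<and> card (set ` set Ns) \<le> bneg}"


section \<open>Turing machines\<close>

text \<open>Deterministic machines with finitely many two-way infinite tapes. States and tape symbols
  are initial segments of the natural numbers; symbol 0 is the blank, 1 and 2 stand for the
  bits \<^const>\<open>False\<close> and \<^const>\<open>True\<close>. The value of \<open>delta\<close> at a state and the list of
  scanned symbols (one per tape) is the new state and, for each tape, the symbol to be written
  and the head move. Only the finitely many arguments constrained in \<open>wf_tm\<close> matter.\<close>

datatype move = Go_Left | Stay | Go_Right

fun offset :: "move \<Rightarrow> int" where
  "offset Go_Left = -1"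
| "offset Stay = 0"
| "offset Go_Right = 1"

record tm =
  num_tapes :: nat
  num_states :: nat
  num_symbols :: nat
  start_state :: nat
  accept_state :: nat
  reject_state :: nat
  delta :: "nat \<Rightarrow> nat list \<Rightarrow> nat \<times> (nat \<times> move) list"

definition wf_tm :: "tm \<Rightarrow> bool" where
  "wf_tm M \<longleftrightarrow>
     num_tapes M \<ge> 1 \<and> num_symbols M \<ge> 3 \<and>
     start_state M < num_states M \<and> accept_state M < num_states M \<and>
     reject_state M < num_states M \<and> accept_state M \<noteq> reject_state M \<and>
     (\<forall>q < num_states M. \<forall>ss. length ss = num_tapes M \<and> set ss \<subseteq> {..<num_symbols M} \<longrightarrow>
        fst (delta M q ss) < num_states M \<and>
        length (snd (delta M q ss)) = num_tapes M \<and>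
        fst ` set (snd (delta M q ss)) \<subseteq> {..<num_symbols M})"

record config =
  state :: nat
  tape :: "nat \<Rightarrow> int \<Rightarrow> nat"
  head :: "nat \<Rightarrow> int"

definition halted :: "tm \<Rightarrow> config \<Rightarrow> bool" where
  "halted M c \<longleftrightarrow> state c = accept_state M \<or> state c = reject_state M"

definition step :: "tm \<Rightarrow> config \<Rightarrow> config" where
  "step M c =
     (if halted M c then c
      else
        let (q, acts) = delta M (state c) (map (\<lambda>i. tape c i (head c i)) [0..<num_tapes M])
        in \<lparr>state = q,
            tape = (\<lambda>i. if i < num_tapes M then (tape c i)(head c i := fst (acts ! i)) else tape c i),
            head = (\<lambda>i. if i < num_tapes M then head c i + offset (snd (acts ! i)) else head c i)\<rparr>)"

definition tape_of :: "bool list \<Rightarrow> int \<Rightarrow> nat" where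
  "tape_of x j =
     (if 0 \<le> j \<and> j < int (length x) then (if x ! nat j then 2 else 1) else 0)"

definition init_config :: "tm \<Rightarrow> bool list \<Rightarrow> config" where
  "init_config M x =
     \<lparr>state = start_state M, tape = (\<lambda>i. if i = 0 then tape_of x else (\<lambda>_. 0)), head = (\<lambda>_. 0)\<rparr>"

definition run :: "tm \<Rightarrow> bool list \<Rightarrow> nat \<Rightarrow> config" where
  "run M x t = (step M ^^ t) (init_config M x)"

definition visited_cells :: "tm \<Rightarrow> bool list \<Rightarrow> (nat \<times> int) set" where
  "visited_cells M x = {(i, head (run M x t) i) | i t. i < num_tapes M}"

definition decides :: "tm \<Rightarrow> bool list set \<Rightarrow> bool" where
  "decides M A \<longleftrightarrow>
     (\<forall>x. \<exists>t. state (run M x t) = (if x \<in> A then accept_state M else reject_state M))"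


section \<open>Polynomial space and polynomial-time reductions\<close>

definition PSPACE :: "bool list set set" where
  "PSPACE =
     {A. \<exists>M (p :: nat poly). wf_tm M \<and> decides M A \<and>
        (\<forall>x. finite (visited_cells M x) \<and> card (visited_cells M x) \<le> poly p (length x))}"

text \<open>The output is read off the first tape, which must contain nothing else.\<close>

definition polytime_computable :: "(bool list \<Rightarrow> bool list) \<Rightarrow> bool" where
  "polytime_computable f \<longleftrightarrow>
     (\<exists>M (p :: nat poly). wf_tm M \<and>
        (\<forall>x. \<exists>t \<le> poly p (length x).
           halted M (run M x t) \<and> tape (run M x t) 0 = tape_of (f x)))"

definition polytime_reducible :: "bool list set \<Rightarrow> bool list set \<Rightarrow> bool" where
  "polytime_reducible A B \<longleftrightarrow> (\<exists>f. polytime_computable f \<and> (\<forall>x. x \<in> A \<longleftrightarrow> f x \<in> B))"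

definition PSPACE_complete :: "bool list set \<Rightarrow> bool" where
  "PSPACE_complete B \<longleftrightarrow> B \<in> PSPACE \<and> (\<forall>A\<in>PSPACE. polytime_reducible A B)"

end

theory Submission
  imports Defs "HOL-Library.Nat_Bijection"
begin

text \<open>Membership: a data instance consistent with a Horn ontology has a least model, and this model is
  periodic from some point on, with exponential bounds. A separating query can be unravelled into a chain
  of blocks. Between two blocks it suffices to remember one time point per positive example, where the
  rest of the query is to hold, and one threshold per negative example, from which on the rest is to fail;
  by periodicity, these numbers may be bounded exponentially. Hence separability is reachability in a
  graph with exponentially many nodes, and polynomial space suffices by Savitch's theorem. For \<open>\<Diamond>\<close> a block
  is a single time point, for path queries with \<open>\<circle>\<close> it may extend over consecutive time points; without the
  restriction to paths, the negative examples can be treated one by one.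

  Hardness: with no positive and one negative example, separability is consistency, and a Horn ontology
  with exactly the polynomially many cells around each head as atoms can follow the computation of a
  machine and contradict itself upon rejection. Letting the tapes move below fixed heads makes the
  axioms for a cell depend on its distance from the head in a uniform way.\<close>

section \<open>A stack language compiled to Turing machines\<close>

text \<open>No machine is programmed by hand for the decision problem. Tests on numbers are shown to
  be decidable in polynomial space by closure rules alone: composition, recursion with polynomially
  long values, bounded quantifiers, games with polynomially many rounds, reachability. A quantifier
  over exponentially many values costs only the space of a counter, and a definition uses a fixed
  number of rules, so that polynomials compose. The reduction must run in polynomial time, where
  counting loops are too slow; it gets rules of its own, for writing strings from templates. The
  form of certificates is dictated by strictness: \<open>Eventually \<kappa>\<close> fails at
  \<open>s\<close> iff \<open>\<kappa>\<close> fails at all times from \<open>Suc s\<close> on. So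
  all one has to know about \<open>\<kappa>\<close> on a negative example is the first time from
  which it fails forever, whereas on a positive example one witness suffices. These are linearly
  many numbers of polynomial length. The number of blocks of a query, however, may be exponential,
  so a chain of blocks cannot be stored; it has to be explored as a path in a graph.\<close>

datatype com =
    Skip
  | Push nat bool
  | Pop nat
  | Seq com com  (infixr ";;" 60)
  | Cond nat "bool option set" com com
  | While nat "bool option set" com

fun regs :: "com \<Rightarrow> nat set" where
  "regs Skip = {}"
| "regs (Push r x) = {r}"
| "regs (Pop r) = {r}"
| "regs (Seq c d) = regs c \<union> regs d"
| "regs (Cond r X c d) = {r} \<union> regs c \<union> regs d"
| "regs (While r X c) = {r} \<union> regs c"

lemma finite_regs: "finite (regs c)"
  by (induction c) auto

fun topb :: "bool list \<Rightarrow> bool option" where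
  "topb [] = None"
| "topb (b # _) = Some b"

text \<open>Register \<open>i\<close> is the content of tape \<open>i\<close>, with the top of the stack under the head. The second
  component of a state gives the position just right of the bottom of each stack: popping an empty
  stack moves this position to the right.\<close>

type_synonym st = "(nat \<Rightarrow> bool list) \<times> (nat \<Rightarrow> int)"

text \<open>\<open>A\<close> is required of every state passed through. One semantics thus serves
  for space bounds, where \<open>A\<close> limits the stacks, and, with \<open>A\<close> trivially
  true, for time bounds. Step counts are those of the compiled code: a push is a head move and a
  write, a taken branch or a loop round costs a test and a jump.\<close>

inductive exec :: "(st \<Rightarrow> bool) \<Rightarrow> com \<Rightarrow> st \<Rightarrow> nat \<Rightarrow> st \<Rightarrow> bool" for A where
  Skip: "A \<sigma> \<Longrightarrow> exec A Skip \<sigma> 0 \<sigma>"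
| Push: "\<lbrakk>A (s, b); A (s(r := x # s r), b)\<rbrakk> \<Longrightarrow> exec A (Push r x) (s, b) 2 (s(r := x # s r), b)"
| Pop: "\<lbrakk>A (s, b); A (s(r := tl (s r)), if s r = [] then b(r := b r + 1) else b)\<rbrakk> \<Longrightarrow>
    exec A (Pop r) (s, b) 1 (s(r := tl (s r)), if s r = [] then b(r := b r + 1) else b)"
| Seq: "\<lbrakk>exec A c \<sigma> t \<sigma>'; exec A d \<sigma>' u \<sigma>''\<rbrakk> \<Longrightarrow> exec A (c ;; d) \<sigma> (t + u) \<sigma>''"
| CondT: "\<lbrakk>topb (fst \<sigma> r) \<in> X; exec A c \<sigma> t \<sigma>'\<rbrakk> \<Longrightarrow> exec A (Cond r X c d) \<sigma> (t + 2) \<sigma>'"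
| CondF: "\<lbrakk>topb (fst \<sigma> r) \<notin> X; exec A d \<sigma> t \<sigma>'\<rbrakk> \<Longrightarrow> exec A (Cond r X c d) \<sigma> (t + 1) \<sigma>'"
| WhileF: "\<lbrakk>topb (fst \<sigma> r) \<notin> X; A \<sigma>\<rbrakk> \<Longrightarrow> exec A (While r X c) \<sigma> 1 \<sigma>"
| WhileT: "\<lbrakk>topb (fst \<sigma> r) \<in> X; exec A c \<sigma> t \<sigma>'; exec A (While r X c) \<sigma>' u \<sigma>''\<rbrakk> \<Longrightarrow>
    exec A (While r X c) \<sigma> (t + u + 2) \<sigma>''"

lemma exec_inv: "exec A c \<sigma> t \<sigma>' \<Longrightarrow> A \<sigma> \<and> A \<sigma>'"
  by (induction rule: exec.induct) auto

section \<open>Jump code and the machines executing it\<close>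

datatype ins =
    IMove nat
  | IWrite nat bool
  | IPop nat
  | IBr nat "bool option set" nat nat
  | IJmp nat

fun clen :: "com \<Rightarrow> nat" where
  "clen Skip = 0"
| "clen (Push r x) = 2"
| "clen (Pop r) = 1"
| "clen (Seq c d) = clen c + clen d"
| "clen (Cond r X c d) = clen c + clen d + 2"
| "clen (While r X c) = clen c + 2"

fun compile :: "com \<Rightarrow> nat \<Rightarrow> ins list" where
  "compile Skip a = []"
| "compile (Push r x) a = [IMove r, IWrite r x]"
| "compile (Pop r) a = [IPop r]"
| "compile (Seq c d) a = compile c a @ compile d (a + clen c)"
| "compile (Cond r X c d) a =
    [IBr r X (a + 1) (a + clen c + 2)] @ compile c (a + 1) @ [IJmp (a + clen c + clen d + 2)]
    @ compile d (a + clen c + 2)"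
| "compile (While r X c) a = [IBr r X (a + 1) (a + clen c + 2)] @ compile c (a + 1) @ [IJmp a]"

lemma length_compile[simp]: "length (compile c a) = clen c"
  by (induction c arbitrary: a) auto

fun targets :: "ins \<Rightarrow> nat set" where
  "targets (IBr r X l l') = {l, l'}"
| "targets (IJmp l) = {l}"
| "targets _ = {}"

text \<open>Equality is possible: loops and conditionals may exit to the address right behind the
  code, where \<open>mach\<close> puts its final branch.\<close>

lemma targets_comp: "i \<in> set (compile c a) \<Longrightarrow> l \<in> targets i \<Longrightarrow> l \<le> a + clen c"
  by (induction c arbitrary: a) (fastforce dest: )+

definition bsym :: "bool \<Rightarrow> nat" where "bsym b = (if b then 2 else 1)"

definition unsym :: "nat \<Rightarrow> bool option" where
  "unsym n = (if n = 0 then None else Some (n = 2))"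

lemma unsym_sym[simp]: "unsym (bsym b) = Some b" "unsym 0 = None"
  by (auto simp: unsym_def bsym_def)

fun act :: "nat \<Rightarrow> ins \<Rightarrow> nat list \<Rightarrow> nat \<times> (nat \<times> move) list" where
  "act q (IMove r) ss = (q + 1, (map (\<lambda>s. (s, Stay)) ss)[r := (ss ! r, Go_Left)])"
| "act q (IWrite r b) ss = (q + 1, (map (\<lambda>s. (s, Stay)) ss)[r := (bsym b, Stay)])"
| "act q (IPop r) ss = (q + 1, (map (\<lambda>s. (s, Stay)) ss)[r := (0, Go_Right)])"
| "act q (IBr r X l l') ss = (if unsym (ss ! r) \<in> X then l else l', map (\<lambda>s. (s, Stay)) ss)"
| "act q (IJmp l) ss = (l, map (\<lambda>s. (s, Stay)) ss)"

text \<open>Instead of running off the end of the code, the program branches to the accepting or the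
  rejecting state, depending on the top of register 0.\<close>

definition mach :: "nat \<Rightarrow> com \<Rightarrow> tm" where
  "mach K c = (let p = compile c 0 @ [IBr 0 {Some True} (clen c + 1) (clen c + 2)] in
    \<lparr>num_tapes = K, num_states = clen c + 3, num_symbols = 3, start_state = 0,
     accept_state = clen c + 1, reject_state = clen c + 2,
     delta = (\<lambda>q ss. if q \<le> clen c then act q (p ! q) ss else (q, map (\<lambda>s. (s, Stay)) ss))\<rparr>)"

lemma mach_simps[simp]:
  "num_tapes (mach K c) = K" "num_states (mach K c) = clen c + 3" "num_symbols (mach K c) = 3"
  "start_state (mach K c) = 0" "accept_state (mach K c) = clen c + 1"
  "reject_state (mach K c) = clen c + 2"
  by (simp_all add: mach_def Let_def)

lemma delta_mach: "q \<le> clen c \<Longrightarrow> delta (mach K c) q ss =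
    act q ((compile c 0 @ [IBr 0 {Some True} (clen c + 1) (clen c + 2)]) ! q) ss"
  by (simp add: mach_def Let_def)

lemma wf_mach: assumes "K \<ge> 1" shows "wf_tm (mach K c)"
proof -
  let ?p = "compile c 0 @ [IBr 0 {Some True} (clen c + 1) (clen c + 2)]"
  have "fst (delta (mach K c) q ss) < clen c + 3 \<and> length (snd (delta (mach K c) q ss)) = K
      \<and> fst ` set (snd (delta (mach K c) q ss)) \<subseteq> {..<3}"
    if q: "q < clen c + 3" and ss: "length ss = K" "set ss \<subseteq> {..<3}" for q ss
  proof (cases "q \<le> clen c")
    case False
    then show ?thesis using q ss by (auto simp: mach_def Let_def)
  next
    case True
    have mem: "?p ! q \<in> set ?p" using True by (intro nth_mem) auto
    have tgt: "l \<le> clen c + 2" if "l \<in> targets (?p ! q)" for l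
      using mem that targets_comp[of _ c 0 l] by fastforce
    have st: "fst ` set ((map (\<lambda>s. (s, Stay)) ss)[r := (a, m)]) \<subseteq> {..<3}" if "a < 3" for r a m
      using ss that set_update_subset_insert[of "map (\<lambda>s. (s, Stay)) ss" r "(a, m)"] by fastforce
    let ?G = "fst (act q (?p ! q) ss) < clen c + 3 \<and> length (snd (act q (?p ! q) ss)) = K
        \<and> fst ` set (snd (act q (?p ! q) ss)) \<subseteq> {..<3}"
    have st0: "fst ` set (map (\<lambda>s. (s, Stay)) ss) \<subseteq> {..<3}" using ss by auto
    show ?thesis unfolding delta_mach[OF True]
    proof (cases "?p ! q")
      case (IMove r)
      have "fst ` set ((map (\<lambda>s. (s, Stay)) ss)[r := (ss ! r, Go_Left)]) \<subseteq> {..<3}"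
      proof (cases "r < length ss")
        case r: True
        then have "ss ! r < 3" using ss(2) nth_mem by fastforce
        then show ?thesis by (rule st)
      next
        case False
        then show ?thesis using st0 by (simp add: list_update_beyond)
      qed
      then show ?G using IMove True ss by auto
    next
      case (IWrite r b)
      then show ?G using True ss st[of "bsym b" r Stay] by (auto simp: bsym_def)
    next
      case (IPop r)
      then show ?G using True ss st[of 0 r Go_Right] by auto
    next
      case (IBr r X l l')
      then show ?G using tgt[of l] tgt[of l'] ss st0 by auto
    next
      case (IJmp l)
      then show ?G using tgt[of l] ss st0 by auto
    qed
  qed
  then show ?thesis using assms by (auto simp: wf_tm_def)
qed

text \<open>The stack grows to the left and ends just before cell \<open>b\<close>. With
  \<open>b\<close> the length of the input this is the initial content of the first tape, so that
  the input is already a stack.\<close>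

definition lay :: "int \<Rightarrow> bool list \<Rightarrow> int \<Rightarrow> nat" where
  "lay b l j = (if b - int (length l) \<le> j \<and> j < b then bsym (l ! nat (j - (b - int (length l)))) else 0)"

lemma lay_top: "unsym (lay b l (b - int (length l))) = topb l"
  by (cases l) (auto simp: lay_def)

lemma lay_Cons: "(lay b l)(b - int (length l) - 1 := bsym x) = lay b (x # l)"
proof
  fix j
  show "((lay b l)(b - int (length l) - 1 := bsym x)) j = lay b (x # l) j"
  proof (cases "b - int (length l) \<le> j \<and> j < b")
    case True
    then have "nat (j - (b - int (length (x # l)))) = Suc (nat (j - (b - int (length l))))" by auto
    then show ?thesis using True by (auto simp: lay_def)
  qed (auto simp: lay_def)
qed

lemma lay_tl: "l \<noteq> [] \<Longrightarrow> (lay b l)(b - int (length l) := 0) = lay b (tl l)"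
proof
  fix j
  assume "l \<noteq> []"
  then obtain x k where l: "l = x # k" by (cases l) auto
  show "((lay b l)(b - int (length l) := 0)) j = lay b (tl l) j"
  proof (cases "b - int (length k) \<le> j \<and> j < b")
    case True
    then have "nat (j - (b - int (length (x # k)))) = Suc (nat (j - (b - int (length k))))" by auto
    then show ?thesis using True l by (auto simp: lay_def)
  qed (auto simp: lay_def l)
qed

lemma lay_Nil: "lay b [] = (\<lambda>_. 0)"
  by (auto simp: lay_def fun_eq_iff)

section \<open>Simulation of stack programs by machine runs\<close>

definition rep :: "nat \<Rightarrow> st \<Rightarrow> nat \<Rightarrow> config \<Rightarrow> bool" where
  "rep K \<sigma> q cf \<longleftrightarrow> state cf = q \<and> (\<forall>i<K. tape cf i = lay (snd \<sigma> i) (fst \<sigma> i) \<and>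
     head cf i = snd \<sigma> i - int (length (fst \<sigma> i)))"

text \<open>Only the heads are recorded, because between the move and the write of a push the tapes
  represent no state. The heads are then already where they are after the push, and visited cells
  depend on heads only.\<close>

definition headsin :: "nat \<Rightarrow> (st \<Rightarrow> bool) \<Rightarrow> config \<Rightarrow> bool" where
  "headsin K A cf \<longleftrightarrow> (\<exists>\<sigma>. A \<sigma> \<and> (\<forall>i<K. head cf i = snd \<sigma> i - int (length (fst \<sigma> i))))"

lemma rep_headsin: "rep K \<sigma> q cf \<Longrightarrow> A \<sigma> \<Longrightarrow> headsin K A cf"
  unfolding rep_def headsin_def by blast

definition reaches :: "tm \<Rightarrow> (config \<Rightarrow> bool) \<Rightarrow> nat \<Rightarrow> config \<Rightarrow> config \<Rightarrow> bool" where
  "reaches M H n c c' \<longleftrightarrow> (step M ^^ n) c = c' \<and> (\<forall>k\<le>n. H ((step M ^^ k) c))"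

lemma reaches_0: "H c \<Longrightarrow> reaches M H 0 c c"
  by (auto simp: reaches_def)

lemma reaches_1: "H c \<Longrightarrow> H (step M c) \<Longrightarrow> reaches M H 1 c (step M c)"
  by (auto simp: reaches_def le_Suc_eq)

lemma reaches_trans: assumes "reaches M H n c c'" "reaches M H m c' c''"
  shows "reaches M H (n + m) c c''"
proof -
  have 1: "(step M ^^ (n + k)) c = (step M ^^ k) c'" for k
    using assms(1) by (simp add: reaches_def funpow_add add.commute[of n])
  have "H ((step M ^^ k) c)" if "k \<le> n + m" for k
  proof (cases "k \<le> n")
    case False
    then have "k = n + (k - n)" "k - n \<le> m" using that by auto
    then obtain j where "k = n + j" "j \<le> m" by blast
    then show ?thesis using assms(2) 1 by (auto simp: reaches_def)
  qed (use assms(1) in \<open>auto simp: reaches_def\<close>)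
  then show ?thesis using 1[of m] assms(2) by (auto simp: reaches_def)
qed

lemma step_mach:
  assumes "q \<le> clen c" "state cf = q"
  shows "step (mach K c) cf = (let (q', acts) = act q ((compile c 0 @ [IBr 0 {Some True} (clen c + 1) (clen c + 2)]) ! q)
      (map (\<lambda>i. tape cf i (head cf i)) [0..<K])
    in \<lparr>state = q', tape = (\<lambda>i. if i < K then (tape cf i)(head cf i := fst (acts ! i)) else tape cf i),
        head = (\<lambda>i. if i < K then head cf i + offset (snd (acts ! i)) else head cf i)\<rparr>)"
  using assms by (auto simp: step_def halted_def delta_mach)

lemma nth_upd_map: "i < K \<Longrightarrow> ((map f (map g [0..<K]))[r := y]) ! i = (if i = r then y else f (g i))"
  by (auto simp: nth_list_update)

lemma nth_map2: "i < K \<Longrightarrow> (map f (map g [0..<K])) ! i = f (g i)"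
  by auto

context
  fixes C :: com and K :: nat and p and M
  defines "p \<equiv> compile C 0 @ [IBr 0 {Some True} (clen C + 1) (clen C + 2)]"
  defines "M \<equiv> mach K C"
begin

lemma step_IBr:
  assumes "rep K \<sigma> q cf" "q \<le> clen C" "p ! q = IBr r X l l'" "r < K"
  shows "rep K \<sigma> (if topb (fst \<sigma> r) \<in> X then l else l') (step M cf)"
proof -
  have "state cf = q" using assms(1) by (simp add: rep_def)
  note s = step_mach[OF assms(2) this, of K, folded p_def M_def, unfolded assms(3)]
  show ?thesis using assms(1,4) lay_top[of "snd \<sigma> r" "fst \<sigma> r"] unfolding s
    by (auto simp: rep_def nth_map2 Let_def simp del: map_map)
qed

lemma step_IJmp:
  assumes "rep K \<sigma> q cf" "q \<le> clen C" "p ! q = IJmp l"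
  shows "rep K \<sigma> l (step M cf)"
proof -
  have "state cf = q" using assms(1) by (simp add: rep_def)
  note s = step_mach[OF assms(2) this, of K, folded p_def M_def, unfolded assms(3)]
  show ?thesis using assms(1) unfolding s
    by (auto simp: rep_def nth_map2 Let_def simp del: map_map)
qed

lemma step_IPop:
  assumes "rep K (s, b) q cf" "q \<le> clen C" "p ! q = IPop r" "r < K"
  shows "rep K (s(r := tl (s r)), if s r = [] then b(r := b r + 1) else b) (Suc q) (step M cf)"
proof -
  have "state cf = q" using assms(1) by (simp add: rep_def)
  note s = step_mach[OF assms(2) this, of K, folded p_def M_def, unfolded assms(3)]
  have l: "s r \<noteq> [] \<Longrightarrow> int (length (s r) - Suc 0) = int (length (s r)) - 1"
    by (cases "s r") auto
  show ?thesis using assms(1,4) lay_tl[of "s r" "b r"] unfolding s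
    by (auto simp: rep_def nth_upd_map lay_Nil l simp del: map_map)
qed

lemma step_Push:
  assumes "rep K (s, b) q cf" "q < clen C" "p ! q = IMove r" "p ! Suc q = IWrite r x" "r < K"
  shows "rep K (s(r := x # s r), b) (Suc (Suc q)) (step M (step M cf))"
    and "\<forall>i<K. head (step M cf) i = b i - int (length ((s(r := x # s r)) i))"
proof -
  have st: "state cf = q" using assms(1) by (simp add: rep_def)
  have q: "q \<le> clen C" "Suc q \<le> clen C" using assms(2) by auto
  note s = step_mach[OF q(1) st, of K, folded p_def M_def, unfolded assms(3)]
  have 1: "state (step M cf) = Suc q" "\<forall>i<K. tape (step M cf) i = lay (b i) (s i)"
      "\<forall>i<K. head (step M cf) i = b i - int (length ((s(r := x # s r)) i))"
    using assms(1,5) unfolding s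
    by (auto simp: rep_def nth_upd_map simp del: map_map)
  note s2 = step_mach[OF q(2) 1(1), of K, folded p_def M_def, unfolded assms(4)]
  show "rep K (s(r := x # s r), b) (Suc (Suc q)) (step M (step M cf))"
    using 1(2,3) assms(5) lay_Cons[of "b r" "s r" x] unfolding s2
    by (auto simp: rep_def nth_upd_map diff_diff_eq add.commute simp del: map_map)
  show "\<forall>i<K. head (step M cf) i = b i - int (length ((s(r := x # s r)) i))" by (rule 1(3))
qed

lemma length_p: "length p = Suc (clen C)"
  by (simp add: p_def)

text \<open>The induction is on the execution, not on the command, since loops repeat their own
  code. As \<open>post\<close> is nonempty, all addresses in the code, and the one behind it, are
  non-halting states.\<close>

lemma comp_correct:
  assumes "exec A c \<sigma> t \<sigma>'" "p = pre @ compile c a @ post" "a = length pre" "post \<noteq> []"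
    "regs c \<subseteq> {..<K}" "rep K \<sigma> a cf"
  shows "\<exists>cf'. reaches M (headsin K A) t cf cf' \<and> rep K \<sigma>' (a + clen c) cf'"
  using assms
proof (induction arbitrary: pre a post cf rule: exec.induct)
  case (Skip \<sigma>)
  then show ?case by (auto intro!: exI[of _ cf] reaches_0 rep_headsin)
next
  case (Push s b r x)
  have q: "a < clen C" "p ! a = IMove r" "p ! Suc a = IWrite r x"
    using Push.prems length_p by (auto simp: nth_append)
  have r: "r < K" using Push.prems by simp
  note P = step_Push[OF Push.prems(5) q r]
  have "headsin K A cf" using rep_headsin Push by blast
  moreover have "headsin K A (step M cf)" unfolding headsin_def
    using P(2) Push.hyps(2) by (intro exI[of _ "(s(r := x # s r), b)"]) simp
  moreover have "headsin K A (step M (step M cf))" using rep_headsin[OF P(1)] Push.hyps by blast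
  ultimately have "reaches M (headsin K A) (1 + 1) cf (step M (step M cf))"
    by (intro reaches_trans[OF reaches_1 reaches_1])
  then show ?case using P(1) by (auto simp: numeral_2_eq_2)
next
  case (Pop s b r)
  have q: "a \<le> clen C" "p ! a = IPop r"
    using Pop.prems length_p by (auto simp: nth_append)
  have r: "r < K" using Pop.prems by simp
  note P = step_IPop[OF Pop.prems(5) q r]
  have "reaches M (headsin K A) 1 cf (step M cf)"
    by (intro reaches_1 rep_headsin[OF P] rep_headsin[OF Pop.prems(5)] Pop.hyps)
  then show ?case using P by auto
next
  case (Seq c \<sigma> t \<sigma>' d u \<sigma>'')
  obtain cf' where 1: "reaches M (headsin K A) t cf cf'" "rep K \<sigma>' (a + clen c) cf'"
    using Seq.IH(1)[of pre a "compile d (a + clen c) @ post" cf] Seq.prems by auto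
  obtain cf'' where 2: "reaches M (headsin K A) u cf' cf''" "rep K \<sigma>'' (a + clen c + clen d) cf''"
    using Seq.IH(2)[of "pre @ compile c a" "a + clen c" post cf'] Seq.prems 1 by auto
  show ?case using reaches_trans[OF 1(1) 2(1)] 2(2) by (auto simp: add.assoc)
next
  case (CondT \<sigma> r X c t \<sigma>' d)
  have q: "a \<le> clen C" "p ! a = IBr r X (a + 1) (a + clen c + 2)"
    using CondT.prems length_p by (auto simp: nth_append)
  have r: "r < K" using CondT.prems by simp
  have s: "rep K \<sigma> (a + 1) (step M cf)" using step_IBr[OF CondT.prems(5) q r] CondT.hyps(1) by simp
  obtain cf' where 1: "reaches M (headsin K A) t (step M cf) cf'" "rep K \<sigma>' (a + 1 + clen c) cf'"
    using CondT.IH[of "pre @ [IBr r X (a + 1) (a + clen c + 2)]" "a + 1"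
        "IJmp (a + clen c + clen d + 2) # compile d (a + clen c + 2) @ post" "step M cf"] CondT.prems s by auto
  have q2: "a + 1 + clen c \<le> clen C" "p ! (a + 1 + clen c) = IJmp (a + clen c + clen d + 2)"
    using CondT.prems length_p by (auto simp: nth_append)
  have s2: "rep K \<sigma>' (a + clen c + clen d + 2) (step M cf')" by (rule step_IJmp[OF 1(2) q2])
  note inv = exec_inv[OF CondT.hyps(2)]
  have "reaches M (headsin K A) (1 + (t + 1)) cf (step M cf')"
    by (rule reaches_trans[OF reaches_1 reaches_trans[OF 1(1) reaches_1]])
      (use inv in \<open>auto intro: rep_headsin[OF s] rep_headsin[OF s2] rep_headsin[OF 1(2)] rep_headsin[OF CondT.prems(5)]\<close>)
  then show ?case using s2 by (auto simp: algebra_simps numeral_2_eq_2)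
next
  case (CondF \<sigma> r X d t \<sigma>' c)
  have q: "a \<le> clen C" "p ! a = IBr r X (a + 1) (a + clen c + 2)"
    using CondF.prems length_p by (auto simp: nth_append)
  have r: "r < K" using CondF.prems by simp
  have s: "rep K \<sigma> (a + clen c + 2) (step M cf)" using step_IBr[OF CondF.prems(5) q r] CondF.hyps(1) by simp
  obtain cf' where 1: "reaches M (headsin K A) t (step M cf) cf'" "rep K \<sigma>' (a + clen c + 2 + clen d) cf'"
    using CondF.IH[of "pre @ [IBr r X (a + 1) (a + clen c + 2)] @ compile c (a + 1) @ [IJmp (a + clen c + clen d + 2)]"
        "a + clen c + 2" post "step M cf"] CondF.prems s by auto
  note inv = exec_inv[OF CondF.hyps(2)]
  have "reaches M (headsin K A) (1 + t) cf cf'"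
    by (rule reaches_trans[OF reaches_1 1(1)])
      (use inv in \<open>auto intro: rep_headsin[OF s] rep_headsin[OF CondF.prems(5)]\<close>)
  then show ?case using 1 by (auto simp: algebra_simps)
next
  case (WhileF \<sigma> r X c)
  have q: "a \<le> clen C" "p ! a = IBr r X (a + 1) (a + clen c + 2)"
    using WhileF.prems length_p by (auto simp: nth_append)
  have r: "r < K" using WhileF.prems by simp
  have s: "rep K \<sigma> (a + clen c + 2) (step M cf)" using step_IBr[OF WhileF.prems(5) q r] WhileF.hyps(1) by simp
  have "reaches M (headsin K A) 1 cf (step M cf)"
    by (intro reaches_1 rep_headsin[OF s] rep_headsin[OF WhileF.prems(5)] WhileF.hyps)
  then show ?case using s by (auto simp: add.assoc)
next
  case (WhileT \<sigma> r X c t \<sigma>' u \<sigma>'')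
  have q: "a \<le> clen C" "p ! a = IBr r X (a + 1) (a + clen c + 2)"
    using WhileT.prems length_p by (auto simp: nth_append)
  have r: "r < K" using WhileT.prems by simp
  have s: "rep K \<sigma> (a + 1) (step M cf)" using step_IBr[OF WhileT.prems(5) q r] WhileT.hyps(1) by simp
  obtain cf' where 1: "reaches M (headsin K A) t (step M cf) cf'" "rep K \<sigma>' (a + 1 + clen c) cf'"
    using WhileT.IH(1)[of "pre @ [IBr r X (a + 1) (a + clen c + 2)]" "a + 1" "IJmp a # post" "step M cf"]
      WhileT.prems s by auto
  have q2: "a + 1 + clen c \<le> clen C" "p ! (a + 1 + clen c) = IJmp a"
    using WhileT.prems length_p by (auto simp: nth_append)
  have s2: "rep K \<sigma>' a (step M cf')" by (rule step_IJmp[OF 1(2) q2])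
  obtain cf'' where 2: "reaches M (headsin K A) u (step M cf') cf''" "rep K \<sigma>'' (a + clen (While r X c)) cf''"
    using WhileT.IH(2)[OF WhileT.prems(1-4) s2] by auto
  note inv = exec_inv[OF WhileT.hyps(2)]
  have "reaches M (headsin K A) (1 + (t + 1)) cf (step M cf')"
    by (rule reaches_trans[OF reaches_1 reaches_trans[OF 1(1) reaches_1]])
      (use inv in \<open>auto intro: rep_headsin[OF s] rep_headsin[OF s2] rep_headsin[OF 1(2)] rep_headsin[OF WhileT.prems(5)]\<close>)
  from reaches_trans[OF this 2(1)] show ?case using 2(2) by (auto simp: algebra_simps numeral_2_eq_2)
qed

end

section \<open>Space and time bounds for compiled programs\<close>

definition init_st :: "bool list \<Rightarrow> st" where
  "init_st x = ((\<lambda>_. [])(0 := x), (\<lambda>_. 0)(0 := int (length x)))"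

lemma tape_of_lay: "tape_of x = lay (int (length x)) x"
  by (auto simp: tape_of_def lay_def bsym_def fun_eq_iff)

lemma rep_init: "rep K (init_st x) 0 (init_config (mach K c) x)"
  by (simp add: rep_def init_st_def init_config_def lay_Nil tape_of_lay)

definition tapes_of :: "com \<Rightarrow> nat" where "tapes_of c = Suc (Max (insert 0 (regs c)))"

lemma tapes_of: "regs c \<subseteq> {..<tapes_of c}" "0 < tapes_of c"
  unfolding tapes_of_def using finite_regs[of c] by (auto simp: less_Suc_eq_le)

lemma mach_run:
  assumes "exec A c (init_st x) t \<sigma>"
  defines "M \<equiv> mach (tapes_of c) c"
  shows "rep (tapes_of c) \<sigma> (if topb (fst \<sigma> 0) = Some True then accept_state M else reject_state M) (run M x (Suc t))"
    and "\<forall>k. headsin (tapes_of c) A (run M x k)"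
proof -
  let ?K = "tapes_of c"
  obtain cf where cf: "reaches M (headsin ?K A) t (init_config M x) cf" "rep ?K \<sigma> (clen c) cf"
    using comp_correct[OF assms(1), of c "[]" 0 _ ?K, OF _ _ _ _ rep_init] tapes_of(1)
    by (fastforce simp: M_def)
  have s: "rep ?K \<sigma> (if topb (fst \<sigma> 0) = Some True then accept_state M else reject_state M) (step M cf)"
    using step_IBr[OF cf(2), of c 0 "{Some True}" "clen c + 1" "clen c + 2"] tapes_of(2)[of c]
    by (simp add: M_def nth_append split: if_split_asm)
  have run: "run M x (Suc t) = step M cf" using cf(1) by (simp add: run_def reaches_def)
  then show 1: "rep ?K \<sigma> (if topb (fst \<sigma> 0) = Some True then accept_state M else reject_state M) (run M x (Suc t))"
    using s by simp
  \<comment> \<open>A halted machine does not move, so that the heads are under control at all times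
    and not just until termination.\<close>
  have h: "halted M (run M x (Suc t))" using 1 by (auto simp: rep_def halted_def)
  have "run M x (Suc t + j) = run M x (Suc t)" for j
    using h by (induction j) (auto simp: run_def step_def)
  note stable = this
  show "\<forall>k. headsin ?K A (run M x k)"
  proof
    fix k
    show "headsin ?K A (run M x k)"
    proof (cases "k \<le> t")
      case True
      then show ?thesis using cf(1) by (auto simp: reaches_def run_def)
    next
      case False
      then have "run M x k = run M x (Suc t)" using stable[of "k - Suc t"] by simp
      then show ?thesis using rep_headsin[OF 1] exec_inv[OF assms(1)] by simp
    qed
  qed
qed

abbreviation inspace :: "nat poly \<Rightarrow> bool list \<Rightarrow> st \<Rightarrow> bool" where
  "inspace q x \<equiv> \<lambda>(s, b). b = snd (init_st x) \<and> (\<forall>r. length (s r) \<le> poly q (length x))"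

text \<open>The stack bottoms stay fixed under \<open>inspace\<close>, so that every head remains
  between \<open>- poly q (length x)\<close> and \<open>length x\<close>.\<close>

theorem PSPACE_I:
  assumes "\<And>x. \<exists>t s b. exec (inspace q x) c
      (init_st x) t (s, b) \<and> (topb (s 0) = Some True \<longleftrightarrow> x \<in> L)"
  shows "L \<in> PSPACE"
proof -
  define M where "M = mach (tapes_of c) c"
  let ?K = "tapes_of c"
  \<comment> \<open>Each tape contributes at most \<open>poly q n + n + 1\<close> cells for inputs
    of length \<open>n\<close>.\<close>
  define Q where "Q = [:?K:] * (q + [:1, 1:])"
  have "\<exists>t. state (run M x t) = (if x \<in> L then accept_state M else reject_state M)" for x
  proof -
    obtain t s b where 1: "exec (inspace q x) c
      (init_st x) t (s, b)" "topb (s 0) = Some True \<longleftrightarrow> x \<in> L" using assms by blast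
    show ?thesis using mach_run(1)[OF 1(1)] 1(2) by (auto simp: rep_def M_def)
  qed
  then have d: "decides M L" unfolding decides_def by blast
  have "finite (visited_cells M x) \<and> card (visited_cells M x) \<le> poly Q (length x)" for x
  proof -
    obtain t s b where 1: "exec (inspace q x) c
      (init_st x) t (s, b)" using assms by blast
    let ?B = "{..<?K} \<times> {- int (poly q (length x)) .. int (length x)}"
    have "visited_cells M x \<subseteq> ?B"
    proof (clarsimp simp: visited_cells_def M_def)
      fix i k
      assume i: "i < ?K"
      obtain \<sigma> :: st where "snd \<sigma> = snd (init_st x)" "\<forall>r. length (fst \<sigma> r) \<le> poly q (length x)"
          "\<forall>i<?K. head (run (mach (tapes_of c) c) x k) i = snd \<sigma> i - int (length (fst \<sigma> i))"
        using mach_run(2)[OF 1, THEN spec[of _ k]] unfolding headsin_def case_prod_unfold by blast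
      then show "- int (poly q (length x)) \<le> head (run (mach (tapes_of c) c) x k) i \<and>
          head (run (mach (tapes_of c) c) x k) i \<le> int (length x)"
        using i by (auto simp: init_st_def dest!: spec[of _ i])
    qed
    moreover have "finite ?B" by simp
    moreover have "card ?B = poly Q (length x)"
      by (simp add: Q_def card_cartesian_product nat_add_distrib algebra_simps)
    ultimately show ?thesis using finite_subset[of "visited_cells M x" ?B] card_mono[of ?B "visited_cells M x"] by simp
  qed
  moreover have "wf_tm M" using wf_mach[of ?K c] tapes_of(2)[of c] by (simp add: M_def)
  ultimately show ?thesis unfolding PSPACE_def using d by blast
qed

text \<open>The condition on \<open>b 0\<close> places the first symbol of the output in cell 0,
  where \<open>tape_of\<close> expects it. One more step is taken by the final branch.\<close>

theorem polytime_computable_I: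
  assumes "\<And>x. \<exists>t s b. exec (\<lambda>_. True) c (init_st x) t (s, b) \<and> s 0 = f x \<and> b 0 = int (length (f x))
     \<and> t \<le> poly q (length x)"
  shows "polytime_computable f"
proof -
  let ?M = "mach (tapes_of c) c"
  have "\<exists>t\<le>poly (q + [:1:]) (length x). halted ?M (run ?M x t) \<and> tape (run ?M x t) 0 = tape_of (f x)" for x
  proof -
    obtain t s b where 1: "exec (\<lambda>_. True) c (init_st x) t (s, b)" "s 0 = f x" "b 0 = int (length (f x))"
     "t \<le> poly q (length x)" using assms by blast
    note m = mach_run(1)[OF 1(1)]
    have "tape (run ?M x (Suc t)) 0 = tape_of (f x)"
      using m tapes_of(2)[of c] 1(2,3) by (simp add: rep_def tape_of_lay)
    moreover have "halted ?M (run ?M x (Suc t))" using m by (simp add: rep_def halted_def)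
    moreover have "Suc t \<le> poly (q + [:1:]) (length x)" using 1(4) by simp
    ultimately show ?thesis by blast
  qed
  moreover have "wf_tm ?M" using wf_mach[of "tapes_of c" c] tapes_of(2)[of c] by simp
  ultimately show ?thesis unfolding polytime_computable_def by blast
qed

section \<open>Arithmetic on binary registers\<close>

text \<open>Least significant digit first and no leading zeros: counting works at the top of the
  stack, and zero is the empty stack, which a single test recognizes.\<close>

fun bin :: "nat \<Rightarrow> bool list" where
  "bin n = (if n = 0 then [] else odd n # bin (n div 2))"

declare bin.simps[simp del]

definition bl :: "nat \<Rightarrow> nat" where "bl n = length (bin n)"

lemma bin_0[simp]: "bin 0 = []"
  by (simp add: bin.simps)

lemma bin_pos: "n \<noteq> 0 \<Longrightarrow> bin n = odd n # bin (n div 2)"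
  by (subst bin.simps) simp

lemma bin_eq_Nil[simp]: "bin n = [] \<longleftrightarrow> n = 0"
  by (subst bin.simps) simp

lemma bl_0[simp]: "bl 0 = 0"
  by (simp add: bl_def)

lemma bl_pos: "n \<noteq> 0 \<Longrightarrow> bl n = Suc (bl (n div 2))"
  by (simp add: bl_def bin_pos)

lemma bl_le_iff: "bl n \<le> k \<longleftrightarrow> n < 2 ^ k"
proof (induction k arbitrary: n)
  case 0
  then show ?case by (auto simp: bl_def)
next
  case (Suc k)
  show ?case
  proof (cases "n = 0")
    case False
    then have "bl n \<le> Suc k \<longleftrightarrow> n div 2 < 2 ^ k" by (simp add: bl_pos Suc)
    also have "\<dots> \<longleftrightarrow> n < 2 ^ Suc k" by (auto simp: div_less_iff_less_mult)
    finally show ?thesis .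
  qed simp
qed

lemma bl_mono: "m \<le> n \<Longrightarrow> bl m \<le> bl n"
  using bl_le_iff[of n "bl n"] bl_le_iff[of m "bl n"] by simp

lemma less_2_bl: "n < 2 ^ bl n"
  using bl_le_iff[of n "bl n"] by simp

lemma bl_Suc: "bl (Suc n) \<le> Suc (bl n)"
  using less_2_bl[of n] by (simp add: bl_le_iff)

lemma topb_bin: "topb (bin n) = (if n = 0 then None else Some (odd n))"
  by (auto simp: bin_pos)

text \<open>The carry inverts the leading ones. The premise on \<open>rest\<close> covers both a
  zero digit and the end of the numeral, and \<open>tl rest\<close> is right in both cases.\<close>

lemma bin_Suc: "bin n = replicate k True @ rest \<Longrightarrow> topb rest \<noteq> Some True \<Longrightarrow>
   bin (Suc n) = replicate k False @ True # tl rest"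
proof (induction k arbitrary: n)
  case 0
  then have "even n" by (cases "n = 0") (auto simp: topb_bin)
  moreover from this have "Suc n div 2 = n div 2" by simp
  ultimately show ?case using 0 by (cases "n = 0") (auto simp: bin_pos[of "Suc n"] bin_pos[of n] bin_pos[of "Suc 0"])
next
  case (Suc k)
  then have n: "n \<noteq> 0" by (intro notI) simp
  with Suc.prems have "odd n" "bin (n div 2) = replicate k True @ rest" by (auto simp: bin_pos)
  moreover from \<open>odd n\<close> have "Suc n div 2 = Suc (n div 2)" by presburger
  ultimately show ?case using Suc.IH[of "n div 2"] Suc.prems by (simp add: bin_pos[of "Suc n"])
qed

text \<open>The case distinction drops the leading zero that would arise when the borrow uses up the
  highest digit.\<close>

lemma bin_pred: "bin n = replicate k False @ True # rest \<Longrightarrow>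
   bin (n - 1) = replicate k True @ (if rest = [] then [] else False # rest)"
proof (induction k arbitrary: n)
  case 0
  then have "n \<noteq> 0" by (intro notI) simp
  with 0 have n: "odd n" "rest = bin (n div 2)" by (auto simp: bin_pos)
  then show ?case
  proof (cases "n = 1")
    case False
    then have "(n - 1) div 2 = n div 2" "n - 1 \<noteq> 0" "n div 2 \<noteq> 0" using n by presburger+
    then show ?thesis using n bin_pos[of "n - 1"] by simp
  qed (use n in auto)
next
  case (Suc k)
  then have n: "n \<noteq> 0" by (intro notI) simp
  with Suc.prems have "even n" "bin (n div 2) = replicate k False @ True # rest" by (auto simp: bin_pos)
  moreover from \<open>even n\<close> n have "(n - 1) div 2 = n div 2 - 1" "odd (n - 1)" "n - 1 \<noteq> 0" by presburger+
  ultimately show ?case using Suc.IH[of "n div 2"] Suc.prems bin_pos[of "n - 1"] by simp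
qed

definition bounded_st :: "(nat \<Rightarrow> int) \<Rightarrow> nat \<Rightarrow> st \<Rightarrow> bool" where
  "bounded_st b N = (\<lambda>(s, b'). b' = b \<and> (\<forall>r. length (s r) \<le> N))"

lemma pour:
  assumes "a \<noteq> c" "s a = replicate k x @ rest" "topb rest \<noteq> Some x" "\<forall>r. length (s r) \<le> N"
    "length (s c) + k \<le> N"
  shows "\<exists>t. exec (bounded_st b N) (While a {Some x} (Pop a ;; Push c y)) (s, b) t
    (s(a := rest, c := replicate k y @ s c), b)"
  using assms
proof (induction k arbitrary: s)
  case 0
  then have "s(a := rest, c := replicate 0 y @ s c) = s" by auto
  moreover have "exec (bounded_st b N) (While a {Some x} (Pop a ;; Push c y)) (s, b) 1 (s, b)"
    using 0 by (intro exec.WhileF) (auto simp: bounded_st_def)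
  ultimately show ?case by metis
next
  case (Suc k)
  let ?s1 = "s(a := replicate k x @ rest)"
  let ?s2 = "?s1(c := y # s c)"
  have A: "bounded_st b N (s, b)" using Suc.prems by (simp add: bounded_st_def)
  have A1: "bounded_st b N (?s1, b)"
    using Suc.prems spec[OF Suc.prems(4), of a] by (auto simp: bounded_st_def)
  have A2: "bounded_st b N (?s2, b)" using A1 Suc.prems by (auto simp: bounded_st_def)
  have 1: "exec (bounded_st b N) (Pop a) (s, b) 1 (?s1, b)"
    using exec.Pop[of "bounded_st b N" s b a] A A1 Suc.prems(2) by simp
  have 2: "exec (bounded_st b N) (Push c y) (?s1, b) 2 (?s2, b)"
    using exec.Push[of "bounded_st b N" ?s1 b c y] A1 A2 Suc.prems(1) by simp
  have "\<exists>t. exec (bounded_st b N) (While a {Some x} (Pop a ;; Push c y)) (?s2, b) t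
    (?s2(a := rest, c := replicate k y @ ?s2 c), b)"
    by (rule Suc.IH) (use Suc.prems A2 in \<open>auto simp: bounded_st_def\<close>)
  then obtain t where 3: "exec (bounded_st b N) (While a {Some x} (Pop a ;; Push c y)) (?s2, b) t
    (?s2(a := rest, c := replicate k y @ ?s2 c), b)" by blast
  have "?s2(a := rest, c := replicate k y @ ?s2 c) = s(a := rest, c := replicate (Suc k) y @ s c)"
    using Suc.prems(1) by (auto simp: replicate_append_same fun_eq_iff)
  moreover have "topb (fst (s, b) a) \<in> {Some x}" using Suc.prems(2) by simp
  ultimately show ?case using exec.WhileT[OF _ exec.Seq[OF 1 2] 3] by metis
qed

text \<open>The view taken for space bounds: registers hold numbers, \<open>N\<close> limits their
  length, and the running time is forgotten.\<close>

definition nx :: "(nat \<Rightarrow> int) \<Rightarrow> nat \<Rightarrow> com \<Rightarrow> (nat \<Rightarrow> nat) \<Rightarrow> (nat \<Rightarrow> nat) \<Rightarrow> bool" where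
  "nx b N c v v' \<longleftrightarrow> (\<exists>t. exec (bounded_st b N) c (\<lambda>r. bin (v r), b) t (\<lambda>r. bin (v' r), b))"

definition bounded_v :: "nat \<Rightarrow> (nat \<Rightarrow> nat) \<Rightarrow> bool" where
  "bounded_v N v \<longleftrightarrow> (\<forall>r. bl (v r) \<le> N)"

lemma bounded_v_st: "bounded_st b N (\<lambda>r. bin (v r), b) \<longleftrightarrow> bounded_v N v"
  by (simp add: bounded_v_def bounded_st_def bl_def)

lemma bounded_v_upd: "bounded_v N v \<Longrightarrow> bl n \<le> N \<Longrightarrow> bounded_v N (v(r := n))"
  by (auto simp: bounded_v_def)

lemma nx_bounded: "nx b N c v v' \<Longrightarrow> bounded_v N v \<and> bounded_v N v'"
  using exec_inv bounded_v_st unfolding nx_def by metis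

text \<open>The digits passed by the carry are parked on register 0 and put back inverted; hence the
  assumption \<open>v 0 = 0\<close> throughout.\<close>

definition inc :: "nat \<Rightarrow> com" where
  "inc r = While r {Some True} (Pop r ;; Push 0 True) ;; Cond r {None} Skip (Pop r) ;; Push r True ;;
     While 0 {Some True} (Pop 0 ;; Push r False)"

definition dec :: "nat \<Rightarrow> com" where
  "dec r = Cond r {None} Skip (While r {Some False} (Pop r ;; Push 0 False) ;; Pop r ;;
     Cond r {None} Skip (Push r False) ;; While 0 {Some False} (Pop 0 ;; Push r True))"

lemma split_replicate: "\<exists>k rest. l = replicate k x @ rest \<and> topb rest \<noteq> Some x"
proof (induction l)
  case Nil
  then show ?case by (auto intro: exI[of _ 0])
next
  case (Cons a l)
  then obtain k rest where "l = replicate k x @ rest" "topb rest \<noteq> Some x" by blast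
  then show ?case
    by (cases "a = x") (auto intro: exI[of _ "Suc k"] exI[of _ 0])
qed

lemma exec_Pop':
  assumes "bounded_st b N (s, b)" "s r \<noteq> []"
  shows "exec (bounded_st b N) (Pop r) (s, b) 1 (s(r := tl (s r)), b)"
proof -
  have "bounded_st b N (s(r := tl (s r)), b)"
    using assms(1) order_trans[OF diff_le_self] by (simp add: bounded_st_def)
  then show ?thesis using exec.Pop[of "bounded_st b N" s b r] assms by simp
qed

lemma exec_Push':
  assumes "bounded_st b N (s, b)" "Suc (length (s r)) \<le> N"
  shows "exec (bounded_st b N) (Push r x) (s, b) 2 (s(r := x # s r), b)"
proof -
  have "bounded_st b N (s(r := x # s r), b)" using assms by (auto simp: bounded_st_def)
  then show ?thesis using exec.Push[of "bounded_st b N" s b r] assms by simp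
qed

lemma nx_inc:
  assumes "v 0 = 0" "r \<noteq> 0" "bounded_v N v" "bl (Suc (v r)) \<le> N"
  shows "nx b N (inc r) v (v(r := Suc (v r)))"
proof -
  let ?s = "\<lambda>r. bin (v r)"
  obtain k rest where k: "bin (v r) = replicate k True @ rest" "topb rest \<noteq> Some True"
    using split_replicate by blast
  note S = bin_Suc[OF k]
  have l: "length rest + k \<le> N" "k + length (tl rest) < N"
    using spec[OF assms(3)[unfolded bounded_v_def], of r] assms(4) unfolding bl_def k(1) S by auto
  have A: "\<forall>r. length (?s r) \<le> N" using assms(3) by (simp add: bounded_v_def bl_def)
  let ?s1 = "?s(r := rest, 0 := replicate k True @ ?s 0)"
  obtain t1 where 1: "exec (bounded_st b N) (While r {Some True} (Pop r ;; Push 0 True)) (?s, b) t1 (?s1, b)"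
    using pour[OF assms(2) k A, of b True] l assms(1) by auto
  let ?s2 = "?s1(r := tl rest)"
  have A1: "bounded_st b N (?s1, b)" using exec_inv[OF 1] by simp
  have "\<exists>t. exec (bounded_st b N) (Cond r {None} Skip (Pop r)) (?s1, b) t (?s2, b)"
  proof (cases rest)
    case Nil
    then have "?s2 = ?s1" using assms(2) by auto
    then show ?thesis using A1 Nil assms(2) exec.CondT[OF _ exec.Skip, of "(?s1, b)" r "{None}" "bounded_st b N" "Pop r"] by auto
  next
    case (Cons y ys)
    then have "exec (bounded_st b N) (Pop r) (?s1, b) 1 (?s2, b)"
      using exec_Pop'[OF A1, of r] assms(2) by simp
    then show ?thesis using exec.CondF[of "(?s1, b)" r "{None}"] Cons assms(2) by fastforce
  qed
  then obtain t2 where 2: "exec (bounded_st b N) (Cond r {None} Skip (Pop r)) (?s1, b) t2 (?s2, b)" by blast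
  have A2: "bounded_st b N (?s2, b)" using exec_inv[OF 2] by simp
  let ?s3 = "?s2(r := True # tl rest)"
  have 3: "exec (bounded_st b N) (Push r True) (?s2, b) 2 (?s3, b)"
    using exec_Push'[OF A2, of r True] l assms(2) by simp
  have A3: "\<forall>r. length (?s3 r) \<le> N" using exec_inv[OF 3] by (simp add: bounded_st_def)
  have "?s3 0 = replicate k True @ []" using assms(1,2) by simp
  moreover have "?s3(0 := [], r := replicate k False @ ?s3 r) = (\<lambda>q. bin ((v(r := Suc (v r))) q))"
    using assms(1,2) S by (auto simp: fun_eq_iff)
  ultimately obtain t4 where 4: "exec (bounded_st b N) (While 0 {Some True} (Pop 0 ;; Push r False)) (?s3, b) t4
      (\<lambda>q. bin ((v(r := Suc (v r))) q), b)"
    using pour[of 0 r ?s3 k True "[]" N b False] A3 assms(2) l by auto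
  show ?thesis unfolding nx_def inc_def
    using exec.Seq[OF 1 exec.Seq[OF 2 exec.Seq[OF 3 4]]] by blast
qed

lemma nx_dec:
  assumes "v 0 = 0" "r \<noteq> 0" "bounded_v N v"
  shows "nx b N (dec r) v (v(r := v r - 1))"
proof (cases "v r = 0")
  case True
  then have "v(r := v r - 1) = v" by auto
  moreover have "exec (bounded_st b N) Skip (\<lambda>r. bin (v r), b) 0 (\<lambda>r. bin (v r), b)"
    using assms(3) by (intro exec.Skip) (simp add: bounded_v_st)
  ultimately show ?thesis unfolding nx_def dec_def using True
    by (auto intro!: exI exec.CondT)
next
  case False
  let ?s = "\<lambda>r. bin (v r)"
  obtain k rest0 where k0: "bin (v r) = replicate k False @ rest0" "topb rest0 \<noteq> Some False"
    using split_replicate by blast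
  \<comment> \<open>A nonzero numeral contains a one, so the borrow ends inside it.\<close>
  have ne: "bin n \<noteq> replicate k False" if "n \<noteq> 0" for n k
  proof
    assume "bin n = replicate k False"
    then show False using that
    proof (induction n arbitrary: k rule: less_induct)
      case (less n)
      then obtain k' where "k = Suc k'" "even n" "bin (n div 2) = replicate k' False"
        by (cases k) (auto simp: bin_pos)
      then show False using less.IH[of "n div 2" k'] less.prems by (auto elim!: evenE)
    qed
  qed
  obtain rest where k: "rest0 = True # rest"
    using ne[OF False, of k] k0 by (cases rest0 rule: topb.cases) auto
  note P = bin_pred[OF k0(1)[unfolded k]]
  have l: "Suc (length rest) + k \<le> N"
    using spec[OF assms(3)[unfolded bounded_v_def], of r] unfolding bl_def k0(1) k by auto
  have A: "\<forall>r. length (?s r) \<le> N" using assms(3) by (simp add: bounded_v_def bl_def)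
  let ?s1 = "?s(r := True # rest, 0 := replicate k False @ ?s 0)"
  obtain t1 where 1: "exec (bounded_st b N) (While r {Some False} (Pop r ;; Push 0 False)) (?s, b) t1 (?s1, b)"
    using pour[OF assms(2) k0 A, of b False] l assms(1) k by auto
  have A1: "bounded_st b N (?s1, b)" using exec_inv[OF 1] by simp
  let ?s2 = "?s1(r := rest)"
  have 2: "exec (bounded_st b N) (Pop r) (?s1, b) 1 (?s2, b)"
    using exec_Pop'[OF A1, of r] assms(2) by simp
  have A2: "bounded_st b N (?s2, b)" using exec_inv[OF 2] by simp
  let ?r3 = "if rest = [] then [] else False # rest"
  let ?s3 = "?s2(r := ?r3)"
  have "\<exists>t. exec (bounded_st b N) (Cond r {None} Skip (Push r False)) (?s2, b) t (?s3, b)"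
  proof (cases rest)
    case Nil
    then have "?s3 = ?s2" by auto
    then show ?thesis using A2 Nil assms(2) exec.CondT[OF _ exec.Skip, of "(?s2, b)" r "{None}" "bounded_st b N" "Push r False"] by auto
  next
    case (Cons y ys)
    then have "exec (bounded_st b N) (Push r False) (?s2, b) 2 (?s3, b)"
      using exec_Push'[OF A2, of r False] assms(2) l by simp
    then show ?thesis using exec.CondF[of "(?s2, b)" r "{None}"] Cons assms(2) by fastforce
  qed
  then obtain t3 where 3: "exec (bounded_st b N) (Cond r {None} Skip (Push r False)) (?s2, b) t3 (?s3, b)" by blast
  have A3: "\<forall>r. length (?s3 r) \<le> N" using exec_inv[OF 3] by (simp add: bounded_st_def)
  have "?s3 0 = replicate k False @ []" using assms(1,2) by simp
  moreover have "?s3(0 := [], r := replicate k True @ ?s3 r) = (\<lambda>q. bin ((v(r := v r - 1)) q))"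
    using assms(1,2) P by (auto simp: fun_eq_iff)
  ultimately obtain t4 where 4: "exec (bounded_st b N) (While 0 {Some False} (Pop 0 ;; Push r True)) (?s3, b) t4
      (\<lambda>q. bin ((v(r := v r - 1)) q), b)"
    using pour[of 0 r ?s3 k False "[]" N b True] A3 assms(2) l by (auto split: if_splits)
  have "topb (fst (?s, b) r) \<notin> {None}" using False by (simp add: topb_bin)
  from exec.CondF[OF this exec.Seq[OF 1 exec.Seq[OF 2 exec.Seq[OF 3 4]]]] show ?thesis
    unfolding nx_def dec_def by blast
qed

definition nz :: "bool option set" where "nz = {Some True, Some False}"

lemma topb_nz: "topb (bin n) \<in> nz \<longleftrightarrow> n \<noteq> 0"
  by (auto simp: nz_def topb_bin)

lemma nx_Skip: "bounded_v N v \<Longrightarrow> nx b N Skip v v"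
  unfolding nx_def using exec.Skip bounded_v_st by metis

lemma nx_Seq: "nx b N c v v' \<Longrightarrow> nx b N d v' v'' \<Longrightarrow> nx b N (c ;; d) v v''"
  unfolding nx_def using exec.Seq by metis

lemma nx_WhileF: "v r = 0 \<Longrightarrow> bounded_v N v \<Longrightarrow> nx b N (While r nz c) v v"
  unfolding nx_def by (intro exI[of _ 1] exec.WhileF) (auto simp: topb_nz bounded_v_st simp del: topb.simps, simp add: nz_def)

lemma nx_WhileT: assumes "v r \<noteq> 0" "nx b N c v v'" "nx b N (While r nz c) v' v''"
  shows "nx b N (While r nz c) v v''"
proof -
  obtain t u where "exec (bounded_st b N) c (\<lambda>r. bin (v r), b) t (\<lambda>r. bin (v' r), b)"
    "exec (bounded_st b N) (While r nz c) (\<lambda>r. bin (v' r), b) u (\<lambda>r. bin (v'' r), b)"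
    using assms(2,3) unfolding nx_def by blast
  from exec.WhileT[OF _ this] assms(1) show ?thesis unfolding nx_def by (auto simp: topb_nz)
qed

lemma nx_for:
  assumes "\<And>i. i < n \<Longrightarrow> nx b N c (V i) (V (Suc i)) \<and> V i r \<noteq> 0" "V n r = 0" "bounded_v N (V n)"
  shows "nx b N (While r nz c) (V 0) (V n)"
proof -
  have "nx b N (While r nz c) (V (n - j)) (V n)" if "j \<le> n" for j
    using that
  proof (induction j)
    case 0
    then show ?case using nx_WhileF[of "V n" r N] assms by simp
  next
    case (Suc j)
    then have "Suc (n - Suc j) = n - j" by simp
    then show ?case using nx_WhileT[of "V (n - Suc j)" r b N c "V (n - j)"] assms(1)[of "n - Suc j"] Suc by simp
  qed
  from this[of n] show ?thesis by simp
qed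

text \<open>Clearing, moving and copying by counting takes time exponential in the length of the
  numbers, which is harmless where only space matters.\<close>

definition clr :: "nat \<Rightarrow> com" where "clr r = While r nz (dec r)"

definition mov :: "nat \<Rightarrow> nat \<Rightarrow> com" where "mov r q = clr q ;; While r nz (dec r ;; inc q)"

definition cpy :: "nat \<Rightarrow> nat \<Rightarrow> nat \<Rightarrow> com" where
  "cpy r q u = mov r u ;; clr q ;; While u nz (dec u ;; inc r ;; inc q)"

lemma nx_clr:
  assumes "v 0 = 0" "r \<noteq> 0" "bounded_v N v"
  shows "nx b N (clr r) v (v(r := 0))"
proof -
  have b: "bounded_v N (v(r := v r - i))" for i
    by (rule bounded_v_upd) (use assms bl_mono[of "v r - i" "v r"] in \<open>auto simp: bounded_v_def intro: order_trans\<close>)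
  have "nx b N (dec r) (v(r := v r - i)) (v(r := v r - Suc i))" for i
    using nx_dec[of "v(r := v r - i)" r N b] b[of i] assms by simp
  then show ?thesis unfolding clr_def using nx_for[of "v r" b N "dec r" "\<lambda>i. v(r := v r - i)" r] b[of "v r"] by simp
qed

lemma nx_mov:
  assumes "v 0 = 0" "r \<noteq> 0" "q \<noteq> 0" "r \<noteq> q" "bounded_v N v"
  shows "nx b N (mov r q) v (v(q := v r, r := 0))"
proof -
  let ?V = "\<lambda>i. v(r := v r - i, q := i)"
  have b: "bounded_v N (v(r := v r - i, q := j))" if "j \<le> v r" for i j
    using assms(5) bl_mono[of "v r - i" "v r"] bl_mono[OF that]
    by (intro bounded_v_upd) (auto simp: bounded_v_def intro: order_trans)
  have "nx b N (dec r ;; inc q) (?V i) (?V (Suc i))" if "i < v r" for i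
  proof (rule nx_Seq)
    show "nx b N (dec r) (?V i) (v(r := v r - Suc i, q := i))"
      using nx_dec[of "?V i" r N b] b[of i i] assms that by (simp add: fun_upd_twist)
    show "nx b N (inc q) (v(r := v r - Suc i, q := i)) (?V (Suc i))"
      using nx_inc[of "v(r := v r - Suc i, q := i)" q N b] b[of i "Suc i"] assms that bl_mono[of "Suc i" "v r"]
      by (auto simp: bounded_v_def intro: order_trans)
  qed
  then have "nx b N (While r nz (dec r ;; inc q)) (?V 0) (?V (v r))"
    by (intro nx_for[where V = ?V] conjI b) (use assms in auto)
  moreover have "?V 0 = v(q := 0)" "?V (v r) = v(q := v r, r := 0)" using assms(4) by (auto simp: fun_eq_iff)
  ultimately show ?thesis unfolding mov_def using nx_Seq[OF nx_clr[of v q N b]] assms by metis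
qed

lemma nx_cpy:
  assumes "v 0 = 0" "r \<noteq> 0" "q \<noteq> 0" "u \<noteq> 0" "r \<noteq> q" "r \<noteq> u" "q \<noteq> u" "bounded_v N v" "v u = 0"
  shows "nx b N (cpy r q u) v (v(q := v r))"
proof -
  let ?V = "\<lambda>i. v(u := v r - i, r := i, q := i)"
  have b: "bounded_v N (v(u := v r - i, r := j, q := k))" if "j \<le> v r" "k \<le> v r" for i j k
    using assms(8) bl_mono[of "v r - i" "v r"] bl_mono[OF that(1)] bl_mono[OF that(2)]
    by (intro bounded_v_upd) (auto simp: bounded_v_def intro: order_trans)
  have B: "bl (Suc i) \<le> N" if "i < v r" for i
    using assms(8) bl_mono[of "Suc i" "v r"] that by (auto simp: bounded_v_def intro: order_trans)
  have "nx b N (dec u ;; inc r ;; inc q) (?V i) (?V (Suc i))" if "i < v r" for i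
  proof (intro nx_Seq)
    show "nx b N (dec u) (?V i) (v(u := v r - Suc i, r := i, q := i))"
      using nx_dec[of "?V i" u N b] b[of i i] assms that by (auto simp: fun_upd_twist)
    show "nx b N (inc r) (v(u := v r - Suc i, r := i, q := i)) (v(u := v r - Suc i, r := Suc i, q := i))"
      using nx_inc[of "v(u := v r - Suc i, r := i, q := i)" r N b] b[of i i "Suc i"] assms that B[OF that]
      by (auto simp: fun_upd_twist)
    show "nx b N (inc q) (v(u := v r - Suc i, r := Suc i, q := i)) (?V (Suc i))"
      using nx_inc[of "v(u := v r - Suc i, r := Suc i, q := i)" q N b] b[of "Suc i" i "Suc i"] assms that B[OF that]
      by (auto simp: fun_upd_twist)
  qed
  then have w: "nx b N (While u nz (dec u ;; inc r ;; inc q)) (?V 0) (?V (v r))"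
    by (intro nx_for[where V = ?V] conjI b) (use assms in auto)
  have m: "nx b N (mov r u) v (v(u := v r, r := 0))" using assms by (intro nx_mov) auto
  have "nx b N (clr q) (v(u := v r, r := 0)) (v(u := v r, r := 0, q := 0))"
    using assms nx_bounded[OF m] by (intro nx_clr) auto
  moreover have "?V 0 = v(u := v r, r := 0, q := 0)" "?V (v r) = v(q := v r)" using assms by (auto simp: fun_eq_iff)
  ultimately show ?thesis unfolding cpy_def using nx_Seq[OF m nx_Seq[OF _ w]] by metis
qed

section \<open>Functions computable in polynomial space\<close>

text \<open>A function of finitely many arguments is given as a function of an environment, that is, an
  infinite sequence of arguments. A variable bound by a quantifier or a recursion is put in front
  of the environment.\<close>

type_synonym env = "nat \<Rightarrow> nat"

definition agree :: "nat \<Rightarrow> env \<Rightarrow> env \<Rightarrow> bool" where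
  "agree k e e' \<longleftrightarrow> (\<forall>i<k. e i = e' i)"

definition small :: "nat \<Rightarrow> nat \<Rightarrow> env \<Rightarrow> bool" where
  "small k L e \<longleftrightarrow> (\<forall>i<k. bl (e i) \<le> L)"

text \<open>\<open>\<rho>\<close> names the registers of the arguments and \<open>q\<close> that of
  the result. Registers from \<open>m\<close> on are free: zero before and again afterwards, so that
  pieces of code can be nested without clashes.\<close>

definition impl :: "nat \<Rightarrow> nat poly \<Rightarrow> (env \<Rightarrow> nat) \<Rightarrow> (nat \<Rightarrow> nat) \<Rightarrow> nat \<Rightarrow> nat \<Rightarrow> com \<Rightarrow> bool" where
  "impl k p F \<rho> q m c \<longleftrightarrow> (\<forall>v b N L. v 0 = 0 \<and> (\<forall>r\<ge>m. v r = 0) \<and> bounded_v N v \<and>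
     small k L (\<lambda>i. v (\<rho> i)) \<and> poly p L \<le> N \<longrightarrow> nx b N c v (v(q := F (\<lambda>i. v (\<rho> i)))))"

text \<open>One polynomial bounds both the space and the length of the value; thus intermediate
  values of compositions stay polynomially long. Code must exist for every choice of registers, as
  the caller decides on them.\<close>

definition PFkp :: "nat \<Rightarrow> nat poly \<Rightarrow> (env \<Rightarrow> nat) \<Rightarrow> bool" where
  "PFkp k p F \<longleftrightarrow> (\<forall>e e'. agree k e e' \<longrightarrow> F e = F e') \<and> (\<forall>e L. small k L e \<longrightarrow> bl (F e) \<le> poly p L) \<and>
     (\<forall>\<rho> q m. 0 < q \<and> q < m \<and> (\<forall>i<k. 0 < \<rho> i \<and> \<rho> i < m) \<longrightarrow> (\<exists>c. impl k p F \<rho> q m c))"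

definition PF :: "(env \<Rightarrow> nat) \<Rightarrow> bool" where
  "PF F \<longleftrightarrow> (\<exists>k p. PFkp k p F)"

lemma implD: "impl k p F \<rho> q m c \<Longrightarrow> v 0 = 0 \<Longrightarrow> (\<And>r. m \<le> r \<Longrightarrow> v r = 0) \<Longrightarrow> bounded_v N v \<Longrightarrow>
    small k L (\<lambda>i. v (\<rho> i)) \<Longrightarrow> poly p L \<le> N \<Longrightarrow> nx b N c v (v(q := F (\<lambda>i. v (\<rho> i))))"
  unfolding impl_def by blast

lemma PFkp_mono:
  assumes "PFkp k p F" "k \<le> k'" shows "PFkp k' p F"
proof -
  have "agree k' e e' \<Longrightarrow> agree k e e'" for e e' using assms(2) by (auto simp: agree_def)
  moreover have "small k' L e \<Longrightarrow> small k L e" for e L using assms(2) by (auto simp: small_def)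
  ultimately show ?thesis using assms unfolding PFkp_def impl_def
    by (smt (verit, best) order_less_le_trans)
qed

lemma PFkp_agree: "PFkp k p F \<Longrightarrow> agree k e e' \<Longrightarrow> F e = F e'"
  unfolding PFkp_def by blast

lemma PFkp_small: "PFkp k p F \<Longrightarrow> small k L e \<Longrightarrow> bl (F e) \<le> poly p L"
  unfolding PFkp_def by blast

lemma PFkp_impl: "PFkp k p F \<Longrightarrow> 0 < q \<and> q < m \<and> (\<forall>i<k. 0 < \<rho> i \<and> \<rho> i < m) \<Longrightarrow> \<exists>c. impl k p F \<rho> q m c"
  unfolding PFkp_def by blast

lemma PFkpI: "(\<And>e e'. agree k e e' \<Longrightarrow> F e = F e') \<Longrightarrow> (\<And>e L. small k L e \<Longrightarrow> bl (F e) \<le> poly p L) \<Longrightarrow>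
   (\<And>\<rho> q m. 0 < q \<and> q < m \<and> (\<forall>i<k. 0 < \<rho> i \<and> \<rho> i < m) \<Longrightarrow> \<exists>c. impl k p F \<rho> q m c) \<Longrightarrow> PFkp k p F"
  unfolding PFkp_def by blast

lemma PF_zero: "PF (\<lambda>e. 0)"
proof -
  have "impl 0 0 (\<lambda>e. 0) \<rho> q m (clr q)" if "0 < q" for \<rho> q m
    unfolding impl_def using nx_clr that by auto
  then have "PFkp 0 0 (\<lambda>e. 0)" unfolding PFkp_def by auto
  then show ?thesis unfolding PF_def by blast
qed

lemma PF_Suc: assumes "PF F" shows "PF (\<lambda>e. Suc (F e))"
proof -
  obtain k p where F: "PFkp k p F" using assms unfolding PF_def by blast
  let ?p = "p + [:1:]"
  have bd: "bl (Suc (F e)) \<le> poly ?p L" if "small k L e" for e L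
    using F that bl_Suc[of "F e"] by (auto simp: PFkp_def intro: order_trans)
  have "\<exists>c. impl k ?p (\<lambda>e. Suc (F e)) \<rho> q m c" if q: "0 < q \<and> q < m \<and> (\<forall>i<k. 0 < \<rho> i \<and> \<rho> i < m)" for \<rho> q m
  proof -
    obtain c where c: "impl k p F \<rho> q m c" using F q unfolding PFkp_def by blast
    have "impl k ?p (\<lambda>e. Suc (F e)) \<rho> q m (c ;; inc q)" unfolding impl_def
    proof (intro allI impI, elim conjE)
      fix v b N L assume v: "v 0 = 0" "\<forall>r\<ge>m. v r = 0" "bounded_v N v" "small k L (\<lambda>i. v (\<rho> i))" "poly ?p L \<le> N"
      have 1: "nx b N c v (v(q := F (\<lambda>i. v (\<rho> i))))" by (rule implD[OF c]) (use v in auto)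
      have "nx b N (inc q) (v(q := F (\<lambda>i. v (\<rho> i)))) (v(q := Suc (F (\<lambda>i. v (\<rho> i)))))"
        using nx_inc[of "v(q := F (\<lambda>i. v (\<rho> i)))" q N b] q v bd[OF v(4)] nx_bounded[OF 1] by auto
      then show "nx b N (c ;; inc q) v (v(q := Suc (F (\<lambda>i. v (\<rho> i)))))" by (rule nx_Seq[OF 1])
    qed
    then show ?thesis by blast
  qed
  then have "PFkp k ?p (\<lambda>e. Suc (F e))" using F bd unfolding PFkp_def by metis
  then show ?thesis unfolding PF_def by blast
qed

lemma PF_const: "PF (\<lambda>e. n)"
  by (induction n) (auto intro: PF_zero PF_Suc)

lemma PF_var: "PF (\<lambda>e. e i)"
proof -
  let ?k = "Suc i"
  have "\<exists>c. impl ?k [:0, 1:] (\<lambda>e. e i) \<rho> q m c" if q: "0 < q \<and> q < m \<and> (\<forall>i<?k. 0 < \<rho> i \<and> \<rho> i < m)" for \<rho> q m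
  proof (cases "\<rho> i = q")
    case True
    then have "impl ?k [:0, 1:] (\<lambda>e. e i) \<rho> q m Skip"
      unfolding impl_def by (auto intro: nx_Skip)
    then show ?thesis by blast
  next
    case False
    then have "impl ?k [:0, 1:] (\<lambda>e. e i) \<rho> q m (cpy (\<rho> i) q m)"
      unfolding impl_def using q by (auto intro!: nx_cpy)
    then show ?thesis by blast
  qed
  then have "PFkp ?k [:0, 1:] (\<lambda>e. e i)" unfolding PFkp_def by (auto simp: agree_def small_def)
  then show ?thesis unfolding PF_def by blast
qed

lemma PF_rename: assumes "PF F" shows "PF (\<lambda>e. F (\<lambda>i. e (\<pi> i)))"
proof -
  obtain k p where F: "PFkp k p F" using assms unfolding PF_def by blast
  \<comment> \<open>The sum is a convenient bound on all indices \<open>\<pi> i\<close> with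
    \<open>i < k\<close>.\<close>
  let ?k = "Suc (\<Sum>i<k. \<pi> i)"
  have \<pi>: "\<pi> i < ?k" if "i < k" for i using that by (auto simp: less_Suc_eq_le intro!: member_le_sum)
  have ag: "agree ?k e e' \<Longrightarrow> agree k (\<lambda>i. e (\<pi> i)) (\<lambda>i. e' (\<pi> i))" for e e' using \<pi> by (auto simp: agree_def)
  have sm: "small ?k L e \<Longrightarrow> small k L (\<lambda>i. e (\<pi> i))" for e L using \<pi> by (auto simp: small_def)
  have "\<exists>c. impl ?k p (\<lambda>e. F (\<lambda>i. e (\<pi> i))) \<rho> q m c" if q: "0 < q \<and> q < m \<and> (\<forall>i<?k. 0 < \<rho> i \<and> \<rho> i < m)" for \<rho> q m
  proof -
    obtain c where c: "impl k p F (\<lambda>i. \<rho> (\<pi> i)) q m c"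
      using F q \<pi> unfolding PFkp_def by (metis (no_types, lifting))
    then have "impl ?k p (\<lambda>e. F (\<lambda>i. e (\<pi> i))) \<rho> q m c" using sm unfolding impl_def by blast
    then show ?thesis by blast
  qed
  then have "PFkp ?k p (\<lambda>e. F (\<lambda>i. e (\<pi> i)))" using F ag sm unfolding PFkp_def by metis
  then show ?thesis unfolding PF_def by blast
qed

text \<open>The value of \<open>G\<close> is kept in the first free register, which is cleared
  afterwards. The space of \<open>F\<close> is measured at the length of that value, whence the
  composition of polynomials.\<close>

lemma PF_let: assumes "PF F" "PF G" shows "PF (\<lambda>e. F (case_nat (G e) e))"
proof -
  obtain k1 k2 p p2 where "PFkp k1 p F" "PFkp k2 p2 G" using assms unfolding PF_def by blast
  then obtain k where F: "PFkp k p F" and G: "PFkp k p2 G" using PFkp_mono by (metis max.cobounded1 max.cobounded2)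
  define P where "P = p2 + [:0, 1:] + pcompose p (p2 + [:0, 1:])"
  have P: "poly P L = poly p2 L + L + poly p (poly p2 L + L)" for L by (simp add: P_def poly_pcompose)
  have Gb: "bl (G e) \<le> poly p2 L" if "small k L e" for e L using G that unfolding PFkp_def by blast
  have sm: "small k (poly p2 L + L) (case_nat (G e) e)" if "small k L e" for e L
    using that Gb[OF that] by (auto simp: small_def split: nat.split intro: trans_le_add2 trans_le_add1)
  have bd: "bl (F (case_nat (G e) e)) \<le> poly P L" if "small k L e" for e L
    using F sm[OF that] unfolding PFkp_def P by (meson trans_le_add2)
  have ag: "F (case_nat (G e) e) = F (case_nat (G e') e')" if "agree k e e'" for e e'
  proof -
    have "G e = G e'" using G that unfolding PFkp_def by blast
    then have "agree k (case_nat (G e) e) (case_nat (G e') e')" using that by (auto simp: agree_def split: nat.split)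
    then show ?thesis using F unfolding PFkp_def by blast
  qed
  have "\<exists>c. impl k P (\<lambda>e. F (case_nat (G e) e)) \<rho> q m c" if q: "0 < q \<and> q < m \<and> (\<forall>i<k. 0 < \<rho> i \<and> \<rho> i < m)" for \<rho> q m
  proof -
    have "0 < m \<and> m < Suc m \<and> (\<forall>i<k. 0 < \<rho> i \<and> \<rho> i < Suc m)" using q by auto
    then obtain c1 where c1: "impl k p2 G \<rho> m (Suc m) c1" using G unfolding PFkp_def by blast
    let ?\<rho> = "case_nat m \<rho>"
    have "0 < q \<and> q < Suc m \<and> (\<forall>i<k. 0 < ?\<rho> i \<and> ?\<rho> i < Suc m)" using q by (auto split: nat.split simp: less_Suc_eq)
    then obtain c2 where c2: "impl k p F ?\<rho> q (Suc m) c2" using F unfolding PFkp_def by blast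
    have "impl k P (\<lambda>e. F (case_nat (G e) e)) \<rho> q m (c1 ;; c2 ;; clr m)" unfolding impl_def
    proof (intro allI impI, elim conjE)
      fix v b N L assume v: "v 0 = 0" "\<forall>r\<ge>m. v r = 0" "bounded_v N v" "small k L (\<lambda>i. v (\<rho> i))" "poly P L \<le> N"
      let ?e = "\<lambda>i. v (\<rho> i)"
      let ?v1 = "v(m := G ?e)"
      have nm: "\<rho> j \<noteq> m" if "j < k" for j using q that by (metis less_irrefl)
      let ?v2 = "?v1(q := F (case_nat (G ?e) ?e))"
      have 1: "nx b N c1 v ?v1" by (rule implD[OF c1]) (use v in \<open>auto simp: P\<close>)
      have "agree k (\<lambda>i. ?v1 (?\<rho> i)) (case_nat (G ?e) ?e)"
        unfolding agree_def
      proof (intro allI impI)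
        fix i assume "i < k"
        then show "?v1 (?\<rho> i) = case_nat (G ?e) ?e i" by (cases i) (simp_all add: nm)
      qed
      then have e: "F (\<lambda>i. ?v1 (?\<rho> i)) = F (case_nat (G ?e) ?e)"
          "small k (poly p2 L + L) (\<lambda>i. ?v1 (?\<rho> i))"
        using F sm[OF v(4)] unfolding PFkp_def by (blast, auto simp: agree_def small_def)
      have 2: "nx b N c2 ?v1 ?v2"
        unfolding e(1)[symmetric]
        by (rule c2[unfolded impl_def, rule_format, of _ N "poly p2 L + L"])
          (use e(2) v q nx_bounded[OF 1] in \<open>auto simp: P\<close>)
      have 3: "nx b N (clr m) ?v2 (?v2(m := 0))"
        using q v nx_bounded[OF 2] by (intro nx_clr) auto
      have "?v2(m := 0) = v(q := F (case_nat (G ?e) ?e))" using q v(2) by (auto simp: fun_eq_iff)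
      then show "nx b N (c1 ;; c2 ;; clr m) v (v(q := F (case_nat (G ?e) ?e)))"
        using nx_Seq[OF 1 nx_Seq[OF 2 3]] by simp
    qed
    then show ?thesis by blast
  qed
  then have "PFkp k P (\<lambda>e. F (case_nat (G e) e))" using ag bd unfolding PFkp_def by blast
  then show ?thesis unfolding PF_def by blast
qed

lemma case_nat2: "P a \<Longrightarrow> P b \<Longrightarrow> \<forall>i<k. P (\<rho> i) \<Longrightarrow> i < Suc (Suc k) \<Longrightarrow> P (case_nat a (case_nat b \<rho>) i)"
  by (auto split: nat.split)

text \<open>The recursion may have exponentially many steps, as long as the length of its values stays
  polynomial.\<close>

lemma PF_rec:
  assumes "PF N" "PF G" "PF (\<lambda>e. H (e 0) (e 1) (\<lambda>i. e (Suc (Suc i))))"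
    and bound: "\<And>e L n. small k0 L e \<Longrightarrow> n \<le> N e \<Longrightarrow> bl (rec_nat (G e) (\<lambda>j a. H j a e) n) \<le> poly p0 L"
  shows "PF (\<lambda>e. rec_nat (G e) (\<lambda>j a. H j a e) (N e))"
proof -
  let ?H = "\<lambda>e. H (e 0) (e 1) (\<lambda>i. e (Suc (Suc i)))"
  let ?R = "\<lambda>e. rec_nat (G e) (\<lambda>j a. H j a e)"
  obtain k1 p1 where k1: "PFkp k1 p1 N" using assms(1) unfolding PF_def by blast
  obtain k2 p2 where k2: "PFkp k2 p2 G" using assms(2) unfolding PF_def by blast
  obtain k3 p3 where k3: "PFkp k3 p3 ?H" using assms(3) unfolding PF_def by blast
  note ks = k1 k2 k3
  define k where "k = k0 + k1 + k2 + k3"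
  have N: "PFkp k p1 N" and G: "PFkp k p2 G" and H: "PFkp (Suc (Suc k)) p3 ?H"
    using PFkp_mono[OF ks(1), of k] PFkp_mono[OF ks(2), of k] PFkp_mono[OF ks(3), of "Suc (Suc k)"]
    by (auto simp: k_def)
  define P where "P = p1 + p2 + p0 + [:0, 1:] + pcompose p3 (p1 + p2 + p0 + [:0, 1:])"
  define Q where "Q L = poly p1 L + poly p2 L + poly p0 L + L" for L
  have P: "poly P L = Q L + poly p3 (Q L)" for L by (simp add: P_def poly_pcompose Q_def)
  have Hag: "H j a e = H j a e'" if "agree k e e'" for j a e e'
  proof -
    have "agree (Suc (Suc k)) (case_nat j (case_nat a e)) (case_nat j (case_nat a e'))"
      using that by (auto simp: agree_def split: nat.split)
    then have "?H (case_nat j (case_nat a e)) = ?H (case_nat j (case_nat a e'))"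
      by (rule PFkp_agree[OF H])
    then show ?thesis by simp
  qed
  have ag: "?R e (N e) = ?R e' (N e')" if "agree k e e'" for e e'
  proof -
    have "N e = N e'" "G e = G e'" using PFkp_agree[OF N that] PFkp_agree[OF G that] by auto
    moreover have "(\<lambda>j a. H j a e) = (\<lambda>j a. H j a e')" using Hag[OF that] by auto
    ultimately show ?thesis by simp
  qed
  have Rb: "bl (?R e n) \<le> poly p0 L" if "small k L e" "n \<le> N e" for e L n
    by (rule bound[OF _ that(2)]) (use that(1) in \<open>auto simp: small_def k_def\<close>)
  have bd: "bl (?R e (N e)) \<le> poly P L" if "small k L e" for e L
    using Rb[OF that, of "N e"] by (simp add: P Q_def)
  have "\<exists>c. impl k P (\<lambda>e. ?R e (N e)) \<rho> q m c" if q: "0 < q \<and> q < m \<and> (\<forall>i<k. 0 < \<rho> i \<and> \<rho> i < m)" for \<rho> q m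
  proof -
    \<comment> \<open>Work registers: \<open>m\<close> counts the remaining rounds down,
      \<open>m + 1\<close> counts the index up, \<open>m + 2\<close> holds the current value and
      \<open>m + 3\<close> receives the next one.\<close>
    let ?m = "m + 4"
    have qs: "0 < m \<and> m < ?m \<and> (\<forall>i<k. 0 < \<rho> i \<and> \<rho> i < ?m)" "0 < m + 2 \<and> m + 2 < ?m \<and> (\<forall>i<k. 0 < \<rho> i \<and> \<rho> i < ?m)"
      using q by auto
    obtain c1 where c1: "impl k p1 N \<rho> m ?m c1" using PFkp_impl[OF N qs(1)] by blast
    obtain c2 where c2: "impl k p2 G \<rho> (m + 2) ?m c2" using PFkp_impl[OF G qs(2)] by blast
    let ?\<rho> = "case_nat (m + 1) (case_nat (m + 2) \<rho>)"
    have qs3: "0 < m + 3 \<and> m + 3 < ?m \<and> (\<forall>i<Suc (Suc k). 0 < ?\<rho> i \<and> ?\<rho> i < ?m)"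
      using case_nat2[of "\<lambda>x. 0 < x \<and> x < ?m" "m + 1" "m + 2" k \<rho>] qs(1) by simp
    obtain c3 where c3: "impl (Suc (Suc k)) p3 ?H ?\<rho> (m + 3) ?m c3" using PFkp_impl[OF H qs3] by blast
    let ?body = "c3 ;; mov (m + 3) (m + 2) ;; inc (m + 1) ;; dec m"
    have "impl k P (\<lambda>e. ?R e (N e)) \<rho> q m (c1 ;; c2 ;; While m nz ?body ;; mov (m + 2) q ;; clr (m + 1))" unfolding impl_def
    proof (intro allI impI, elim conjE)
      fix v b B L assume v: "v 0 = 0" "\<forall>r\<ge>m. v r = 0" "bounded_v B v" "small k L (\<lambda>i. v (\<rho> i))" "poly P L \<le> B"
      define e where "e = (\<lambda>i. v (\<rho> i))"
      have sm: "small k L e" using v(4) by (simp add: e_def)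
      have B: "poly p1 L \<le> B" "poly p2 L \<le> B" "poly p0 L \<le> B" "Q L \<le> B" "poly p3 (Q L) \<le> B"
        using v(5) by (auto simp: P Q_def)
      have NB: "bl (N e) \<le> poly p1 L" by (rule PFkp_small[OF N sm])
      let ?v1 = "v(m := N e)"
      have 1: "nx b B c1 v ?v1" unfolding e_def by (rule implD[OF c1]) (use v B in auto)
      let ?V = "\<lambda>i. v(m := N e - i, m + 1 := i, m + 2 := ?R e i)"
      have G0: "G (\<lambda>i. ?v1 (\<rho> i)) = G e"
      proof -
        have "agree k (\<lambda>i. ?v1 (\<rho> i)) e" using q by (auto simp: agree_def e_def)
        then show ?thesis by (rule PFkp_agree[OF G])
      qed
      have "nx b B c2 ?v1 (?v1(m + 2 := G (\<lambda>i. ?v1 (\<rho> i))))"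
        by (rule implD[OF c2, of _ _ L]) (use v B q nx_bounded[OF 1] in \<open>auto simp: small_def\<close>)
      moreover have "?v1(m + 2 := G e) = ?V 0" using v(2) by (auto simp: fun_eq_iff)
      ultimately have 2: "nx b B c2 ?v1 (?V 0)" unfolding G0 by simp
      have bV: "bounded_v B (v(m := n, m + 1 := i, m + 2 := ?R e j))" if "i \<le> N e" "j \<le> N e" "n \<le> N e" for i j n
        using v(3) Rb[OF sm that(2)] B NB bl_mono[OF that(1)] bl_mono[OF that(3)]
        by (intro bounded_v_upd) auto
      have step: "nx b B ?body (?V i) (?V (Suc i))" if i: "i < N e" for i
      proof -
        have Vi: "H i (?R e i) (\<lambda>j. ?V i (\<rho> j)) = ?R e (Suc i)"
        proof -
          have "agree k (\<lambda>j. ?V i (\<rho> j)) e" using q by (auto simp: agree_def e_def)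
          from Hag[OF this] show ?thesis by simp
        qed
        let ?W1 = "(?V i)(m + 3 := ?R e (Suc i))"
        have e3: "?H (\<lambda>j. ?V i (?\<rho> j)) = ?R e (Suc i)" using Vi by simp
        have "bl (?V i (\<rho> j)) \<le> Q L" if "j < k" for j
        proof -
          have "\<rho> j < m" using q that by blast
          then show ?thesis using sm that by (auto simp: small_def e_def Q_def intro: trans_le_add2)
        qed
        then have small3: "small (Suc (Suc k)) (Q L) (\<lambda>j. ?V i (?\<rho> j))"
          using bl_mono[of i "N e"] i NB Rb[OF sm, of i] case_nat2[of "\<lambda>x. bl (?V i x) \<le> Q L" "m + 1" "m + 2" k \<rho>]
          by (simp add: small_def Q_def)
        have 3: "nx b B c3 (?V i) ?W1" unfolding e3[symmetric]
          by (rule implD[OF c3, of _ _ "Q L"]) (use v B small3 q bV[of i i "N e - i"] i in auto)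
        let ?W2 = "v(m := N e - i, m + 1 := i, m + 2 := ?R e (Suc i))"
        have "nx b B (mov (m + 3) (m + 2)) ?W1 (?W1(m + 2 := ?W1 (m + 3), m + 3 := 0))"
          using v q nx_bounded[OF 3] by (intro nx_mov) auto
        moreover have "?W1(m + 2 := ?W1 (m + 3), m + 3 := 0) = ?W2" using v(2) by (auto simp: fun_eq_iff)
        ultimately have 4: "nx b B (mov (m + 3) (m + 2)) ?W1 ?W2" by simp
        let ?W3 = "v(m := N e - i, m + 1 := Suc i, m + 2 := ?R e (Suc i))"
        have "nx b B (inc (m + 1)) ?W2 (?W2(m + 1 := Suc (?W2 (m + 1))))"
          using v q nx_bounded[OF 4] bl_mono[of "Suc i" "N e"] i NB B by (intro nx_inc) auto
        moreover have "?W2(m + 1 := Suc (?W2 (m + 1))) = ?W3" by (auto simp: fun_eq_iff)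
        ultimately have 5: "nx b B (inc (m + 1)) ?W2 ?W3" by simp
        have "nx b B (dec m) ?W3 (?W3(m := ?W3 m - 1))"
          using v q nx_bounded[OF 5] by (intro nx_dec) auto
        moreover have "?W3(m := ?W3 m - 1) = ?V (Suc i)" by (auto simp: fun_eq_iff)
        ultimately have 6: "nx b B (dec m) ?W3 (?V (Suc i))" by simp
        show ?thesis by (rule nx_Seq[OF 3 nx_Seq[OF 4 nx_Seq[OF 5 6]]])
      qed
      have 3: "nx b B (While m nz ?body) (?V 0) (?V (N e))"
        by (rule nx_for[where V = ?V]) (use step bV[of "N e" "N e" 0] in auto)
      have 4: "nx b B (mov (m + 2) q) (?V (N e)) ((?V (N e))(q := ?R e (N e), m + 2 := 0))"
        using nx_mov[of "?V (N e)" "m + 2" q B b] v q nx_bounded[OF 3] by auto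
      let ?W = "(?V (N e))(q := ?R e (N e), m + 2 := 0)"
      have "nx b B (clr (m + 1)) ?W (?W(m + 1 := 0))"
        using v q nx_bounded[OF 4] by (intro nx_clr) auto
      moreover have "?W(m + 1 := 0) = v(q := ?R e (N e))" using v(2) q by (auto simp: fun_eq_iff)
      ultimately have 5: "nx b B (clr (m + 1)) ?W (v(q := ?R e (N e)))" by simp
      show "nx b B (c1 ;; c2 ;; While m nz ?body ;; mov (m + 2) q ;; clr (m + 1)) v
          (v(q := ?R (\<lambda>i. v (\<rho> i)) (N (\<lambda>i. v (\<rho> i)))))"
        using nx_Seq[OF 1 nx_Seq[OF 2 nx_Seq[OF 3 nx_Seq[OF 4 5]]]] unfolding e_def .
    qed
    then show ?thesis by blast
  qed
  then have "PFkp k P (\<lambda>e. ?R e (N e))" using PFkpI[of k "\<lambda>e. ?R e (N e)" P] ag bd by blast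
  then show ?thesis unfolding PF_def by blast
qed

section \<open>Arithmetic in polynomial space\<close>

text \<open>Simultaneous substitution by iterating \<open>PF_let\<close>: the last argument is
  rotated to the front, and its term is shifted past the \<open>n\<close> arguments that are still
  to be substituted.\<close>

lemma PF_subst:
  assumes "PF F" "\<And>i. i < n \<Longrightarrow> PF (g i)"
  shows "PF (\<lambda>e. F (\<lambda>i. if i < n then g i e else e (i - n)))"
  using assms
proof (induction n arbitrary: F)
  case 0
  then show ?case by simp
next
  case (Suc n)
  let ?F1 = "\<lambda>e. F (\<lambda>i. e (if i < n then Suc i else if i = n then 0 else i))"
  let ?G = "\<lambda>e. g n (\<lambda>i. e (n + i))"
  have "PF ?F1" by (rule PF_rename[OF Suc.prems(1)])
  moreover have "PF ?G" using PF_rename[OF Suc.prems(2)[of n], of "(+) n"] by simp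
  ultimately have "PF (\<lambda>e. ?F1 (case_nat (?G e) e))"
    by (rule PF_let[where F = ?F1 and G = ?G])
  from Suc.IH[OF this] Suc.prems(2)
  have "PF (\<lambda>e. ?F1 (case_nat (?G (\<lambda>i. if i < n then g i e else e (i - n))) (\<lambda>i. if i < n then g i e else e (i - n))))"
    by (metis less_SucI)
  moreover have "?F1 (case_nat (?G (\<lambda>i. if i < n then g i e else e (i - n))) (\<lambda>i. if i < n then g i e else e (i - n)))
      = F (\<lambda>i. if i < Suc n then g i e else e (i - Suc n))" for e
  proof -
    have "(\<lambda>i. case_nat (?G (\<lambda>i. if i < n then g i e else e (i - n))) (\<lambda>i. if i < n then g i e else e (i - n))
      (if i < n then Suc i else if i = n then 0 else i)) = (\<lambda>i. if i < Suc n then g i e else e (i - Suc n))"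
      by (auto simp: fun_eq_iff less_Suc_eq split: nat.split)
    then show ?thesis by simp
  qed
  ultimately show ?case by simp
qed

lemma PF_list:
  assumes "PF F" "list_all PF gs"
  shows "PF (\<lambda>e. F (\<lambda>i. if i < length gs then (gs ! i) e else e (i - length gs)))"
  by (rule PF_subst[OF assms(1), where n = "length gs" and g = "\<lambda>i. gs ! i"]) (use assms(2) in \<open>auto simp: list_all_length\<close>)

lemma PF_comp1: "PF (\<lambda>e. f (e 0)) \<Longrightarrow> PF A \<Longrightarrow> PF (\<lambda>e. f (A e))"
  using PF_list[of "\<lambda>e. f (e 0)" "[A]"] by simp

lemma PF_comp2: "PF (\<lambda>e. f (e 0) (e 1)) \<Longrightarrow> PF A \<Longrightarrow> PF B \<Longrightarrow> PF (\<lambda>e. f (A e) (B e))"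
  using PF_list[of "\<lambda>e. f (e 0) (e 1)" "[A, B]"] by simp

lemma PF_comp3: "PF (\<lambda>e. f (e 0) (e 1) (e 2)) \<Longrightarrow> \<lbrakk>PF A; PF B; PF C\<rbrakk> \<Longrightarrow> PF (\<lambda>e. f (A e) (B e) (C e))"
  using PF_list[of "\<lambda>e. f (e 0) (e 1) (e 2)" "[A, B, C]"] by simp

lemma PF_comp4: "PF (\<lambda>e. f (e 0) (e 1) (e 2) (e 3)) \<Longrightarrow> \<lbrakk>PF A; PF B; PF C\<rbrakk> \<Longrightarrow> PF D \<Longrightarrow>
    PF (\<lambda>e. f (A e) (B e) (C e) (D e))"
  using PF_list[of "\<lambda>e. f (e 0) (e 1) (e 2) (e 3)" "[A, B, C, D]"] by simp

lemma PF_comp5: "PF (\<lambda>e. f (e 0) (e 1) (e 2) (e 3) (e 4)) \<Longrightarrow> \<lbrakk>PF A; PF B; PF C; PF D\<rbrakk> \<Longrightarrow> PF E \<Longrightarrow>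
    PF (\<lambda>e. f (A e) (B e) (C e) (D e) (E e))"
  using PF_list[of "\<lambda>e. f (e 0) (e 1) (e 2) (e 3) (e 4)" "[A, B, C, D, E]"] by simp

lemma PF_comp6: "PF (\<lambda>e. f (e 0) (e 1) (e 2) (e 3) (e 4) (e 5)) \<Longrightarrow> \<lbrakk>PF A; PF B; PF C; PF D; PF E\<rbrakk> \<Longrightarrow> PF G \<Longrightarrow>
    PF (\<lambda>e. f (A e) (B e) (C e) (D e) (E e) (G e))"
  using PF_list[of "\<lambda>e. f (e 0) (e 1) (e 2) (e 3) (e 4) (e 5)" "[A, B, C, D, E, G]"] by simp

section \<open>Predicates, bounded recursion and bounded quantifiers\<close>

definition PP :: "(env \<Rightarrow> bool) \<Rightarrow> bool" where "PP P \<longleftrightarrow> PF (\<lambda>e. of_bool (P e))"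

lemma PP_comp2: "PP (\<lambda>e. f (e 0) (e 1)) \<Longrightarrow> PF A \<Longrightarrow> PF B \<Longrightarrow> PP (\<lambda>e. f (A e) (B e))"
  unfolding PP_def by (rule PF_comp2)

lemma PP_comp3: "PP (\<lambda>e. f (e 0) (e 1) (e 2)) \<Longrightarrow> \<lbrakk>PF A; PF B; PF C\<rbrakk> \<Longrightarrow> PP (\<lambda>e. f (A e) (B e) (C e))"
  unfolding PP_def by (rule PF_comp3)

lemma PP_comp4: "PP (\<lambda>e. f (e 0) (e 1) (e 2) (e 3)) \<Longrightarrow> \<lbrakk>PF A; PF B; PF C\<rbrakk> \<Longrightarrow> PF D \<Longrightarrow>
    PP (\<lambda>e. f (A e) (B e) (C e) (D e))"
  unfolding PP_def by (rule PF_comp4)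

lemma PP_comp6: "PP (\<lambda>e. f (e 0) (e 1) (e 2) (e 3) (e 4) (e 5)) \<Longrightarrow> \<lbrakk>PF A; PF B; PF C; PF D; PF E\<rbrakk> \<Longrightarrow> PF G \<Longrightarrow>
    PP (\<lambda>e. f (A e) (B e) (C e) (D e) (E e) (G e))"
  unfolding PP_def by (rule PF_comp6)

named_theorems pf

lemmas [pf] = PF_const PF_Suc PF_var

lemma rec_add: "rec_nat x (\<lambda>j a. Suc a) y = x + y"
  by (induction y) auto

lemma PF_add[pf]: "PF A \<Longrightarrow> PF B \<Longrightarrow> PF (\<lambda>e. A e + B e)"
proof (rule PF_comp2[where f = "(+)"])
  have "PF (\<lambda>e. rec_nat (e 0) (\<lambda>j a. (\<lambda>_ a _. Suc a) j a e) (e 1))"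
  proof (rule PF_rec[where ?k0.0 = 2 and ?p0.0 = "[:1, 1:]"])
    fix e :: env and L n :: nat
    assume "small 2 L e" "n \<le> e 1"
    then have "e 0 < 2 ^ L" "n < 2 ^ L" by (auto simp: small_def bl_le_iff less_2_cases_iff)
    then show "bl (rec_nat (e 0) (\<lambda>j a. Suc a) n) \<le> poly [:1, 1:] L" by (simp add: rec_add bl_le_iff)
  qed (intro pf)+
  then show "PF (\<lambda>e. e 0 + e 1)" by (simp add: rec_add)
qed

lemma rec_mult: "rec_nat 0 (\<lambda>j a. a + x) y = x * (y :: nat)"
  by (induction y) auto

lemma PF_mult[pf]: "PF A \<Longrightarrow> PF B \<Longrightarrow> PF (\<lambda>e. A e * B e)"
proof (rule PF_comp2[where f = "(*)"])
  have "PF (\<lambda>e. rec_nat 0 (\<lambda>j a. (\<lambda>_ a e. a + e 0) j a e) (e 1))"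
  proof (rule PF_rec[where ?k0.0 = 2 and ?p0.0 = "[:0, 2:]"])
    fix e :: env and L n :: nat
    assume "small 2 L e" "n \<le> e 1"
    then have "e 0 < 2 ^ L" "n < 2 ^ L" by (auto simp: small_def bl_le_iff less_2_cases_iff)
    then have "e 0 * n < 2 ^ L * 2 ^ L" by (intro mult_strict_mono) auto
    then show "bl (rec_nat 0 (\<lambda>j a. a + e 0) n) \<le> poly [:0, 2:] L"
      by (simp add: rec_mult bl_le_iff power_add[symmetric] mult.commute mult_2_right)
  qed (intro pf)+
  then show "PF (\<lambda>e. e 0 * e 1)" by (simp add: rec_mult)
qed

text \<open>Limited recursion as in the Grzegorczyk hierarchy: a majorant from the class itself
  replaces an explicit bound on the length of the values.\<close>

lemma PF_rec_bounded:
  assumes "PF N" "PF G" "PF (\<lambda>e. H (e 0) (e 1) (\<lambda>i. e (Suc (Suc i))))" "PF B"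
    and bound: "\<And>e n. n \<le> N e \<Longrightarrow> rec_nat (G e) (\<lambda>j a. H j a e) n \<le> B e"
  shows "PF (\<lambda>e. rec_nat (G e) (\<lambda>j a. H j a e) (N e))"
proof -
  obtain k p where B: "PFkp k p B" using assms(4) unfolding PF_def by blast
  show ?thesis
    by (rule PF_rec[OF assms(1-3), where ?k0.0 = k and ?p0.0 = p])
      (use bound bl_mono PFkp_small[OF B] order_trans in blast)
qed

lemma rec_pred: "rec_nat 0 (\<lambda>j a. j) y = y - 1"
  by (cases y) auto

lemma PF_pred[pf]: "PF A \<Longrightarrow> PF (\<lambda>e. A e - 1)"
proof (rule PF_comp1[where f = "\<lambda>x. x - 1"])
  have "PF (\<lambda>e. rec_nat 0 (\<lambda>j a. (\<lambda>j _ _. j) j a e) (e 0))"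
    by (rule PF_rec_bounded[where B = "\<lambda>e. e 0"]) (intro pf | simp add: rec_pred)+
  then show "PF (\<lambda>e. e 0 - 1)" by (simp add: rec_pred)
qed

lemma rec_diff: "rec_nat x (\<lambda>j a. a - 1) y = x - (y :: nat)"
  by (induction y) auto

lemma PF_diff[pf]: "PF A \<Longrightarrow> PF B \<Longrightarrow> PF (\<lambda>e. A e - B e)"
proof (rule PF_comp2[where f = "(-)"])
  have "PF (\<lambda>e. rec_nat (e 0) (\<lambda>j a. (\<lambda>_ a _. a - 1) j a e) (e 1))"
    by (rule PF_rec_bounded[where B = "\<lambda>e. e 0"]) (intro pf | simp add: rec_diff[unfolded One_nat_def])+
  then show "PF (\<lambda>e. e 0 - e 1)" by (simp add: rec_diff[unfolded One_nat_def])
qed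

lemma PF_if[pf]: "PP C \<Longrightarrow> PF A \<Longrightarrow> PF B \<Longrightarrow> PF (\<lambda>e. if C e then A e else B e)"
proof -
  assume C: "PP C" "PF A" "PF B"
  have r: "rec_nat b (\<lambda>_ _. a) c = (if c \<noteq> 0 then a else b)" for a b c :: nat by (cases c) auto
  have "PF (\<lambda>e. rec_nat (e 2) (\<lambda>j a. (\<lambda>_ _ e. e 1) j a e) (e 0))"
    by (rule PF_rec_bounded[where B = "\<lambda>e. e 1 + e 2"]) (intro pf | simp add: r)+
  then have "PF (\<lambda>e. if e 0 \<noteq> 0 then e 1 else e 2)" unfolding r .
  from PF_comp3[where f = "\<lambda>c a b. if c \<noteq> 0 then a else b", OF this C[unfolded PP_def]] show ?thesis
    by simp
qed

lemma PF_of_bool[pf]: "PP P \<Longrightarrow> PF (\<lambda>e. of_bool (P e))"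
  by (simp add: PP_def)

lemma PP_le[pf]: assumes "PF A" "PF B" shows "PP (\<lambda>e. A e \<le> B e)"
proof -
  have "(of_bool (x \<le> y) :: nat) = 1 - (x - y)" for x y :: nat by auto
  then show ?thesis unfolding PP_def by (simp only:) (intro pf assms)
qed

lemma PP_not[pf]: assumes "PP P" shows "PP (\<lambda>e. \<not> P e)"
proof -
  have "(of_bool (\<not> b) :: nat) = 1 - of_bool b" for b by auto
  then show ?thesis unfolding PP_def by (simp only:) (intro pf assms)
qed

lemma PP_and[pf]: assumes "PP P" "PP Q" shows "PP (\<lambda>e. P e \<and> Q e)"
proof -
  have "(of_bool (a \<and> b) :: nat) = of_bool a * of_bool b" for a b by auto
  then show ?thesis unfolding PP_def by (simp only:) (intro pf assms)
qed

lemma PP_or[pf]: assumes "PP P" "PP Q" shows "PP (\<lambda>e. P e \<or> Q e)"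
  unfolding disj_not1[symmetric] using PP_not[OF PP_and[OF PP_not[OF assms(1)] PP_not[OF assms(2)]]]
  by (simp add: imp_conv_disj)

lemma PP_imp[pf]: assumes "PP P" "PP Q" shows "PP (\<lambda>e. P e \<longrightarrow> Q e)"
  unfolding imp_conv_disj by (intro pf assms)

lemma PP_iff[pf]: assumes "PP P" "PP Q" shows "PP (\<lambda>e. P e \<longleftrightarrow> Q e)"
  unfolding iff_conv_conj_imp by (intro pf assms)

lemma PP_less[pf]: assumes "PF A" "PF B" shows "PP (\<lambda>e. A e < B e)"
  unfolding less_eq_Suc_le by (intro pf assms)

lemma PP_eq[pf]: assumes "PF A" "PF B" shows "PP (\<lambda>e. A e = B e)"
  unfolding order_eq_iff by (intro pf assms)

lemma PP_const[pf]: "PP (\<lambda>e. b)"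
  unfolding PP_def by (rule PF_const)

text \<open>Exhaustive search stores just the current candidate and a truth value. The renaming is
  due to the accumulator, which the recursion inserts between the bound variable and the
  environment.\<close>

lemma PP_ex[pf]:
  assumes "PF B" "PP (\<lambda>e. P (e 0) (\<lambda>i. e (Suc i)))"
  shows "PP (\<lambda>e. \<exists>y<B e. P y e)"
proof -
  let ?R = "\<lambda>e. rec_nat (0 :: nat) (\<lambda>j a. (\<lambda>j a e. if a \<noteq> 0 \<or> P j e then 1 else 0) j a e)"
  have r: "?R e n = of_bool (\<exists>y<n. P y e)" for e n
    by (induction n) (auto simp: less_Suc_eq)
  have "PP (\<lambda>e. (\<lambda>e. P (e 0) (\<lambda>i. e (Suc i))) (\<lambda>i. e (if i = 0 then 0 else Suc i)))"
    unfolding PP_def by (rule PF_rename[OF assms(2)[unfolded PP_def]])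
  then have P: "PP (\<lambda>e. P (e 0) (\<lambda>i. e (Suc (Suc i))))" by simp
  have "PF (\<lambda>e. ?R e (B e))"
  proof (rule PF_rec_bounded[where B = "\<lambda>e. 1"])
    fix e n show "?R e n \<le> 1" unfolding r by simp
  qed (intro pf assms P)+
  then show ?thesis unfolding PP_def r .
qed

lemma PP_all[pf]:
  assumes "PF B" "PP (\<lambda>e. P (e 0) (\<lambda>i. e (Suc i)))"
  shows "PP (\<lambda>e. \<forall>y<B e. P y e)"
proof -
  have "(\<forall>y<B e. P y e) \<longleftrightarrow> \<not> (\<exists>y<B e. \<not> P y e)" for e by auto
  then show ?thesis by (simp only:) (intro pf assms)
qed

lemma PP_ex_le[pf]:
  "PF B \<Longrightarrow> PP (\<lambda>e. P (e 0) (\<lambda>i. e (Suc i))) \<Longrightarrow> PP (\<lambda>e. \<exists>y\<le>B e. P y e)"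
  unfolding less_Suc_eq_le[symmetric] by (intro pf)

lemma PP_all_le[pf]:
  "PF B \<Longrightarrow> PP (\<lambda>e. P (e 0) (\<lambda>i. e (Suc i))) \<Longrightarrow> PP (\<lambda>e. \<forall>y\<le>B e. P y e)"
  unfolding less_Suc_eq_le[symmetric] by (intro pf)

text \<open>Bounded minimization with \<open>B\<close> as the default; inverse functions such as
  division and binary length are obtained from it.\<close>

definition bmin :: "nat \<Rightarrow> (nat \<Rightarrow> bool) \<Rightarrow> nat" where
  "bmin B P = (LEAST z. P z \<or> z = B)"

lemma bmin_Suc: "bmin (Suc n) P = (if bmin n P < n then bmin n P else if P n then n else Suc n)"
proof -
  have 1: "P (bmin n P) \<or> bmin n P = n" for n unfolding bmin_def by (rule LeastI_ex) auto
  have 2: "bmin n P \<le> z" if "P z \<or> z = n" for n z unfolding bmin_def by (rule Least_le) (use that in auto)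
  have "bmin (Suc n) P \<le> bmin n P" if "bmin n P < n" using 1[of n] 2[of "bmin n P" "Suc n"] that by auto
  moreover have "bmin n P \<le> bmin (Suc n) P" if "bmin n P < n"
    using 1[of "Suc n"] 2[of "bmin (Suc n) P" n] that by auto
  moreover have "bmin (Suc n) P = (if P n then n else Suc n)" if "\<not> bmin n P < n"
  proof -
    have e: "bmin n P = n" using that 2[of n n] by simp
    have "n \<le> bmin (Suc n) P" using 1[of "Suc n"] 2[of "bmin (Suc n) P" n] e by auto
    moreover have "P n \<Longrightarrow> bmin (Suc n) P \<le> n" "bmin (Suc n) P \<le> Suc n" using 2 by auto
    moreover have "bmin (Suc n) P = n \<Longrightarrow> P n" using 1[of "Suc n"] by auto
    ultimately show ?thesis by (auto simp: le_Suc_eq)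
  qed
  ultimately show ?thesis by auto
qed

lemma PF_bmin[pf]:
  assumes "PF B" "PP (\<lambda>e. P (e 0) (\<lambda>i. e (Suc i)))"
  shows "PF (\<lambda>e. bmin (B e) (\<lambda>z. P z e))"
proof -
  let ?R = "\<lambda>e. rec_nat (0 :: nat) (\<lambda>j a. (\<lambda>j a e. if a < j then a else if P j e then j else Suc j) j a e)"
  have r: "?R e n = bmin n (\<lambda>z. P z e)" for e n
  proof (induction n)
    case 0
    then show ?case by (simp add: bmin_def)
  qed (simp add: bmin_Suc)
  have le: "bmin n Q \<le> n" for n Q unfolding bmin_def by (rule Least_le) simp
  have "PP (\<lambda>e. (\<lambda>e. P (e 0) (\<lambda>i. e (Suc i))) (\<lambda>i. e (if i = 0 then 0 else Suc i)))"
    unfolding PP_def by (rule PF_rename[OF assms(2)[unfolded PP_def]])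
  then have P: "PP (\<lambda>e. P (e 0) (\<lambda>i. e (Suc (Suc i))))" by simp
  have "PF (\<lambda>e. ?R e (B e))"
  proof (rule PF_rec_bounded[where B = B])
    fix e n assume "n \<le> B e"
    then show "?R e n \<le> B e" unfolding r using le[of n "\<lambda>z. P z e"] by simp
  qed (intro pf assms P)+
  then show ?thesis unfolding r .
qed

lemma bmin_eq: "P x \<Longrightarrow> (\<And>z. P z \<Longrightarrow> x \<le> z) \<Longrightarrow> x \<le> B \<Longrightarrow> bmin B P = x"
  unfolding bmin_def by (rule Least_equality) auto

lemma PF_div[pf]: assumes "PF A" "PF B" shows "PF (\<lambda>e. A e div B e)"
proof (rule PF_comp2[where f = "(div)", OF _ assms])
  have "x div y = (if y = 0 then 0 else bmin x (\<lambda>z. x < Suc z * y))" for x y :: nat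
  proof (cases "y = 0")
    case False
    then have "bmin x (\<lambda>z. x < Suc z * y) = x div y"
      by (intro bmin_eq) (auto simp: div_less_iff_less_mult[symmetric] less_Suc_eq_le simp del: mult_Suc)
    then show ?thesis using False by simp
  qed simp
  then show "PF (\<lambda>e. e 0 div e 1)" by (simp only:) (intro pf)
qed

lemma PF_mod[pf]: assumes "PF A" "PF B" shows "PF (\<lambda>e. A e mod B e)"
  unfolding modulo_nat_def by (intro pf assms)

text \<open>The power function itself leaves the class, its values being too long. Above
  \<open>b\<close> it is replaced by 0, which serves as a mark of overflow.\<close>

definition pow2 :: "nat \<Rightarrow> nat \<Rightarrow> nat" where
  "pow2 i b = (if 2 ^ i \<le> b then 2 ^ i else 0)"

lemma PF_pow2[pf]: assumes "PF A" "PF B" shows "PF (\<lambda>e. pow2 (A e) (B e))"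
proof (rule PF_comp2[where f = pow2, OF _ assms])
  let ?R = "\<lambda>e. rec_nat (if 1 \<le> e 1 then 1 else 0 :: nat) (\<lambda>j a. (\<lambda>j a e. if 2 * a \<le> e 1 then 2 * a else 0) j a e)"
  have r: "?R e n = pow2 n (e 1)" for e :: env and n
    by (induction n) (auto simp: pow2_def)
  have "PF (\<lambda>e. ?R e (e 0))"
  proof (rule PF_rec_bounded[where B = "\<lambda>e. e 1"])
    fix e :: env and n show "?R e n \<le> e 1" unfolding r by (simp add: pow2_def)
  qed (intro pf)+
  then show "PF (\<lambda>e. pow2 (e 0) (e 1))" unfolding r .
qed

lemma PP_odd[pf]: assumes "PF A" shows "PP (\<lambda>e. odd (A e))"
  unfolding odd_iff_mod_2_eq_one by (intro pf assms)

lemma PP_bit[pf]: assumes "PF A" "PF B" shows "PP (\<lambda>e. bit (A e) (B e))"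
proof -
  have "bit x i \<longleftrightarrow> pow2 i x \<noteq> 0 \<and> odd (x div pow2 i x)" for x i :: nat
    by (auto simp: bit_iff_odd pow2_def)
  then show ?thesis by (simp only:) (intro pf assms)
qed

lemma PF_bl[pf]: assumes "PF A" shows "PF (\<lambda>e. bl (A e))"
proof -
  have "bl x = bmin x (\<lambda>n. pow2 n x = 0)" for x
  proof (rule bmin_eq[symmetric])
    show "pow2 (bl x) x = 0" using less_2_bl[of x] by (simp add: pow2_def)
    show "bl x \<le> z" if "pow2 z x = 0" for z using that by (auto simp: bl_le_iff pow2_def split: if_splits)
    show "bl x \<le> x" by (simp add: bl_le_iff)
  qed
  then have "PF (\<lambda>e. bl (e 0))" by (simp only:) (intro pf)
  then show ?thesis by (rule PF_comp1[OF _ assms])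
qed

lemma bl_power[simp]: "bl (2 ^ n) = Suc n"
  using bl_le_iff[of "2 ^ n" n] bl_le_iff[of "2 ^ n" "Suc n"] by simp

text \<open>The smash function of bounded arithmetic. Its value has the product of the lengths as
  exponent, so that nesting it supplies the exponential bounds needed below without leaving
  polynomial length.\<close>

definition smash :: "nat \<Rightarrow> nat \<Rightarrow> nat" where "smash x y = 2 ^ (bl x * bl y)"

lemma PF_smash[pf]: assumes "PF A" "PF B" shows "PF (\<lambda>e. smash (A e) (B e))"
proof (rule PF_comp2[where f = smash, OF _ assms])
  have r: "rec_nat 1 (\<lambda>j a. 2 * a) n = (2 :: nat) ^ n" for n by (induction n) auto
  have "PF (\<lambda>e. rec_nat 1 (\<lambda>j a. (\<lambda>j a e. 2 * a) j a e) (bl (e 0) * bl (e 1)))"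
  proof (rule PF_rec[where ?k0.0 = 2 and ?p0.0 = "[:1, 0, 1:]"])
    fix e :: env and L n :: nat
    assume "small 2 L e" "n \<le> bl (e 0) * bl (e 1)"
    moreover from this have "bl (e 0) * bl (e 1) \<le> L * L" by (intro mult_mono) (auto simp: small_def)
    ultimately have "n \<le> L * L" by simp
    then show "bl (rec_nat 1 (\<lambda>j a. 2 * a) n) \<le> poly [:1, 0, 1:] L" unfolding r by simp
  qed (intro pf)+
  then show "PF (\<lambda>e. smash (e 0) (e 1))" unfolding r smash_def .
qed

lemma exists_bits: "\<exists>Z::nat. Z < 2 ^ n \<and> (\<forall>i. bit Z i \<longleftrightarrow> i < n \<and> P i)"
proof (induction n)
  case 0
  show ?case by (intro exI[of _ 0]) simp
next
  case (Suc n)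
  then obtain Z :: nat where Z: "Z < 2 ^ n" "\<forall>i. bit Z i \<longleftrightarrow> i < n \<and> P i" by blast
  define Y :: nat where "Y = (if P n then Bit_Operations.set_bit n Z else Z)"
  have b: "bit Y i \<longleftrightarrow> i < Suc n \<and> P i" for i
    using Z(2)[rule_format, of i] unfolding Y_def by (cases "i = n") (simp_all add: bit_set_bit_iff less_Suc_eq)
  have "take_bit (Suc n) Y = Y"
   by (rule bit_eqI) (simp only: b bit_take_bit_iff, blast)
  then have "Y < 2 ^ Suc n" by (rule iffD1[OF take_bit_nat_eq_self_iff])
  then show ?case using b by (intro exI[of _ Y] conjI allI)
qed

section \<open>Alternation and reachability in polynomial space\<close>

text \<open>The value of a game with \<open>n\<close> rounds, in each of which a number below \<open>B\<close> is chosen and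
  appended as a digit to the history \<open>z\<close>. The existential player moves in the rounds with odd
  numbers.\<close>

fun val :: "(nat \<Rightarrow> bool) \<Rightarrow> nat \<Rightarrow> nat \<Rightarrow> nat \<Rightarrow> bool" where
  "val M B 0 z = M z"
| "val M B (Suc n) z = ((\<exists>y<B. val M B n (z * B + y) = odd n) = odd n)"

lemma val_odd: "odd n \<Longrightarrow> val M B (Suc n) z = (\<exists>y<B. val M B n (z * B + y))"
  by simp

lemma val_even: "even n \<Longrightarrow> val M B (Suc n) z = (\<forall>y<B. val M B n (z * B + y))"
  by auto

text \<open>Depth-first evaluation. Because of short-circuiting, the current position and a flag suffice:
  flag 0 means that the position is still to be evaluated, flags 1 and 2 that its value is false
  or true.\<close>

definition dcode :: "nat \<Rightarrow> nat \<Rightarrow> nat \<Rightarrow> nat \<Rightarrow> nat" where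
  "dcode N i z f = (z * Suc N + i) * 3 + f"

lemma digit: "r < b \<Longrightarrow> (q * b + r) mod b = r" "r < b \<Longrightarrow> (q * b + r) div b = q" for r b q :: nat
  by simp_all

lemma dcode_decode:
  assumes "i \<le> N" "f < 3"
  shows "dcode N i z f mod 3 = f" "(dcode N i z f div 3) mod Suc N = i" "dcode N i z f div 3 div Suc N = z"
  using assms unfolding dcode_def by (simp_all only: digit[of f 3] digit[of i "Suc N"] less_Suc_eq_le)

text \<open>A child settles its parent at once if it is true and the existential player moves, or
  false and the universal one does; the last child, with \<open>z mod B = B - 1\<close>, settles it
  in any case. Otherwise the next sibling \<open>Suc z\<close> is evaluated. No stack is kept
  because the parent is \<open>z div B\<close>.\<close>

definition dmove :: "(nat \<Rightarrow> bool) \<Rightarrow> nat \<Rightarrow> nat \<Rightarrow> nat \<Rightarrow> nat \<Rightarrow> nat \<Rightarrow> nat" where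
  "dmove M B N i z f =
    (if f = 0 then if i = 0 then dcode N 0 z (if M z then 2 else 1) else dcode N (i - 1) (z * B) 0
     else if i = N then dcode N i z f
     else if (f = 2 \<longleftrightarrow> odd i) \<or> z mod B = B - 1 then dcode N (Suc i) (z div B) f
     else dcode N i (Suc z) 0)"

definition dstep :: "(nat \<Rightarrow> bool) \<Rightarrow> nat \<Rightarrow> nat \<Rightarrow> nat \<Rightarrow> nat" where
  "dstep M B N c = dmove M B N ((c div 3) mod Suc N) (c div 3 div Suc N) (c mod 3)"

lemma dstep_dcode: "i \<le> N \<Longrightarrow> f < 3 \<Longrightarrow> dstep M B N (dcode N i z f) = dmove M B N i z f"
  by (simp only: dstep_def dcode_decode)

lemma dstep_down: "i < N \<Longrightarrow> dstep M B N (dcode N (Suc i) z 0) = dcode N i (z * B) 0"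
  by (simp add: dstep_dcode dmove_def)

lemma dstep_leaf: "dstep M B N (dcode N 0 z 0) = dcode N 0 z (if M z then 2 else 1)"
  by (simp add: dstep_dcode dmove_def)

lemma dstep_up:
  assumes "i < N" "f = 1 \<or> f = 2"
  shows "dstep M B N (dcode N i z f) =
   (if (f = 2 \<longleftrightarrow> odd i) \<or> z mod B = B - 1 then dcode N (Suc i) (z div B) f else dcode N i (Suc z) 0)"
proof -
  have "i \<le> N" "f < 3" "f \<noteq> 0" "i \<noteq> N" using assms by auto
  then show ?thesis by (simp add: dstep_dcode dmove_def)
qed

lemma dstep_end: "f = 1 \<or> f = 2 \<Longrightarrow> dstep M B N (dcode N N z f) = dcode N N z f"
  using dstep_dcode[of N N f M B z] by (auto simp: dmove_def)

definition flag :: "bool \<Rightarrow> nat" where "flag b = (if b then 2 else 1)"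

lemma flag: "flag b = 1 \<or> flag b = 2" "flag b = 2 \<longleftrightarrow> b" "flag b < 3"
  by (auto simp: flag_def)

lemma dfs_correct:
  assumes "B \<ge> 1"
  shows "i \<le> N \<Longrightarrow> \<exists>t \<le> (2 * B + 2) ^ Suc i. (dstep M B N ^^ t) (dcode N i z 0) = dcode N i z (flag (val M B i z))"
proof (induction i arbitrary: z)
  case 0
  then show ?case using assms by (intro exI[of _ 1]) (simp add: dstep_leaf flag_def)
next
  case (Suc i)
  define T where "T = (2 * B + 2) ^ Suc i"
  define D where "D = dstep M B N"
  have i: "i < N" using Suc.prems by simp
  have IH: "\<exists>t\<le>T. (D ^^ t) (dcode N i y 0) = dcode N i y (flag (val M B i y))" for y
    using Suc.IH[of y] i unfolding T_def D_def by simp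
  \<comment> \<open>Here \<open>j\<close> is the number of siblings after the current child, and no
    earlier child has settled the parent.\<close>
  have loop: "j < B \<Longrightarrow> \<forall>y<B - Suc j. val M B i (z * B + y) \<noteq> odd i \<Longrightarrow>
     \<exists>t\<le>Suc j * Suc T. (D ^^ t) (dcode N i (z * B + (B - Suc j)) 0) = dcode N (Suc i) z (flag (val M B (Suc i) z))" for j
  proof (induction j)
    case 0
    let ?v = "val M B i (z * B + (B - 1))"
    obtain t where t: "t \<le> T" "(D ^^ t) (dcode N i (z * B + (B - 1)) 0) = dcode N i (z * B + (B - 1)) (flag ?v)"
      using IH by blast
    have "(\<exists>y<B. val M B i (z * B + y) = odd i) \<longleftrightarrow> ?v = odd i"
    proof
      assume "\<exists>y<B. val M B i (z * B + y) = odd i"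
      then obtain y where "y < B" "val M B i (z * B + y) = odd i" by blast
      moreover from this 0(2) have "y = B - 1" by (metis One_nat_def Suc_pred assms less_Suc_eq less_eq_Suc_le)
      ultimately show "?v = odd i" by simp
    next
      assume "?v = odd i"
      then show "\<exists>y<B. val M B i (z * B + y) = odd i" using assms by (intro exI[of _ "B - 1"]) auto
    qed
    then have v: "?v = val M B (Suc i) z" by auto
    have m: "(z * B + (B - 1)) mod B = B - 1" "(z * B + (B - 1)) div B = z"
      using assms by (intro digit, simp)+
    have "D (dcode N i (z * B + (B - 1)) (flag ?v)) = dcode N (Suc i) z (flag ?v)"
      unfolding D_def using dstep_up[OF i flag(1)] m by simp
    then have "(D ^^ Suc t) (dcode N i (z * B + (B - 1)) 0) = dcode N (Suc i) z (flag (val M B (Suc i) z))"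
      using t(2) v by simp
    then show ?case using t(1) by (intro exI[of _ "Suc t"]) simp
  next
    case (Suc j)
    let ?y = "B - Suc (Suc j)"
    let ?v = "val M B i (z * B + ?y)"
    obtain t where t: "t \<le> T" "(D ^^ t) (dcode N i (z * B + ?y) 0) = dcode N i (z * B + ?y) (flag ?v)"
      using IH by blast
    have m: "(z * B + ?y) mod B = ?y" "(z * B + ?y) div B = z" using Suc.prems(1) by (intro digit, simp)+
    moreover have "?y \<noteq> B - 1" using Suc.prems(1) by simp
    ultimately have m: "(z * B + ?y) mod B = ?y" "(z * B + ?y) div B = z" "?y \<noteq> B - 1" by blast+
    show ?case
    proof (cases "?v = odd i")
      case True
      then have "(\<exists>y<B. val M B i (z * B + y) = odd i)" using assms by (intro exI[of _ ?y]) auto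
      then have v: "?v = val M B (Suc i) z" using True by simp
      have "D (dcode N i (z * B + ?y) (flag ?v)) = dcode N (Suc i) z (flag ?v)"
        unfolding D_def using dstep_up[OF i flag(1)] m True by (simp add: flag(2))
      then have "(D ^^ Suc t) (dcode N i (z * B + ?y) 0) = dcode N (Suc i) z (flag (val M B (Suc i) z))"
        using t(2) v by simp
      then show ?thesis using t(1) by (intro exI[of _ "Suc t"]) simp
    next
      case False
      have s: "Suc ?y = B - Suc j" using Suc.prems(1) by simp
      have "\<forall>y<B - Suc j. val M B i (z * B + y) \<noteq> odd i"
        using Suc.prems(2) False unfolding s[symmetric] by (auto simp: less_Suc_eq)
      then obtain u where u: "u \<le> Suc j * Suc T"
         "(D ^^ u) (dcode N i (z * B + (B - Suc j)) 0) = dcode N (Suc i) z (flag (val M B (Suc i) z))"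
        using Suc.IH Suc.prems(1) by auto
      have s2: "Suc (z * B + ?y) = z * B + (B - Suc j)" using s by simp
      have "dstep M B N (dcode N i (z * B + ?y) (flag ?v)) = dcode N i (Suc (z * B + ?y)) 0"
        using dstep_up[OF i flag(1), of M B "z * B + ?y" ?v] m False unfolding flag(2) by presburger
      then have "D (dcode N i (z * B + ?y) (flag ?v)) = dcode N i (z * B + (B - Suc j)) 0"
        unfolding D_def s2 .
      then have "(D ^^ Suc t) (dcode N i (z * B + ?y) 0) = dcode N i (z * B + (B - Suc j)) 0" using t(2) by simp
      then have "(D ^^ (u + Suc t)) (dcode N i (z * B + ?y) 0) = dcode N (Suc i) z (flag (val M B (Suc i) z))"
        using u(2) by (simp only: funpow_add o_apply)
      then show ?thesis using t(1) u(1) by (intro exI[of _ "u + Suc t"]) auto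
    qed
  qed
  obtain t where t: "t \<le> B * Suc T" "(D ^^ t) (dcode N i (z * B) 0) = dcode N (Suc i) z (flag (val M B (Suc i) z))"
    using loop[of "B - 1"] assms by auto
  have "(D ^^ Suc t) (dcode N (Suc i) z 0) = dcode N (Suc i) z (flag (val M B (Suc i) z))"
    using t(2) i by (simp add: funpow_swap1 D_def dstep_down)
  moreover have "Suc t \<le> (2 * B + 2) ^ Suc (Suc i)"
  proof -
    have "T \<ge> 1" unfolding T_def by (rule one_le_power) simp
    from mult_le_mono2[OF this, of "B + 1"] have "B + 1 \<le> (B + 1) * T" by simp
    then have "B * Suc T + 1 \<le> (2 * B + 2) * T" by (simp add: algebra_simps)
    then show ?thesis using t(1) by (simp add: T_def)
  qed
  ultimately show ?case unfolding D_def by blast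
qed

text \<open>With \<open>i\<close> rounds to go, the history has \<open>N - i\<close> digits in base
  \<open>B\<close>. This invariant bounds the codes, as limited recursion requires.\<close>

definition dinv :: "nat \<Rightarrow> nat \<Rightarrow> nat \<Rightarrow> bool" where
  "dinv B N c \<longleftrightarrow> (\<exists>i z f. c = dcode N i z f \<and> i \<le> N \<and> f < 3 \<and> z < B ^ (N - i))"

lemma dinv_dstep: assumes "B \<ge> 1" "dinv B N c" shows "dinv B N (dstep M B N c)"
proof -
  obtain i z f where c: "c = dcode N i z f" "i \<le> N" "f < 3" "z < B ^ (N - i)" using assms(2) by (auto simp: dinv_def)
  have I: "i' \<le> N \<Longrightarrow> f' < 3 \<Longrightarrow> z' < B ^ (N - i') \<Longrightarrow> dinv B N (dcode N i' z' f')" for i' z' f'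
    unfolding dinv_def by blast
  consider "f = 0" "i = 0" | i' where "f = 0" "i = Suc i'" | "f \<noteq> 0" "i = N" | "f \<noteq> 0" "i < N"
    using c(2) by (cases i) (auto simp: le_less)
  then show ?thesis
  proof cases
    case 1
    then show ?thesis using c by (auto simp: dstep_leaf intro: I)
  next
    case 2
    then have "N - i' = Suc (N - i)" using c(2) by simp
    then show ?thesis using 2 c assms(1) by (auto simp: dstep_down mult.commute intro!: I)
  next
    case 3
    then have "f = 1 \<or> f = 2" using c(3) by auto
    then show ?thesis using 3 c assms(2) dstep_end[of f M B N z] by simp
  next
    case 4
    then have f: "f = 1 \<or> f = 2" using c(3) by auto
    have e: "B ^ (N - i) = B * B ^ (N - Suc i)" using 4 by (simp add: Suc_diff_Suc[symmetric])
    have up: "z div B < B ^ (N - Suc i)" using c(4) assms(1) unfolding e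
      by (simp add: div_less_iff_less_mult mult.commute)
    have "Suc z < B ^ (N - i)" if "z mod B \<noteq> B - 1"
    proof (rule ccontr)
      assume "\<not> Suc z < B ^ (N - i)"
      then have "z = B * B ^ (N - Suc i) - 1" using c(4) e by simp
      moreover obtain q where "B ^ (N - Suc i) = Suc q" using assms(1) by (metis One_nat_def Suc_le_D one_le_power)
      ultimately have z: "z = q * B + (B - 1)" using assms(1) by (simp add: mult.commute)
      have "z mod B = B - 1" unfolding z by (rule digit) (use assms(1) in simp)
      then show False using that by simp
    qed
    then show ?thesis using 4 c up unfolding c(1) dstep_up[OF 4(2) f] by (auto intro!: I)
  qed
qed

lemma dinv_bound: assumes "dinv B N c" "B \<ge> 1" shows "c \<le> (B ^ N * Suc N + N) * 3 + 3"
proof -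
  obtain i z f where c: "c = dcode N i z f" "i \<le> N" "f < 3" "z < B ^ (N - i)" using assms by (auto simp: dinv_def)
  have "B ^ (N - i) \<le> B ^ N" using assms(2) by (intro power_increasing) auto
  then have "z * Suc N \<le> B ^ N * Suc N" using c(4) by (intro mult_right_mono) auto
  then show ?thesis using c by (simp add: dcode_def)
qed

lemma PF_dcode: "\<lbrakk>PF A; PF B; PF C; PF D\<rbrakk> \<Longrightarrow> PF (\<lambda>e. dcode (A e) (B e) (C e) (D e))"
  unfolding dcode_def by (intro pf)

text \<open>The search is iterated \<open>W\<close> times; it may end earlier, as its final position
  is a fixed point. The same \<open>W\<close> serves to majorize the codes.\<close>

lemma PP_val:
  assumes M: "PP (\<lambda>e. M (e 0) (\<lambda>i. e (Suc i)))" and B: "PF B" and N: "PF N" and W: "PF W"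
    and bd: "\<And>e. (2 * B e + 2) ^ Suc (N e) \<le> W e" "\<And>e. 1 \<le> B e"
  shows "PP (\<lambda>e. val (\<lambda>z. M z e) (B e) (N e) 0)"
proof -
  let ?S = "\<lambda>e. dstep (\<lambda>z. M z e) (B e) (N e)"
  have r: "rec_nat (dcode (N e) (N e) 0 0) (\<lambda>j a. ?S e a) n = (?S e ^^ n) (dcode (N e) (N e) 0 0)" for e n
    by (induction n) auto
  have inv: "dinv (B e) (N e) ((?S e ^^ n) (dcode (N e) (N e) 0 0))" for e n
  proof (induction n)
    case 0
    show ?case unfolding dinv_def
      by (rule exI[of _ "N e"], rule exI[of _ 0], rule exI[of _ 0]) (use bd(2)[of e] in simp)
  next
    case (Suc n)
    then show ?case using dinv_dstep[OF bd(2) Suc] by simp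
  qed
  have M': "PP (\<lambda>e. M (A e) (\<lambda>i. e (Suc (Suc i))))" if A: "PF A" for A
  proof -
    have "PF (\<lambda>e. of_bool (M (e 0) (\<lambda>i. e (Suc (Suc (Suc i))))))"
      using PF_rename[where F = "\<lambda>e. of_bool (M (e 0) (\<lambda>i. e (Suc i)))" and \<pi> = "\<lambda>i. if i = 0 then 0 else Suc (Suc i)",
            OF M[unfolded PP_def]] by simp
    from PF_let[where F = "\<lambda>e. of_bool (M (e 0) (\<lambda>i. e (Suc (Suc (Suc i)))))" and G = A, OF this A]
    show ?thesis by (simp add: PP_def)
  qed
  have B': "PF (\<lambda>e. B (\<lambda>i. e (Suc (Suc i))))" by (rule PF_rename[OF B])
  have N': "PF (\<lambda>e. N (\<lambda>i. e (Suc (Suc i))))" by (rule PF_rename[OF N])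
  have "PF (\<lambda>e. rec_nat (dcode (N e) (N e) 0 0) (\<lambda>j a. (\<lambda>j a e. ?S e a) j a e) (W e))"
  proof (rule PF_rec_bounded[where B = "\<lambda>e. (W e * Suc (N e) + N e) * 3 + 3"])
    show "PF (\<lambda>e. dstep (\<lambda>z. M z (\<lambda>i. e (Suc (Suc i)))) (B (\<lambda>i. e (Suc (Suc i)))) (N (\<lambda>i. e (Suc (Suc i)))) (e 1))"
      unfolding dstep_def dmove_def by (intro pf PF_dcode M' B' N')
    fix e n
    have "B e ^ N e \<le> W e"
    proof -
      have "B e ^ N e \<le> (2 * B e + 2) ^ N e" by (intro power_mono) auto
      also have "\<dots> \<le> (2 * B e + 2) ^ Suc (N e)" by (intro power_increasing) auto
      finally show ?thesis using bd(1)[of e] by simp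
    qed
    then have "(B e ^ N e * Suc (N e) + N e) * 3 + 3 \<le> (W e * Suc (N e) + N e) * 3 + 3"
      by (intro add_mono mult_right_mono) auto
    then show "rec_nat (dcode (N e) (N e) 0 0) (\<lambda>j a. ?S e a) n \<le> (W e * Suc (N e) + N e) * 3 + 3"
      unfolding r using dinv_bound[OF inv[of e n] bd(2)] by (rule order_trans[rotated])
  qed (intro pf PF_dcode B N W)+
  then have F: "PF (\<lambda>e. (?S e ^^ W e) (dcode (N e) (N e) 0 0))" unfolding r .
  have "(?S e ^^ W e) (dcode (N e) (N e) 0 0) mod 3 = flag (val (\<lambda>z. M z e) (B e) (N e) 0)" for e
  proof -
    obtain t where t: "t \<le> W e" "(?S e ^^ t) (dcode (N e) (N e) 0 0) = dcode (N e) (N e) 0 (flag (val (\<lambda>z. M z e) (B e) (N e) 0))"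
      using dfs_correct[OF bd(2)[of e], of "N e" "N e" "\<lambda>z. M z e" 0] bd(1)[of e] by (metis le_refl order_trans)
    have st: "(?S e ^^ j) (dcode (N e) (N e) 0 (flag b)) = dcode (N e) (N e) 0 (flag b)" for j b
      by (induction j) (auto simp: dstep_end[OF flag(1)])
    have "(?S e ^^ W e) (dcode (N e) (N e) 0 0) = (?S e ^^ (W e - t)) ((?S e ^^ t) (dcode (N e) (N e) 0 0))"
      using t(1) by (simp add: funpow_add[symmetric, THEN fun_cong, unfolded o_def])
    then show ?thesis unfolding t(2) st using dcode_decode(1)[OF le_refl flag(3)] by simp
  qed
  then have "val (\<lambda>z. M z e) (B e) (N e) 0 \<longleftrightarrow> (?S e ^^ W e) (dcode (N e) (N e) 0 0) mod 3 = 2" for e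
    by (simp add: flag(2))
  then show ?thesis by (simp only:) (intro pf F)
qed

text \<open>Savitch's theorem: a path of length at most \<open>2\<^sup>d\<close> has a midpoint from which both halves have
  length at most \<open>2\<^sup>d\<^sup>-\<^sup>1\<close>. The existential player names midpoints, the universal player selects halves.\<close>

fun sav :: "(nat \<times> nat) set \<Rightarrow> nat \<Rightarrow> nat \<Rightarrow> nat \<Rightarrow> nat \<Rightarrow> bool" where
  "sav R B 0 u v \<longleftrightarrow> u = v \<or> (u, v) \<in> R"
| "sav R B (Suc d) u v \<longleftrightarrow> (\<exists>w<B. sav R B d u w \<and> sav R B d w v)"

lemma sav_rtrancl: "sav R B d u v \<Longrightarrow> (u, v) \<in> R\<^sup>*"
  by (induction d arbitrary: u v) (auto, meson rtrancl_trans)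

lemma sav_relpow:
  assumes "R \<subseteq> {..<B} \<times> {..<B}"
  shows "u < B \<Longrightarrow> v < B \<Longrightarrow> n \<le> 2 ^ d \<Longrightarrow> (u, v) \<in> R ^^ n \<Longrightarrow> sav R B d u v"
proof (induction d arbitrary: u v n)
  case 0
  then have "n = 0 \<or> n = 1" by auto
  then show ?case using 0 by auto
next
  case (Suc d)
  let ?k = "n div 2"
  have n: "?k \<le> 2 ^ d" "n - ?k \<le> 2 ^ d" "?k + (n - ?k) = n" using Suc.prems(3) by auto
  have "(u, v) \<in> R ^^ (?k + (n - ?k))" by (simp only: n(3) Suc.prems(4))
  then obtain w where w: "(u, w) \<in> R ^^ ?k" "(w, v) \<in> R ^^ (n - ?k)"
    unfolding relpow_add by blast
  have "w < B"
  proof (cases "?k")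
    case 0
    then show ?thesis using w(1) Suc.prems by simp
  next
    case (Suc j)
    then show ?thesis using w(1) assms by auto
  qed
  then show ?case using Suc.IH[OF Suc.prems(1) _ n(1) w(1)] Suc.IH[OF _ Suc.prems(2) n(2) w(2)] by auto
qed

text \<open>A shortest path is no longer than the number of edges, which is at most
  \<open>C * C\<close>.\<close>

lemma rtrancl_sav:
  assumes "R \<subseteq> {..<C} \<times> {..<C}" "C \<le> B" "u < C" "v < C" "C * C \<le> 2 ^ d" "(u, v) \<in> R\<^sup>*"
  shows "sav R B d u v"
proof -
  have f: "finite R" "card R \<le> C * C"
    using finite_subset[OF assms(1)] card_mono[OF _ assms(1)] by (auto simp: card_cartesian_product)
  obtain n where n: "n \<le> card R" "(u, v) \<in> R ^^ n"
    using assms(6) rtrancl_finite_eq_relpow[OF f(1)] by auto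
  show ?thesis by (rule sav_relpow[OF _ _ _ _ n(2)]) (use assms f n(1) in auto)
qed

text \<open>The pair of endpoints left after \<open>j\<close> rounds. A round takes two digits of
  \<open>z\<close>: the higher one is the midpoint, the lower one selects a half.\<close>

fun savpos :: "nat \<Rightarrow> nat \<Rightarrow> nat \<Rightarrow> nat \<Rightarrow> nat \<Rightarrow> nat \<times> nat" where
  "savpos B u v 0 z = (u, v)"
| "savpos B u v (Suc j) z = (case savpos B u v j (z div (B * B)) of (a, b) \<Rightarrow>
     if z mod B = 0 then (a, (z div B) mod B) else ((z div B) mod B, b))"

lemma savpos_less: "u < B \<Longrightarrow> v < B \<Longrightarrow> fst (savpos B u v j z) < B \<and> snd (savpos B u v j z) < B"
  by (induction j arbitrary: z) (auto simp: case_prod_beta)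

text \<open>A selector is a digit below \<open>B\<close>: zero selects the first half and anything
  else the second. With \<open>2 \<le> B\<close> both choices exist.\<close>

lemma val_sav:
  assumes "2 \<le> B" "i \<le> d"
  shows "val (\<lambda>z. let p = savpos B u v d z in fst p = snd p \<or> p \<in> R) B (2 * i) z \<longleftrightarrow>
    sav R B i (fst (savpos B u v (d - i) z)) (snd (savpos B u v (d - i) z))"
  using assms(2)
proof (induction i arbitrary: z)
  case 0
  then show ?case by (simp add: Let_def)
next
  case (Suc i)
  let ?M = "\<lambda>z. let p = savpos B u v d z in fst p = snd p \<or> p \<in> R"
  let ?p = "savpos B u v (d - Suc i) z"
  have d: "d - i = Suc (d - Suc i)" using Suc.prems by simp
  have h: "savpos B u v (d - i) ((z * B + w) * B + y) = (if y = 0 then (fst ?p, w) else (w, snd ?p))"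
    if "w < B" "y < B" for w y
  proof -
    have "((z * B + w) * B + y) div (B * B) = z" using that
      by (simp add: div_mult2_eq)
    moreover have "((z * B + w) * B + y) mod B = y" "((z * B + w) * B + y) div B mod B = w" using that by auto
    ultimately show ?thesis unfolding d using that(1) by (simp add: case_prod_beta)
  qed
  have "val ?M B (2 * Suc i) z \<longleftrightarrow> (\<exists>w<B. \<forall>y<B. val ?M B (2 * i) ((z * B + w) * B + y))"
    using val_odd[of "Suc (2 * i)" ?M B z] val_even[of "2 * i" ?M B] by (simp del: val.simps)
  also have "\<dots> \<longleftrightarrow> (\<exists>w<B. \<forall>y<B. if y = 0 then sav R B i (fst ?p) w else sav R B i w (snd ?p))"
    using Suc h by (intro ex_cong1 conj_cong refl all_cong1 imp_cong) auto
  also have "\<dots> \<longleftrightarrow> sav R B (Suc i) (fst ?p) (snd ?p)"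
  proof -
    have "(\<forall>y<B. if y = 0 then P else Q) \<longleftrightarrow> P \<and> Q" for P Q
    proof
      assume a: "\<forall>y<B. if y = 0 then P else Q"
      then show "P \<and> Q" using assms(1) spec[OF a, of 0] spec[OF a, of 1] by simp
    qed auto
    then show ?thesis by simp
  qed
  finally show ?case .
qed

text \<open>A power truncated at \<open>c\<close>. When \<open>z\<close> is divided by it,
  truncation at \<open>Suc z\<close> does no harm: the divisor exceeds \<open>z\<close> with or
  without it.\<close>

definition powm :: "nat \<Rightarrow> nat \<Rightarrow> nat \<Rightarrow> nat" where
  "powm b n c = rec_nat (min 1 c) (\<lambda>j a. min (a * b) c) n"

lemma powm: "1 \<le> b \<Longrightarrow> powm b n c = min (b ^ n) c"
proof (induction n)
  case (Suc n)
  have "min (min x c * b) c = min (b * x) c" for x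
  proof (cases "x \<le> c")
    case False
    then have "c \<le> c * b" "c \<le> b * x" using Suc.prems mult_le_mono[of 1 b c x] by auto
    then show ?thesis using False by simp
  qed (simp add: mult.commute)
  then show ?case using Suc by (simp add: powm_def)
qed (simp add: powm_def)

lemma PF_min[pf]: "PF A \<Longrightarrow> PF B \<Longrightarrow> PF (\<lambda>e. min (A e) (B e))"
  unfolding min_def by (intro pf)

lemma PF_powm[pf]: assumes "PF A" "PF B" "PF C" shows "PF (\<lambda>e. powm (A e) (B e) (C e))"
proof (rule PF_comp3[where f = powm, OF _ assms])
  have "PF (\<lambda>e. rec_nat (min 1 (e 2)) (\<lambda>j a. (\<lambda>j a e. min (a * e 0) (e 2)) j a e) (e 1))"
  proof (rule PF_rec_bounded[where B = "\<lambda>e. e 2"])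
    fix e :: env and n
    show "rec_nat (min 1 (e 2)) (\<lambda>j a. min (a * e 0) (e 2)) n \<le> e 2" by (cases n) auto
  qed (intro pf)+
  then show "PF (\<lambda>e. powm (e 0) (e 1) (e 2))" by (simp add: powm_def)
qed

text \<open>\<open>savpos\<close> as a recursion with one numerical value, the pair being coded in
  base \<open>B\<close>. The reductions modulo \<open>B\<close> keep the code small for all
  arguments, including those outside the intended range.\<close>

definition savcode :: "nat \<Rightarrow> nat \<Rightarrow> nat \<Rightarrow> nat \<Rightarrow> nat \<Rightarrow> nat" where
  "savcode B u v d z = rec_nat (u mod B * B + v mod B) (\<lambda>j a. (\<lambda>x. if x mod B = 0 then a div B * B + (x div B) mod B
     else ((x div B) mod B) * B + a mod B) (z div powm (B * B) (d - Suc j) (Suc z))) d"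

lemma savcode:
  assumes "u < B" "v < B"
  shows "savcode B u v d z = fst (savpos B u v d z) * B + snd (savpos B u v d z)"
proof -
  let ?f = "\<lambda>j a. (\<lambda>x. if x mod B = 0 then a div B * B + (x div B) mod B
     else ((x div B) mod B) * B + a mod B) (z div powm (B * B) (d - Suc j) (Suc z))"
  have dv: "z div powm (B * B) n (Suc z) = z div (B * B) ^ n" for n
  proof (cases "(B * B) ^ n \<le> Suc z")
    case True
    then show ?thesis using assms by (simp add: powm min_def)
  next
    case False
    then show ?thesis using assms by (simp add: powm min_def)
  qed
  have "j \<le> d \<Longrightarrow> rec_nat (u mod B * B + v mod B) ?f j =
     fst (savpos B u v j (z div (B * B) ^ (d - j))) * B + snd (savpos B u v j (z div (B * B) ^ (d - j)))" for j
  proof (induction j)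
    case (Suc j)
    let ?x = "z div (B * B) ^ (d - Suc j)"
    have "?x div (B * B) = z div (B * B) ^ (d - j)"
      using Suc.prems by (simp add: div_mult2_eq[symmetric] mult.commute Suc_diff_Suc[symmetric] del: div_mult2_eq)
    moreover have "snd (savpos B u v j (z div (B * B) ^ (d - j))) < B" using savpos_less[OF assms] by blast
    ultimately show ?case using Suc by (simp add: dv case_prod_beta)
  qed (use assms in simp)
  from this[of d] show ?thesis unfolding savcode_def by simp
qed

lemma PF_savcode:
  assumes "PF A" "PF B" "PF C" "PF D" "PF E"
  shows "PF (\<lambda>e. savcode (A e) (B e) (C e) (D e) (E e))"
proof (rule PF_comp5[where f = savcode, OF _ assms])
  let ?H = "\<lambda>j a e. (\<lambda>x. if x mod e 0 = 0 then a div e 0 * e 0 + (x div e 0) mod e 0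
     else ((x div e 0) mod e 0) * e 0 + a mod e 0) (e 4 div powm (e 0 * e 0) (e 3 - Suc j) (Suc (e 4)))"
  have "PF (\<lambda>e. rec_nat (e 1 mod e 0 * e 0 + e 2 mod e 0) (\<lambda>j a. ?H j a e) (e 3))"
  proof (rule PF_rec_bounded[where B = "\<lambda>e. e 0 * e 0 + e 2"])
    fix e :: env and n
    let ?R = "rec_nat (e 1 mod e 0 * e 0 + e 2 mod e 0) (\<lambda>j a. ?H j a e)"
    have less: "q * e 0 + p < e 0 * e 0" if "q < e 0" "p < e 0" for q p
    proof -
      have "q * e 0 + p < Suc q * e 0" using that(2) by simp
      also have "\<dots> \<le> e 0 * e 0" using that(1) by (intro mult_right_mono) auto
      finally show ?thesis .
    qed
    show "?R n \<le> e 0 * e 0 + e 2"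
    proof (cases "e 0 = 0")
      case True
      then have "?R n \<le> e 2" by (induction n) auto
      then show ?thesis by simp
    next
      case False
      then have "?R n < e 0 * e 0"
      proof (induction n)
        case (Suc n)
        then have "?R n div e 0 < e 0" by (simp add: div_less_iff_less_mult)
        then show ?case using less False by simp
      qed (use less in simp)
      then show ?thesis by simp
    qed
  qed (intro pf)+
  then show "PF (\<lambda>e. savcode (e 0) (e 1) (e 2) (e 3) (e 4))" by (simp add: savcode_def)
qed

lemma bl_15: "bl 15 = 4"
  using bl_le_iff[of 15 4] bl_le_iff[of 15 3] by simp

lemma PP_reach:
  assumes C: "PF C" and E: "PP (\<lambda>e. E (e 0) (e 1) (\<lambda>i. e (Suc (Suc i))))" and U: "PF U" and V: "PF V"
  shows "PP (\<lambda>e. (U e, V e) \<in> {(a, b). a < C e \<and> b < C e \<and> E a b e}\<^sup>*)"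
proof -
  let ?R = "\<lambda>e. {(a, b). a < C e \<and> b < C e \<and> E a b e}"
  \<comment> \<open>Two extra digits, so that the selector has two values even if there are no
    vertices.\<close>
  define B where "B e = C e + 2" for e
  \<comment> \<open>Then \<open>C e * C e \<le> 2 ^ d e\<close>, which exceeds the length of
    shortest paths.\<close>
  define d where "d e = 2 * bl (C e)" for e
  have B: "PF B" and d: "PF d" unfolding B_def d_def by (intro pf C)+
  let ?w = "\<lambda>z e. savcode (B e) (U e) (V e) (d e) z"
  let ?M = "\<lambda>z e. ?w z e div B e = ?w z e mod B e \<or>
     ?w z e div B e < C e \<and> ?w z e mod B e < C e \<and> E (?w z e div B e) (?w z e mod B e) e"
  let ?v = "\<lambda>e. val (\<lambda>z. ?M z e) (B e) (2 * d e) 0"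
  have sh: "PF (\<lambda>e. F (\<lambda>i. e (Suc i)))" if "PF F" for F by (rule PF_rename[OF that])
  note S = PF_savcode[OF sh[OF B] sh[OF U] sh[OF V] sh[OF d] PF_var[of 0]]
  have E': "PP (\<lambda>e. E (F e) (G e) (\<lambda>i. e (Suc i)))" if F: "PF F" and G: "PF G" for F G
  proof -
    have "PF (\<lambda>e. of_bool (E (e 0) (e 1) (\<lambda>i. e (Suc (Suc (Suc i))))))"
      using PF_rename[where F = "\<lambda>e. of_bool (E (e 0) (e 1) (\<lambda>i. e (Suc (Suc i))))" and \<pi> = "\<lambda>i. if i < 2 then i else Suc i",
            OF E[unfolded PP_def]] by simp
    from PF_let[where F = "\<lambda>e. of_bool (E (e 0) (e 1) (\<lambda>i. e (Suc (Suc (Suc i)))))" and G = "\<lambda>e. F (\<lambda>i. e (Suc i))", OF this sh[OF F]]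
    have "PF (\<lambda>e. of_bool (E (F (\<lambda>i. e (Suc i))) (e 0) (\<lambda>i. e (Suc (Suc i)))))" by simp
    from PF_let[where F = "\<lambda>e. of_bool (E (F (\<lambda>i. e (Suc i))) (e 0) (\<lambda>i. e (Suc (Suc i))))" and G = G, OF this G]
    show ?thesis by (simp add: PP_def)
  qed
  have PM: "PP (\<lambda>e. ?M (e 0) (\<lambda>i. e (Suc i)))"
    by (intro pf S sh[OF B] sh[OF C] E')
  \<comment> \<open>If \<open>b\<close> is the length of \<open>C e\<close>, the game has
    \<open>4 * b\<close> rounds and \<open>2 * B e + 2\<close> is at most
    \<open>2 ^ (b + 3)\<close>. As \<open>X e\<close> has length \<open>4 * b + 4\<close>, the
    square of which is the exponent in \<open>smash (X e) (X e)\<close>, that number bounds the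
    running time.\<close>
  define X where "X e = smash (C e) 15 * 8" for e
  have X: "PF (\<lambda>e. smash (X e) (X e))" unfolding X_def by (intro pf C)
  have "PP ?v"
  proof (rule PP_val[OF PM B _ X])
    show "PF (\<lambda>e. 2 * d e)" by (intro pf d)
    show "1 \<le> B e" for e by (simp add: B_def)
    show "(2 * B e + 2) ^ Suc (2 * d e) \<le> smash (X e) (X e)" for e
    proof -
      let ?b = "bl (C e)"
      have "X e = 2 ^ (4 * ?b + 3)" by (simp add: X_def smash_def bl_15 power_add mult.commute)
      then have bX: "bl (X e) = 4 * ?b + 4" by simp
      have "2 * C e + 6 \<le> 2 ^ (?b + 3)" using less_2_bl[of "C e"] by (simp add: power_add)
      then have "(2 * B e + 2) ^ Suc (2 * d e) \<le> (2 ^ (?b + 3)) ^ Suc (2 * d e)"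
        by (intro power_mono) (auto simp: B_def)
      also have "\<dots> = 2 ^ ((?b + 3) * Suc (4 * ?b))" by (simp only: d_def power_mult[symmetric]) simp
      also have "\<dots> \<le> 2 ^ ((4 * ?b + 4) * (4 * ?b + 4))"
        by (intro power_increasing mult_mono) auto
      finally show ?thesis by (simp add: smash_def bX)
    qed
  qed
  have eq: "?v e \<longleftrightarrow> sav (?R e) (B e) (d e) (U e) (V e)" if u: "U e < C e" "V e < C e" for e
  proof -
    have ub: "U e < B e" "V e < B e" using u by (auto simp: B_def)
    let ?p = "\<lambda>z. savpos (B e) (U e) (V e) (d e) z"
    have "snd (?p z) < B e" for z using savpos_less[OF ub] by blast
    then have "?w z e div B e = fst (?p z)" "?w z e mod B e = snd (?p z)" for z
      unfolding savcode[OF ub] by (simp_all only: digit)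
    then have "(\<lambda>z. ?M z e) = (\<lambda>z. let p = ?p z in fst p = snd p \<or> p \<in> ?R e)"
      by (auto simp: Let_def fun_eq_iff case_prod_beta)
    then show ?thesis using val_sav[of "B e" "d e" "d e" "U e" "V e" "?R e" 0] by (simp add: B_def)
  qed
  \<comment> \<open>The closure is reflexive also at points outside the vertex set, hence the
    separate disjunct.\<close>
  have "(U e, V e) \<in> (?R e)\<^sup>* \<longleftrightarrow> U e = V e \<or> U e < C e \<and> V e < C e \<and> ?v e" for e
  proof
    assume r: "(U e, V e) \<in> (?R e)\<^sup>*"
    show "U e = V e \<or> U e < C e \<and> V e < C e \<and> ?v e"
    proof (cases "U e = V e")
      case False
      have "U e < C e" using r False by (cases rule: converse_rtranclE) auto
      moreover have "V e < C e" using r False by (cases rule: rtranclE) auto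
      ultimately have u: "U e < C e" "V e < C e" .
      have "C e \<le> 2 ^ bl (C e)" using less_2_bl[of "C e"] by (rule less_imp_le)
      then have "C e * C e \<le> 2 ^ bl (C e) * 2 ^ bl (C e)" by (intro mult_le_mono)
      then have "C e * C e \<le> 2 ^ d e" by (simp add: d_def power_add[symmetric] mult_2)
      then have "sav (?R e) (B e) (d e) (U e) (V e)"
        by (intro rtrancl_sav[OF _ _ u _ r]) (auto simp: B_def)
      then show ?thesis using eq[OF u] u by simp
    qed simp
  next
    assume "U e = V e \<or> U e < C e \<and> V e < C e \<and> ?v e"
    then show "(U e, V e) \<in> (?R e)\<^sup>*" using eq sav_rtrancl by auto
  qed
  then show ?thesis by (simp only:) (intro pf U V C \<open>PP ?v\<close>)
qed

section \<open>Certificates for separability\<close>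

lemma sat_Until_shift:
  "sat I n (Until \<phi> \<psi>) \<longleftrightarrow> (\<exists>d>0. sat I (n + d) \<psi> \<and> (\<forall>c. 0 < c \<and> c < d \<longrightarrow> sat I (n + c) \<phi>))"
proof
  assume "sat I n (Until \<phi> \<psi>)"
  then obtain m where m: "m > n" "sat I m \<psi>" "\<forall>k. n < k \<and> k < m \<longrightarrow> sat I k \<phi>" by auto
  then show "\<exists>d>0. sat I (n + d) \<psi> \<and> (\<forall>c. 0 < c \<and> c < d \<longrightarrow> sat I (n + c) \<phi>)"
    by (intro exI[of _ "m - n"]) auto
next
  assume "\<exists>d>0. sat I (n + d) \<psi> \<and> (\<forall>c. 0 < c \<and> c < d \<longrightarrow> sat I (n + c) \<phi>)"
  then obtain d where d: "d > 0" "sat I (n + d) \<psi>" "\<forall>c. 0 < c \<and> c < d \<longrightarrow> sat I (n + c) \<phi>" by blast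
  have "sat I k \<phi>" if "n < k" "k < n + d" for k
    using d(3)[rule_format, of "k - n"] that by simp
  then show "sat I n (Until \<phi> \<psi>)" using d(1,2) by (auto intro!: exI[of _ "n + d"])
qed

section \<open>Truth in ultimately periodic interpretations\<close>

lemma sat_suffix: "(\<And>m. I (n + m) = J (n' + m)) \<Longrightarrow> sat I n \<phi> \<longleftrightarrow> sat J n' \<phi>"
proof (induction \<phi> arbitrary: n n')
  case (Atom a)
  from Atom[of 0] show ?case by simp
next
  case (Until \<phi>1 \<phi>2)
  have "sat I (n + d) \<phi>1 = sat J (n' + d) \<phi>1" "sat I (n + d) \<phi>2 = sat J (n' + d) \<phi>2" for d
    using Until.IH[of "n + d" "n' + d"] Until.prems by (simp_all add: add.assoc)
  then show ?case unfolding sat_Until_shift by simp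
qed simp_all

text \<open>Time points with the same future in every interpretation that has period
  \<open>P\<close> from \<open>T\<close> on.\<close>

definition eqv :: "nat \<Rightarrow> nat \<Rightarrow> nat \<Rightarrow> nat \<Rightarrow> bool" where
  "eqv T P t u \<longleftrightarrow> t = u \<or> T \<le> t \<and> T \<le> u \<and> t mod P = u mod P"

definition per :: "nat \<Rightarrow> nat \<Rightarrow> interp \<Rightarrow> bool" where
  "per T P I \<longleftrightarrow> (\<forall>t\<ge>T. I (t + P) = I t)"

lemma per_mult: "per T P I \<Longrightarrow> T \<le> t \<Longrightarrow> I (t + n * P) = I t"
proof (induction n)
  case (Suc n)
  then have "I ((t + n * P) + P) = I (t + n * P)" unfolding per_def by simp
  then show ?case using Suc by (simp add: add_ac)
qed simp

lemma per_eqv_aux: assumes "per T P I" "t \<le> u" "T \<le> t" "t mod P = u mod P" shows "I t = I u"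
proof -
  have "P dvd u - t" using mod_eq_dvd_iff_nat[OF assms(2), of P] assms(4) by simp
  then obtain q where "u - t = P * q" by (auto simp: dvd_def)
  then have "u = t + q * P" using assms(2) by (simp add: mult.commute)
  then show ?thesis using per_mult[OF assms(1,3)] by simp
qed

lemma per_eqv: "per T P I \<Longrightarrow> eqv T P t u \<Longrightarrow> I (t + k) = I (u + k)"
proof -
  assume a: "per T P I" "eqv T P t u"
  show ?thesis
  proof (cases "t = u")
    case False
    then have T: "T \<le> t" "T \<le> u" and m: "t mod P = u mod P" using a(2) unfolding eqv_def by blast+
    have m: "(t + k) mod P = (u + k) mod P" by (rule mod_add_cong[OF m refl])
    show ?thesis
    proof (cases "t \<le> u")
      case True
      then show ?thesis using T by (intro per_eqv_aux[OF a(1) _ _ m]) auto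
    next
      case False
      then show ?thesis using T by (intro per_eqv_aux[OF a(1) _ _ m[symmetric], symmetric]) auto
    qed
  qed simp
qed

lemma sat_eqv: "per T P I \<Longrightarrow> eqv T P t u \<Longrightarrow> sat I t \<phi> \<longleftrightarrow> sat I u \<phi>"
  by (rule sat_suffix) (rule per_eqv)

definition red :: "nat \<Rightarrow> nat \<Rightarrow> nat \<Rightarrow> nat" where
  "red T P t = (if t < T then t else T + (t - T) mod P)"

lemma eqv_red: "eqv T P t (red T P t)"
proof (cases "t < T")
  case False
  have "(T + (t - T) mod P) mod P = (T + (t - T)) mod P" by (rule mod_add_right_eq)
  then show ?thesis using False by (simp add: red_def eqv_def)
qed (simp add: red_def eqv_def)

lemma red_less: "0 < P \<Longrightarrow> red T P t < T + P"
  by (auto simp: red_def)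

lemma red_ge: "T \<le> t \<Longrightarrow> T \<le> red T P t"
  by (simp add: red_def)

text \<open>A certificate describes a query as a chain of blocks. The query is satisfied by the positive
  example \<open>i\<close> from \<open>v i\<close> on and, unless \<open>v j\<close> exceeds \<open>T\<close>, it is not satisfied by the negative example
  \<open>j\<close> at any time after \<open>v j\<close>. A block \<open>(k, K)\<close> lists the common atoms of the positive examples for
  \<open>K\<close> time points; the next block is reached by \<open>Eventually\<close> from time point \<open>k\<close> of the block. For path
  queries \<open>k = K\<close>; without \<open>Next\<close>, \<open>k = K = 0\<close>.\<close>

abbreviation splits :: "(nat \<Rightarrow> interp) \<Rightarrow> nat set \<Rightarrow> nat set \<Rightarrow> ltl \<Rightarrow> bool" where
  "splits C PS NS \<kappa> \<equiv> (\<forall>i\<in>PS. sat (C i) 0 \<kappa>) \<and> (\<forall>j\<in>NS. \<not> sat (C j) 0 \<kappa>)"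

text \<open>\<open>T + 1 < B\<close> leaves room for \<open>T + 1\<close>, the mark of a missing
  threshold. Closure of \<open>KK\<close> under truncation allows blocks to be cut at
  \<open>B\<close>, behind which nothing new happens by periodicity.\<close>

locale certificates =
  fixes C :: "nat \<Rightarrow> interp" and PS NS :: "nat set" and T P B :: nat and KK :: "(nat \<times> nat) set" and At :: "nat set"
  assumes per: "\<And>i. i \<in> PS \<union> NS \<Longrightarrow> per T P (C i)" and P: "0 < P" and B: "T + P \<le> B" "T + 1 < B"
    and PS: "PS \<noteq> {}" and At: "finite At" "\<And>i t. i \<in> PS \<Longrightarrow> C i t \<subseteq> At"
    and disj: "PS \<inter> NS = {}"
    and KK: "(0, 0) \<in> KK" "\<And>k K b. (k, K) \<in> KK \<Longrightarrow> (min k b, min K b) \<in> KK"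
begin

text \<open>Failure of the strongest conjunction of atoms that holds at offset \<open>k\<close> in
  all positive examples. Adding more common atoms never hurts, so this conjunction is the only one
  to consider.\<close>

definition mism :: "(nat \<Rightarrow> nat) \<Rightarrow> nat \<Rightarrow> nat \<Rightarrow> nat \<Rightarrow> bool" where
  "mism v k j s \<longleftrightarrow> (\<exists>a. (\<forall>i\<in>PS. a \<in> C i (v i + k)) \<and> a \<notin> C j (s + k))"

text \<open>The two reasons why a block fails at \<open>s\<close>: an atom within its width is
  missing, or the rest fails at all times that a strict \<open>Eventually\<close> can reach from
  \<open>s + k\<close>, the first of which is \<open>Suc (s + k)\<close>.\<close>

definition blk :: "(nat \<Rightarrow> nat) \<Rightarrow> nat \<Rightarrow> nat \<Rightarrow> (nat \<Rightarrow> nat) \<Rightarrow> nat \<Rightarrow> nat \<Rightarrow> bool" where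
  "blk v k K v' j s \<longleftrightarrow> (\<exists>l\<le>K. mism v l j s) \<or> v' j \<le> Suc (s + k) \<and> v' j \<le> T"

text \<open>Since \<open>v' i\<close> is reduced modulo the period, a value from \<open>T\<close> on
  always has copies later than \<open>v i + k\<close>; below \<open>T\<close> the order has to be
  checked.\<close>

definition est :: "(nat \<Rightarrow> nat) \<Rightarrow> (nat \<Rightarrow> nat) \<Rightarrow> bool" where
  "est v v' \<longleftrightarrow> (\<exists>k\<le>B. \<exists>K\<le>B. (k, K) \<in> KK \<and> (\<forall>i\<in>PS. T \<le> v' i \<or> v i + k < v' i) \<and>
     (\<forall>j\<in>NS. \<forall>s<B. v j \<le> s \<and> v j \<le> T \<longrightarrow> blk v k K v' j s))"

definition bnd :: "(nat \<Rightarrow> nat) \<Rightarrow> bool" where "bnd v \<longleftrightarrow> (\<forall>i\<in>PS \<union> NS. v i < B)"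

text \<open>The base case belongs to the query \<open>Top\<close>, which fails nowhere, so that no
  threshold may be claimed.\<close>

inductive cert :: "(nat \<Rightarrow> nat) \<Rightarrow> bool" where
  base: "(\<And>j. j \<in> NS \<Longrightarrow> T < v j) \<Longrightarrow> bnd v \<Longrightarrow> cert v"
| step: "bnd v \<Longrightarrow> est v v' \<Longrightarrow> cert v' \<Longrightarrow> cert v"

text \<open>The first block is special: on a negative example it has to fail at time 0 only, not
  from a threshold on.\<close>

definition top_cert :: bool where
  "top_cert \<longleftrightarrow> (\<exists>v. cert v \<and> (\<exists>k\<le>B. \<exists>K\<le>B. (k, K) \<in> KK \<and> (\<forall>i\<in>PS. T \<le> v i \<or> k < v i) \<and>
     (\<forall>j\<in>NS. blk (\<lambda>_. 0) k K v j 0)))"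

definition common :: "(nat \<Rightarrow> nat) \<Rightarrow> ltl \<Rightarrow> bool" where
  "common v \<rho> \<longleftrightarrow> (\<exists>As. \<rho> = Conj (map Atom As) \<and> set As = (\<Inter>i\<in>PS. C i (v i)))"

lemma ex_common: "\<exists>As \<rho>. common v \<rho> \<and> \<rho> = Conj (map Atom As)"
proof -
  obtain i where "i \<in> PS" using PS by blast
  then have "(\<Inter>i\<in>PS. C i (v i)) \<subseteq> At" using At(2) by blast
  then have "finite (\<Inter>i\<in>PS. C i (v i))" using At(1) by (rule finite_subset)
  from finite_list[OF this] obtain As where "set As = (\<Inter>i\<in>PS. C i (v i))" ..
  then have "common v (Conj (map Atom As))" unfolding common_def by (intro exI[of _ As] conjI refl)
  then show ?thesis by blast
qed

lemma sat_common: "common v \<rho> \<Longrightarrow> i \<in> PS \<Longrightarrow> sat (C i) (v i) \<rho>"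
  by (auto simp: common_def sat_Conj)

lemma sat_common_neg: "common (\<lambda>i. v i + k) \<rho> \<Longrightarrow> sat (C j) (s + k) \<rho> \<Longrightarrow> \<not> mism v k j s"
proof -
  assume a: "common (\<lambda>i. v i + k) \<rho>" "sat (C j) (s + k) \<rho>"
  obtain As where As: "\<rho> = Conj (map Atom As)" "set As = (\<Inter>i\<in>PS. C i (v i + k))"
    using a(1) unfolding common_def by blast
  have "\<forall>a\<in>set As. a \<in> C j (s + k)" using a(2) unfolding As(1) sat_Conj by simp
  moreover have "a \<in> set As" if "\<forall>i\<in>PS. a \<in> C i (v i + k)" for a
    unfolding As(2) using that by (intro INT_I) blast
  ultimately show ?thesis unfolding mism_def by metis
qed

text \<open>The query that belongs to a block, followed by the query \<open>\<kappa>'\<close>.\<close>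

definition block_query :: "(nat \<Rightarrow> nat) \<Rightarrow> nat \<Rightarrow> nat \<Rightarrow> ltl \<Rightarrow> ltl \<Rightarrow> bool" where
  "block_query v k K \<kappa>' \<kappa> \<longleftrightarrow>
    ((\<forall>i\<in>PS. sat (C i) (v i + k) (Eventually \<kappa>')) \<longrightarrow> (\<forall>i\<in>PS. sat (C i) (v i) \<kappa>)) \<and>
    (\<forall>j s. sat (C j) s \<kappa> \<longrightarrow> (\<forall>l\<le>K. \<not> mism v l j s) \<and> sat (C j) (s + k) (Eventually \<kappa>'))"

lemma path_block:
  assumes "Eventually \<in> \<Phi>" "k = 0 \<or> Next \<in> \<Phi>" "\<kappa>' \<in> path_queries \<Phi>"
  shows "\<exists>\<kappa>\<in>path_queries \<Phi>. block_query v k k \<kappa>' \<kappa>"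
  using assms(2)
proof (induction k arbitrary: v)
  case 0
  obtain As \<rho> where r: "common v \<rho>" and As: "\<rho> = Conj (map Atom As)" using ex_common by blast
  have "And \<rho> (Eventually \<kappa>') \<in> path_queries \<Phi>" unfolding As by (rule path_queries.intros(2)[OF assms(1,3)])
  moreover have "block_query v 0 0 \<kappa>' (And \<rho> (Eventually \<kappa>'))"
    unfolding block_query_def using sat_common[OF r] sat_common_neg[of v 0 \<rho>] r by auto
  ultimately show ?case by blast
next
  case (Suc k)
  then have N: "Next \<in> \<Phi>" by simp
  then obtain \<kappa> where \<kappa>: "\<kappa> \<in> path_queries \<Phi>" "block_query (\<lambda>i. Suc (v i)) k k \<kappa>' \<kappa>"
    using Suc.IH by blast
  obtain As \<rho> where r: "common v \<rho>" and As: "\<rho> = Conj (map Atom As)" using ex_common by blast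
  have "And \<rho> (Next \<kappa>) \<in> path_queries \<Phi>" unfolding As by (rule path_queries.intros(2)[OF N \<kappa>(1)])
  moreover have "block_query v (Suc k) (Suc k) \<kappa>' (And \<rho> (Next \<kappa>))"
    unfolding block_query_def
  proof (intro conjI impI allI ballI)
    fix i
    assume "\<forall>i\<in>PS. sat (C i) (v i + Suc k) (Eventually \<kappa>')" "i \<in> PS"
    then show "sat (C i) (v i) (And \<rho> (Next \<kappa>))"
      using \<kappa>(2) sat_common[OF r] unfolding block_query_def sat.simps(5) sat_Next by simp
  next
    fix j s l
    assume s: "sat (C j) s (And \<rho> (Next \<kappa>))" and l: "l \<le> Suc k"
    show "\<not> mism v l j s"
    proof (cases l)
      case 0
      then show ?thesis using s sat_common_neg[of v 0 \<rho>] r by simp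
    next
      case (Suc l')
      have "sat (C j) (Suc s) \<kappa>" using s unfolding sat.simps(5) sat_Next by simp
      then have "\<not> mism (\<lambda>i. Suc (v i)) l' j (Suc s)" using \<kappa>(2) l Suc unfolding block_query_def by auto
      then show ?thesis unfolding mism_def Suc by simp
    qed
  next
    fix j s
    assume s: "sat (C j) s (And \<rho> (Next \<kappa>))"
    then have "sat (C j) (Suc s) \<kappa>" unfolding sat.simps(5) sat_Next by simp
    then have "sat (C j) (Suc s + k) (Eventually \<kappa>')" using \<kappa>(2) unfolding block_query_def by blast
    then show "sat (C j) (s + Suc k) (Eventually \<kappa>')" by (simp only: add_Suc add_Suc_right)
  qed
  ultimately show ?case by blast
qed

lemma query_atoms: "Conj (map Atom As) \<in> queries \<Phi>"
  by (induction As) (auto intro: queries.intros)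

lemma query_block:
  assumes "Eventually \<in> \<Phi>" "K = 0 \<or> Next \<in> \<Phi>" "k \<le> K" "\<kappa>' \<in> queries \<Phi>"
  shows "\<exists>\<kappa>\<in>queries \<Phi>. block_query v k K \<kappa>' \<kappa>"
  using assms(2,3)
proof (induction K arbitrary: v k)
  case 0
  obtain As \<rho> where r: "common v \<rho>" and As: "\<rho> = Conj (map Atom As)" using ex_common by blast
  have "And \<rho> (Eventually \<kappa>') \<in> queries \<Phi>" unfolding As
    by (intro queries.intros(4) query_atoms queries.intros(5)[OF assms(1,4)])
  moreover have "block_query v 0 0 \<kappa>' (And \<rho> (Eventually \<kappa>'))"
    unfolding block_query_def using sat_common[OF r] sat_common_neg[of v 0 \<rho>] r by auto
  ultimately show ?case using 0 by auto
next
  case (Suc K)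
  then have N: "Next \<in> \<Phi>" by simp
  obtain \<kappa> where \<kappa>: "\<kappa> \<in> queries \<Phi>" "block_query (\<lambda>i. Suc (v i)) (k - 1) K \<kappa>' \<kappa>"
  proof -
    have "k - 1 \<le> K" using Suc.prems(2) by simp
    then have "\<exists>\<kappa>\<in>queries \<Phi>. block_query (\<lambda>i. Suc (v i)) (k - 1) K \<kappa>' \<kappa>" using Suc.IH N by blast
    then show ?thesis using that by blast
  qed
  obtain As \<rho> where r: "common v \<rho>" and As: "\<rho> = Conj (map Atom As)" using ex_common by blast
  \<comment> \<open>The common atoms over the whole width need a branch of their own: a block may be
    wider than the offset \<open>k\<close> at which its rest is attached. A path cannot branch in
    this way.\<close>
  obtain \<kappa>0 where \<kappa>0: "\<kappa>0 \<in> queries \<Phi>" "\<And>j s. sat (C j) s \<kappa>0 \<Longrightarrow> \<forall>l\<le>K. \<not> mism (\<lambda>i. Suc (v i)) l j s"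
      "\<forall>i\<in>PS. sat (C i) (Suc (v i)) \<kappa>0"
  proof -
    have "\<exists>\<kappa>0\<in>queries \<Phi>. (\<forall>j s. sat (C j) s \<kappa>0 \<longrightarrow> (\<forall>l\<le>K. \<not> mism u l j s)) \<and> (\<forall>i\<in>PS. sat (C i) (u i) \<kappa>0)" for K u
    proof (induction K arbitrary: u)
      case 0
      obtain As \<rho> where r: "common u \<rho>" and As: "\<rho> = Conj (map Atom As)" using ex_common by blast
      show ?case using query_atoms[of As \<Phi>] sat_common[OF r] sat_common_neg[of u 0 \<rho>] r
        by (intro bexI[of _ \<rho>]) (auto simp: As)
    next
      case (Suc K)
      obtain As \<rho> where r: "common u \<rho>" and As: "\<rho> = Conj (map Atom As)" using ex_common by blast
      obtain \<kappa>1 where k: "\<kappa>1 \<in> queries \<Phi>" "\<forall>j s. sat (C j) s \<kappa>1 \<longrightarrow> (\<forall>l\<le>K. \<not> mism (\<lambda>i. Suc (u i)) l j s)"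
          "\<forall>i\<in>PS. sat (C i) (Suc (u i)) \<kappa>1" using Suc.IH[of "\<lambda>i. Suc (u i)"] by blast
      show ?case
      proof (intro bexI[of _ "And \<rho> (Next \<kappa>1)"] conjI allI impI ballI)
        show "And \<rho> (Next \<kappa>1) \<in> queries \<Phi>" unfolding As
          by (intro queries.intros(4) query_atoms queries.intros(5)[OF N k(1)])
        show "sat (C i) (u i) (And \<rho> (Next \<kappa>1))" if "i \<in> PS" for i
          using that k(3) sat_common[OF r] unfolding sat.simps(5) sat_Next by simp
        fix j s l assume s: "sat (C j) s (And \<rho> (Next \<kappa>1))" and l: "l \<le> Suc K"
        show "\<not> mism u l j s"
        proof (cases l)
          case 0
          then show ?thesis using s sat_common_neg[of u 0 \<rho>] r by simp
        next
          case (Suc l')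
          have "sat (C j) (Suc s) \<kappa>1" using s unfolding sat.simps(5) sat_Next by simp
          then have "\<not> mism (\<lambda>i. Suc (u i)) l' j (Suc s)" using k(2) l Suc by auto
          then show ?thesis unfolding mism_def Suc by simp
        qed
      qed
    qed
    then show ?thesis using that by blast
  qed
  let ?nx = "And \<rho> (And (Next \<kappa>0) (if k = 0 then Eventually \<kappa>' else Next \<kappa>))"
  have "?nx \<in> queries \<Phi>" unfolding As
    by (auto intro!: queries.intros(4) query_atoms queries.intros(5)[OF N] queries.intros(5)[OF assms(1,4)] \<kappa> \<kappa>0)
  moreover have "block_query v k (Suc K) \<kappa>' ?nx"
    unfolding block_query_def
  proof (intro conjI impI allI ballI)
    fix i
    assume a: "\<forall>i\<in>PS. sat (C i) (v i + k) (Eventually \<kappa>')" "i \<in> PS"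
    have "sat (C i) (v i) (if k = 0 then Eventually \<kappa>' else Next \<kappa>)"
    proof (cases k)
      case 0
      then show ?thesis using a by simp
    next
      case (Suc k')
      then have "sat (C i) (Suc (v i)) \<kappa>" using \<kappa>(2) a unfolding block_query_def by simp
      then show ?thesis using Suc sat_Next[of "C i" "v i" \<kappa>] by simp
    qed
    then show "sat (C i) (v i) ?nx"
      using \<kappa>0(3) a(2) sat_common[OF r] unfolding sat.simps(5) sat_Next by simp
  next
    fix j s l
    assume s: "sat (C j) s ?nx" and l: "l \<le> Suc K"
    show "\<not> mism v l j s"
    proof (cases l)
      case 0
      then show ?thesis using s sat_common_neg[of v 0 \<rho>] r by simp
    next
      case (Suc l')
      have "sat (C j) (Suc s) \<kappa>0" using s unfolding sat.simps(5) sat_Next by simp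
      then have "\<not> mism (\<lambda>i. Suc (v i)) l' j (Suc s)" using \<kappa>0(2) l Suc by auto
      then show ?thesis unfolding mism_def Suc by simp
    qed
  next
    fix j s
    assume s: "sat (C j) s ?nx"
    show "sat (C j) (s + k) (Eventually \<kappa>')"
    proof (cases k)
      case 0
      then show ?thesis using s by simp
    next
      case (Suc k')
      then have "sat (C j) (Suc s) \<kappa>" using s sat_Next[of "C j" s \<kappa>] by simp
      then have "sat (C j) (Suc s + (k - 1)) (Eventually \<kappa>')" using \<kappa>(2) unfolding block_query_def by blast
      moreover have "Suc s + (k - 1) = s + k" using Suc by simp
      ultimately show ?thesis by (simp only:)
    qed
  qed
  ultimately show ?case by blast
qed

lemma cert_sound:
  assumes "\<And>v k K \<kappa>'. (k, K) \<in> KK \<Longrightarrow> \<kappa>' \<in> Q \<Longrightarrow> \<exists>\<kappa>\<in>Q. block_query v k K \<kappa>' \<kappa>" "Top \<in> Q"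
  shows "cert v \<Longrightarrow> \<exists>\<kappa>\<in>Q. (\<forall>i\<in>PS. sat (C i) (v i) \<kappa>) \<and>
    (\<forall>j\<in>NS. \<forall>s. v j \<le> s \<and> v j \<le> T \<longrightarrow> \<not> sat (C j) s \<kappa>)"
    and "top_cert \<Longrightarrow> \<exists>\<kappa>\<in>Q. splits C PS NS \<kappa>"
proof -
  have block: "\<exists>\<kappa>\<in>Q. (\<forall>i\<in>PS. sat (C i) (v i) \<kappa>) \<and> (\<forall>j\<in>NS. \<forall>s. blk v k K v' j s \<longrightarrow> \<not> sat (C j) s \<kappa>)"
    if k: "(k, K) \<in> KK" and v': "\<forall>i\<in>PS. T \<le> v' i \<or> v i + k < v' i"
      and \<kappa>': "\<kappa>' \<in> Q" "\<forall>i\<in>PS. sat (C i) (v' i) \<kappa>'" "\<forall>j\<in>NS. \<forall>s. v' j \<le> s \<and> v' j \<le> T \<longrightarrow> \<not> sat (C j) s \<kappa>'"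
    for v v' k K \<kappa>'
  proof -
    obtain \<kappa> where \<kappa>: "\<kappa> \<in> Q" "block_query v k K \<kappa>' \<kappa>" using assms(1)[OF k \<kappa>'(1)] by blast
    have "sat (C i) (v i + k) (Eventually \<kappa>')" if i: "i \<in> PS" for i
    proof (cases "v i + k < v' i")
      case True
      then show ?thesis using \<kappa>'(2) i unfolding sat_Eventually by blast
    next
      case False
      \<comment> \<open>A copy of \<open>v' i\<close>, by so many periods later that it lies behind
        \<open>v i + k\<close>.\<close>
      let ?u = "v' i + P * Suc (v i + k)"
      have "T \<le> v' i" using v' i False by auto
      then have "eqv T P ?u (v' i)" by (simp add: eqv_def del: mult_Suc_right)
      then have "sat (C i) ?u \<kappa>'" using sat_eqv[OF per, of i ?u "v' i" \<kappa>'] i \<kappa>'(2) by blast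
      moreover have "v i + k < ?u" using P by (cases P) auto
      ultimately show ?thesis unfolding sat_Eventually by blast
    qed
    moreover have "\<not> sat (C j) s \<kappa>" if "j \<in> NS" "blk v k K v' j s" for j s
    proof
      assume "sat (C j) s \<kappa>"
      then have "\<forall>l\<le>K. \<not> mism v l j s" "sat (C j) (s + k) (Eventually \<kappa>')" using \<kappa>(2) unfolding block_query_def by blast+
      then show False using that \<kappa>'(3) unfolding blk_def sat_Eventually by (meson Suc_leI order_trans)
    qed
    ultimately show ?thesis using \<kappa> unfolding block_query_def by blast
  qed
  show *: "\<exists>\<kappa>\<in>Q. (\<forall>i\<in>PS. sat (C i) (v i) \<kappa>) \<and> (\<forall>j\<in>NS. \<forall>s. v j \<le> s \<and> v j \<le> T \<longrightarrow> \<not> sat (C j) s \<kappa>)"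
    if "cert v" for v using that
  proof (induction rule: cert.induct)
    case (base v)
    then show ?case using assms(2) by (intro bexI[of _ Top]) force+
  next
    case (step v v')
    then obtain \<kappa>' where \<kappa>': "\<kappa>' \<in> Q" "\<forall>i\<in>PS. sat (C i) (v' i) \<kappa>'" "\<forall>j\<in>NS. \<forall>s. v' j \<le> s \<and> v' j \<le> T \<longrightarrow> \<not> sat (C j) s \<kappa>'"
      by blast
    obtain k K where k: "(k, K) \<in> KK" "\<forall>i\<in>PS. T \<le> v' i \<or> v i + k < v' i"
      "\<forall>j\<in>NS. \<forall>s<B. v j \<le> s \<and> v j \<le> T \<longrightarrow> blk v k K v' j s" using step.hyps(2) unfolding est_def by blast
    obtain \<kappa> where \<kappa>: "\<kappa> \<in> Q" "\<forall>i\<in>PS. sat (C i) (v i) \<kappa>" "\<forall>j\<in>NS. \<forall>s. blk v k K v' j s \<longrightarrow> \<not> sat (C j) s \<kappa>"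
      using block[OF k(1,2) \<kappa>'] by blast
    have "\<not> sat (C j) s \<kappa>" if j: "j \<in> NS" "v j \<le> s" "v j \<le> T" for j s
    proof (cases "s < B")
      case True
      then show ?thesis using k(3) \<kappa>(3) j by blast
    next
      case False
      \<comment> \<open>A time from \<open>B\<close> on has the same future as its reduction, which
        is still not below the threshold since the threshold is at most \<open>T\<close>.\<close>
      then have "T \<le> s" using B by simp
      then have "T \<le> red T P s" by (rule red_ge)
      then have "v j \<le> red T P s" using j(3) by simp
      moreover have "red T P s < B" using red_less[OF P, of T s] B by simp
      ultimately have "\<not> sat (C j) (red T P s) \<kappa>" using k(3) \<kappa>(3) j by blast
      then show ?thesis using sat_eqv[OF per eqv_red, of j s \<kappa>] j(1) by blast
    qed
    then show ?case using \<kappa>(1,2) by blast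
  qed
  show "\<exists>\<kappa>\<in>Q. splits C PS NS \<kappa>" if top_cert
  proof -
    obtain v k K where v: "cert v" "(k, K) \<in> KK" "\<forall>i\<in>PS. T \<le> v i \<or> k < v i"
      "\<forall>j\<in>NS. blk (\<lambda>_. 0) k K v j 0" using \<open>top_cert\<close> unfolding top_cert_def by blast
    obtain \<kappa>' where \<kappa>': "\<kappa>' \<in> Q" "\<forall>i\<in>PS. sat (C i) (v i) \<kappa>'" "\<forall>j\<in>NS. \<forall>s. v j \<le> s \<and> v j \<le> T \<longrightarrow> \<not> sat (C j) s \<kappa>'"
      using *[OF v(1)] by blast
    then show ?thesis using block[OF v(2), of v "\<lambda>_. 0" \<kappa>'] v(3,4) by auto
  qed
qed

text \<open>The invariant for completeness: a certified chain of blocks may replace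
  \<open>\<kappa>\<close>, as it starts at the times \<open>t\<close> of the positive examples and
  fails on the negative ones wherever \<open>\<kappa>\<close> does. The size of the first block is
  not yet bounded.\<close>

definition claim :: "ltl \<Rightarrow> (nat \<Rightarrow> nat) \<Rightarrow> bool" where
  "claim \<kappa> t \<longleftrightarrow> (\<exists>k K v. (k, K) \<in> KK \<and> cert v \<and> (\<forall>i\<in>PS. T \<le> v i \<or> t i + k < v i) \<and>
     (\<forall>j\<in>NS. \<forall>s. \<not> sat (C j) s \<kappa> \<longrightarrow> blk t k K v j s))"

text \<open>An offset beyond \<open>B\<close> is at least \<open>T + P\<close>, so the same mismatch
  occurs one period earlier.\<close>

lemma mism_bound:
  assumes "mism t l j s" "j \<in> NS" shows "\<exists>l'\<le>min l B. mism t l' j s"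
  using assms(1)
proof (induction l rule: less_induct)
  case (less l)
  show ?case
  proof (cases "l \<le> B")
    case False
    then have l: "T \<le> l - P" "l - P < l" using B P by auto
    have d: "I (x + (l - P)) = I (x + l)" if "per T P I" for I x
    proof -
      have "I (x + (l - P) + P) = I (x + (l - P))" using that l(1) unfolding per_def by simp
      then show ?thesis using False B by simp
    qed
    have "C i (t i + (l - P)) = C i (t i + l)" if "i \<in> PS" for i using d per that by blast
    moreover have "C j (s + (l - P)) = C j (s + l)" using d per assms(2) by blast
    ultimately have "mism t (l - P) j s" using less.prems unfolding mism_def by auto
    from less.IH[OF l(2) this] obtain l' where "l' \<le> l - P" "l' \<le> B" "mism t l' j s" by auto
    then show ?thesis by (intro exI[of _ l']) simp
  qed (use less.prems in auto)
qed

lemma blk_bound: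
  assumes "blk t k K v j s" "j \<in> NS" shows "blk t (min k B) (min K B) v j s"
  using assms(1) unfolding blk_def
proof
  assume "\<exists>l\<le>K. mism t l j s"
  then obtain l where "l \<le> K" "mism t l j s" by blast
  then show "(\<exists>l\<le>min K B. mism t l j s) \<or> v j \<le> Suc (s + min k B) \<and> v j \<le> T"
    using mism_bound[OF _ assms(2)] by (meson min.mono order_trans order_refl)
next
  assume "v j \<le> Suc (s + k) \<and> v j \<le> T"
  then show "(\<exists>l\<le>min K B. mism t l j s) \<or> v j \<le> Suc (s + min k B) \<and> v j \<le> T" using B by auto
qed

lemma claim_est:
  assumes "claim \<kappa> t"
  shows "\<exists>k\<le>B. \<exists>K\<le>B. \<exists>v. (k, K) \<in> KK \<and> cert v \<and> (\<forall>i\<in>PS. T \<le> v i \<or> t i + k < v i) \<and>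
     (\<forall>j\<in>NS. \<forall>s. \<not> sat (C j) s \<kappa> \<longrightarrow> blk t k K v j s)"
proof -
  obtain k K v where k: "(k, K) \<in> KK" "cert v" "\<forall>i\<in>PS. T \<le> v i \<or> t i + k < v i"
     "\<forall>j\<in>NS. \<forall>s. \<not> sat (C j) s \<kappa> \<longrightarrow> blk t k K v j s" using assms unfolding claim_def by blast
  have "\<forall>i\<in>PS. T \<le> v i \<or> t i + min k B < v i" using k(3) by auto
  moreover have "\<forall>j\<in>NS. \<forall>s. \<not> sat (C j) s \<kappa> \<longrightarrow> blk t (min k B) (min K B) v j s" using k(4) blk_bound by blast
  moreover have "min k B \<le> B" "min K B \<le> B" by auto
  ultimately show ?thesis using KK(2)[OF k(1)] k(2) by blast
qed

lemma claim_atoms: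
  assumes "\<forall>i\<in>PS. sat (C i) (t i) (Conj (map Atom As))" shows "claim (Conj (map Atom As)) t"
proof -
  \<comment> \<open>\<open>T + 1\<close> demands nothing: it is no threshold for a negative example
    and lies in the periodic part for a positive one.\<close>
  let ?v = "\<lambda>i. T + 1"
  have "cert ?v" by (rule base) (use B in \<open>auto simp: bnd_def\<close>)
  moreover have "blk t 0 0 ?v j s" if "\<not> sat (C j) s (Conj (map Atom As))" for j s
    using that assms by (auto simp: blk_def mism_def sat_Conj)
  ultimately show ?thesis unfolding claim_def using KK(1) by (intro exI[of _ 0] exI[of _ ?v]) auto
qed

lemma claim_and_atoms:
  assumes "\<forall>i\<in>PS. sat (C i) (t i) (Conj (map Atom As))" "claim \<kappa> t" shows "claim (And (Conj (map Atom As)) \<kappa>) t"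
proof -
  obtain k K v where k: "(k, K) \<in> KK" "cert v" "\<forall>i\<in>PS. T \<le> v i \<or> t i + k < v i"
     "\<forall>j\<in>NS. \<forall>s. \<not> sat (C j) s \<kappa> \<longrightarrow> blk t k K v j s" using assms unfolding claim_def by blast
  have "blk t k K v j s" if "j \<in> NS" "\<not> sat (C j) s (And (Conj (map Atom As)) \<kappa>)" for j s
  proof (cases "sat (C j) s \<kappa>")
    case True
    then have "mism t 0 j s" using that assms(1) by (auto simp: mism_def sat_Conj)
    then show ?thesis unfolding blk_def by blast
  qed (use k(4) that in blast)
  then show ?thesis unfolding claim_def using k by blast
qed

lemma claim_next:
  assumes "\<And>k K. (k, K) \<in> KK \<Longrightarrow> (Suc k, Suc K) \<in> KK" "claim \<kappa> (\<lambda>i. Suc (t i))"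
  shows "claim (Next \<kappa>) t"
proof -
  obtain k K v where k: "(k, K) \<in> KK" "cert v" "\<forall>i\<in>PS. T \<le> v i \<or> Suc (t i) + k < v i"
     "\<forall>j\<in>NS. \<forall>s. \<not> sat (C j) s \<kappa> \<longrightarrow> blk (\<lambda>i. Suc (t i)) k K v j s" using assms unfolding claim_def by blast
  have "blk t (Suc k) (Suc K) v j s" if j: "j \<in> NS" "\<not> sat (C j) s (Next \<kappa>)" for j s
  proof -
    have "blk (\<lambda>i. Suc (t i)) k K v j (Suc s)" using k(4) j unfolding sat_Next by blast
    moreover have "mism (\<lambda>i. Suc (t i)) l j (Suc s) = mism t (Suc l) j s" for l by (simp add: mism_def)
    ultimately show ?thesis unfolding blk_def using Suc_le_mono by auto
  qed
  then show ?thesis unfolding claim_def using k assms(1)[OF k(1)]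
    by (intro exI[of _ "Suc k"] exI[of _ "Suc K"] exI[of _ v]) auto
qed

text \<open>A trivial block followed by a new vertex \<open>v\<close>. On a positive example
  \<open>v\<close> is the reduced witness. On a negative one \<open>\<kappa>\<close> either recurs
  forever, marked by \<open>T + 1\<close>, or there is a least time from which it fails;
  \<open>Eventually \<kappa>\<close> fails at \<open>s\<close> exactly if \<open>Suc s\<close> is
  not below that time.\<close>

lemma claim_eventually:
  assumes sat: "\<forall>i\<in>PS. sat (C i) (t i) (Eventually \<kappa>)"
    and IH: "\<And>t. \<forall>i\<in>PS. sat (C i) (t i) \<kappa> \<Longrightarrow> claim \<kappa> t"
  shows "claim (Eventually \<kappa>) t"
proof -
  obtain u where u: "\<forall>i\<in>PS. t i < u i \<and> sat (C i) (u i) \<kappa>"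
    using sat unfolding sat_Eventually by metis
  let ?D = "\<lambda>j \<theta>. \<forall>s\<ge>\<theta>. \<not> sat (C j) s \<kappa>"
  define v where "v i = (if i \<in> PS then red T P (u i) else if \<exists>\<theta>. ?D i \<theta> then LEAST \<theta>. ?D i \<theta> else T + 1)" for i
  have vP: "v i = red T P (u i)" if "i \<in> PS" for i using that by (simp add: v_def)
  have vN: "v j = (if \<exists>\<theta>. ?D j \<theta> then LEAST \<theta>. ?D j \<theta> else T + 1)" if "j \<in> NS" for j
  proof -
    have "j \<notin> PS" using that disj by blast
    then show ?thesis by (simp only: v_def if_False)
  qed
  have vN1: "v j = (LEAST \<theta>. ?D j \<theta>)" if "j \<in> NS" "?D j \<theta>" for j \<theta>
    unfolding vN[OF that(1)] by (rule if_P, rule exI, rule that(2))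
  have vN2: "v j = T + 1" if "j \<in> NS" "\<not> (\<exists>\<theta>. ?D j \<theta>)" for j
    unfolding vN[OF that(1)] by (rule if_not_P, rule that(2))
  have dead: "v j \<le> T \<and> ?D j (v j)" if j: "j \<in> NS" "?D j \<theta>" for j \<theta>
  proof -
    \<comment> \<open>If \<open>\<kappa>\<close> held at some time from \<open>T\<close> on, it
      would hold again beyond any bound. Hence thresholds never exceed \<open>T\<close>.\<close>
    have "?D j T"
    proof (intro allI impI)
      fix s assume s: "T \<le> s"
      have "eqv T P (s + P * \<theta>) s" using s by (simp add: eqv_def)
      then have "sat (C j) s \<kappa> = sat (C j) (s + P * \<theta>) \<kappa>" using sat_eqv[OF per] j(1) by blast
      moreover have "\<theta> \<le> s + P * \<theta>" using P by (cases P) auto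
      ultimately show "\<not> sat (C j) s \<kappa>" using j(2) by blast
    qed
    then have "(LEAST \<theta>. ?D j \<theta>) \<le> T" by (rule Least_le)
    moreover have "?D j (LEAST \<theta>. ?D j \<theta>)" by (rule LeastI[where P = "?D j", OF j(2)])
    ultimately show ?thesis unfolding vN1[OF j] by blast
  qed
  have bnd: "bnd v" unfolding bnd_def
  proof
    fix i assume "i \<in> PS \<union> NS"
    then show "v i < B"
    proof
      assume "i \<in> PS"
      then show ?thesis using vP red_less[OF P, of T "u i"] B by simp
    next
      assume i: "i \<in> NS"
      show ?thesis
      proof (cases "\<exists>\<theta>. ?D i \<theta>")
        case True
        then obtain \<theta> where "?D i \<theta>" by blast
        from dead[OF i this] show ?thesis using B by simp
      next
        case False
        then show ?thesis using vN2[OF i] B by simp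
      qed
    qed
  qed
  have "\<forall>i\<in>PS. sat (C i) (v i) \<kappa>"
  proof
    fix i assume i: "i \<in> PS"
    then have "sat (C i) (u i) \<kappa> = sat (C i) (red T P (u i)) \<kappa>" by (intro sat_eqv[OF per eqv_red]) simp
    then show "sat (C i) (v i) \<kappa>" using u i vP[OF i] by simp
  qed
  then have "claim \<kappa> v" by (rule IH)
  then obtain k K v' where k: "k \<le> B" "K \<le> B" "(k, K) \<in> KK" "cert v'" "\<forall>i\<in>PS. T \<le> v' i \<or> v i + k < v' i"
     "\<forall>j\<in>NS. \<forall>s. \<not> sat (C j) s \<kappa> \<longrightarrow> blk v k K v' j s" using claim_est by blast
  have "\<not> sat (C j) s \<kappa>" if "j \<in> NS" "v j \<le> s" "v j \<le> T" for j s
  proof -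
    have "\<exists>\<theta>. ?D j \<theta>"
    proof (rule ccontr)
      assume "\<not> (\<exists>\<theta>. ?D j \<theta>)"
      from vN2[OF that(1) this] show False using that(3) by simp
    qed
    then show ?thesis using dead that by blast
  qed
  then have "est v v'" unfolding est_def using k by blast
  then have "cert v" using step bnd k(4) by blast
  moreover have "\<forall>i\<in>PS. T \<le> v i \<or> t i + 0 < v i"
  proof
    fix i assume i: "i \<in> PS"
    show "T \<le> v i \<or> t i + 0 < v i" using u i vP[OF i] by (cases "T \<le> u i") (auto simp: red_def)
  qed
  moreover have "blk t 0 0 v j s" if j: "j \<in> NS" "\<not> sat (C j) s (Eventually \<kappa>)" for j s
  proof -
    have d: "?D j (Suc s)" using j(2) unfolding sat_Eventually by (meson Suc_le_lessD)
    have "v j \<le> Suc s" unfolding vN1[OF j(1) d] by (rule Least_le[where P = "?D j", OF d])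
    then show ?thesis using dead[OF j(1) d] unfolding blk_def by simp
  qed
  ultimately show ?thesis unfolding claim_def using KK(1) by blast
qed

text \<open>Two blocks with different continuations cannot be merged into one chain. With a single
  negative example one continuation suffices: that with the smaller threshold relative to its exit,
  \<open>v j - k\<close>, fails at more times. The atoms of both are kept by taking the larger
  width.\<close>

lemma claim_and:
  assumes NS: "NS = {j}" and K1: "\<And>k1 K1 k2 K2. (k1, K1) \<in> KK \<Longrightarrow> (k2, K2) \<in> KK \<Longrightarrow> (k1, max K1 K2) \<in> KK"
    and "claim \<kappa>1 t" "claim \<kappa>2 t"
  shows "claim (And \<kappa>1 \<kappa>2) t"
proof -
  have j: "j \<in> NS" "\<And>i. i \<in> NS \<Longrightarrow> i = j" using NS by auto
  obtain k1 K1 v1 where 1: "(k1, K1) \<in> KK" "cert v1" "\<forall>i\<in>PS. T \<le> v1 i \<or> t i + k1 < v1 i"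
     "\<forall>s. \<not> sat (C j) s \<kappa>1 \<longrightarrow> blk t k1 K1 v1 j s" using assms(3) j(1) unfolding claim_def by blast
  obtain k2 K2 v2 where 2: "(k2, K2) \<in> KK" "cert v2" "\<forall>i\<in>PS. T \<le> v2 i \<or> t i + k2 < v2 i"
     "\<forall>s. \<not> sat (C j) s \<kappa>2 \<longrightarrow> blk t k2 K2 v2 j s" using assms(4) j(1) unfolding claim_def by blast
  let ?K = "max K1 K2"
  show ?thesis
  proof (cases "v1 j \<le> T \<and> (v2 j \<le> T \<longrightarrow> v1 j + k2 \<le> v2 j + k1)")
    case True
    then have "blk t k1 ?K v1 j s" if "blk t k1 K1 v1 j s \<or> blk t k2 K2 v2 j s" for s
      using that unfolding blk_def by (auto simp: le_max_iff_disj)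
    then have "\<forall>s. \<not> sat (C j) s (And \<kappa>1 \<kappa>2) \<longrightarrow> blk t k1 ?K v1 j s" using 1(4) 2(4) by auto
    then show ?thesis unfolding claim_def using 1 K1[OF 1(1) 2(1)] j(2) by blast
  next
    case False
    then have "blk t k2 ?K v2 j s" if "blk t k1 K1 v1 j s \<or> blk t k2 K2 v2 j s" for s
      using that unfolding blk_def by (auto simp: le_max_iff_disj)
    then have "\<forall>s. \<not> sat (C j) s (And \<kappa>1 \<kappa>2) \<longrightarrow> blk t k2 ?K v2 j s" using 1(4) 2(4) by auto
    then show ?thesis unfolding claim_def using 2 K1[OF 2(1) 1(1), unfolded max.commute[of K2]] j(2) by blast
  qed
qed

lemma path_claim:
  assumes "\<kappa> \<in> path_queries \<Phi>" "\<Phi> \<subseteq> {Next, Eventually}" "Next \<in> \<Phi> \<Longrightarrow> (\<And>k K. (k, K) \<in> KK \<Longrightarrow> (Suc k, Suc K) \<in> KK)"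
  shows "\<forall>i\<in>PS. sat (C i) (t i) \<kappa> \<Longrightarrow> claim \<kappa> t"
  using assms(1)
proof (induction arbitrary: t rule: path_queries.induct)
  case (1 As)
  then show ?case by (rule claim_atoms)
next
  case (2 op \<kappa> As)
  have a: "\<forall>i\<in>PS. sat (C i) (t i) (Conj (map Atom As))" "\<forall>i\<in>PS. sat (C i) (t i) (op \<kappa>)" using 2(4) by auto
  have "op = Next \<or> op = Eventually" using 2(1) assms(2) by auto
  then have "claim (op \<kappa>) t"
  proof
    assume op: "op = Next"
    have N: "Next \<in> \<Phi>" using 2(1) unfolding op .
    have "\<forall>i\<in>PS. sat (C i) (Suc (t i)) \<kappa>" using a(2) unfolding op sat_Next .
    from claim_next[OF assms(3)[OF N] 2(3)[OF this]] show ?thesis unfolding op .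
  next
    assume op: "op = Eventually"
    show ?thesis unfolding op by (rule claim_eventually[OF a(2)[unfolded op] 2(3)])
  qed
  then show ?case by (rule claim_and_atoms[OF a(1)])
qed

lemma query_claim:
  assumes "\<kappa> \<in> queries \<Phi>" "\<Phi> \<subseteq> {Next, Eventually}" "Next \<in> \<Phi> \<Longrightarrow> (\<And>k K. (k, K) \<in> KK \<Longrightarrow> (Suc k, Suc K) \<in> KK)"
    "NS = {j}" "\<And>k1 K1 k2 K2. (k1, K1) \<in> KK \<Longrightarrow> (k2, K2) \<in> KK \<Longrightarrow> (k1, max K1 K2) \<in> KK"
  shows "\<forall>i\<in>PS. sat (C i) (t i) \<kappa> \<Longrightarrow> claim \<kappa> t"
  using assms(1)
proof (induction arbitrary: t rule: queries.induct)
  case (1 a)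
  then show ?case using claim_and_atoms[of t "[]"] claim_atoms[of t "[a]"] by (simp add: claim_def)
next
  case 2
  then show ?case using claim_atoms[of t "[]"] by simp
next
  case 3
  then show ?case using PS by auto
next
  case (4 \<kappa> \<kappa>')
  then show ?case by (intro claim_and[OF assms(4,5)]) auto
next
  case (5 op \<kappa>)
  have "op = Next \<or> op = Eventually" using 5(1) assms(2) by auto
  then show ?case
  proof
    assume op: "op = Next"
    have N: "Next \<in> \<Phi>" using 5(1) unfolding op .
    have "\<forall>i\<in>PS. sat (C i) (Suc (t i)) \<kappa>" using 5(4) unfolding op sat_Next .
    from claim_next[OF assms(3)[OF N] 5(3)[OF this]] show ?thesis unfolding op .
  next
    assume op: "op = Eventually"
    show ?thesis unfolding op by (rule claim_eventually[OF 5(4)[unfolded op] 5(3)])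
  qed
qed

lemma claim_top_cert: assumes "claim \<kappa> (\<lambda>_. 0)" "\<forall>j\<in>NS. \<not> sat (C j) 0 \<kappa>" shows top_cert
proof -
  obtain k K v where "k \<le> B" "K \<le> B" "(k, K) \<in> KK" "cert v" "\<forall>i\<in>PS. T \<le> v i \<or> 0 + k < v i"
     "\<forall>j\<in>NS. \<forall>s. \<not> sat (C j) s \<kappa> \<longrightarrow> blk (\<lambda>_. 0) k K v j s" using claim_est[OF assms(1)] by blast
  then show ?thesis using assms(2) unfolding top_cert_def add_0 by blast
qed

end

section \<open>Parsing\<close>

text \<open>An input \<open>x\<close> is represented by the number whose binary expansion (least significant bit
  first) is \<open>x\<close> followed by a 1.\<close>

definition len :: "nat \<Rightarrow> nat" where "len X = bl X - 1"

definition suf :: "nat \<Rightarrow> nat \<Rightarrow> bool list" where "suf X i = map (bit X) [i..<len X]"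

definition hasw :: "bool list \<Rightarrow> nat \<Rightarrow> nat \<Rightarrow> bool" where
  "hasw w X i \<longleftrightarrow> i \<le> len X \<and> take (length w) (suf X i) = w"

definition lat :: "bool list set \<Rightarrow> nat \<Rightarrow> nat \<Rightarrow> nat \<Rightarrow> bool" where
  "lat L X i j \<longleftrightarrow> (\<exists>w\<in>L. hasw w X i \<and> j = i + length w)"

lemma drop_suf: "drop n (suf X i) = suf X (i + n)"
  by (simp add: suf_def drop_map)

lemma length_suf[simp]: "length (suf X i) = len X - i"
  by (simp add: suf_def)

lemma hasw_le: "hasw w X i \<Longrightarrow> i + length w \<le> len X"
  unfolding hasw_def by (metis length_suf length_take min.absorb_iff2 le_diff_conv2 add.commute)

lemma hasw_append: "hasw (u @ v) X i \<longleftrightarrow> hasw u X i \<and> hasw v X (i + length u)"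
proof
  assume a: "hasw (u @ v) X i"
  then have "take (length u) (suf X i) @ take (length v) (drop (length u) (suf X i)) = u @ v"
    by (simp add: hasw_def take_add)
  moreover have "length (take (length u) (suf X i)) = length u" using hasw_le[OF a] by simp
  ultimately show "hasw u X i \<and> hasw v X (i + length u)"
    using hasw_le[OF a] by (simp add: hasw_def drop_suf)
next
  assume a: "hasw u X i \<and> hasw v X (i + length u)"
  then show "hasw (u @ v) X i" by (simp add: hasw_def take_add drop_suf)
qed

lemma hasw_Nil: "hasw [] X i \<longleftrightarrow> i \<le> len X"
  by (simp add: hasw_def)

lemma hasw_single: "hasw [b] X i \<longleftrightarrow> i < len X \<and> bit X i = b"
  by (cases "i < len X") (auto simp: hasw_def suf_def upt_conv_Cons)

lemma hasw_Cons: "hasw (b # w) X i \<longleftrightarrow> i < len X \<and> bit X i = b \<and> hasw w X (Suc i)"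
  using hasw_append[of "[b]" w X i] by (simp add: hasw_single)

lemma hasw_prefix: "hasw w X i \<longleftrightarrow> i \<le> len X \<and> (\<exists>v. suf X i = w @ v)"
  unfolding hasw_def by (metis append_eq_conv_conj append_take_drop_id)

lemma hasw_unique:
  assumes "\<And>x y u v. enc x @ u = enc y @ v \<Longrightarrow> x = y \<and> u = v" "hasw (enc x) X i" "hasw (enc y) X i"
  shows "x = y"
  using assms(2,3) unfolding hasw_prefix by (metis assms(1))

lemma lat_Un: "lat (A \<union> B) X i j \<longleftrightarrow> lat A X i j \<or> lat B X i j"
  by (auto simp: lat_def)

lemma lat_single: "lat {w} X i j \<longleftrightarrow> hasw w X i \<and> j = i + length w"
  by (auto simp: lat_def)

lemma lat_insert: "lat (insert w A) X i j \<longleftrightarrow> hasw w X i \<and> j = i + length w \<or> lat A X i j"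
  by (auto simp: lat_def)

lemma lat_eqI: "L = L' \<Longrightarrow> P \<longleftrightarrow> lat L' X i j \<Longrightarrow> P \<longleftrightarrow> lat L X i j"
  by simp

lemma lat_le: "lat L X i j \<Longrightarrow> i \<le> j \<and> j \<le> len X"
  by (auto simp: lat_def dest: hasw_le)

definition cat :: "bool list set \<Rightarrow> bool list set \<Rightarrow> bool list set" where
  "cat A B = {u @ v | u v. u \<in> A \<and> v \<in> B}"

lemma lat_cat: "lat (cat A B) X i j \<longleftrightarrow> (\<exists>k\<le>len X. lat A X i k \<and> lat B X k j)"
proof
  assume "lat (cat A B) X i j"
  then obtain u v where w: "u \<in> A" "v \<in> B" "hasw u X i" "hasw v X (i + length u)" "j = i + length u + length v"
    unfolding lat_def cat_def by (auto simp: hasw_append)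
  then have "lat A X i (i + length u)" "lat B X (i + length u) j" unfolding lat_def by auto
  moreover have "i + length u \<le> len X" by (rule hasw_le[OF w(3)])
  ultimately show "\<exists>k\<le>len X. lat A X i k \<and> lat B X k j" by blast
next
  assume "\<exists>k\<le>len X. lat A X i k \<and> lat B X k j"
  then obtain u v where "u \<in> A" "v \<in> B" "hasw u X i" "hasw v X (i + length u)" "j = i + length u + length v"
    unfolding lat_def by auto
  then show "lat (cat A B) X i j" unfolding lat_def cat_def
    by (intro bexI[of _ "u @ v"]) (auto simp: hasw_append)
qed

lemma lat_word: "lat (cat {w} L) X i j \<longleftrightarrow> hasw w X i \<and> lat L X (i + length w) j"
  unfolding lat_cat lat_single using hasw_le[of w X i] by auto

lemma PF_len[pf]: "PF A \<Longrightarrow> PF (\<lambda>e. len (A e))"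
  unfolding len_def by (intro pf)

lemma PP_hasw[pf]: "PF A \<Longrightarrow> PF B \<Longrightarrow> PP (\<lambda>e. hasw w (A e) (B e))"
proof (induction w arbitrary: B)
  case Nil
  then show ?case unfolding hasw_Nil by (intro pf)
next
  case (Cons b w)
  have "PP (\<lambda>e. hasw w (A e) (Suc (B e)))" by (rule Cons.IH[OF Cons.prems(1) PF_Suc[OF Cons.prems(2)]])
  then show ?case unfolding hasw_Cons by (intro pf Cons.prems)
qed

text \<open>The entries of a relation on positions, coded as the bits of a number.\<close>

definition mat :: "nat \<Rightarrow> nat \<Rightarrow> nat \<Rightarrow> nat \<Rightarrow> bool" where
  "mat X Z i j \<longleftrightarrow> i \<le> len X \<and> j \<le> len X \<and> bit Z (i * Suc (len X) + j)"

lemma PP_mat[pf]: "\<lbrakk>PF A; PF B; PF C; PF D\<rbrakk> \<Longrightarrow> PP (\<lambda>e. mat (A e) (B e) (C e) (D e))"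
  unfolding mat_def by (intro pf)

lemma ex_mat: assumes "\<And>i j. r i j \<Longrightarrow> i \<le> len X \<and> j \<le> len X"
  shows "\<exists>Z<smash (2 * X + 1) (2 * X + 1). mat X Z = r"
proof -
  let ?N = "Suc (len X)"
  obtain Z :: nat where Z: "Z < 2 ^ (?N * ?N)" "\<forall>c. bit Z c \<longleftrightarrow> c < ?N * ?N \<and> r (c div ?N) (c mod ?N)"
    using exists_bits[of "?N * ?N" "\<lambda>c. r (c div ?N) (c mod ?N)"] by blast
  have "mat X Z i j = r i j" for i j
  proof (cases "i \<le> len X \<and> j \<le> len X")
    case True
    have "i * ?N + j < ?N * ?N"
    proof -
      have "i * ?N + j < Suc i * ?N" using True by simp
      also have "\<dots> \<le> ?N * ?N" using True by (intro mult_right_mono) auto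
      finally show ?thesis .
    qed
    moreover have "(i * ?N + j) div ?N = i" "(i * ?N + j) mod ?N = j" using True by (intro digit, simp)+
    ultimately show ?thesis using True Z(2) unfolding mat_def by metis
  next
    case False
    then show ?thesis using assms unfolding mat_def by blast
  qed
  moreover have "Z < smash (2 * X + 1) (2 * X + 1)"
  proof -
    \<comment> \<open>Doubling makes this true for \<open>X = 0\<close> as well.\<close>
    have "?N \<le> bl (2 * X + 1)" by (simp add: bl_pos len_def)
    then have "(2 :: nat) ^ (?N * ?N) \<le> 2 ^ (bl (2 * X + 1) * bl (2 * X + 1))"
      by (intro power_increasing mult_mono) auto
    then show ?thesis using Z(1) unfolding smash_def by linarith
  qed
  ultimately show ?thesis by (intro exI[of _ Z]) (auto simp: fun_eq_iff)
qed

text \<open>A relation that is determined by a recursion on decreasing distance from the end of the input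
  is the unique fixpoint of that recursion, and can therefore be guessed.\<close>

lemma PP_fix:
  assumes PP: "PP (\<lambda>e. \<Psi> (e 0) (mat (e 0) (e 1)) (e 2) (e 3))"
    and sem: "\<And>X i j r. (\<And>i' j'. i < i' \<Longrightarrow> r i' j' = R X i' j') \<Longrightarrow> \<Psi> X r i j = R X i j"
    and dom: "\<And>X i j. R X i j \<Longrightarrow> i \<le> len X \<and> j \<le> len X"
    and A: "PF A" and B: "PF B" and C: "PF C"
  shows "PP (\<lambda>e. R (A e) (B e) (C e))"
proof (rule PP_comp3[OF _ A B C])
  have eq: "R X i j \<longleftrightarrow> (\<exists>Z<smash (2 * X + 1) (2 * X + 1).
    (\<forall>i\<le>len X. \<forall>j\<le>len X. mat X Z i j \<longleftrightarrow> \<Psi> X (mat X Z) i j) \<and> mat X Z i j)" (is "_ \<longleftrightarrow> ?Q") for X i j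
  proof
    assume r: "R X i j"
    obtain Z where Z: "Z < smash (2 * X + 1) (2 * X + 1)" "mat X Z = R X" using ex_mat[OF dom] by blast
    have "\<Psi> X (R X) i j = R X i j" for i j by (rule sem) simp
    then show ?Q
      using Z r by (intro exI[of _ Z]) simp
  next
    assume ?Q
    then obtain Z where Z: "\<And>i j. i \<le> len X \<Longrightarrow> j \<le> len X \<Longrightarrow> mat X Z i j \<longleftrightarrow> \<Psi> X (mat X Z) i j" "mat X Z i j" by blast
    have "i \<le> len X \<longrightarrow> (\<forall>j. mat X Z i j = R X i j)" for i
    proof (induction "len X - i" arbitrary: i rule: less_induct)
      case less
      show ?case
      proof (intro impI allI)
        fix j assume i: "i \<le> len X"
        have "mat X Z i' j' = R X i' j'" if "i < i'" for i' j'
        proof (cases "i' \<le> len X")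
          case True
          then show ?thesis using less[of i'] that by auto
        next
          case False
          then show ?thesis using dom[of X i' j'] unfolding mat_def by auto
        qed
        then have P: "\<Psi> X (mat X Z) i j = R X i j" by (rule sem)
        show "mat X Z i j = R X i j"
        proof (cases "j \<le> len X")
          case True
          then show ?thesis using Z(1)[OF i] P by simp
        next
          case False
          then show ?thesis using dom[of X i j] unfolding mat_def by auto
        qed
      qed
    qed
    moreover have "i \<le> len X" using Z(2) by (simp add: mat_def)
    ultimately show "R X i j" using Z(2) by simp
  qed
  have P: "PP (\<lambda>e. \<Psi> (D e) (mat (D e) (E e)) (F e) (G e))" if "PF D" "PF E" "PF F" "PF G" for D E F G
    using PP_comp4[where f = "\<lambda>X Z i j. \<Psi> X (mat X Z) i j", OF PP that] .
  show "PP (\<lambda>e. R (e 0) (e 1) (e 2))" unfolding eq by (intro pf P)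
qed

section \<open>Grammars of the encodings\<close>

definition nameL :: "bool list set" where "nameL = range enc_name"
definition posnameL :: "bool list set" where "posnameL = enc_name ` {0<..}"
definition unaryL :: "bool list set" where "unaryL = range enc_unary"
definition ltlL :: "bool list set" where "ltlL = range enc_ltl"
definition litL :: "bool list set" where "litL = enc_ltl ` horn_literals"
definition bodyL :: "bool list set" where "bodyL = {enc_ltl (Conj Cs) | Cs. set Cs \<subseteq> horn_literals}"
definition axiomL :: "bool list set" where "axiomL = enc_ltl ` horn_axioms"
definition factL :: "bool list set" where "factL = range enc_fact"

definition starL :: "bool list set \<Rightarrow> bool list set" where
  "starL L = {concat (map ((#) True) us) | us. set us \<subseteq> L}"

definition listL :: "bool list set \<Rightarrow> bool list set" where "listL L = cat (starL L) {[False]}"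

lemma catI: "u \<in> A \<Longrightarrow> v \<in> B \<Longrightarrow> u @ v \<in> cat A B"
  by (auto simp: cat_def)

lemma catE: "w \<in> cat A B \<Longrightarrow> (\<And>u v. w = u @ v \<Longrightarrow> u \<in> A \<Longrightarrow> v \<in> B \<Longrightarrow> thesis) \<Longrightarrow> thesis"
  by (auto simp: cat_def)

lemma cat_image: "cat {w} (f ` A) = (\<lambda>x. w @ f x) ` A"
  by (auto simp: cat_def)

lemma enc_name_0: "enc_name 0 = [False]"
  by (simp add: enc_name.simps)

lemma enc_name_pos: "n \<noteq> 0 \<Longrightarrow> enc_name n = True # odd n # enc_name (n div 2)"
  by (simp add: enc_name.simps)

text \<open>Names have no leading zeros: an even digit may not be followed by the end mark. This is
  why positive names need a nonterminal of their own.\<close>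

lemma posnameL_eq: "posnameL = cat {[True, True]} ({[False]} \<union> posnameL) \<union> cat {[True, False]} posnameL"
proof -
  have u: "(UNIV :: nat set) = insert 0 {0<..}" by auto
  have "{[False]} \<union> posnameL = range enc_name"
    by (simp only: posnameL_def u image_insert enc_name_0 Un_insert_left Un_empty_left)
  moreover have "posnameL = (\<lambda>n. [True, True] @ enc_name n) ` UNIV \<union> (\<lambda>n. [True, False] @ enc_name n) ` {0<..}"
  proof (intro set_eqI iffI)
    fix w assume "w \<in> posnameL"
    then obtain n where n: "n > 0" "w = enc_name n" by (auto simp: posnameL_def)
    show "w \<in> (\<lambda>n. [True, True] @ enc_name n) ` UNIV \<union> (\<lambda>n. [True, False] @ enc_name n) ` {0<..}"
    proof (cases "odd n")
      case True
      then show ?thesis using n by (auto simp: enc_name_pos)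
    next
      case False
      then have "n div 2 > 0" using n by auto
      then show ?thesis using n False by (auto simp: enc_name_pos)
    qed
  next
    fix w assume "w \<in> (\<lambda>n. [True, True] @ enc_name n) ` UNIV \<union> (\<lambda>n. [True, False] @ enc_name n) ` {0<..}"
    then consider n where "w = [True, True] @ enc_name n" | n where "n > 0" "w = [True, False] @ enc_name n" by blast
    then show "w \<in> posnameL"
    proof cases
      case 1
      then have "w = enc_name (2 * n + 1)" by (simp add: enc_name_pos)
      then show ?thesis by (auto simp: posnameL_def)
    next
      case 2
      then have "w = enc_name (2 * n)" by (simp add: enc_name_pos)
      then show ?thesis using 2 by (auto simp: posnameL_def)
    qed
  qed
  ultimately show ?thesis by (metis cat_image posnameL_def)
qed

lemma nameL_eq: "nameL = {[False]} \<union> posnameL"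
proof -
  have u: "(UNIV :: nat set) = insert 0 {0<..}" by auto
  show ?thesis
    by (simp only: posnameL_def nameL_def u image_insert enc_name_0 Un_insert_left Un_empty_left)
qed

lemma unaryL_eq: "unaryL = {[False]} \<union> cat {[True]} unaryL"
proof -
  have "enc_unary 0 = [False]" "\<And>n. enc_unary (Suc n) = [True] @ enc_unary n" by (simp_all add: enc_unary_def)
  moreover have "range enc_unary = {enc_unary 0} \<union> range (\<lambda>n. enc_unary (Suc n))"
    by (auto simp: image_iff) (metis not0_implies_Suc)
  ultimately show ?thesis unfolding unaryL_def cat_image by simp
qed

lemma range_ltl: "range f = range (\<lambda>a. f (Atom a)) \<union> {f Top} \<union> {f Bot} \<union> range (\<lambda>\<phi>. f (Neg \<phi>)) \<union>
   {f (And \<phi> \<psi>) | \<phi> \<psi>. True} \<union> {f (Until \<phi> \<psi>) | \<phi> \<psi>. True}"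
proof (intro set_eqI iffI)
  fix w assume "w \<in> range f"
  then obtain \<phi> where "w = f \<phi>" by blast
  then show "w \<in> range (\<lambda>a. f (Atom a)) \<union> {f Top} \<union> {f Bot} \<union> range (\<lambda>\<phi>. f (Neg \<phi>)) \<union>
   {f (And \<phi> \<psi>) | \<phi> \<psi>. True} \<union> {f (Until \<phi> \<psi>) | \<phi> \<psi>. True}" by (cases \<phi>) auto
qed auto

lemma ltlL_eq: "ltlL = cat {[False, False, False]} nameL \<union> {[False, False, True]} \<union> {[False, True, False]} \<union>
   cat {[False, True, True]} ltlL \<union> cat {[True, False, False]} (cat ltlL ltlL) \<union> cat {[True, False, True]} (cat ltlL ltlL)"
proof -
  have "cat ltlL ltlL = {enc_ltl \<phi> @ enc_ltl \<psi> | \<phi> \<psi>. True}" by (auto simp: cat_def ltlL_def)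
  then have "cat {w} (cat ltlL ltlL) = {w @ enc_ltl \<phi> @ enc_ltl \<psi> | \<phi> \<psi>. True}" for w
    by (auto simp: cat_def)
  then show ?thesis unfolding ltlL_def nameL_def cat_image by (subst range_ltl) simp
qed

text \<open>The two longer words are what \<open>enc_ltl\<close> writes for the nested constructors
  of \<open>Always\<close>, namely \<open>Neg\<close>, \<open>Until\<close>, \<open>Top\<close>,
  \<open>Neg\<close>, and for those of \<open>Next\<close>, namely \<open>Until\<close>,
  \<open>Bot\<close>.\<close>

lemma litL_eq: "litL = cat {[False, False, False]} nameL \<union> {[False, True, False]} \<union>
   cat {[False, True, True, True, False, True, False, False, True, False, True, True]} litL \<union>
   cat {[True, False, True, False, True, False]} litL"
proof -
  have "horn_literals = range Atom \<union> {Bot} \<union> Always ` horn_literals \<union> Next ` horn_literals"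
    by (auto intro: horn_literals.intros elim: horn_literals.cases)
  then have "litL = enc_ltl ` (range Atom \<union> {Bot} \<union> Always ` horn_literals \<union> Next ` horn_literals)"
    unfolding litL_def by simp
  then show ?thesis unfolding litL_def nameL_def cat_image by (simp add: image_Un image_image)
qed

lemma bodyL_eq: "bodyL = {[False, False, True]} \<union> cat {[True, False, False]} (cat litL bodyL)"
proof (intro set_eqI iffI)
  fix w assume "w \<in> bodyL"
  then obtain Cs where Cs: "set Cs \<subseteq> horn_literals" "w = enc_ltl (Conj Cs)" by (auto simp: bodyL_def)
  show "w \<in> {[False, False, True]} \<union> cat {[True, False, False]} (cat litL bodyL)"
  proof (cases Cs)
    case (Cons C Ds)
    then have "w = [True, False, False] @ (enc_ltl C @ enc_ltl (Conj Ds))" using Cs by simp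
    moreover have "enc_ltl C \<in> litL" "enc_ltl (Conj Ds) \<in> bodyL" using Cs Cons by (auto simp: litL_def bodyL_def)
    ultimately show ?thesis by (simp only:) (intro UnI2 catI singletonI)
  qed (use Cs in simp)
next
  fix w assume "w \<in> {[False, False, True]} \<union> cat {[True, False, False]} (cat litL bodyL)"
  then consider "w = [False, False, True]" | "w \<in> cat {[True, False, False]} (cat litL bodyL)" by blast
  then show "w \<in> bodyL"
  proof cases
    case 1
    then have "w = enc_ltl (Conj [])" by simp
    then show ?thesis unfolding bodyL_def by (intro CollectI exI[of _ "[]"]) simp
  next
    case 2
    then obtain C Ds where "C \<in> horn_literals" "set Ds \<subseteq> horn_literals" "w = [True, False, False] @ enc_ltl C @ enc_ltl (Conj Ds)"
      by (auto elim!: catE simp: litL_def bodyL_def)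
    then show ?thesis unfolding bodyL_def by (intro CollectI exI[of _ "C # Ds"]) simp
  qed
qed

lemma axiomL_eq: "axiomL = cat {[False, True, True, True, False, False]} (cat bodyL (cat {[False, True, True]} litL))"
proof (intro set_eqI iffI)
  fix w assume "w \<in> axiomL"
  then obtain Cs C where C: "set Cs \<subseteq> horn_literals" "C \<in> horn_literals" "w = enc_ltl (Imp (Conj Cs) C)"
    by (auto simp: axiomL_def horn_axioms_def)
  have w: "w = [False, True, True, True, False, False] @ (enc_ltl (Conj Cs) @ ([False, True, True] @ enc_ltl C))"
    using C(3) by simp
  have "enc_ltl (Conj Cs) \<in> bodyL" "enc_ltl C \<in> litL" using C unfolding bodyL_def litL_def by blast+
  then show "w \<in> cat {[False, True, True, True, False, False]} (cat bodyL (cat {[False, True, True]} litL))"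
    unfolding w by (intro catI singletonI)
next
  fix w assume "w \<in> cat {[False, True, True, True, False, False]} (cat bodyL (cat {[False, True, True]} litL))"
  then obtain Cs C where "set Cs \<subseteq> horn_literals" "C \<in> horn_literals"
     "w = [False, True, True, True, False, False] @ (enc_ltl (Conj Cs) @ ([False, True, True] @ enc_ltl C))"
    by (auto elim!: catE simp: litL_def bodyL_def)
  moreover from this have "w = enc_ltl (Imp (Conj Cs) C)" by simp
  ultimately show "w \<in> axiomL" unfolding axiomL_def horn_axioms_def by blast
qed

lemma factL_eq: "factL = cat nameL unaryL"
proof (intro set_eqI iffI)
  fix w assume "w \<in> factL"
  then obtain f where "w = enc_fact f" unfolding factL_def by blast
  then show "w \<in> cat nameL unaryL" unfolding enc_fact_def nameL_def unaryL_def by (simp only:) (intro catI rangeI)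
next
  fix w assume "w \<in> cat nameL unaryL"
  then obtain a l where "w = enc_name a @ enc_unary l" unfolding cat_def nameL_def unaryL_def by blast
  then have "w = enc_fact (a, l)" by (simp add: enc_fact_def)
  then show "w \<in> factL" unfolding factL_def by blast
qed

lemma starL_eq: "starL L = {[]} \<union> cat {[True]} (cat L (starL L))"
proof (intro set_eqI iffI)
  fix w assume "w \<in> starL L"
  then obtain us where us: "set us \<subseteq> L" "w = concat (map ((#) True) us)" by (auto simp: starL_def)
  show "w \<in> {[]} \<union> cat {[True]} (cat L (starL L))"
  proof (cases us)
    case (Cons u vs)
    then have "w = [True] @ (u @ concat (map ((#) True) vs))" "u \<in> L" "concat (map ((#) True) vs) \<in> starL L"
      using us by (auto simp: starL_def)
    then show ?thesis by (simp only:) (intro UnI2 catI singletonI)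
  qed (use us in simp)
next
  fix w assume "w \<in> {[]} \<union> cat {[True]} (cat L (starL L))"
  then consider "w = []" | "w \<in> cat {[True]} (cat L (starL L))" by blast
  then show "w \<in> starL L"
  proof cases
    case 1
    then show ?thesis unfolding starL_def by (intro CollectI exI[of _ "[]"]) simp
  next
    case 2
    then obtain u us where "u \<in> L" "set us \<subseteq> L" "w = [True] @ u @ concat (map ((#) True) us)"
      by (auto elim!: catE simp: starL_def)
    then show ?thesis unfolding starL_def by (intro CollectI exI[of _ "u # us"]) simp
  qed
qed

lemma enc_list_concat: "enc_list enc xs = concat (map ((#) True) (map enc xs)) @ [False]"
  by (induction xs) auto

lemma listL_enc: "listL (enc ` A) = {enc_list enc xs | xs. set xs \<subseteq> A}"
proof -
  have "set us \<subseteq> enc ` A \<longleftrightarrow> (\<exists>xs. us = map enc xs \<and> set xs \<subseteq> A)" for us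
  proof -
    have "set us \<subseteq> enc ` A \<longleftrightarrow> us \<in> map enc ` lists A" unfolding lists_image[symmetric] by (simp add: lists_eq_set)
    then show ?thesis by (auto simp: lists_eq_set)
  qed
  then have "starL (enc ` A) = {concat (map ((#) True) (map enc xs)) | xs. set xs \<subseteq> A}"
    unfolding starL_def by (simp only:) blast
  then show ?thesis unfolding listL_def cat_def enc_list_concat by (simp only:) blast
qed

section \<open>Recognizing the grammars in polynomial space\<close>

lemma lat_dom: "lat L X i j \<Longrightarrow> i \<le> len X \<and> j \<le> len X"
  using lat_le[of L X i j] by simp

lemma PP_posnameL: "\<lbrakk>PF A; PF B; PF C\<rbrakk> \<Longrightarrow> PP (\<lambda>e. lat posnameL (A e) (B e) (C e))"
proof (rule PP_fix[where R = "lat posnameL" and \<Psi> = "\<lambda>X r i j.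
    hasw [True, True] X i \<and> (hasw [False] X (i + 2) \<and> j = i + 3 \<or> r (i + 2) j) \<or> hasw [True, False] X i \<and> r (i + 2) j"])
  show "PP (\<lambda>e. hasw [True, True] (e 0) (e 2) \<and> (hasw [False] (e 0) (e 2 + 2) \<and> e 3 = e 2 + 3 \<or> mat (e 0) (e 1) (e 2 + 2) (e 3)) \<or>
     hasw [True, False] (e 0) (e 2) \<and> mat (e 0) (e 1) (e 2 + 2) (e 3))" by (intro pf)
  fix X i j r
  assume r: "\<And>i' j'. i < i' \<Longrightarrow> r i' j' = lat posnameL X i' j'"
  show "(hasw [True, True] X i \<and> (hasw [False] X (i + 2) \<and> j = i + 3 \<or> r (i + 2) j) \<or> hasw [True, False] X i \<and> r (i + 2) j) =
     lat posnameL X i j"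
    by (rule lat_eqI[OF posnameL_eq]) (simp add: lat_Un lat_insert lat_word lat_single r numeral_3_eq_3)
qed (rule lat_dom)

lemma PP_nameL[pf]: "\<lbrakk>PF A; PF B; PF C\<rbrakk> \<Longrightarrow> PP (\<lambda>e. lat nameL (A e) (B e) (C e))"
  unfolding nameL_eq lat_Un lat_single by (intro pf PP_posnameL)

lemma PP_unaryL[pf]: "\<lbrakk>PF A; PF B; PF C\<rbrakk> \<Longrightarrow> PP (\<lambda>e. lat unaryL (A e) (B e) (C e))"
proof (rule PP_fix[where R = "lat unaryL" and \<Psi> = "\<lambda>X r i j. hasw [False] X i \<and> j = i + 1 \<or> hasw [True] X i \<and> r (i + 1) j"])
  show "PP (\<lambda>e. hasw [False] (e 0) (e 2) \<and> e 3 = e 2 + 1 \<or> hasw [True] (e 0) (e 2) \<and> mat (e 0) (e 1) (e 2 + 1) (e 3))" by (intro pf)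
  fix X i j r
  assume r: "\<And>i' j'. i < i' \<Longrightarrow> r i' j' = lat unaryL X i' j'"
  show "(hasw [False] X i \<and> j = i + 1 \<or> hasw [True] X i \<and> r (i + 1) j) = lat unaryL X i j"
    by (rule lat_eqI[OF unaryL_eq]) (simp add: lat_Un lat_insert lat_word lat_single r)
qed (rule lat_dom)

text \<open>The conjunct \<open>i \<le> k\<close> makes it visible that the recursion refers to
  later positions only, as \<open>PP_fix\<close> demands.\<close>

lemma lat_cat_less: "lat (cat A B) X i j \<longleftrightarrow> (\<exists>k\<le>len X. i \<le> k \<and> lat A X i k \<and> lat B X k j)"
  unfolding lat_cat using lat_le[of A X i] by blast

definition ltlF :: "nat \<Rightarrow> (nat \<Rightarrow> nat \<Rightarrow> bool) \<Rightarrow> nat \<Rightarrow> nat \<Rightarrow> bool" where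
  "ltlF X r i j \<longleftrightarrow> hasw [False, False, False] X i \<and> lat nameL X (i + 3) j \<or> hasw [False, False, True] X i \<and> j = i + 3 \<or>
    hasw [False, True, False] X i \<and> j = i + 3 \<or> hasw [False, True, True] X i \<and> r (i + 3) j \<or>
    hasw [True, False, False] X i \<and> (\<exists>k\<le>len X. i + 3 \<le> k \<and> r (i + 3) k \<and> r k j) \<or>
    hasw [True, False, True] X i \<and> (\<exists>k\<le>len X. i + 3 \<le> k \<and> r (i + 3) k \<and> r k j)"

lemma PP_ltlL[pf]: "\<lbrakk>PF A; PF B; PF C\<rbrakk> \<Longrightarrow> PP (\<lambda>e. lat ltlL (A e) (B e) (C e))"
proof (rule PP_fix[where R = "lat ltlL" and \<Psi> = ltlF])
  show "PP (\<lambda>e. ltlF (e 0) (mat (e 0) (e 1)) (e 2) (e 3))" unfolding ltlF_def by (intro pf)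
  fix X i j r
  assume r: "\<And>i' j'. i < i' \<Longrightarrow> r i' j' = lat ltlL X i' j'"
  have k: "(\<exists>k\<le>len X. i + 3 \<le> k \<and> r (i + 3) k \<and> r k j) \<longleftrightarrow> lat (cat ltlL ltlL) X (i + 3) j"
    unfolding lat_cat_less using r by (intro ex_cong1) auto
  show "ltlF X r i j = lat ltlL X i j"
    unfolding ltlF_def k by (rule lat_eqI[OF ltlL_eq]) (simp add: lat_Un lat_insert lat_word lat_single r eval_nat_numeral, argo)
qed (rule lat_dom)

definition litF :: "nat \<Rightarrow> (nat \<Rightarrow> nat \<Rightarrow> bool) \<Rightarrow> nat \<Rightarrow> nat \<Rightarrow> bool" where
  "litF X r i j \<longleftrightarrow> hasw [False, False, False] X i \<and> lat nameL X (i + 3) j \<or> hasw [False, True, False] X i \<and> j = i + 3 \<or>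
    hasw [False, True, True, True, False, True, False, False, True, False, True, True] X i \<and> r (i + 12) j \<or>
    hasw [True, False, True, False, True, False] X i \<and> r (i + 6) j"

lemma PP_litL[pf]: "\<lbrakk>PF A; PF B; PF C\<rbrakk> \<Longrightarrow> PP (\<lambda>e. lat litL (A e) (B e) (C e))"
proof (rule PP_fix[where R = "lat litL" and \<Psi> = litF])
  show "PP (\<lambda>e. litF (e 0) (mat (e 0) (e 1)) (e 2) (e 3))" unfolding litF_def by (intro pf)
  fix X i j r
  assume r: "\<And>i' j'. i < i' \<Longrightarrow> r i' j' = lat litL X i' j'"
  show "litF X r i j = lat litL X i j"
    unfolding litF_def by (rule lat_eqI[OF litL_eq]) (simp add: lat_Un lat_insert lat_word lat_single r eval_nat_numeral, argo)
qed (rule lat_dom)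

lemma PP_cat:
  assumes "\<And>A B C. \<lbrakk>PF A; PF B; PF C\<rbrakk> \<Longrightarrow> PP (\<lambda>e. lat K (A e) (B e) (C e))"
    "\<And>A B C. \<lbrakk>PF A; PF B; PF C\<rbrakk> \<Longrightarrow> PP (\<lambda>e. lat L (A e) (B e) (C e))" "PF A" "PF B" "PF C"
  shows "PP (\<lambda>e. lat (cat K L) (A e) (B e) (C e))"
proof (rule PP_comp3[OF _ assms(3-5)])
  show "PP (\<lambda>e. lat (cat K L) (e 0) (e 1) (e 2))" unfolding lat_cat by (intro pf assms(1,2))
qed

lemma PP_starL:
  assumes "\<And>A B C. \<lbrakk>PF A; PF B; PF C\<rbrakk> \<Longrightarrow> PP (\<lambda>e. lat L (A e) (B e) (C e))"
  shows "\<lbrakk>PF A; PF B; PF C\<rbrakk> \<Longrightarrow> PP (\<lambda>e. lat (starL L) (A e) (B e) (C e))"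
proof (rule PP_fix[where R = "lat (starL L)" and \<Psi> = "\<lambda>X r i j. i \<le> len X \<and> j = i \<or>
    hasw [True] X i \<and> (\<exists>k\<le>len X. i + 1 \<le> k \<and> lat L X (i + 1) k \<and> r k j)"])
  show "PP (\<lambda>e. e 2 \<le> len (e 0) \<and> e 3 = e 2 \<or> hasw [True] (e 0) (e 2) \<and>
     (\<exists>k\<le>len (e 0). e 2 + 1 \<le> k \<and> lat L (e 0) (e 2 + 1) k \<and> mat (e 0) (e 1) k (e 3)))" by (intro pf assms)
  fix X i j r
  assume r: "\<And>i' j'. i < i' \<Longrightarrow> r i' j' = lat (starL L) X i' j'"
  have k: "(\<exists>k\<le>len X. i + 1 \<le> k \<and> lat L X (i + 1) k \<and> r k j) \<longleftrightarrow> lat (cat L (starL L)) X (i + 1) j"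
    unfolding lat_cat_less using r by (intro ex_cong1) auto
  show "(i \<le> len X \<and> j = i \<or> hasw [True] X i \<and> (\<exists>k\<le>len X. i + 1 \<le> k \<and> lat L X (i + 1) k \<and> r k j)) = lat (starL L) X i j"
    unfolding k by (rule lat_eqI[OF starL_eq]) (simp add: lat_Un lat_insert lat_word lat_single hasw_Nil)
qed (rule lat_dom)

lemma PP_listL:
  assumes "\<And>A B C. \<lbrakk>PF A; PF B; PF C\<rbrakk> \<Longrightarrow> PP (\<lambda>e. lat L (A e) (B e) (C e))" "PF A" "PF B" "PF C"
  shows "PP (\<lambda>e. lat (listL L) (A e) (B e) (C e))"
  unfolding listL_def
proof (rule PP_cat[OF PP_starL[OF assms(1)] _ assms(2-4)])
  show "PP (\<lambda>e. lat {[False]} (A e) (B e) (C e))" if "PF A" "PF B" "PF C" for A B C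
    unfolding lat_single by (intro pf that)
qed

lemma PP_bodyL: "\<lbrakk>PF A; PF B; PF C\<rbrakk> \<Longrightarrow> PP (\<lambda>e. lat bodyL (A e) (B e) (C e))"
proof (rule PP_fix[where R = "lat bodyL" and \<Psi> = "\<lambda>X r i j. hasw [False, False, True] X i \<and> j = i + 3 \<or>
    hasw [True, False, False] X i \<and> (\<exists>k\<le>len X. i + 3 \<le> k \<and> lat litL X (i + 3) k \<and> r k j)"])
  show "PP (\<lambda>e. hasw [False, False, True] (e 0) (e 2) \<and> e 3 = e 2 + 3 \<or> hasw [True, False, False] (e 0) (e 2) \<and>
     (\<exists>k\<le>len (e 0). e 2 + 3 \<le> k \<and> lat litL (e 0) (e 2 + 3) k \<and> mat (e 0) (e 1) k (e 3)))" by (intro pf)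
  fix X i j r
  assume r: "\<And>i' j'. i < i' \<Longrightarrow> r i' j' = lat bodyL X i' j'"
  have k: "(\<exists>k\<le>len X. i + 3 \<le> k \<and> lat litL X (i + 3) k \<and> r k j) \<longleftrightarrow> lat (cat litL bodyL) X (i + 3) j"
    unfolding lat_cat_less using r by (intro ex_cong1) auto
  show "(hasw [False, False, True] X i \<and> j = i + 3 \<or>
    hasw [True, False, False] X i \<and> (\<exists>k\<le>len X. i + 3 \<le> k \<and> lat litL X (i + 3) k \<and> r k j)) = lat bodyL X i j"
    unfolding k by (rule lat_eqI[OF bodyL_eq]) (simp add: lat_Un lat_insert lat_word lat_single numeral_3_eq_3)
qed (rule lat_dom)

lemma PP_axiomL[pf]: assumes "PF A" "PF B" "PF C" shows "PP (\<lambda>e. lat axiomL (A e) (B e) (C e))"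
proof -
  have s: "PP (\<lambda>e. lat {w} (A e) (B e) (C e))" if "PF A" "PF B" "PF C" for A B C w
    unfolding lat_single by (intro pf that)
  show ?thesis unfolding axiomL_eq by (rule PP_cat[OF s PP_cat[OF PP_bodyL PP_cat[OF s PP_litL]] assms])
qed

lemma PP_factL[pf]: "\<lbrakk>PF A; PF B; PF C\<rbrakk> \<Longrightarrow> PP (\<lambda>e. lat factL (A e) (B e) (C e))"
  unfolding factL_eq by (rule PP_cat[OF PP_nameL PP_unaryL])

text \<open>The position \<open>p\<close> is the start of an element of the list that starts at \<open>d\<close>.\<close>

definition elem_at :: "bool list set \<Rightarrow> nat \<Rightarrow> nat \<Rightarrow> nat \<Rightarrow> bool" where
  "elem_at L X d p \<longleftrightarrow> (\<exists>c\<le>len X. lat (starL L) X d c \<and> hasw [True] X c \<and> p = Suc c)"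

lemma PP_elem_at:
  assumes "\<And>A B C. \<lbrakk>PF A; PF B; PF C\<rbrakk> \<Longrightarrow> PP (\<lambda>e. lat L (A e) (B e) (C e))" "PF A" "PF B" "PF C"
  shows "PP (\<lambda>e. elem_at L (A e) (B e) (C e))"
proof (rule PP_comp3[OF _ assms(2-4)])
  show "PP (\<lambda>e. elem_at L (e 0) (e 1) (e 2))" unfolding elem_at_def by (intro pf PP_starL assms(1))
qed

text \<open>By prefix-freeness the words skipped before \<open>p\<close> are forced to be the
  encodings of initial elements of \<open>xs\<close>.\<close>

lemma elem_at_sound:
  assumes pf: "\<And>x y u v. enc x @ u = enc y @ v \<Longrightarrow> x = y \<and> u = v"
    and xs: "hasw (enc_list enc xs) X d" and el: "elem_at (enc ` A) X d p"
  shows "\<exists>y\<in>set xs. hasw (enc y) X p"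
proof -
  obtain us where us: "set us \<subseteq> enc ` A" "hasw (concat (map ((#) True) us)) X d"
     "hasw [True] X (d + length (concat (map ((#) True) us)))" "p = Suc (d + length (concat (map ((#) True) us)))"
    using el unfolding elem_at_def lat_def starL_def by blast
  then show ?thesis using xs
  proof (induction us arbitrary: d xs)
    case Nil
    then have T: "bit X d" by (simp add: hasw_single)
    show ?case
    proof (cases xs)
      case (Cons y ys)
      then show ?thesis using Nil.prems(4,5) by (auto simp: hasw_Cons hasw_append)
    qed (use T Nil in \<open>simp add: hasw_single\<close>)
  next
    case (Cons u us)
    from Cons.prems(1) obtain y0 where y0: "u = enc y0" by auto
    have h: "bit X d" "hasw (enc y0) X (Suc d)" "hasw (concat (map ((#) True) us)) X (Suc d + length u)"
      using Cons.prems(2) y0 by (auto simp: hasw_Cons hasw_append)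
    show ?case
    proof (cases xs)
      case Nil
      then show ?thesis using h Cons.prems(5) by (simp add: hasw_single)
    next
      case c: (Cons y ys)
      then have h2: "hasw (enc y) X (Suc d)" "hasw (enc_list enc ys) X (Suc d + length (enc y))"
        using Cons.prems(5) by (auto simp: hasw_Cons hasw_append)
      have y: "y = y0" by (rule hasw_unique[OF pf h2(1) h(2)])
      have "\<exists>z\<in>set ys. hasw (enc z) X p"
        by (rule Cons.IH[of "Suc d + length u"]) (use Cons.prems h h2 y y0 in \<open>auto simp: add_ac\<close>)
      then show ?thesis using c by auto
    qed
  qed
qed

lemma elem_at_complete:
  assumes xs: "hasw (enc_list enc xs) X d" and "set xs \<subseteq> A" and y: "y \<in> set xs"
  shows "\<exists>p. elem_at (enc ` A) X d p \<and> hasw (enc y) X p"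
proof -
  obtain ys zs where s: "xs = ys @ y # zs" using split_list[OF y] by blast
  let ?w = "concat (map ((#) True) (map enc ys))"
  have "enc_list enc xs = ?w @ [True] @ enc y @ enc_list enc zs" unfolding s enc_list_concat by simp
  then have h: "hasw ?w X d" "hasw [True] X (d + length ?w)" "hasw (enc y) X (Suc (d + length ?w))"
    using xs by (simp_all only: hasw_append) simp_all
  have "?w \<in> starL (enc ` A)" unfolding starL_def using assms(2) s by (intro CollectI exI[of _ "map enc ys"]) auto
  then have "lat (starL (enc ` A)) X d (d + length ?w)" using h(1) unfolding lat_def by blast
  moreover have "d + length ?w \<le> len X" using hasw_le[OF h(1)] .
  ultimately have "elem_at (enc ` A) X d (Suc (d + length ?w))" using h(2) unfolding elem_at_def by blast
  then show ?thesis using h(3) by blast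
qed

section \<open>Satisfiability by sequences of types\<close>

abbreviation fm :: "nat \<Rightarrow> nat \<Rightarrow> ltl \<Rightarrow> bool" where "fm X i \<phi> \<equiv> hasw (enc_ltl \<phi>) X i"
abbreviation nm :: "nat \<Rightarrow> nat \<Rightarrow> nat \<Rightarrow> bool" where "nm X q a \<equiv> hasw (enc_name a) X q"

lemma fm_unique: "fm X i \<phi> \<Longrightarrow> fm X i \<psi> \<Longrightarrow> \<phi> = \<psi>"
  by (rule hasw_unique[OF enc_ltl_prefix_free])

lemma nm_unique: "nm X i a \<Longrightarrow> nm X i b \<Longrightarrow> a = b"
  by (rule hasw_unique[OF enc_name_prefix_free])

lemma lat_ltlL: "lat ltlL X i j \<longleftrightarrow> (\<exists>\<phi>. fm X i \<phi> \<and> j = i + length (enc_ltl \<phi>))"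
  by (auto simp: lat_def ltlL_def)

lemma lat_nameL: "lat nameL X i j \<longleftrightarrow> (\<exists>a. nm X i a \<and> j = i + length (enc_name a))"
  by (auto simp: lat_def nameL_def)

definition atomf :: "nat \<Rightarrow> nat \<Rightarrow> bool" where
  "atomf X i \<longleftrightarrow> hasw [False, False, False] X i \<and> (\<exists>j\<le>len X. lat nameL X (i + 3) j)"

definition negf :: "nat \<Rightarrow> nat \<Rightarrow> bool" where
  "negf X i \<longleftrightarrow> hasw [False, True, True] X i \<and> (\<exists>j\<le>len X. lat ltlL X (i + 3) j)"

definition binf :: "bool list \<Rightarrow> nat \<Rightarrow> nat \<Rightarrow> nat \<Rightarrow> bool" where
  "binf w X i k \<longleftrightarrow> hasw w X i \<and> lat ltlL X (i + 3) k \<and> (\<exists>j\<le>len X. lat ltlL X k j)"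

text \<open>Two names agree if their words do; the equation between positions says that the words
  have equal length, without truncated subtraction.\<close>

definition same :: "nat \<Rightarrow> nat \<Rightarrow> nat \<Rightarrow> bool" where
  "same X q q' \<longleftrightarrow> (\<exists>k\<le>len X. \<exists>k'\<le>len X. lat nameL X q k \<and> lat nameL X q' k' \<and> k + q' = k' + q \<and>
     (\<forall>l<k - q. bit X (q + l) = bit X (q' + l)))"

lemma fm_le: "fm X i \<phi> \<Longrightarrow> i \<le> len X \<and> i + length (enc_ltl \<phi>) \<le> len X"
  using hasw_le by fastforce

lemma nm_le: "nm X i a \<Longrightarrow> i \<le> len X \<and> i + length (enc_name a) \<le> len X"
  using hasw_le by fastforce

lemma atomf_iff: "atomf X i \<longleftrightarrow> (\<exists>a. fm X i (Atom a) \<and> nm X (i + 3) a)"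
proof
  assume "atomf X i"
  then obtain a where "hasw [False, False, False] X i" "nm X (i + 3) a" unfolding atomf_def lat_nameL by blast
  moreover from this have "hasw ([False, False, False] @ enc_name a) X i" unfolding hasw_append by (simp add: numeral_3_eq_3)
  ultimately show "\<exists>a. fm X i (Atom a) \<and> nm X (i + 3) a" by (intro exI[of _ a]) simp
next
  assume "\<exists>a. fm X i (Atom a) \<and> nm X (i + 3) a"
  then obtain a where a: "hasw ([False, False, False] @ enc_name a) X i" "nm X (i + 3) a" by auto
  then have "hasw [False, False, False] X i" unfolding hasw_append by blast
  then show "atomf X i" using a(2) nm_le[OF a(2)] unfolding atomf_def lat_nameL by blast
qed

lemma fm_Atom: "fm X i (Atom a) \<Longrightarrow> nm X (i + 3) a"
proof -
  assume "fm X i (Atom a)"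
  then have "hasw ([False, False, False] @ enc_name a) X i" by simp
  then have "nm X (i + length [False, False, False]) a" unfolding hasw_append by blast
  then show ?thesis by (simp add: numeral_3_eq_3)
qed

lemma negf_iff: "negf X i \<longleftrightarrow> (\<exists>\<phi>. fm X i (Neg \<phi>) \<and> fm X (i + 3) \<phi>)"
proof
  assume "negf X i"
  then obtain \<phi> where "hasw [False, True, True] X i" "fm X (i + 3) \<phi>" unfolding negf_def lat_ltlL by blast
  moreover from this have "hasw ([False, True, True] @ enc_ltl \<phi>) X i" unfolding hasw_append by (simp add: numeral_3_eq_3)
  ultimately show "\<exists>\<phi>. fm X i (Neg \<phi>) \<and> fm X (i + 3) \<phi>" by (intro exI[of _ \<phi>]) simp
next
  assume "\<exists>\<phi>. fm X i (Neg \<phi>) \<and> fm X (i + 3) \<phi>"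
  then obtain \<phi> where a: "hasw ([False, True, True] @ enc_ltl \<phi>) X i" "fm X (i + 3) \<phi>" by auto
  then have "hasw [False, True, True] X i" unfolding hasw_append by blast
  then show "negf X i" using a(2) fm_le[OF a(2)] unfolding negf_def lat_ltlL by blast
qed

lemma fm_Neg: "fm X i (Neg \<phi>) \<Longrightarrow> fm X (i + 3) \<phi>"
proof -
  assume "fm X i (Neg \<phi>)"
  then have "hasw ([False, True, True] @ enc_ltl \<phi>) X i" by simp
  then have "fm X (i + length [False, True, True]) \<phi>" unfolding hasw_append by blast
  then show ?thesis by (simp add: numeral_3_eq_3)
qed

lemma hasw_bin:
  assumes "length w = 3"
  shows "hasw (w @ enc_ltl \<phi> @ enc_ltl \<psi>) X i \<longleftrightarrow> hasw w X i \<and> fm X (i + 3) \<phi> \<and> fm X (i + 3 + length (enc_ltl \<phi>)) \<psi>"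
  unfolding hasw_append assms by simp

lemma binf_iff:
  assumes "length w = 3"
  shows "binf w X i k \<longleftrightarrow> (\<exists>\<phi> \<psi>. hasw (w @ enc_ltl \<phi> @ enc_ltl \<psi>) X i \<and> fm X (i + 3) \<phi> \<and> fm X k \<psi> \<and> k = i + 3 + length (enc_ltl \<phi>))"
  (is "_ \<longleftrightarrow> ?R")
proof
  assume "binf w X i k"
  then obtain \<phi> \<psi> where "hasw w X i" "fm X (i + 3) \<phi>" "k = i + 3 + length (enc_ltl \<phi>)" "fm X k \<psi>"
    unfolding binf_def lat_ltlL by blast
  then show ?R
    unfolding hasw_bin[OF assms] by blast
next
  assume ?R
  then obtain \<phi> \<psi> where a: "hasw w X i" "fm X (i + 3) \<phi>" "fm X k \<psi>" "k = i + 3 + length (enc_ltl \<phi>)"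
    unfolding hasw_bin[OF assms] by blast
  then show "binf w X i k" unfolding binf_def lat_ltlL using fm_le[OF a(3)] by blast
qed

lemma binf_And: "binf [True, False, False] X i k \<longleftrightarrow> (\<exists>\<phi> \<psi>. fm X i (And \<phi> \<psi>) \<and> fm X (i + 3) \<phi> \<and> fm X k \<psi> \<and> k = i + 3 + length (enc_ltl \<phi>))"
  using binf_iff[of "[True, False, False]" X i k] by simp

lemma binf_Until: "binf [True, False, True] X i k \<longleftrightarrow> (\<exists>\<phi> \<psi>. fm X i (Until \<phi> \<psi>) \<and> fm X (i + 3) \<phi> \<and> fm X k \<psi> \<and> k = i + 3 + length (enc_ltl \<phi>))"
  using binf_iff[of "[True, False, True]" X i k] by simp

lemma fm_And: "fm X i (And \<phi> \<psi>) \<Longrightarrow> fm X (i + 3) \<phi> \<and> fm X (i + 3 + length (enc_ltl \<phi>)) \<psi>"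
  using hasw_bin[of "[True, False, False]" \<phi> \<psi> X i] by simp

lemma fm_Until: "fm X i (Until \<phi> \<psi>) \<Longrightarrow> fm X (i + 3) \<phi> \<and> fm X (i + 3 + length (enc_ltl \<phi>)) \<psi>"
  using hasw_bin[of "[True, False, True]" \<phi> \<psi> X i] by simp

lemma nm_nth: assumes "nm X p c" "l < length (enc_name c)" shows "enc_name c ! l = bit X (p + l)"
proof -
  have "enc_name c ! l = take (length (enc_name c)) (suf X p) ! l" using assms(1) unfolding hasw_def by simp
  moreover have "l < len X - p" using assms(2) nm_le[OF assms(1)] by linarith
  ultimately show ?thesis using assms(2) by (simp add: suf_def)
qed

lemma same_iff: "same X q q' \<longleftrightarrow> (\<exists>a. nm X q a \<and> nm X q' a)"
proof
  assume "same X q q'"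
  then obtain a b where a: "nm X q a" "nm X q' b" "length (enc_name a) = length (enc_name b)"
     "\<forall>l<length (enc_name a). bit X (q + l) = bit X (q' + l)" unfolding same_def lat_nameL by auto
  have "enc_name a = enc_name b" by (rule nth_equalityI) (use a nm_nth in auto)
  then have "a = b" using enc_name_prefix_free[of a "[]" b "[]"] by simp
  then show "\<exists>a. nm X q a \<and> nm X q' a" using a by blast
next
  assume "\<exists>a. nm X q a \<and> nm X q' a"
  then obtain a where a: "nm X q a" "nm X q' a" by blast
  let ?k = "q + length (enc_name a)" and ?k' = "q' + length (enc_name a)"
  have "\<forall>l<?k - q. bit X (q + l) = bit X (q' + l)" using nm_nth[OF a(1)] nm_nth[OF a(2)] by auto
  moreover have "lat nameL X q ?k" "lat nameL X q' ?k'" using a unfolding lat_nameL by blast+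
  moreover have "?k \<le> len X" "?k' \<le> len X" using nm_le a by blast+
  moreover have "?k + q' = ?k' + q" by simp
  ultimately show "same X q q'" unfolding same_def by blast
qed

text \<open>A type is a set of bits: bit \<open>i\<close> for the formula at position \<open>i\<close> and bit \<open>Suc (len X) + q\<close> for the
  atom whose name is at position \<open>q\<close>.\<close>

definition loc :: "nat \<Rightarrow> nat \<Rightarrow> bool" where
  "loc X \<tau> \<longleftrightarrow> (\<forall>i\<le>len X. (atomf X i \<longrightarrow> (bit \<tau> i \<longleftrightarrow> bit \<tau> (Suc (len X) + (i + 3)))) \<and>
     (hasw [False, False, True] X i \<longrightarrow> bit \<tau> i) \<and> (hasw [False, True, False] X i \<longrightarrow> \<not> bit \<tau> i) \<and>
     (negf X i \<longrightarrow> (bit \<tau> i \<longleftrightarrow> \<not> bit \<tau> (i + 3))) \<and>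
     (\<forall>k\<le>len X. binf [True, False, False] X i k \<longrightarrow> (bit \<tau> i \<longleftrightarrow> bit \<tau> (i + 3) \<and> bit \<tau> k))) \<and>
   (\<forall>q\<le>len X. \<forall>q'\<le>len X. same X q q' \<longrightarrow> (bit \<tau> (Suc (len X) + q) \<longleftrightarrow> bit \<tau> (Suc (len X) + q')))"

text \<open>The expansion law of the strict \<open>Until\<close>, whose right-hand side refers to
  the next type only.\<close>

definition nxt :: "nat \<Rightarrow> nat \<Rightarrow> nat \<Rightarrow> bool" where
  "nxt X \<tau> \<tau>' \<longleftrightarrow> (\<forall>i\<le>len X. \<forall>k\<le>len X. binf [True, False, True] X i k \<longrightarrow>
     (bit \<tau> i \<longleftrightarrow> bit \<tau>' k \<or> bit \<tau>' (i + 3) \<and> bit \<tau>' i))"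

definition isU :: "nat \<Rightarrow> nat \<Rightarrow> bool" where
  "isU X i \<longleftrightarrow> (\<exists>k\<le>len X. binf [True, False, True] X i k)"

definition ful :: "nat \<Rightarrow> nat \<Rightarrow> nat \<Rightarrow> bool" where
  "ful X i \<tau> \<longleftrightarrow> (\<exists>k\<le>len X. binf [True, False, True] X i k \<and> bit \<tau> k)"

definition fair :: "nat \<Rightarrow> (nat \<Rightarrow> nat) \<Rightarrow> bool" where
  "fair X \<sigma> \<longleftrightarrow> (\<forall>n i. isU X i \<and> bit (\<sigma> n) i \<longrightarrow> (\<exists>m>n. ful X i (\<sigma> m)))"

text \<open>Types have \<open>2 * Suc (len X)\<close> bits. The factor 2 comes from the number 3,
  whose binary length is 2.\<close>

definition TB :: "nat \<Rightarrow> nat" where "TB X = smash (2 * X + 1) 3"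

lemma bl_3: "bl 3 = 2"
  using bl_le_iff[of 3 2] bl_le_iff[of 3 1] by simp

lemma len_bl: "Suc (len X) \<le> bl (2 * X + 1)"
  by (simp add: bl_pos len_def)

lemma TB: "(2 :: nat) ^ (2 * Suc (len X)) \<le> TB X"
  unfolding TB_def smash_def bl_3 using len_bl[of X] by (intro power_increasing) auto

lemma TB_pos: "0 < TB X"
  by (simp add: TB_def smash_def)

definition istyp :: "nat \<Rightarrow> interp \<Rightarrow> nat \<Rightarrow> nat \<Rightarrow> bool" where
  "istyp X I n \<tau> \<longleftrightarrow> (\<forall>i \<phi>. fm X i \<phi> \<longrightarrow> (bit \<tau> i \<longleftrightarrow> sat I n \<phi>)) \<and>
     (\<forall>q a. nm X q a \<longrightarrow> (bit \<tau> (Suc (len X) + q) \<longleftrightarrow> a \<in> I n))"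

lemma ex_typ: "\<exists>\<tau><TB X. istyp X I n \<tau>"
proof -
  let ?K = "Suc (len X)"
  obtain \<tau> :: nat where \<tau>: "\<tau> < 2 ^ (2 * ?K)" "\<forall>b. bit \<tau> b \<longleftrightarrow> b < 2 * ?K \<and>
      (if b < ?K then \<exists>\<phi>. fm X b \<phi> \<and> sat I n \<phi> else \<exists>a. nm X (b - ?K) a \<and> a \<in> I n)"
    using exists_bits[of "2 * ?K" "\<lambda>b. if b < ?K then \<exists>\<phi>. fm X b \<phi> \<and> sat I n \<phi> else \<exists>a. nm X (b - ?K) a \<and> a \<in> I n"] by blast
  have "bit \<tau> i \<longleftrightarrow> sat I n \<phi>" if "fm X i \<phi>" for i \<phi>
  proof -
    have "i < ?K" using fm_le[OF that] by simp
    then have "bit \<tau> i \<longleftrightarrow> (\<exists>\<phi>. fm X i \<phi> \<and> sat I n \<phi>)" using \<tau>(2) by simp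
    then show ?thesis using that fm_unique by blast
  qed
  moreover have "bit \<tau> (?K + q) \<longleftrightarrow> a \<in> I n" if "nm X q a" for q a
  proof -
    have "q < ?K" using nm_le[OF that] by simp
    then have "bit \<tau> (?K + q) \<longleftrightarrow> (\<exists>a. nm X q a \<and> a \<in> I n)" using \<tau>(2)[rule_format, of "?K + q"] by simp
    then show ?thesis using that nm_unique by blast
  qed
  ultimately have "istyp X I n \<tau>" unfolding istyp_def by blast
  then show ?thesis using \<tau>(1) TB[of X] by (intro exI[of _ \<tau>]) simp
qed

lemma typ_fm: "istyp X I n \<tau> \<Longrightarrow> fm X i \<phi> \<Longrightarrow> bit \<tau> i \<longleftrightarrow> sat I n \<phi>"
  unfolding istyp_def by blast

lemma typ_nm: "istyp X I n \<tau> \<Longrightarrow> nm X q a \<Longrightarrow> bit \<tau> (Suc (len X) + q) \<longleftrightarrow> a \<in> I n"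
  unfolding istyp_def by blast

lemma typ_loc: assumes "istyp X I n \<tau>" shows "loc X \<tau>"
  unfolding loc_def
proof (intro conjI allI impI)
  fix i assume "atomf X i"
  then obtain a where "fm X i (Atom a)" "nm X (i + 3) a" unfolding atomf_iff by blast
  then show "bit \<tau> i \<longleftrightarrow> bit \<tau> (Suc (len X) + (i + 3))" using typ_fm[OF assms] typ_nm[OF assms] by (metis sat.simps(1))
next
  fix i assume "hasw [False, False, True] X i"
  then show "bit \<tau> i" using typ_fm[OF assms, where i = i and \<phi> = Top] by simp
next
  fix i assume "hasw [False, True, False] X i"
  then show "\<not> bit \<tau> i" using typ_fm[OF assms, where i = i and \<phi> = Bot] by simp
next
  fix i assume "negf X i"
  then obtain \<phi> where "fm X i (Neg \<phi>)" "fm X (i + 3) \<phi>" unfolding negf_iff by blast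
  from this[THEN typ_fm[OF assms]] show "bit \<tau> i \<longleftrightarrow> \<not> bit \<tau> (i + 3)" by simp
next
  fix i k assume "binf [True, False, False] X i k"
  then obtain \<phi> \<psi> where "fm X i (And \<phi> \<psi>)" "fm X (i + 3) \<phi>" "fm X k \<psi>" unfolding binf_And by blast
  from this[THEN typ_fm[OF assms]] show "bit \<tau> i \<longleftrightarrow> bit \<tau> (i + 3) \<and> bit \<tau> k" by simp
next
  fix q q' assume "same X q q'"
  then obtain a where "nm X q a" "nm X q' a" unfolding same_iff by blast
  from this[THEN typ_nm[OF assms]] show "bit \<tau> (Suc (len X) + q) \<longleftrightarrow> bit \<tau> (Suc (len X) + q')" by simp
qed

lemma sat_Until_Suc: "sat I n (Until \<phi> \<psi>) \<longleftrightarrow> sat I (Suc n) \<psi> \<or> sat I (Suc n) \<phi> \<and> sat I (Suc n) (Until \<phi> \<psi>)" (is "_ \<longleftrightarrow> ?R")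
proof
  assume "sat I n (Until \<phi> \<psi>)"
  then obtain m where m: "m > n" "sat I m \<psi>" "\<forall>k. n < k \<and> k < m \<longrightarrow> sat I k \<phi>" by auto
  show ?R
  proof (cases "m = Suc n")
    case False
    then have "Suc n < m" using m(1) by simp
    then show ?thesis using m by auto
  qed (use m in simp)
next
  assume ?R
  then show "sat I n (Until \<phi> \<psi>)"
  proof
    assume "sat I (Suc n) \<psi>"
    then show ?thesis by (auto intro!: exI[of _ "Suc n"])
  next
    assume a: "sat I (Suc n) \<phi> \<and> sat I (Suc n) (Until \<phi> \<psi>)"
    then obtain m where m: "m > Suc n" "sat I m \<psi>" "\<forall>k. Suc n < k \<and> k < m \<longrightarrow> sat I k \<phi>" by auto
    have "sat I k \<phi>" if "n < k" "k < m" for k using that m(3) a by (cases "k = Suc n") auto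
    then show ?thesis using m(1,2) by (auto intro!: exI[of _ m])
  qed
qed

lemma typ_nxt: assumes "istyp X I n \<tau>" "istyp X I (Suc n) \<tau>'" shows "nxt X \<tau> \<tau>'"
  unfolding nxt_def
proof (intro allI impI)
  fix i k assume "binf [True, False, True] X i k"
  then obtain \<phi> \<psi> where f: "fm X i (Until \<phi> \<psi>)" "fm X (i + 3) \<phi>" "fm X k \<psi>" unfolding binf_Until by blast
  show "bit \<tau> i \<longleftrightarrow> bit \<tau>' k \<or> bit \<tau>' (i + 3) \<and> bit \<tau>' i"
    unfolding typ_fm[OF assms(1) f(1)] typ_fm[OF assms(2) f(1)] typ_fm[OF assms(2) f(2)] typ_fm[OF assms(2) f(3)]
    by (rule sat_Until_Suc)
qed

lemma typ_fair: assumes "\<And>n. istyp X I n (\<sigma> n)" shows "fair X \<sigma>"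
  unfolding fair_def
proof (intro allI impI, elim conjE)
  fix n i assume "isU X i" and b: "bit (\<sigma> n) i"
  then obtain k \<phi> \<psi> where k: "k \<le> len X" "binf [True, False, True] X i k" "fm X i (Until \<phi> \<psi>)" "fm X k \<psi>"
    unfolding isU_def binf_Until by blast
  have "sat I n (Until \<phi> \<psi>)" using b typ_fm[OF assms k(3)] by blast
  then obtain m where "m > n" "sat I m \<psi>" by auto
  then show "\<exists>m>n. ful X i (\<sigma> m)" unfolding ful_def using k typ_fm[OF assms k(4)] by blast
qed

definition interp_of :: "nat \<Rightarrow> (nat \<Rightarrow> nat) \<Rightarrow> interp" where
  "interp_of X \<sigma> n = {a. \<exists>q. nm X q a \<and> bit (\<sigma> n) (Suc (len X) + q)}"

text \<open>The truth lemma of the tableau construction, by induction on formulas. Fairness is used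
  for \<open>Until\<close> only: the expansion law alone would let a bit be postponed
  forever.\<close>

lemma typ_interp_of:
  assumes loc: "\<And>n. loc X (\<sigma> n)" and nxt: "\<And>n. nxt X (\<sigma> n) (\<sigma> (Suc n))" and fair: "fair X \<sigma>"
  shows "istyp X (interp_of X \<sigma>) n (\<sigma> n)"
proof -
  let ?I = "interp_of X \<sigma>"
  have name: "bit (\<sigma> n) (Suc (len X) + q) \<longleftrightarrow> a \<in> ?I n" if "nm X q a" for q a n
  proof -
    have "bit (\<sigma> n) (Suc (len X) + q) \<longleftrightarrow> bit (\<sigma> n) (Suc (len X) + q')" if q': "nm X q' a" for q'
    proof -
      have "same X q q'" unfolding same_iff using \<open>nm X q a\<close> q' by blast
      then show ?thesis using loc[of n] nm_le[OF \<open>nm X q a\<close>] nm_le[OF q'] unfolding loc_def by blast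
    qed
    then show ?thesis unfolding interp_of_def using that by blast
  qed
  have "bit (\<sigma> n) i \<longleftrightarrow> sat ?I n \<phi>" if "fm X i \<phi>" for i n \<phi>
    using that
  proof (induction \<phi> arbitrary: i n)
    case (Atom a)
    have "atomf X i" unfolding atomf_iff using Atom fm_Atom by blast
    then have "bit (\<sigma> n) i \<longleftrightarrow> bit (\<sigma> n) (Suc (len X) + (i + 3))"
      using loc[of n] fm_le[OF Atom] unfolding loc_def by blast
    then show ?case using name[OF fm_Atom[OF Atom]] by simp
  next
    case Top
    then show ?case using loc[of n] fm_le[OF Top] unfolding loc_def by simp
  next
    case Bot
    then show ?case using loc[of n] fm_le[OF Bot] unfolding loc_def by simp
  next
    case (Neg \<phi>)
    have f: "fm X (i + 3) \<phi>" by (rule fm_Neg[OF Neg.prems])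
    then have "negf X i" unfolding negf_iff using Neg.prems by blast
    then have "bit (\<sigma> n) i \<longleftrightarrow> \<not> bit (\<sigma> n) (i + 3)" using loc[of n] fm_le[OF Neg.prems] unfolding loc_def by blast
    then show ?case using Neg.IH[OF f] by simp
  next
    case (And \<phi> \<psi>)
    let ?k = "i + 3 + length (enc_ltl \<phi>)"
    have f: "fm X (i + 3) \<phi>" "fm X ?k \<psi>" using fm_And[OF And.prems] by blast+
    then have "binf [True, False, False] X i ?k" unfolding binf_And using And.prems by blast
    then have "bit (\<sigma> n) i \<longleftrightarrow> bit (\<sigma> n) (i + 3) \<and> bit (\<sigma> n) ?k"
      using loc[of n] fm_le[OF And.prems] fm_le[OF f(2)] unfolding loc_def by blast
    then show ?case using And.IH(1)[OF f(1)] And.IH(2)[OF f(2)] by simp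
  next
    case (Until \<phi> \<psi>)
    let ?k = "i + 3 + length (enc_ltl \<phi>)"
    have f: "fm X (i + 3) \<phi>" "fm X ?k \<psi>" using fm_Until[OF Until.prems] by blast+
    have le: "i \<le> len X" "?k \<le> len X" using fm_le[OF Until.prems] fm_le[OF f(2)] by blast+
    have b: "binf [True, False, True] X i ?k" unfolding binf_Until using f Until.prems by blast
    have "bit (\<sigma> n) i \<longleftrightarrow> bit (\<sigma> (Suc n)) ?k \<or> bit (\<sigma> (Suc n)) (i + 3) \<and> bit (\<sigma> (Suc n)) i" for n
      using nxt[of n] b le unfolding nxt_def by blast
    then have step: "bit (\<sigma> n) i \<longleftrightarrow> sat ?I (Suc n) \<psi> \<or> sat ?I (Suc n) \<phi> \<and> bit (\<sigma> (Suc n)) i" for n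
      using Until.IH(1)[OF f(1)] Until.IH(2)[OF f(2)] by blast
    show ?case
    proof
      assume "sat ?I n (Until \<phi> \<psi>)"
      then obtain m where m: "m > n" "sat ?I m \<psi>" "\<forall>k. n < k \<and> k < m \<longrightarrow> sat ?I k \<phi>" by auto
      have "j < m - n \<Longrightarrow> bit (\<sigma> (m - Suc j)) i" for j
      proof (induction j)
        case 0
        then have "Suc (m - Suc 0) = m" using m(1) by simp
        then show ?case using step[of "m - Suc 0"] m(2) by simp
      next
        case (Suc j)
        then have "Suc (m - Suc (Suc j)) = m - Suc j" by simp
        moreover have "sat ?I (m - Suc j) \<phi>" using m(3) Suc.prems by simp
        ultimately show ?case using step[of "m - Suc (Suc j)"] Suc by simp
      qed
      from this[of "m - Suc n"] show "bit (\<sigma> n) i" using m(1) by (simp add: Suc_diff_Suc)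
    next
      assume bn: "bit (\<sigma> n) i"
      have u: "isU X i" unfolding isU_def using b le by blast
      have kk: "ful X i \<tau> \<longleftrightarrow> bit \<tau> ?k" for \<tau>
      proof
        assume "ful X i \<tau>"
        then obtain k \<phi>' \<psi>' where "fm X i (Until \<phi>' \<psi>')" "k = i + 3 + length (enc_ltl \<phi>')" "bit \<tau> k"
          unfolding ful_def binf_Until by blast
        then show "bit \<tau> ?k" using fm_unique[OF Until.prems] by blast
      qed (use b le in \<open>auto simp: ful_def\<close>)
      obtain m0 where "m0 > n" "ful X i (\<sigma> m0)" using fair u bn unfolding fair_def by blast
      then have m0: "m0 > n \<and> sat ?I m0 \<psi>" using kk Until.IH(2)[OF f(2)] by blast
      \<comment> \<open>At the first fulfilment after \<open>n\<close>. Before it the expansion law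
        has only its second disjunct, which forces the left argument and passes the bit on.\<close>
      define m where "m = (LEAST m. m > n \<and> sat ?I m \<psi>)"
      have m: "m > n" "sat ?I m \<psi>" using LeastI[of "\<lambda>m. m > n \<and> sat ?I m \<psi>", OF m0] unfolding m_def by blast+
      have least: "\<not> sat ?I k \<psi>" if "n < k" "k < m" for k
        using not_less_Least[of k "\<lambda>m. m > n \<and> sat ?I m \<psi>"] that unfolding m_def by blast
      have "n + j < m \<Longrightarrow> bit (\<sigma> (n + j)) i \<and> (0 < j \<longrightarrow> sat ?I (n + j) \<phi>)" for j
      proof (induction j)
        case (Suc j)
        then have "bit (\<sigma> (n + j)) i" "\<not> sat ?I (Suc (n + j)) \<psi>" using least[of "Suc (n + j)"] by simp_all
        then show ?case using step[of "n + j"] by simp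
      qed (use bn in simp)
      then have "sat ?I k \<phi>" if "n < k" "k < m" for k
        using that by (metis less_imp_add_positive)
      then show "sat ?I n (Until \<phi> \<psi>)" using m by auto
    qed
  qed
  then show ?thesis unfolding istyp_def using name by blast
qed

lemma nxt_persist: assumes "nxt X \<tau> \<tau>'" "isU X i" "bit \<tau> i" "\<not> ful X i \<tau>'" shows "bit \<tau>' i"
proof -
  obtain k where k: "k \<le> len X" "binf [True, False, True] X i k" using assms(2) unfolding isU_def by blast
  then have "i \<le> len X" unfolding binf_def using hasw_le by fastforce
  then have "bit \<tau> i \<longleftrightarrow> bit \<tau>' k \<or> bit \<tau>' (i + 3) \<and> bit \<tau>' i" using assms(1) k unfolding nxt_def by blast
  then show ?thesis using assms(3,4) k unfolding ful_def by blast
qed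

section \<open>Fair sequences of types as lassos\<close>

definition tseq :: "nat \<Rightarrow> (nat \<Rightarrow> nat \<Rightarrow> bool) \<Rightarrow> (nat \<Rightarrow> nat) \<Rightarrow> bool" where
  "tseq X ok \<sigma> \<longleftrightarrow> (\<forall>n. \<sigma> n < TB X \<and> ok n (\<sigma> n) \<and> nxt X (\<sigma> n) (\<sigma> (Suc n))) \<and> fair X \<sigma>"

text \<open>A vertex is \<open>time * TB X + type\<close>; the clock stops at \<open>T\<close>, from
  which on \<open>ok\<close> does not change.\<close>

definition E1 :: "nat \<Rightarrow> (nat \<Rightarrow> nat \<Rightarrow> bool) \<Rightarrow> nat \<Rightarrow> nat \<Rightarrow> nat \<Rightarrow> bool" where
  "E1 X ok T a b \<longleftrightarrow> nxt X (a mod TB X) (b mod TB X) \<and> ok (b div TB X) (b mod TB X) \<and>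
     b div TB X = min (Suc (a div TB X)) T"

text \<open>A vertex is \<open>type * TB X + set\<close>. The set may record fewer formulas than
  have been fulfilled, but never more.\<close>

definition E2 :: "nat \<Rightarrow> (nat \<Rightarrow> bool) \<Rightarrow> nat \<Rightarrow> nat \<Rightarrow> bool" where
  "E2 X ok a b \<longleftrightarrow> nxt X (a div TB X) (b div TB X) \<and> ok (b div TB X) \<and>
     (\<forall>i\<le>len X. bit (b mod TB X) i \<longrightarrow> bit (a mod TB X) i \<or> ful X i (b div TB X))"

text \<open>The path from \<open>u\<close> to \<open>w\<close> records the time, up to \<open>T\<close>; the cycle at \<open>w\<close> collects the fulfilled
  \<open>Until\<close> formulas.\<close>

definition lasso :: "nat \<Rightarrow> (nat \<Rightarrow> nat \<Rightarrow> bool) \<Rightarrow> nat \<Rightarrow> bool" where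
  "lasso X ok T \<longleftrightarrow> (\<exists>u<TB X. ok 0 u \<and> (\<exists>w<TB X.
     (u, T * TB X + w) \<in> {(a, b). a < Suc T * TB X \<and> b < Suc T * TB X \<and> E1 X ok T a b}\<^sup>* \<and>
     (\<exists>y<TB X * TB X. E2 X (ok T) (w * TB X) y \<and> (\<exists>S<TB X.
       (y, w * TB X + S) \<in> {(a, b). a < TB X * TB X \<and> b < TB X * TB X \<and> E2 X (ok T) a b}\<^sup>* \<and>
       (\<forall>i\<le>len X. isU X i \<and> bit w i \<longrightarrow> bit S i)))))"

lemma rtrancl_path: "(a, b) \<in> R\<^sup>* \<Longrightarrow> \<exists>f (k :: nat). f 0 = a \<and> f k = b \<and> (\<forall>i<k. (f i, f (Suc i)) \<in> R)"
  unfolding rtrancl_power relpow_fun_conv by blast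

lemma path_rtrancl: "(\<And>i. i < k \<Longrightarrow> (f i, f (Suc i)) \<in> R) \<Longrightarrow> (f 0, f (k :: nat)) \<in> R\<^sup>*"
  unfolding rtrancl_power relpow_fun_conv by blast

lemma isU_le: "isU X i \<Longrightarrow> i \<le> len X"
  unfolding isU_def binf_def using hasw_le by fastforce

lemma code_less: "p < (a :: nat) \<Longrightarrow> q < b \<Longrightarrow> p * b + q < a * b"
proof -
  assume "p < a" "q < b"
  then have "p * b + q < Suc p * b" by simp
  also have "\<dots> \<le> a * b" using \<open>p < a\<close> by (intro mult_right_mono) auto
  finally show ?thesis .
qed

lemma lasso_tseq:
  assumes okT: "\<And>n. T \<le> n \<Longrightarrow> ok n = ok T" and "lasso X ok T"
  shows "\<exists>\<sigma>. tseq X ok \<sigma>"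
proof -
  let ?B = "TB X"
  obtain u w y S where u: "u < ?B" "ok 0 u" and w: "w < ?B"
    and stem: "(u, T * ?B + w) \<in> {(a, b). a < Suc T * ?B \<and> b < Suc T * ?B \<and> E1 X ok T a b}\<^sup>*"
    and y: "y < ?B * ?B" "E2 X (ok T) (w * ?B) y" and S: "S < ?B"
    and cyc: "(y, w * ?B + S) \<in> {(a, b). a < ?B * ?B \<and> b < ?B * ?B \<and> E2 X (ok T) a b}\<^sup>*"
    and US: "\<And>i. isU X i \<Longrightarrow> bit w i \<Longrightarrow> bit S i"
    using assms(2) isU_le unfolding lasso_def by blast
  obtain f k where f: "f 0 = u" "f k = T * ?B + w" and fE: "\<And>i. i < k \<Longrightarrow> E1 X ok T (f i) (f (Suc i))"
    using rtrancl_path[OF stem] by blast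
  obtain g0 l0 where g0: "g0 0 = y" "g0 l0 = w * ?B + S"
    and g0R: "\<And>i. i < l0 \<Longrightarrow> (g0 i, g0 (Suc i)) \<in> {(a, b). a < ?B * ?B \<and> b < ?B * ?B \<and> E2 X (ok T) a b}"
    using rtrancl_path[OF cyc] by blast
  have g0E: "E2 X (ok T) (g0 i) (g0 (Suc i))" if "i < l0" for i using g0R[OF that] by blast
  have g0b: "g0 i < ?B * ?B" if "i \<le> l0" for i
    using that y(1) g0(1) g0R[of "i - 1"] by (cases i) auto
  \<comment> \<open>The first edge of the cycle is prescribed separately, since reachability alone
    would admit an empty cycle.\<close>
  define g where "g = case_nat (w * ?B) g0"
  let ?l = "Suc l0"
  have g: "g 0 = w * ?B" "g ?l = w * ?B + S" by (simp_all add: g_def g0)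
  have gE: "E2 X (ok T) (g i) (g (Suc i))" if "i < ?l" for i
    using that y(2) g0E by (cases i) (auto simp: g_def g0)
  have dg: "g 0 div ?B = w" "g ?l div ?B = w" "g ?l mod ?B = S" "g 0 mod ?B = 0"
    using w S TB_pos[of X] unfolding g by simp_all
  have df: "f k mod ?B = w" "f k div ?B = T" "f 0 mod ?B = u" "f 0 div ?B = 0" using w u unfolding f by simp_all
  have ft: "i \<le> k \<Longrightarrow> f i div ?B = min i T" for i
  proof (induction i)
    case (Suc i)
    then show ?case using fE[of i] by (simp add: E1_def)
  qed (simp add: df)
  have Tk: "T \<le> k" using ft[of k] df(2) by simp
  define \<sigma> where "\<sigma> n = (if n < k then f n mod ?B else g ((n - k) mod ?l) div ?B)" for n
  have nx_ok: "nxt X (\<sigma> n) (\<sigma> (Suc n)) \<and> ok (Suc n) (\<sigma> (Suc n))" for n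
  proof (cases "n < k")
    case True
    have s: "\<sigma> (Suc n) = f (Suc n) mod ?B"
    proof (cases "Suc n < k")
      case False
      then have "Suc n = k" using True by simp
      then show ?thesis by (simp add: \<sigma>_def dg df)
    qed (simp add: \<sigma>_def)
    have "min (Suc n) T = f (Suc n) div ?B" using ft[of "Suc n"] True by simp
    moreover have "ok (min (Suc n) T) = ok (Suc n)" using okT[of "Suc n"] by (simp add: min_def)
    ultimately show ?thesis using fE[OF True] True unfolding s by (auto simp: E1_def \<sigma>_def)
  next
    case False
    let ?r = "(n - k) mod ?l"
    have r: "?r < ?l" by simp
    have s: "\<sigma> (Suc n) = g (Suc ?r) div ?B"
    proof (cases "Suc ?r = ?l")
      case True
      then have "(Suc n - k) mod ?l = 0" using False by (simp add: Suc_diff_le mod_Suc)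
      then show ?thesis unfolding True using False dg by (simp add: \<sigma>_def)
    next
      case F: False
      then have "(Suc n - k) mod ?l = Suc ?r" using False by (simp add: Suc_diff_le mod_Suc)
      then show ?thesis using False by (simp add: \<sigma>_def)
    qed
    have "ok (Suc n) = ok T" using okT[of "Suc n"] Tk False by simp
    then show ?thesis using gE[OF r] False unfolding s by (simp add: E2_def \<sigma>_def)
  qed
  have ok0: "ok 0 (\<sigma> 0)"
  proof (cases "0 < k")
    case False
    then have "w = u" using f df by simp
    then show ?thesis using False u dg by (simp add: \<sigma>_def)
  qed (simp add: \<sigma>_def df u)
  have bnd: "\<sigma> n < ?B" for n
  proof (cases "n < k")
    case False
    have "g i < ?B * ?B" if "i < ?l" for i
    proof (cases i)
      case 0
      then show ?thesis using w code_less[of w ?B 0 ?B] TB_pos[of X] by (simp add: g)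
    next
      case (Suc j)
      then show ?thesis using g0b[of j] that by (simp add: g_def)
    qed
    then show ?thesis using False by (simp add: \<sigma>_def div_less_iff_less_mult TB_pos)
  qed (simp add: \<sigma>_def TB_pos)
  have "fair X \<sigma>" unfolding fair_def
  proof (intro allI impI, elim conjE, rule ccontr)
    fix n i assume i: "isU X i" "bit (\<sigma> n) i" and no: "\<not> (\<exists>m>n. ful X i (\<sigma> m))"
    have p: "bit (\<sigma> (n + j)) i" for j
    proof (induction j)
      case (Suc j)
      have "\<not> ful X i (\<sigma> (Suc (n + j)))" using no by (metis less_Suc_eq_le le_add1)
      then show ?case using nxt_persist[of X "\<sigma> (n + j)" "\<sigma> (Suc (n + j))" i] nx_ok[of "n + j"] i Suc by simp
    qed (use i in simp)
    \<comment> \<open>A return to \<open>w\<close> that is not before \<open>n\<close>. An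
      unfulfilled formula persists up to it, so it belongs to \<open>w\<close>, hence to
      \<open>S\<close>, and \<open>S\<close> records only what is fulfilled during the next
      round.\<close>
    let ?m = "k + n * ?l"
    have m: "n \<le> ?m" by simp
    have sw: "\<sigma> ?m = w" by (simp add: \<sigma>_def dg del: mult_Suc_right)
    have "bit w i" using p[of "?m - n"] unfolding le_add_diff_inverse[OF m] sw .
    then have "bit S i" using US[OF i(1)] by blast
    then have "bit (g ?l mod ?B) i" using dg by simp
    moreover have "j \<le> ?l \<Longrightarrow> bit (g j mod ?B) i \<Longrightarrow> \<exists>j'. 0 < j' \<and> j' \<le> j \<and> ful X i (g j' div ?B)" for j
    proof (induction j)
      case 0
      then show ?case by (simp add: dg)
    next
      case (Suc j)
      then have "bit (g j mod ?B) i \<or> ful X i (g (Suc j) div ?B)"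
        using gE[of j] isU_le[OF i(1)] unfolding E2_def by auto
      then show ?case using Suc.IH Suc.prems by (meson Suc_leD le_SucI le_refl zero_less_Suc)
    qed
    ultimately obtain j' where j': "0 < j'" "j' \<le> ?l" "ful X i (g j' div ?B)" by blast
    have "\<sigma> (?m + j') = g j' div ?B"
    proof (cases "j' = ?l")
      case True
      then have "?m + j' - k = Suc n * ?l" by simp
      then have "(?m + j' - k) mod ?l = 0" by (simp only: mod_mult_self2_is_0)
      then show ?thesis using True dg by (simp add: \<sigma>_def)
    next
      case False
      then have "j' < ?l" using j' by simp
      then have d: "(n * ?l + j') mod ?l = j'" by (rule digit)
      have e: "?m + j' - k = n * ?l + j'" "\<not> ?m + j' < k" by simp_all
      show ?thesis by (simp only: \<sigma>_def e d if_False)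
    qed
    then have "ful X i (\<sigma> (?m + j'))" using j' by simp
    moreover have "?m + j' > n" using m j'(1) by simp
    ultimately show False using no by blast
  qed
  then have "tseq X ok \<sigma>" unfolding tseq_def using bnd nx_ok ok0 by (metis not0_implies_Suc)
  then show ?thesis by blast
qed

text \<open>Some type \<open>w\<close> recurs infinitely often. Two of its occurrences are chosen
  such that the first is not before \<open>T\<close> and every \<open>Until\<close> formula in
  \<open>w\<close> is fulfilled between them.\<close>

lemma tseq_lasso:
  assumes okT: "\<And>n. T \<le> n \<Longrightarrow> ok n = ok T" and \<sigma>: "tseq X ok \<sigma>"
  shows "lasso X ok T"
proof -
  let ?B = "TB X"
  have bnd: "\<sigma> n < ?B" and ok: "ok n (\<sigma> n)" and nx: "nxt X (\<sigma> n) (\<sigma> (Suc n))" for n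
    using \<sigma> unfolding tseq_def by blast+
  have fair: "fair X \<sigma>" using \<sigma> unfolding tseq_def by blast
  have "finite (\<sigma> ` UNIV)" by (rule finite_subset[of _ "{..<?B}"]) (use bnd in auto)
  then obtain w where w: "infinite (\<sigma> -` {w})" using inf_img_fin_dom[of \<sigma> UNIV] by auto
  have unb: "\<exists>n\<ge>m. \<sigma> n = w" for m using w unfolding infinite_nat_iff_unbounded_le by auto
  obtain n1 where n1: "n1 \<ge> T" "\<sigma> n1 = w" using unb by blast
  have wB: "w < ?B" using bnd[of n1] n1 by simp
  let ?f = "\<lambda>n. min n T * ?B + \<sigma> n"
  have "(?f i, ?f (Suc i)) \<in> {(a, b). a < Suc T * ?B \<and> b < Suc T * ?B \<and> E1 X ok T a b}" for i
  proof -
    have d: "?f i mod ?B = \<sigma> i" "?f i div ?B = min i T" for i by (rule digit, rule bnd)+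
    have b: "?f i < Suc T * ?B" for i using code_less[of "min i T" "Suc T" "\<sigma> i" ?B] bnd by simp
    have "ok (min (Suc i) T) = ok (Suc i)" using okT[of "Suc i"] by (simp add: min_def)
    then have "E1 X ok T (?f i) (?f (Suc i))" unfolding E1_def d using nx[of i] ok[of "Suc i"] by simp
    then show ?thesis using b[of i] b[of "Suc i"] by blast
  qed
  then have "(?f 0, ?f n1) \<in> {(a, b). a < Suc T * ?B \<and> b < Suc T * ?B \<and> E1 X ok T a b}\<^sup>*"
    by (rule path_rtrancl)
  then have stem: "(\<sigma> 0, T * ?B + w) \<in> {(a, b). a < Suc T * ?B \<and> b < Suc T * ?B \<and> E1 X ok T a b}\<^sup>*"
    using n1 by (simp add: min_absorb2)
  have "\<exists>m. isU X i \<and> bit w i \<longrightarrow> m > n1 \<and> ful X i (\<sigma> m)" for i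
    using fair n1(2) unfolding fair_def by blast
  then obtain mf where mf: "\<And>i. isU X i \<Longrightarrow> bit w i \<Longrightarrow> mf i > n1 \<and> ful X i (\<sigma> (mf i))" by metis
  \<comment> \<open>The sum exceeds each of the finitely many times of fulfilment
    \<open>mf i\<close>.\<close>
  obtain n2 where n2: "n2 \<ge> Suc (n1 + (\<Sum>i\<le>len X. mf i))" "\<sigma> n2 = w" using unb by blast
  have mfb: "mf i \<le> n2" if "i \<le> len X" for i
    using member_le_sum[of i "{..len X}" mf] that n2(1) by simp
  have "\<exists>S :: nat. S < ?B \<and> (\<forall>i. bit S i \<longleftrightarrow> i \<le> len X \<and> (\<exists>m. n1 < m \<and> m \<le> n1 + j \<and> ful X i (\<sigma> m)))" for j
  proof -
    obtain S :: nat where S: "S < 2 ^ Suc (len X)" "\<forall>i. bit S i \<longleftrightarrow> i < Suc (len X) \<and> (\<exists>m. n1 < m \<and> m \<le> n1 + j \<and> ful X i (\<sigma> m))"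
      using exists_bits[of "Suc (len X)" "\<lambda>i. \<exists>m. n1 < m \<and> m \<le> n1 + j \<and> ful X i (\<sigma> m)"] by blast
    have "(2 :: nat) ^ Suc (len X) \<le> 2 ^ (2 * Suc (len X))" by (intro power_increasing) auto
    then have "S < ?B" using S(1) TB[of X] by linarith
    then show ?thesis using S(2) by (intro exI[of _ S]) (simp add: less_Suc_eq_le)
  qed
  then obtain Sf where Sf: "\<And>j. Sf j < ?B" "\<And>j i. bit (Sf j) i \<longleftrightarrow> i \<le> len X \<and> (\<exists>m. n1 < m \<and> m \<le> n1 + j \<and> ful X i (\<sigma> m))"
    by metis
  let ?h = "\<lambda>j. \<sigma> (n1 + Suc j) * ?B + Sf (Suc j)"
  have hd: "?h j mod ?B = Sf (Suc j)" "?h j div ?B = \<sigma> (n1 + Suc j)" for j by (rule digit, rule Sf(1))+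
  have hb: "?h j < ?B * ?B" for j by (rule code_less[OF bnd Sf(1)])
  have okn: "ok T (\<sigma> (n1 + j))" for j using ok[of "n1 + j"] okT[of "n1 + j"] n1(1) by simp
  have "(?h j, ?h (Suc j)) \<in> {(a, b). a < ?B * ?B \<and> b < ?B * ?B \<and> E2 X (ok T) a b}" for j
  proof -
    have "bit (Sf (Suc j)) i \<or> ful X i (\<sigma> (n1 + Suc (Suc j)))" if "bit (Sf (Suc (Suc j))) i" for i
      using that unfolding Sf(2) by (metis add_Suc_right le_Suc_eq)
    then have "E2 X (ok T) (?h j) (?h (Suc j))" unfolding E2_def hd using nx[of "n1 + Suc j"] okn[of "Suc (Suc j)"] by simp
    then show ?thesis using hb[of j] hb[of "Suc j"] by blast
  qed
  then have "(?h 0, ?h (n2 - Suc n1)) \<in> {(a, b). a < ?B * ?B \<and> b < ?B * ?B \<and> E2 X (ok T) a b}\<^sup>*"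
    by (rule path_rtrancl)
  moreover have "n1 + Suc (n2 - Suc n1) = n2" using n2(1) by simp
  ultimately have cyc: "(?h 0, w * ?B + Sf (Suc (n2 - Suc n1))) \<in> {(a, b). a < ?B * ?B \<and> b < ?B * ?B \<and> E2 X (ok T) a b}\<^sup>*"
    using n2(2) by simp
  have first: "E2 X (ok T) (w * ?B) (?h 0)"
  proof -
    have d: "(w * ?B) div ?B = w" using TB_pos[of X] by simp
    have "ful X i (\<sigma> (n1 + Suc 0))" if "bit (Sf (Suc 0)) i" for i
    proof -
      from that obtain m where "n1 < m" "m \<le> n1 + Suc 0" "ful X i (\<sigma> m)" unfolding Sf(2) by blast
      moreover from this have "m = n1 + Suc 0" by simp
      ultimately show ?thesis by simp
    qed
    then show ?thesis unfolding E2_def hd d using nx[of n1] n1(2) okn[of "Suc 0"] by simp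
  qed
  have fin: "bit (Sf (Suc (n2 - Suc n1))) i" if "isU X i" "bit w i" for i
    unfolding Sf(2) using mf[OF that] isU_le[OF that(1)] mfb[OF isU_le[OF that(1)]] n2(1) by (intro conjI exI[of _ "mf i"]) auto
  show ?thesis unfolding lasso_def
    using bnd[of 0] ok[of 0] wB stem hb[of 0] first Sf(1)[of "Suc (n2 - Suc n1)"] cyc fin by blast
qed

section \<open>Models of an input\<close>

definition onto_ok :: "nat \<Rightarrow> nat \<Rightarrow> bool" where
  "onto_ok X \<tau> \<longleftrightarrow> (\<forall>p\<le>len X. elem_at axiomL X 0 p \<longrightarrow> bit \<tau> p)"

text \<open>The timestamp is read off as a distance: the unary code of \<open>n\<close> has
  \<open>n + 1\<close> symbols.\<close>

definition data_ok :: "nat \<Rightarrow> nat \<Rightarrow> nat \<Rightarrow> nat \<Rightarrow> bool" where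
  "data_ok X d n \<tau> \<longleftrightarrow> (\<forall>p\<le>len X. \<forall>k\<le>len X. elem_at factL X d p \<and> lat nameL X p k \<and> lat unaryL X k (k + n + 1) \<longrightarrow>
     bit \<tau> (Suc (len X) + p))"

text \<open>If \<open>q\<close> is a position of the input, the atom named there must be false at
  time \<open>t\<close>; unsatisfiability then means that the atom is entailed at \<open>t\<close>.
  A larger \<open>q\<close> switches this off.\<close>

definition okd :: "nat \<Rightarrow> nat \<Rightarrow> nat \<Rightarrow> nat \<Rightarrow> nat \<Rightarrow> nat \<Rightarrow> bool" where
  "okd X d t q n \<tau> \<longleftrightarrow> loc X \<tau> \<and> onto_ok X \<tau> \<and> data_ok X d n \<tau> \<and> (n = t \<and> q \<le> len X \<longrightarrow> \<not> bit \<tau> (Suc (len X) + q))"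

definition satisf :: "nat \<Rightarrow> nat \<Rightarrow> nat \<Rightarrow> nat \<Rightarrow> bool" where
  "satisf X d t q \<longleftrightarrow> lasso X (okd X d t q) (t + len X + 1)"

text \<open>Timestamps in unary are smaller than the length of the input, so later times carry no
  data, and \<open>t\<close> has passed as well.\<close>

lemma okd_const: "t + len X + 1 \<le> n \<Longrightarrow> okd X d t q n = okd X d t q (t + len X + 1)"
proof -
  assume n: "t + len X + 1 \<le> n"
  have "data_ok X d m \<tau>" if "t + len X + 1 \<le> m" for m \<tau>
    unfolding data_ok_def using that lat_le[of unaryL X] by fastforce
  then show ?thesis using n unfolding okd_def by (intro ext) auto
qed

lemma onto_ok_iff:
  assumes "hasw (enc_list enc_ltl Os) X 0" "set Os \<subseteq> horn_axioms" "istyp X I n \<tau>"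
  shows "onto_ok X \<tau> \<longleftrightarrow> (\<forall>\<alpha>\<in>set Os. sat I n \<alpha>)"
proof
  assume o: "onto_ok X \<tau>"
  show "\<forall>\<alpha>\<in>set Os. sat I n \<alpha>"
  proof
    fix \<alpha> assume "\<alpha> \<in> set Os"
    then obtain p where p: "elem_at axiomL X 0 p" "fm X p \<alpha>"
      using elem_at_complete[OF assms(1,2)] unfolding axiomL_def by blast
    then have "bit \<tau> p" using o fm_le[OF p(2)] unfolding onto_ok_def by blast
    then show "sat I n \<alpha>" using typ_fm[OF assms(3) p(2)] by blast
  qed
next
  assume s: "\<forall>\<alpha>\<in>set Os. sat I n \<alpha>"
  show "onto_ok X \<tau>" unfolding onto_ok_def
  proof (intro allI impI)
    fix p assume "elem_at axiomL X 0 p"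
    then obtain \<alpha> where "\<alpha> \<in> set Os" "fm X p \<alpha>"
      using elem_at_sound[of enc_ltl, OF enc_ltl_prefix_free assms(1)] unfolding axiomL_def by blast
    then show "bit \<tau> p" using typ_fm[OF assms(3)] s by blast
  qed
qed

lemma data_ok_iff:
  assumes "hasw (enc_list enc_fact fs) X d" "istyp X I n \<tau>"
  shows "data_ok X d n \<tau> \<longleftrightarrow> (\<forall>a. (a, n) \<in> set fs \<longrightarrow> a \<in> I n)"
proof
  assume o: "data_ok X d n \<tau>"
  show "\<forall>a. (a, n) \<in> set fs \<longrightarrow> a \<in> I n"
  proof (intro allI impI)
    fix a assume "(a, n) \<in> set fs"
    then obtain p where p: "elem_at factL X d p" "hasw (enc_fact (a, n)) X p"
      using elem_at_complete[OF assms(1), of UNIV] unfolding factL_def by blast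
    then have h: "nm X p a" "hasw (enc_unary n) X (p + length (enc_name a))"
      unfolding enc_fact_def hasw_append by simp_all
    have "length (enc_unary n) = n + 1" by (simp add: enc_unary_def)
    then have "lat unaryL X (p + length (enc_name a)) (p + length (enc_name a) + n + 1)"
      using h(2) unfolding lat_def unaryL_def by (intro bexI[of _ "enc_unary n"]) simp_all
    moreover have "lat nameL X p (p + length (enc_name a))" using h(1) unfolding lat_nameL by blast
    ultimately have "bit \<tau> (Suc (len X) + p)" using o p(1) nm_le[OF h(1)] unfolding data_ok_def by blast
    then show "a \<in> I n" using typ_nm[OF assms(2) h(1)] by blast
  qed
next
  assume s: "\<forall>a. (a, n) \<in> set fs \<longrightarrow> a \<in> I n"
  show "data_ok X d n \<tau>" unfolding data_ok_def
  proof (intro allI impI, elim conjE)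
    fix p k assume e: "elem_at factL X d p" and k: "lat nameL X p k" "lat unaryL X k (k + n + 1)"
    obtain f where f: "f \<in> set fs" "hasw (enc_fact f) X p"
      using elem_at_sound[of enc_fact, OF enc_fact_prefix_free assms(1)] e unfolding factL_def by blast
    obtain a l where al: "f = (a, l)" by (cases f)
    have h: "nm X p a" "hasw (enc_unary l) X (p + length (enc_name a))"
      using f(2) unfolding al enc_fact_def hasw_append by simp_all
    obtain b where b: "nm X p b" "k = p + length (enc_name b)" using k(1) unfolding lat_nameL by blast
    have ab: "a = b" by (rule nm_unique[OF h(1) b(1)])
    obtain l' where l': "hasw (enc_unary l') X k" "k + n + 1 = k + length (enc_unary l')"
      using k(2) unfolding lat_def unaryL_def by blast
    have "hasw (enc_unary l') X (p + length (enc_name a))" using l'(1) unfolding b(2) ab .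
    then have "l = l'" by (intro hasw_unique[of enc_unary, OF _ h(2)]) (rule enc_unary_prefix_free)
    then have "l = n" using l'(2) by (simp add: enc_unary_def)
    then show "bit \<tau> (Suc (len X) + p)" using s f(1) al typ_nm[OF assms(2) h(1)] by blast
  qed
qed

definition cmodel :: "interp \<Rightarrow> ltl list \<Rightarrow> (nat \<times> nat) list \<Rightarrow> bool" where
  "cmodel I Os fs \<longleftrightarrow> model I (set Os) \<and> satisfies_data I (set fs)"

lemma cmodel_tseq:
  assumes "hasw (enc_list enc_ltl Os) X 0" "set Os \<subseteq> horn_axioms" "hasw (enc_list enc_fact fs) X d"
    and \<sigma>: "tseq X (okd X d t q) \<sigma>"
  shows "cmodel (interp_of X \<sigma>) Os fs" "nm X q a \<Longrightarrow> a \<notin> interp_of X \<sigma> t"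
    "\<And>n. istyp X (interp_of X \<sigma>) n (\<sigma> n)"
proof -
  have ok: "okd X d t q n (\<sigma> n)" and nx: "nxt X (\<sigma> n) (\<sigma> (Suc n))" for n
    using \<sigma> unfolding tseq_def by blast+
  have fair: "fair X \<sigma>" using \<sigma> unfolding tseq_def by blast
  have t: "istyp X (interp_of X \<sigma>) n (\<sigma> n)" for n
    by (rule typ_interp_of[OF _ nx fair]) (use ok in \<open>auto simp: okd_def\<close>)
  then show "\<And>n. istyp X (interp_of X \<sigma>) n (\<sigma> n)" .
  have "model (interp_of X \<sigma>) (set Os)" unfolding model_def
    using onto_ok_iff[OF assms(1,2) t] ok unfolding okd_def by blast
  moreover have "satisfies_data (interp_of X \<sigma>) (set fs)" unfolding satisfies_data_def
    using data_ok_iff[OF assms(3) t] ok unfolding okd_def by blast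
  ultimately show "cmodel (interp_of X \<sigma>) Os fs" unfolding cmodel_def by blast
  show "a \<notin> interp_of X \<sigma> t" if "nm X q a"
    using ok[of t] nm_le[OF that] typ_nm[OF t that] unfolding okd_def by blast
qed

lemma tseq_cmodel:
  assumes "hasw (enc_list enc_ltl Os) X 0" "set Os \<subseteq> horn_axioms" "hasw (enc_list enc_fact fs) X d"
    and I: "cmodel I Os fs" and \<sigma>: "\<And>n. \<sigma> n < TB X" "\<And>n. istyp X I n (\<sigma> n)"
    and q: "len X < q \<or> (\<exists>a. nm X q a \<and> a \<notin> I t)"
  shows "tseq X (okd X d t q) \<sigma>"
proof -
  have "okd X d t q n (\<sigma> n)" for n unfolding okd_def
  proof (intro conjI impI)
    show "loc X (\<sigma> n)" by (rule typ_loc[OF \<sigma>(2)])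
    show "onto_ok X (\<sigma> n)" using onto_ok_iff[OF assms(1,2) \<sigma>(2)] I unfolding cmodel_def model_def by blast
    show "data_ok X d n (\<sigma> n)" using data_ok_iff[OF assms(3) \<sigma>(2)] I unfolding cmodel_def satisfies_data_def by blast
    assume "n = t \<and> q \<le> len X"
    then obtain a where "nm X q a" "a \<notin> I n" using q by auto
    then show "\<not> bit (\<sigma> n) (Suc (len X) + q)" using typ_nm[OF \<sigma>(2)] by blast
  qed
  then show ?thesis unfolding tseq_def using \<sigma>(1) typ_nxt[OF \<sigma>(2) \<sigma>(2)] typ_fair[OF \<sigma>(2)] by blast
qed

text \<open>The first version adds that the model can be chosen with atoms named in the input only.
  It confines canonical models to finitely many atoms.\<close>

lemma satisf_iff:
  assumes "hasw (enc_list enc_ltl Os) X 0" "set Os \<subseteq> horn_axioms" "hasw (enc_list enc_fact fs) X d"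
    and q: "len X < q \<or> nm X q a"
  shows "satisf X d t q \<longleftrightarrow> (\<exists>I. cmodel I Os fs \<and> (\<forall>n. I n \<subseteq> {a. \<exists>q. nm X q a}) \<and> (q \<le> len X \<longrightarrow> a \<notin> I t))"
    "satisf X d t q \<longleftrightarrow> (\<exists>I. cmodel I Os fs \<and> (q \<le> len X \<longrightarrow> a \<notin> I t))"
proof -
  have 1: "\<exists>I. cmodel I Os fs \<and> (\<forall>n. I n \<subseteq> {a. \<exists>q. nm X q a}) \<and> (q \<le> len X \<longrightarrow> a \<notin> I t)" if s: "satisf X d t q"
  proof -
    obtain \<sigma> where \<sigma>: "tseq X (okd X d t q) \<sigma>"
      using lasso_tseq[of "t + len X + 1" "okd X d t q", OF okd_const] s unfolding satisf_def by blast
    have "q \<le> len X \<longrightarrow> a \<notin> interp_of X \<sigma> t" using cmodel_tseq(2)[OF assms(1-3) \<sigma>] q by auto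
    moreover have "interp_of X \<sigma> n \<subseteq> {a. \<exists>q. nm X q a}" for n unfolding interp_of_def by blast
    ultimately show ?thesis using cmodel_tseq(1)[OF assms(1-3) \<sigma>] by blast
  qed
  have 2: "satisf X d t q" if I: "cmodel I Os fs" "q \<le> len X \<longrightarrow> a \<notin> I t" for I
  proof -
    obtain \<sigma> where \<sigma>: "\<And>n. \<sigma> n < TB X \<and> istyp X I n (\<sigma> n)" using ex_typ[of X I] by metis
    have "len X < q \<or> (\<exists>a. nm X q a \<and> a \<notin> I t)" using q I(2) by (cases "len X < q") auto
    then have "tseq X (okd X d t q) \<sigma>" using tseq_cmodel[OF assms(1-3) I(1)] \<sigma> by blast
    from tseq_lasso[of "t + len X + 1" "okd X d t q", OF okd_const this] show ?thesis unfolding satisf_def .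
  qed
  show "satisf X d t q \<longleftrightarrow> (\<exists>I. cmodel I Os fs \<and> (\<forall>n. I n \<subseteq> {a. \<exists>q. nm X q a}) \<and> (q \<le> len X \<longrightarrow> a \<notin> I t))"
    using 1 2 by blast
  show "satisf X d t q \<longleftrightarrow> (\<exists>I. cmodel I Os fs \<and> (q \<le> len X \<longrightarrow> a \<notin> I t))"
    using 1 2 by blast
qed

section \<open>Satisfiability in polynomial space\<close>

lemma PP_binf[pf]: "\<lbrakk>PF A; PF B; PF C\<rbrakk> \<Longrightarrow> PP (\<lambda>e. binf w (A e) (B e) (C e))"
proof (rule PP_comp3[where f = "binf w"])
  show "PP (\<lambda>e. binf w (e 0) (e 1) (e 2))" unfolding binf_def by (intro pf)
qed

lemma PP_loc[pf]: "PF A \<Longrightarrow> PF B \<Longrightarrow> PP (\<lambda>e. loc (A e) (B e))"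
proof (rule PP_comp2[where f = loc])
  show "PP (\<lambda>e. loc (e 0) (e 1))" unfolding loc_def atomf_def negf_def same_def by (intro pf)
qed

lemma PP_nxt[pf]: "\<lbrakk>PF A; PF B; PF C\<rbrakk> \<Longrightarrow> PP (\<lambda>e. nxt (A e) (B e) (C e))"
proof (rule PP_comp3[where f = nxt])
  show "PP (\<lambda>e. nxt (e 0) (e 1) (e 2))" unfolding nxt_def by (intro pf)
qed

lemma PP_isU[pf]: "PF A \<Longrightarrow> PF B \<Longrightarrow> PP (\<lambda>e. isU (A e) (B e))"
proof (rule PP_comp2[where f = isU])
  show "PP (\<lambda>e. isU (e 0) (e 1))" unfolding isU_def by (intro pf)
qed

lemma PP_ful[pf]: "\<lbrakk>PF A; PF B; PF C\<rbrakk> \<Longrightarrow> PP (\<lambda>e. ful (A e) (B e) (C e))"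
proof (rule PP_comp3[where f = ful])
  show "PP (\<lambda>e. ful (e 0) (e 1) (e 2))" unfolding ful_def by (intro pf)
qed

lemma PF_TB[pf]: "PF A \<Longrightarrow> PF (\<lambda>e. TB (A e))"
  unfolding TB_def by (intro pf)

lemma PP_okd[pf]:
  "\<lbrakk>PF A; PF B; PF C; PF D; PF E; PF G\<rbrakk> \<Longrightarrow> PP (\<lambda>e. okd (A e) (B e) (C e) (D e) (E e) (G e))"
proof (rule PP_comp6[where f = okd])
  show "PP (\<lambda>e. okd (e 0) (e 1) (e 2) (e 3) (e 4) (e 5))"
    unfolding okd_def onto_ok_def data_ok_def by (intro pf PP_elem_at[OF PP_axiomL] PP_elem_at[OF PP_factL])
qed

lemma PP_satisf[pf]: "\<lbrakk>PF A; PF B; PF C; PF D\<rbrakk> \<Longrightarrow> PP (\<lambda>e. satisf (A e) (B e) (C e) (D e))"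
proof (rule PP_comp4[where f = satisf])
  have r1: "PP (\<lambda>e. (A e, B e) \<in> {(a, b). a < Suc (e 2 + len (e 0) + 1) * TB (e 0) \<and> b < Suc (e 2 + len (e 0) + 1) * TB (e 0) \<and>
      E1 (e 0) (okd (e 0) (e 1) (e 2) (e 3)) (e 2 + len (e 0) + 1) a b}\<^sup>*)" if "PF A" "PF B" for A B
  proof (rule PP_reach[OF _ _ that])
    show "PP (\<lambda>e. E1 (e (Suc (Suc 0))) (okd (e (Suc (Suc 0))) (e (Suc (Suc 1))) (e (Suc (Suc 2))) (e (Suc (Suc 3))))
         (e (Suc (Suc 2)) + len (e (Suc (Suc 0))) + 1) (e 0) (e 1))"
      unfolding E1_def by (intro pf)
  qed (intro pf)
  have r2: "PP (\<lambda>e. (A e, B e) \<in> {(a, b). a < TB (e 0) * TB (e 0) \<and> b < TB (e 0) * TB (e 0) \<and>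
      E2 (e 0) (okd (e 0) (e 1) (e 2) (e 3) (e 2 + len (e 0) + 1)) a b}\<^sup>*)" if "PF A" "PF B" for A B
  proof (rule PP_reach[OF _ _ that])
    show "PP (\<lambda>e. E2 (e (Suc (Suc 0))) (okd (e (Suc (Suc 0))) (e (Suc (Suc 1))) (e (Suc (Suc 2))) (e (Suc (Suc 3)))
         (e (Suc (Suc 2)) + len (e (Suc (Suc 0))) + 1)) (e 0) (e 1))"
      unfolding E2_def by (intro pf)
  qed (intro pf)
  have r1': "PP (\<lambda>e. (A e, B e) \<in> {(a, b). a < Suc (V2 e + len (V0 e) + 1) * TB (V0 e) \<and> b < Suc (V2 e + len (V0 e) + 1) * TB (V0 e) \<and>
      E1 (V0 e) (okd (V0 e) (V1 e) (V2 e) (V3 e)) (V2 e + len (V0 e) + 1) a b}\<^sup>*)"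
    if "PF V0" "PF V1" "PF V2" "PF V3" "PF A" "PF B" for A B V0 V1 V2 V3
    by (rule PP_comp6[where f = "\<lambda>x d t q a b. (a, b) \<in> {(a, b). a < Suc (t + len x + 1) * TB x \<and> b < Suc (t + len x + 1) * TB x \<and>
      E1 x (okd x d t q) (t + len x + 1) a b}\<^sup>*", OF r1[OF PF_var[of 4] PF_var[of 5]] that])
  have r2': "PP (\<lambda>e. (A e, B e) \<in> {(a, b). a < TB (V0 e) * TB (V0 e) \<and> b < TB (V0 e) * TB (V0 e) \<and>
      E2 (V0 e) (okd (V0 e) (V1 e) (V2 e) (V3 e) (V2 e + len (V0 e) + 1)) a b}\<^sup>*)"
    if "PF V0" "PF V1" "PF V2" "PF V3" "PF A" "PF B" for A B V0 V1 V2 V3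
    by (rule PP_comp6[where f = "\<lambda>x d t q a b. (a, b) \<in> {(a, b). a < TB x * TB x \<and> b < TB x * TB x \<and>
      E2 x (okd x d t q (t + len x + 1)) a b}\<^sup>*", OF r2[OF PF_var[of 4] PF_var[of 5]] that])
  have e2: "PP (\<lambda>e. E2 (V0 e) (okd (V0 e) (V1 e) (V2 e) (V3 e) (V2 e + len (V0 e) + 1)) (A e) (B e))"
    if "PF V0" "PF V1" "PF V2" "PF V3" "PF A" "PF B" for A B V0 V1 V2 V3
  proof (rule PP_comp6[where f = "\<lambda>x d t q a b. E2 x (okd x d t q (t + len x + 1)) a b", OF _ that])
    show "PP (\<lambda>e. E2 (e 0) (okd (e 0) (e 1) (e 2) (e 3) (e 2 + len (e 0) + 1)) (e 4) (e 5))" unfolding E2_def by (intro pf)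
  qed
  show "PP (\<lambda>e. satisf (e 0) (e 1) (e 2) (e 3))" unfolding satisf_def lasso_def by (intro pf r1' r2' e2)
qed

section \<open>Canonical models\<close>

text \<open>Literals commute with intersections of interpretations, since \<open>Always\<close> and
  \<open>Next\<close> only shift or universally quantify the time; for \<open>Bot\<close> the family
  must not be empty.\<close>

lemma Inter_literal:
  assumes "S \<noteq> {}" "C \<in> horn_literals"
  shows "sat (\<lambda>n. \<Inter>I\<in>S. I n) n C \<longleftrightarrow> (\<forall>I\<in>S. sat I n C)"
  using assms(2)
proof (induction arbitrary: n)
  case (3 C)
  then show ?case unfolding sat_Always by blast
next
  case (4 C)
  then show ?case unfolding sat_Next by blast
qed (use assms(1) in auto)

lemma Inter_axiom:
  assumes "S \<noteq> {}" "\<alpha> \<in> horn_axioms" "\<forall>I\<in>S. sat I n \<alpha>"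
  shows "sat (\<lambda>n. \<Inter>I\<in>S. I n) n \<alpha>"
proof -
  obtain Cs C where \<alpha>: "\<alpha> = Imp (Conj Cs) C" "set Cs \<subseteq> horn_literals" "C \<in> horn_literals"
    using assms(2) unfolding horn_axioms_def by blast
  have "\<forall>I\<in>S. sat I n C" if "\<forall>D\<in>set Cs. \<forall>I\<in>S. sat I n D"
    using assms(3) that unfolding \<alpha>(1) sat_Imp sat_Conj by blast
  moreover have "sat (\<lambda>n. \<Inter>I\<in>S. I n) n D \<longleftrightarrow> (\<forall>I\<in>S. sat I n D)" if "D \<in> set Cs" for D
    using Inter_literal[OF assms(1)] that \<alpha>(2) by blast
  ultimately show ?thesis unfolding \<alpha>(1) sat_Imp sat_Conj Inter_literal[OF assms(1) \<alpha>(3)] by blast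
qed

lemma path_queries_subset: "\<kappa> \<in> path_queries \<Phi> \<Longrightarrow> \<kappa> \<in> queries \<Phi>"
proof (induction rule: path_queries.induct)
  case (1 As)
  show ?case by (induction As) (auto intro: queries.intros(1,2,4))
next
  case (2 op \<kappa> As)
  have "Conj (map Atom As) \<in> queries \<Phi>" by (induction As) (auto intro: queries.intros(1,2,4))
  then show ?case by (rule queries.intros(4)[OF _ queries.intros(5)[OF 2(1,3)]])
qed

lemma sat_query_mono:
  assumes "\<Phi> \<subseteq> {Next, Eventually}" "\<And>n. I n \<subseteq> J n"
  shows "\<kappa> \<in> queries \<Phi> \<Longrightarrow> sat I n \<kappa> \<Longrightarrow> sat J n \<kappa>"
proof (induction arbitrary: n rule: queries.induct)
  case (5 op \<kappa>)
  have "op = Next \<or> op = Eventually" using 5(1) assms(1) by auto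
  then show ?case
  proof
    assume op: "op = Next"
    show ?thesis using 5(4) 5(3) unfolding op sat_Next by blast
  next
    assume op: "op = Eventually"
    show ?thesis using 5(4) 5(3) unfolding op sat_Eventually by blast
  qed
qed (use assms(2) in auto)

definition can :: "ltl list \<Rightarrow> (nat \<times> nat) list \<Rightarrow> interp" where
  "can Os fs = (\<lambda>n. \<Inter>I\<in>{I. cmodel I Os fs}. I n)"

lemma can_le: "cmodel I Os fs \<Longrightarrow> can Os fs n \<subseteq> I n"
  unfolding can_def by blast

lemma cmodel_can:
  assumes "cmodel I Os fs" "set Os \<subseteq> horn_axioms"
  shows "cmodel (can Os fs) Os fs"
  unfolding cmodel_def
proof
  have ne: "{I. cmodel I Os fs} \<noteq> {}" using assms(1) by blast
  show "model (can Os fs) (set Os)" unfolding model_def can_def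
  proof (intro ballI allI)
    fix \<alpha> n assume a: "\<alpha> \<in> set Os"
    have "\<forall>I\<in>{I. cmodel I Os fs}. sat I n \<alpha>" using a unfolding cmodel_def model_def by blast
    then show "sat (\<lambda>n. \<Inter>I\<in>{I. cmodel I Os fs}. I n) n \<alpha>"
      by (intro Inter_axiom[OF ne]) (use a assms(2) in auto)
  qed
  show "satisfies_data (can Os fs) (set fs)" unfolding satisfies_data_def can_def cmodel_def by blast
qed

lemma entails_can:
  assumes "cmodel I Os fs" "set Os \<subseteq> horn_axioms" "\<Phi> \<subseteq> {Next, Eventually}" "\<kappa> \<in> queries \<Phi>"
  shows "entails (set Os) (set fs) \<kappa> \<longleftrightarrow> sat (can Os fs) 0 \<kappa>"
proof
  assume "entails (set Os) (set fs) \<kappa>"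
  then show "sat (can Os fs) 0 \<kappa>" using cmodel_can[OF assms(1,2)] unfolding entails_def cmodel_def by blast
next
  assume s: "sat (can Os fs) 0 \<kappa>"
  show "entails (set Os) (set fs) \<kappa>" unfolding entails_def
  proof (intro allI impI)
    fix J assume "model J (set Os) \<and> satisfies_data J (set fs)"
    then have "cmodel J Os fs" unfolding cmodel_def .
    then show "sat J 0 \<kappa>" using sat_query_mono[OF assms(3) _ assms(4) s, of J] can_le by blast
  qed
qed

lemma entails_inconsistent: "\<not> (\<exists>I. cmodel I Os fs) \<Longrightarrow> entails (set Os) (set fs) \<kappa>"
  unfolding entails_def cmodel_def by blast

section \<open>Periodicity of canonical models\<close>

lemma persist_until:
  assumes nx: "\<And>n. nxt X (\<sigma> n) (\<sigma> (Suc n))" and i: "isU X i"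
  shows "bit (\<sigma> m) i \<Longrightarrow> \<forall>k. m < k \<and> k \<le> m + j \<longrightarrow> \<not> ful X i (\<sigma> k) \<Longrightarrow> bit (\<sigma> (m + j)) i"
proof (induction j)
  case (Suc j)
  then have "bit (\<sigma> (m + j)) i" "\<not> ful X i (\<sigma> (Suc (m + j)))" by auto
  then show ?case using nxt_persist[OF nx i] by simp
qed simp

text \<open>Cut and paste: where two types agree, the future of one time may be replaced by that of
  the other. After \<open>len X\<close> there are no data that could object, and an unfulfilled
  \<open>Until\<close> persists up to the joint, where fairness of the pasted part takes
  over.\<close>

lemma tseq_splice:
  assumes \<sigma>: "tseq X (okd X d t q) \<sigma>" and q: "len X < q" and n: "len X \<le> n" and eq: "\<sigma> n = \<sigma> n'"
  shows "tseq X (okd X d t q) (\<lambda>m. if m \<le> n then \<sigma> m else \<sigma> (m - n + n'))"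
proof -
  let ?s = "\<lambda>m. if m \<le> n then \<sigma> m else \<sigma> (m - n + n')"
  have bnd: "\<sigma> m < TB X" and ok: "okd X d t q m (\<sigma> m)" and nx: "nxt X (\<sigma> m) (\<sigma> (Suc m))" for m
    using \<sigma> unfolding tseq_def by blast+
  have fr: "fair X \<sigma>" using \<sigma> unfolding tseq_def by blast
  have "data_ok X d m \<tau>" if "n \<le> m" for m \<tau>
    unfolding data_ok_def using that n lat_le[of unaryL X] by fastforce
  then have ok': "okd X d t q m (?s m)" for m
    using ok[of m] ok[of "m - n + n'"] q unfolding okd_def by auto
  have nx': "nxt X (?s m) (?s (Suc m))" for m
  proof -
    consider "Suc m \<le> n" | "m = n" | "n < m" by linarith
    then show ?thesis
    proof cases
      case 2
      then show ?thesis using nx[of n'] eq by simp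
    next
      case 3
      then show ?thesis using nx[of "m - n + n'"] by (simp add: Suc_diff_le)
    qed (use nx in simp)
  qed
  have far: "\<exists>m>n. ful X i (?s m)" if i: "isU X i" and b: "bit (\<sigma> (n' + j)) i" for i j
  proof -
    obtain m where m: "m > n' + j" "ful X i (\<sigma> m)" using fr i b unfolding fair_def by blast
    then have "m - n' + n > n" "?s (m - n' + n) = \<sigma> m" by auto
    then show ?thesis using m(2) by metis
  qed
  have "fair X ?s" unfolding fair_def
  proof (intro allI impI, elim conjE)
    fix m i assume i: "isU X i" and b: "bit (?s m) i"
    show "\<exists>k>m. ful X i (?s k)"
    proof (cases "m \<le> n")
      case True
      show ?thesis
      proof (cases "\<exists>k. m < k \<and> k \<le> n \<and> ful X i (\<sigma> k)")
        case True
        then obtain k where "m < k" "k \<le> n" "ful X i (\<sigma> k)" by blast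
        then show ?thesis by (intro exI[of _ k]) simp
      next
        case False
        have "bit (\<sigma> (m + (n - m))) i"
          by (rule persist_until[where \<sigma> = \<sigma>, OF nx i]) (use b \<open>m \<le> n\<close> False in auto)
        then have "bit (\<sigma> (n' + 0)) i" using \<open>m \<le> n\<close> eq by simp
        from far[OF i this] obtain k where "k > n" "ful X i (?s k)" by blast
        then show ?thesis using \<open>m \<le> n\<close> by (intro exI[of _ k]) simp
      qed
    next
      case False
      then have "bit (\<sigma> (m - n + n')) i" using b by simp
      then obtain k where k: "k > m - n + n'" "ful X i (\<sigma> k)" using fr i unfolding fair_def by blast
      then have "k - n' + n > m" "\<not> k - n' + n \<le> n" "k - n' + n - n + n' = k" using False by auto
      then show ?thesis using k(2) by (intro exI[of _ "k - n' + n"]) simp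
    qed
  qed
  then show ?thesis unfolding tseq_def using ok' nx' bnd by simp
qed

text \<open>Splicing at two times of equal type gives a model, in which the least model is
  contained. So the future of one time is included in that of the other and, by symmetry, they
  coincide. Two such times exist among any \<open>TB X + 1\<close> by the pigeonhole
  principle.\<close>

lemma can_period:
  assumes O: "hasw (enc_list enc_ltl Os) X 0" "set Os \<subseteq> horn_axioms" "hasw (enc_list enc_fact fs) X d"
    and I: "cmodel I Os fs"
  shows "\<exists>P>0. P \<le> TB X \<and> per (len X + TB X) P (can Os fs)"
proof -
  let ?C = "can Os fs" and ?q = "Suc (len X)"
  have cC: "cmodel ?C Os fs" by (rule cmodel_can[OF I O(2)])
  obtain \<sigma> where "\<And>n. \<sigma> n < TB X \<and> istyp X ?C n (\<sigma> n)" using ex_typ[of X ?C] by metis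
  then have \<sigma>: "\<And>n. \<sigma> n < TB X" "\<And>n. istyp X ?C n (\<sigma> n)" by blast+
  have ts: "tseq X (okd X d 0 ?q) \<sigma>" by (rule tseq_cmodel[OF O cC \<sigma>]) simp
  have sub: "?C (n + k) \<subseteq> ?C (n' + k)" if n: "len X \<le> n" "\<sigma> n = \<sigma> n'" for n n' k
  proof -
    let ?s = "\<lambda>m. if m \<le> n then \<sigma> m else \<sigma> (m - n + n')"
    have "tseq X (okd X d 0 ?q) ?s" by (rule tseq_splice[OF ts _ n]) simp
    from cmodel_tseq(1)[OF O this] have "?C (n + k) \<subseteq> interp_of X ?s (n + k)" by (rule can_le)
    also have "?s (n + k) = \<sigma> (n' + k)" using n(2) by (cases k) (auto simp: add.commute)
    then have "interp_of X ?s (n + k) \<subseteq> ?C (n' + k)"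
      unfolding interp_of_def using typ_nm[OF \<sigma>(2)[of "n' + k"]] by auto
    finally show ?thesis .
  qed
  let ?A = "{len X..len X + TB X}"
  have "\<not> inj_on \<sigma> ?A"
  proof
    assume "inj_on \<sigma> ?A"
    then have "card ?A \<le> card {..<TB X}" by (rule card_inj_on_le) (use \<sigma>(1) in auto)
    then show False by simp
  qed
  then obtain a b where ab: "a \<in> ?A" "b \<in> ?A" "\<sigma> a = \<sigma> b" "a \<noteq> b" unfolding inj_on_def by blast
  obtain n n' where n: "n \<in> ?A" "n' \<in> ?A" "\<sigma> n = \<sigma> n'" "n < n'"
  proof (cases "a < b")
    case True
    then show ?thesis using that[of a b] ab by blast
  next
    case False
    then show ?thesis using that[of b a] ab by simp
  qed
  have eq: "?C (n' + k) = ?C (n + k)" for k using sub[of n n' k] sub[of n' n k] n by auto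
  have "per (len X + TB X) (n' - n) ?C" unfolding per_def
  proof (intro allI impI)
    fix t assume "len X + TB X \<le> t"
    then have "t + (n' - n) = n' + (t - n)" "t = n + (t - n)" using n by auto
    then show "?C (t + (n' - n)) = ?C t" using eq[of "t - n"] by metis
  qed
  then show ?thesis using n by (intro exI[of _ "n' - n"]) auto
qed

section \<open>Separability as a condition on the input\<close>

lemma per_dvd: "per T P I \<Longrightarrow> P dvd P' \<Longrightarrow> per T P' I"
  unfolding per_def
proof (intro allI impI)
  fix t assume p: "\<forall>t\<ge>T. I (t + P) = I t" "P dvd P'" "T \<le> t"
  then obtain n where "P' = n * P" by (auto simp: dvd_def mult.commute)
  then show "I (t + P') = I t" using per_mult[of T P I t n] p unfolding per_def by simp
qed

lemma path_queries_fresh: "Conj (map Atom [a]) \<in> path_queries \<Phi>"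
  by (rule path_queries.intros)

text \<open>The four query languages: \<open>pth\<close> distinguishes path queries, \<open>wn\<close> allows \<open>Next\<close>.\<close>

definition ops :: "bool \<Rightarrow> (ltl \<Rightarrow> ltl) set" where
  "ops wn = (if wn then {Next, Eventually} else {Eventually})"

definition lang :: "bool \<Rightarrow> bool \<Rightarrow> ltl set" where
  "lang pth wn = (if pth then path_queries (ops wn) else queries (ops wn))"

definition blocks :: "bool \<Rightarrow> bool \<Rightarrow> (nat \<times> nat) set" where
  "blocks pth wn = {(k, K). if wn then (if pth then k = K else k \<le> K) else k = 0 \<and> K = 0}"

lemma Next_neq_Eventually: "Next \<noteq> Eventually"
proof
  assume "Next = Eventually"
  then have "Next Top = Eventually Top" by (rule fun_cong)
  then show False by simp
qed

lemma Next_ops: "Next \<in> ops wn \<longleftrightarrow> wn" "Eventually \<in> ops wn"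
  using Next_neq_Eventually by (auto simp: ops_def)

lemma lang_block:
  assumes "certificates C PS NS T P B KK At" "(k, K) \<in> blocks pth wn" "\<kappa>' \<in> lang pth wn"
  shows "\<exists>\<kappa>\<in>lang pth wn. certificates.block_query C PS v k K \<kappa>' \<kappa>"
proof -
  have o: "wn \<Longrightarrow> Next \<in> ops wn" using Next_ops by blast
  show ?thesis
  proof (cases pth)
    case True
    have "K = k" "k = 0 \<or> Next \<in> ops wn" using assms(2) True o by (auto simp: blocks_def split: if_splits)
    then show ?thesis using certificates.path_block[OF assms(1) Next_ops(2)] assms(3) True by (simp add: lang_def)
  next
    case False
    have "K = 0 \<or> Next \<in> ops wn" "k \<le> K" using assms(2) False o by (auto simp: blocks_def split: if_splits)
    then show ?thesis using certificates.query_block[OF assms(1) Next_ops(2)] assms(3) False by (simp add: lang_def)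
  qed
qed

lemma lang_claim:
  assumes c: "certificates C PS NS T P B (blocks pth wn) At" and "pth \<or> NS = {j}" "\<kappa> \<in> lang pth wn"
    "\<forall>i\<in>PS. sat (C i) (t i) \<kappa>"
  shows "certificates.claim C PS NS T B (blocks pth wn) \<kappa> t"
proof -
  have o: "ops wn \<subseteq> {Next, Eventually}" by (auto simp: ops_def)
  have s: "(Suc k, Suc K) \<in> blocks pth wn" if "Next \<in> ops wn" "(k, K) \<in> blocks pth wn" for k K
    using that Next_ops(1) by (auto simp: blocks_def)
  show ?thesis
  proof (cases pth)
    case True
    then show ?thesis using certificates.path_claim[OF c _ o s] assms(3,4) by (simp add: lang_def)
  next
    case False
    then have NS: "NS = {j}" using assms(2) by simp
    have m: "(k1, max K1 K2) \<in> blocks pth wn" if "(k1, K1) \<in> blocks pth wn" "(k2, K2) \<in> blocks pth wn" for k1 K1 k2 K2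
      using that False by (auto simp: blocks_def split: if_splits)
    show ?thesis using certificates.query_claim[OF c _ o s NS m] assms(3,4) False by (simp add: lang_def)
  qed
qed

lemma Top_lang: "Top \<in> lang pth wn"
proof -
  have "Conj (map Atom []) \<in> path_queries (ops wn)" by (rule path_queries.intros)
  then show ?thesis by (auto simp: lang_def intro: queries.intros(1,2,4))
qed

lemma lang_queries: "\<kappa> \<in> lang pth wn \<Longrightarrow> \<kappa> \<in> queries (ops wn)"
  by (auto simp: lang_def path_queries_subset split: if_splits)

lemma top_cert_iff:
  assumes c: "certificates C PS NS T P B (blocks pth wn) At" and "pth \<or> NS = {j}"
  shows "certificates.top_cert C PS NS T B (blocks pth wn) \<longleftrightarrow>
    (\<exists>\<kappa>\<in>lang pth wn. splits C PS NS \<kappa>)"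
proof
  assume "certificates.top_cert C PS NS T B (blocks pth wn)"
  then show "\<exists>\<kappa>\<in>lang pth wn. splits C PS NS \<kappa>"
    using certificates.cert_sound(2)[OF c lang_block[OF c] Top_lang] by blast
next
  assume "\<exists>\<kappa>\<in>lang pth wn. splits C PS NS \<kappa>"
  then obtain \<kappa> where k: "\<kappa> \<in> lang pth wn" "\<forall>i\<in>PS. sat (C i) 0 \<kappa>" "\<forall>j\<in>NS. \<not> sat (C j) 0 \<kappa>" by blast
  have "certificates.claim C PS NS T B (blocks pth wn) \<kappa> (\<lambda>_. 0)"
    by (rule lang_claim[OF c assms(2) k(1)]) (use k(2) in simp)
  then show "certificates.top_cert C PS NS T B (blocks pth wn)"
    using certificates.claim_top_cert[OF c] k(3) by blast
qed

lemma separate_each: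
  assumes "finite NS" "\<And>j. j \<in> NS \<Longrightarrow> \<exists>\<kappa>\<in>queries \<Phi>. (\<forall>i\<in>PS. sat (C i) 0 \<kappa>) \<and> \<not> sat (C j) 0 \<kappa>"
  shows "\<exists>\<kappa>\<in>queries \<Phi>. splits C PS NS \<kappa>"
  using assms
proof (induction NS rule: finite_induct)
  case empty
  show ?case by (rule bexI[of _ Top]) (auto intro: queries.intros(1,2,4))
next
  case (insert j NS)
  obtain \<kappa>1 where 1: "\<kappa>1 \<in> queries \<Phi>" "\<forall>i\<in>PS. sat (C i) 0 \<kappa>1" "\<not> sat (C j) 0 \<kappa>1" using insert.prems by blast
  have "\<exists>\<kappa>\<in>queries \<Phi>. splits C PS NS \<kappa>"
    by (rule insert.IH) (use insert.prems in blast)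
  then obtain \<kappa>2 where 2: "\<kappa>2 \<in> queries \<Phi>" "\<forall>i\<in>PS. sat (C i) 0 \<kappa>2" "\<forall>j\<in>NS. \<not> sat (C j) 0 \<kappa>2" by blast
  show ?case by (rule bexI[of _ "And \<kappa>1 \<kappa>2"]) (use 1 2 in \<open>auto intro: queries.intros\<close>)
qed

lemma lang_separate:
  assumes c: "\<And>j. j \<in> NS \<Longrightarrow> certificates C PS (if pth then NS else {j}) T P B (blocks pth wn) At" and fin: "finite NS"
  shows "(\<exists>\<kappa>\<in>lang pth wn. splits C PS NS \<kappa>) \<longleftrightarrow>
    (\<forall>j\<in>NS. certificates.top_cert C PS (if pth then NS else {j}) T B (blocks pth wn))"
proof -
  have t: "certificates.top_cert C PS (if pth then NS else {j}) T B (blocks pth wn) \<longleftrightarrow>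
    (\<exists>\<kappa>\<in>lang pth wn. splits C PS (if pth then NS else {j}) \<kappa>)" if "j \<in> NS" for j
    by (rule top_cert_iff[OF c[OF that], of j]) simp
  show ?thesis
  proof (cases pth)
    case True
    show ?thesis
    proof (cases "NS = {}")
      case True
      then show ?thesis using Top_lang by (auto intro: bexI[of _ Top])
    next
      case False
      then show ?thesis using t \<open>pth\<close> by auto
    qed
  next
    case False
    then show ?thesis using t separate_each[OF fin, of "ops wn" PS C] by (auto simp: lang_def)
  qed
qed

definition dataL :: "bool list set" where "dataL = listL factL"

lemma dataL_eq: "dataL = range (enc_list enc_fact)"
  unfolding dataL_def factL_def listL_enc by auto

lemma lat_ontology: "lat (listL axiomL) X i j \<longleftrightarrow> (\<exists>Os. set Os \<subseteq> horn_axioms \<and> hasw (enc_list enc_ltl Os) X i \<and> j = i + length (enc_list enc_ltl Os))"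
  unfolding lat_def axiomL_def listL_enc by blast

abbreviation enc_examples :: "(nat \<times> nat) list list \<Rightarrow> bool list" where
  "enc_examples \<equiv> enc_list (enc_list enc_fact)"

lemma lat_examples: "lat (listL dataL) X i j \<longleftrightarrow> (\<exists>Ds. hasw (enc_examples Ds) X i \<and> j = i + length (enc_examples Ds))"
  unfolding lat_def dataL_eq listL_enc by blast

lemma enc_data_prefix_free: "enc_list enc_fact f @ u = enc_list enc_fact g @ v \<Longrightarrow> f = g \<and> u = v"
  by (rule enc_list_prefix_free[OF enc_fact_prefix_free])

definition dat :: "nat \<Rightarrow> nat \<Rightarrow> (nat \<times> nat) list" where
  "dat X d = (THE fs. hasw (enc_list enc_fact fs) X d)"

lemma dat: "hasw (enc_list enc_fact fs) X d \<Longrightarrow> dat X d = fs"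
  unfolding dat_def
proof (rule the_equality)
  fix gs assume "hasw (enc_list enc_fact fs) X d" "hasw (enc_list enc_fact gs) X d"
  then show "gs = fs" by (intro hasw_unique[of "enc_list enc_fact"]) (rule enc_data_prefix_free)
qed

lemma elem_dat:
  assumes "hasw (enc_examples Ds) X i"
  shows "elem_at dataL X i d \<Longrightarrow> dat X d \<in> set Ds \<and> hasw (enc_list enc_fact (dat X d)) X d"
    and "fs \<in> set Ds \<Longrightarrow> \<exists>d. elem_at dataL X i d \<and> dat X d = fs"
proof -
  assume "elem_at dataL X i d"
  then obtain fs where "fs \<in> set Ds" "hasw (enc_list enc_fact fs) X d"
    using elem_at_sound[of "enc_list enc_fact", OF enc_data_prefix_free assms] unfolding dataL_eq by blast
  then show "dat X d \<in> set Ds \<and> hasw (enc_list enc_fact (dat X d)) X d" using dat by simp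
next
  assume "fs \<in> set Ds"
  then obtain d where "elem_at dataL X i d" "hasw (enc_list enc_fact fs) X d"
    using elem_at_complete[OF assms, of UNIV] unfolding dataL_eq by blast
  then show "\<exists>d. elem_at dataL X i d \<and> dat X d = fs" using dat by blast
qed

lemma image_dat:
  assumes "hasw (enc_examples Ds) X i"
  shows "set ` set Ds = {set (dat X d) | d. elem_at dataL X i d}"
proof (intro set_eqI iffI)
  fix D assume "D \<in> set ` set Ds"
  then obtain fs where fs: "fs \<in> set Ds" "D = set fs" by blast
  obtain d where "elem_at dataL X i d" "dat X d = fs" using elem_dat(2)[OF assms fs(1)] by blast
  then show "D \<in> {set (dat X d) | d. elem_at dataL X i d}" using fs(2) by blast
next
  fix D assume "D \<in> {set (dat X d) | d. elem_at dataL X i d}"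
  then obtain d where "elem_at dataL X i d" "D = set (dat X d)" by blast
  then show "D \<in> set ` set Ds" using elem_dat(1)[OF assms] by blast
qed

lemma ball_dat:
  assumes "hasw (enc_examples Ds) X i"
  shows "(\<forall>D\<in>set ` set Ds. Q D) \<longleftrightarrow> (\<forall>d. elem_at dataL X i d \<longrightarrow> Q (set (dat X d)))"
  unfolding image_dat[OF assms] by blast

text \<open>\<open>Tm\<close> is the start of periodicity in all examples. \<open>Bd\<close> leaves
  room for it and for a common period, a product of at most \<open>Suc (len X)\<close> factors below
  or equal to \<open>TB X\<close>. \<open>NB\<close> bounds the codes of vectors of
  \<open>2 * Suc (len X)\<close> digits in base \<open>Bd X\<close>.\<close>

definition Tm :: "nat \<Rightarrow> nat" where "Tm X = len X + TB X"
definition Bd :: "nat \<Rightarrow> nat" where "Bd X = smash (TB X * 2) (TB X * 2)"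
definition NB :: "nat \<Rightarrow> nat" where "NB X = smash (Bd X) (TB X)"

lemma TB_eq: "TB X = 2 ^ (2 * bl (2 * X + 1))"
  unfolding TB_def smash_def bl_3 by (simp add: mult.commute)

lemma Bd_eq: "Bd X = 2 ^ ((2 * bl (2 * X + 1) + 2) * (2 * bl (2 * X + 1) + 2))"
proof -
  have "TB X * 2 = 2 ^ Suc (2 * bl (2 * X + 1))" unfolding TB_eq by simp
  then show ?thesis unfolding Bd_def smash_def by (simp only: bl_power) simp
qed

lemma Bd_bound: assumes "P \<le> TB X ^ Suc (len X)" shows "Tm X + P \<le> Bd X" "Tm X + 1 < Bd X"
proof -
  let ?L = "bl (2 * X + 1)"
  \<comment> \<open>The first summand and half of nothing else would cover the product of the
    periods; the second one makes room for \<open>TB X\<close> alone, also when the first is small,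
    and \<open>len X\<close> fits in as well.\<close>
  let ?e = "2 * ?L * ?L + 2 * ?L"
  have "TB X ^ Suc (len X) = 2 ^ (2 * ?L * Suc (len X))" unfolding TB_eq by (simp only: power_mult[symmetric])
  also have "\<dots> \<le> 2 ^ ?e" using len_bl[of X] by (intro power_increasing) (auto intro: trans_le_add1 mult_le_mono2)
  finally have P: "P \<le> 2 ^ ?e" using assms by simp
  have T: "TB X \<le> 2 ^ ?e" unfolding TB_eq by (intro power_increasing) auto
  have "len X < 2 ^ ?L" using len_bl[of X] less_exp[of ?L] by linarith
  also have "(2 :: nat) ^ ?L \<le> 2 ^ ?e" by (intro power_increasing) auto
  finally have l: "len X < 2 ^ ?e" .
  have "(4 :: nat) * 2 ^ ?e = 2 ^ (?e + 2)" by (simp add: power_add)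
  also have "\<dots> \<le> Bd X" unfolding Bd_eq by (intro power_increasing) (auto simp: algebra_simps)
  finally have B: "4 * 2 ^ ?e \<le> Bd X" .
  have "(1 :: nat) \<le> 2 ^ ?e" by simp
  then show "Tm X + P \<le> Bd X" "Tm X + 1 < Bd X" using P T l B unfolding Tm_def by linarith+
qed

lemma NB_bound: "Bd X ^ (2 * Suc (len X)) \<le> NB X"
proof -
  obtain b where b: "Bd X = 2 ^ b" unfolding Bd_eq by blast
  have "bl (TB X) = Suc (2 * bl (2 * X + 1))" unfolding TB_eq by simp
  then have "2 * Suc (len X) \<le> bl (TB X)" using len_bl[of X] by simp
  then have "b * (2 * Suc (len X)) \<le> bl (Bd X) * bl (TB X)" unfolding b bl_power by (intro mult_mono) auto
  then have "(2 :: nat) ^ (b * (2 * Suc (len X))) \<le> 2 ^ (bl (Bd X) * bl (TB X))" by (intro power_increasing) auto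
  then show ?thesis unfolding NB_def smash_def b power_mult .
qed

lemma Bd_pos: "0 < Bd X"
  by (simp add: Bd_eq)

definition dig :: "nat \<Rightarrow> nat \<Rightarrow> nat \<Rightarrow> nat" where
  "dig X V i = (V div powm (Bd X) i (Suc V)) mod Bd X"

lemma dig_eq: "dig X V i = (V div Bd X ^ i) mod Bd X"
proof -
  have "V div min (Bd X ^ i) (Suc V) = V div Bd X ^ i"
    by (cases "Bd X ^ i \<le> Suc V") (simp_all add: min_def)
  then show ?thesis using powm[of "Bd X" i "Suc V"] Bd_pos[of X] unfolding dig_def by simp
qed

lemma dig_less: "dig X V i < Bd X"
  unfolding dig_def using Bd_pos by simp

lemma dig_0: "dig X 0 i = 0"
  by (simp add: dig_def)

lemma ex_digits: "(\<And>i. i < M \<Longrightarrow> u i < b) \<Longrightarrow> \<exists>V<b ^ M. \<forall>i<M. (V div b ^ i) mod b = (u i :: nat)"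
proof (induction M)
  case (Suc M)
  then obtain V where V: "V < b ^ M" "\<forall>i<M. (V div b ^ i) mod b = u i" by auto
  have b: "0 < b" using Suc.prems[of M] by simp
  let ?V = "u M * b ^ M + V"
  have "(?V div b ^ i) mod b = u i" if "i < Suc M" for i
  proof (cases "i = M")
    case True
    then show ?thesis using digit(2)[OF V(1), of "u M"] Suc.prems[of M] by simp
  next
    case False
    then have i: "i < M" using that by simp
    then have e: "b ^ M = b ^ i * (b * b ^ (M - Suc i))" by (metis Suc_diff_Suc le_add_diff_inverse less_imp_le power_Suc power_add)
    have "?V div b ^ i = u M * (b * b ^ (M - Suc i)) + V div b ^ i"
    proof -
      have v: "?V = V + b ^ i * (u M * (b * b ^ (M - Suc i)))" unfolding e by (simp only: ac_simps)
      have "b ^ i \<noteq> 0" using b by simp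
      from div_mult_self2[OF this] show ?thesis unfolding v .
    qed
    then have "(?V div b ^ i) mod b = (V div b ^ i + b * (u M * b ^ (M - Suc i))) mod b" by (simp add: ac_simps)
    then show ?thesis using V(2) i by simp
  qed
  moreover have "?V < b ^ Suc M" using code_less[of "u M" b V "b ^ M"] Suc.prems[of M] V(1) by simp
  ultimately show ?case by blast
qed simp

lemma ex_dig: assumes "\<And>i. i < 2 * Suc (len X) \<Longrightarrow> u i < Bd X"
  shows "\<exists>V<NB X. \<forall>i<2 * Suc (len X). dig X V i = u i"
  using ex_digits[of "2 * Suc (len X)" u "Bd X", OF assms] NB_bound[of X] unfolding dig_eq by (meson order_less_le_trans)

section \<open>Separability in polynomial space\<close>

definition consX :: "nat \<Rightarrow> nat \<Rightarrow> bool" where "consX X d \<longleftrightarrow> satisf X d 0 (Suc (len X))"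

definition posX :: "nat \<Rightarrow> nat \<Rightarrow> nat \<Rightarrow> bool" where
  "posX X j d \<longleftrightarrow> elem_at dataL X j d \<and> consX X d"

text \<open>For path queries all negative examples are treated together; otherwise \<open>c\<close>
  is the one under consideration.\<close>

definition negX :: "bool \<Rightarrow> nat \<Rightarrow> nat \<Rightarrow> nat \<Rightarrow> nat \<Rightarrow> bool" where
  "negX pth X k c d \<longleftrightarrow> elem_at dataL X k d \<and> (pth \<or> d = c)"

text \<open>Examples are identified by their positions in the input and atoms by positions of their
  names. An atom belongs to a canonical model exactly if its falsity is unsatisfiable. Digit
  \<open>2 * p\<close> of a vector belongs to the positive example at \<open>p\<close>, digit
  \<open>2 * d + 1\<close> to the negative one at \<open>d\<close>.\<close>

definition misX :: "nat \<Rightarrow> nat \<Rightarrow> nat \<Rightarrow> nat \<Rightarrow> nat \<Rightarrow> nat \<Rightarrow> bool" where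
  "misX X j V l d s \<longleftrightarrow> (\<exists>q\<le>len X. (\<exists>k\<le>len X. lat nameL X q k) \<and>
     (\<forall>p\<le>len X. posX X j p \<longrightarrow> \<not> satisf X p (dig X V (2 * p) + l) q) \<and> satisf X d (s + l) q)"

definition kk :: "bool \<Rightarrow> bool \<Rightarrow> nat \<Rightarrow> nat \<Rightarrow> bool" where
  "kk pth wn k K \<longleftrightarrow> (if wn then (if pth then k = K else k \<le> K) else k = 0 \<and> K = 0)"

definition estX :: "bool \<Rightarrow> bool \<Rightarrow> nat \<Rightarrow> nat \<Rightarrow> nat \<Rightarrow> nat \<Rightarrow> nat \<Rightarrow> nat \<Rightarrow> bool" where
  "estX pth wn X j i c V W \<longleftrightarrow> (\<exists>k\<le>Bd X. \<exists>K\<le>Bd X. kk pth wn k K \<and>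
     (\<forall>p\<le>len X. posX X j p \<longrightarrow> Tm X \<le> dig X W (2 * p) \<or> dig X V (2 * p) + k < dig X W (2 * p)) \<and>
     (\<forall>d\<le>len X. negX pth X i c d \<longrightarrow> (\<forall>s<Bd X. dig X V (2 * d + 1) \<le> s \<and> dig X V (2 * d + 1) \<le> Tm X \<longrightarrow>
        (\<exists>l\<le>K. misX X j V l d s) \<or> dig X W (2 * d + 1) \<le> Suc (s + k) \<and> dig X W (2 * d + 1) \<le> Tm X)))"

text \<open>All digits of 0 are 0, so that the vector 0 stands for the initial time in every
  example.\<close>

definition topX :: "bool \<Rightarrow> bool \<Rightarrow> nat \<Rightarrow> nat \<Rightarrow> nat \<Rightarrow> nat \<Rightarrow> bool" where
  "topX pth wn X j i c \<longleftrightarrow> (\<exists>V<NB X. (\<exists>W<NB X.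
      (V, W) \<in> {(a, b). a < NB X \<and> b < NB X \<and> estX pth wn X j i c a b}\<^sup>* \<and>
      (\<forall>d\<le>len X. negX pth X i c d \<longrightarrow> Tm X < dig X W (2 * d + 1))) \<and>
    (\<exists>k\<le>Bd X. \<exists>K\<le>Bd X. kk pth wn k K \<and>
     (\<forall>p\<le>len X. posX X j p \<longrightarrow> Tm X \<le> dig X V (2 * p) \<or> k < dig X V (2 * p)) \<and>
     (\<forall>d\<le>len X. negX pth X i c d \<longrightarrow>
        (\<exists>l\<le>K. misX X j 0 l d 0) \<or> dig X V (2 * d + 1) \<le> Suc k \<and> dig X V (2 * d + 1) \<le> Tm X)))"

text \<open>Inconsistent examples entail every query: a negative one excludes separability, a
  positive one can be ignored. If no consistent positive example remains, an atom that does not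
  occur in the input separates.\<close>

definition sepX :: "bool \<Rightarrow> bool \<Rightarrow> nat \<Rightarrow> nat \<Rightarrow> nat \<Rightarrow> bool" where
  "sepX pth wn X j i \<longleftrightarrow> (\<forall>d\<le>len X. elem_at dataL X i d \<longrightarrow> consX X d) \<and>
     ((\<forall>d\<le>len X. \<not> posX X j d) \<or> (\<forall>c\<le>len X. elem_at dataL X i c \<longrightarrow> topX pth wn X j i c))"

lemma elem_at_le: "elem_at L X i d \<Longrightarrow> d \<le> len X"
  unfolding elem_at_def hasw_single by auto

lemma half_less: "n div 2 \<le> l \<Longrightarrow> n < 2 * Suc l" for n l :: nat
  by presburger

locale qbe_input =
  fixes X j i :: nat and Os :: "ltl list" and Ps Ns :: "(nat \<times> nat) list list"
  assumes Os: "hasw (enc_list enc_ltl Os) X 0" "set Os \<subseteq> horn_axioms"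
    and Ps: "hasw (enc_examples Ps) X j"
    and Ns: "hasw (enc_examples Ns) X i"
begin

text \<open>Doubling the positions keeps the indices of positive and negative examples apart by
  parity, without an argument about where the two lists lie.\<close>

definition C :: "nat \<Rightarrow> interp" where "C n = can Os (dat X (n div 2))"

definition PS :: "nat set" where "PS = {2 * d | d. posX X j d}"

definition NS :: "bool \<Rightarrow> nat \<Rightarrow> nat set" where "NS pth c = {2 * d + 1 | d. negX pth X i c d}"

lemma data_elem: "elem_at dataL X j d \<or> elem_at dataL X i d \<Longrightarrow> hasw (enc_list enc_fact (dat X d)) X d"
  using elem_dat(1)[OF Ps] elem_dat(1)[OF Ns] by blast

lemma cons_iff:
  assumes "elem_at dataL X j d \<or> elem_at dataL X i d"
  shows "consX X d \<longleftrightarrow> (\<exists>I. cmodel I Os (dat X d))"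
proof -
  have "satisf X d 0 (Suc (len X)) \<longleftrightarrow> (\<exists>I. cmodel I Os (dat X d) \<and> (Suc (len X) \<le> len X \<longrightarrow> undefined \<notin> I 0))"
    by (rule satisf_iff(2)[OF Os data_elem[OF assms]]) simp
  then show ?thesis unfolding consX_def by simp
qed

lemma satisf_can:
  assumes "elem_at dataL X j d \<or> elem_at dataL X i d" "consX X d" "nm X q a"
  shows "satisf X d t q \<longleftrightarrow> a \<notin> can Os (dat X d) t"
proof -
  have "q \<le> len X" using nm_le[OF assms(3)] by simp
  then have "satisf X d t q \<longleftrightarrow> (\<exists>I. cmodel I Os (dat X d) \<and> a \<notin> I t)"
    using satisf_iff(2)[OF Os data_elem[OF assms(1)], of q a t] assms(3) by simp
  then show ?thesis unfolding can_def by blast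
qed

definition named :: "nat set" where "named = {a. \<exists>q. nm X q a}"

lemma finite_named: "finite named"
proof -
  have "named \<subseteq> (\<lambda>q. THE a. nm X q a) ` {..len X}"
  proof
    fix a assume "a \<in> named"
    then obtain q where q: "nm X q a" unfolding named_def by blast
    then have "(THE a. nm X q a) = a" using nm_unique by blast
    then show "a \<in> (\<lambda>q. THE a. nm X q a) ` {..len X}" using nm_le[OF q] by (intro image_eqI[of _ _ q]) auto
  qed
  then show ?thesis by (rule finite_subset) simp
qed

lemma can_named:
  assumes "elem_at dataL X j d \<or> elem_at dataL X i d" "consX X d"
  shows "can Os (dat X d) t \<subseteq> named"
proof -
  obtain I where I: "cmodel I Os (dat X d)" "\<forall>n. I n \<subseteq> {a. \<exists>q. nm X q a}"
    using satisf_iff(1)[OF Os data_elem[OF assms(1)], of "Suc (len X)" undefined 0] assms(2) unfolding consX_def by auto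
  then show ?thesis using can_le[OF I(1)] unfolding named_def by blast
qed

definition period :: "nat \<Rightarrow> nat" where
  "period d = (SOME P. 0 < P \<and> P \<le> TB X \<and> per (Tm X) P (can Os (dat X d)))"

lemma period:
  assumes "elem_at dataL X j d \<or> elem_at dataL X i d" "consX X d"
  shows "0 < period d \<and> period d \<le> TB X \<and> per (Tm X) (period d) (can Os (dat X d))"
proof -
  obtain I where "cmodel I Os (dat X d)" using assms(2) unfolding cons_iff[OF assms(1)] by blast
  from can_period[OF Os data_elem[OF assms(1)] this] have
    "\<exists>P. 0 < P \<and> P \<le> TB X \<and> per (Tm X) P (can Os (dat X d))" unfolding Tm_def by blast
  then show ?thesis unfolding period_def by (rule someI_ex)
qed

definition Dx :: "nat set" where "Dx = {d. (elem_at dataL X j d \<or> elem_at dataL X i d) \<and> consX X d}"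

text \<open>Any common multiple of the periods will do; the product has an easy exponential
  bound.\<close>

definition PP0 :: nat where "PP0 = (\<Prod>d\<in>Dx. period d)"

lemma Dx_sub: "Dx \<subseteq> {..len X}"
  unfolding Dx_def using elem_at_le by blast

lemma PP0: "0 < PP0" "PP0 \<le> TB X ^ Suc (len X)" "d \<in> Dx \<Longrightarrow> per (Tm X) PP0 (can Os (dat X d))"
proof -
  have f: "finite Dx" using Dx_sub by (rule finite_subset) simp
  have p: "0 < period d \<and> period d \<le> TB X \<and> per (Tm X) (period d) (can Os (dat X d))" if "d \<in> Dx" for d
    using period that unfolding Dx_def by blast
  show "0 < PP0" unfolding PP0_def using p by (intro prod_pos) blast
  have "PP0 \<le> (\<Prod>d\<in>Dx. TB X)" unfolding PP0_def using p by (intro prod_mono) simp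
  also have "\<dots> = TB X ^ card Dx" by simp
  also have "\<dots> \<le> TB X ^ Suc (len X)"
    using card_mono[OF _ Dx_sub] TB_pos[of X] by (intro power_increasing) auto
  finally show "PP0 \<le> TB X ^ Suc (len X)" .
  assume d: "d \<in> Dx"
  have "period d dvd PP0" unfolding PP0_def using f d by (rule dvd_prodI)
  then show "per (Tm X) PP0 (can Os (dat X d))" using p[OF d] per_dvd by blast
qed

lemma PS_D: "n \<in> PS \<Longrightarrow> n div 2 \<in> Dx \<and> n = 2 * (n div 2) \<and> posX X j (n div 2)"
  unfolding PS_def Dx_def posX_def by auto

lemma NS_D: "n \<in> NS pth c \<Longrightarrow> n = 2 * (n div 2) + 1 \<and> negX pth X i c (n div 2)"
  unfolding NS_def by auto

lemma certs:
  assumes "\<forall>d\<le>len X. elem_at dataL X i d \<longrightarrow> consX X d" "PS \<noteq> {}"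
  shows "certificates C PS (NS pth c) (Tm X) PP0 (Bd X) (blocks pth' wn) named"
proof
  fix n assume n: "n \<in> PS \<union> NS pth c"
  have "n div 2 \<in> Dx"
  proof (cases "n \<in> PS")
    case False
    then have "elem_at dataL X i (n div 2)" using n NS_D unfolding negX_def by blast
    then show ?thesis using assms(1) elem_at_le unfolding Dx_def by blast
  qed (use PS_D in blast)
  then show "per (Tm X) PP0 (C n)" unfolding C_def by (rule PP0(3))
next
  show "0 < PP0" by (rule PP0(1))
  show "Tm X + PP0 \<le> Bd X" "Tm X + 1 < Bd X" using Bd_bound[OF PP0(2)] by blast+
  show "PS \<noteq> {}" by (rule assms(2))
  show "finite named" by (rule finite_named)
  show "C n t \<subseteq> named" if "n \<in> PS" for n t
    unfolding C_def using PS_D[OF that] can_named unfolding Dx_def by blast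
  show "PS \<inter> NS pth c = {}"
  proof (rule ccontr)
    assume "PS \<inter> NS pth c \<noteq> {}"
    then obtain n where "n \<in> PS" "n \<in> NS pth c" by blast
    then show False using PS_D[of n] NS_D[of n pth c] by linarith
  qed
  show "(0, 0) \<in> blocks pth' wn" by (auto simp: blocks_def)
  show "(min k b, min K b) \<in> blocks pth' wn" if "(k, K) \<in> blocks pth' wn" for k K b
    using that by (auto simp: blocks_def split: if_splits)
qed

context
  assumes Ncons: "\<forall>d\<le>len X. elem_at dataL X i d \<longrightarrow> consX X d" and PSne: "PS \<noteq> {}"
begin

lemma mism_iff:
  assumes "negX pth X i c d"
  shows "certificates.mism C PS (dig X V) l (2 * d + 1) s \<longleftrightarrow> misX X j V l d s"
proof -
  interpret certificates C PS "NS pth c" "Tm X" PP0 "Bd X" "blocks pth wn" named by (rule certs[OF Ncons PSne])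
  have d: "elem_at dataL X j d \<or> elem_at dataL X i d" "consX X d" using assms Ncons elem_at_le unfolding negX_def by blast+
  have p: "elem_at dataL X j p \<or> elem_at dataL X i p" "consX X p" "p \<le> len X" if "posX X j p" for p
    using that elem_at_le unfolding posX_def by blast+
  have Cd: "C (2 * d + 1) = can Os (dat X d)" "C (2 * p) = can Os (dat X p)" for p by (simp_all add: C_def)
  have all: "(\<forall>n\<in>PS. a \<in> C n (dig X V n + l)) \<longleftrightarrow> (\<forall>p. posX X j p \<longrightarrow> a \<in> can Os (dat X p) (dig X V (2 * p) + l))" for a
    unfolding PS_def using Cd(2) by auto
  show ?thesis
  proof
    assume "mism (dig X V) l (2 * d + 1) s"
    then obtain a where a: "\<forall>p. posX X j p \<longrightarrow> a \<in> can Os (dat X p) (dig X V (2 * p) + l)" "a \<notin> can Os (dat X d) (s + l)"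
      unfolding mism_def all Cd by blast
    obtain n where "n \<in> PS" using PSne by blast
    then have n: "posX X j (n div 2)" using PS_D by blast
    then have "a \<in> named" using a(1) can_named[OF p(1,2)] by blast
    then obtain q where q: "nm X q a" unfolding named_def by blast
    have "\<exists>k\<le>len X. lat nameL X q k" using q nm_le[OF q] unfolding lat_nameL by blast
    moreover have "\<forall>p\<le>len X. posX X j p \<longrightarrow> \<not> satisf X p (dig X V (2 * p) + l) q"
      using a(1) satisf_can[OF p(1,2) q] by blast
    moreover have "satisf X d (s + l) q" using a(2) satisf_can[OF d q] by blast
    ultimately show "misX X j V l d s" unfolding misX_def using nm_le[OF q] by blast
  next
    assume "misX X j V l d s"
    then obtain q k where q: "lat nameL X q k" "\<forall>p\<le>len X. posX X j p \<longrightarrow> \<not> satisf X p (dig X V (2 * p) + l) q"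
      "satisf X d (s + l) q" unfolding misX_def by blast
    obtain a where a: "nm X q a" using q(1) unfolding lat_nameL by blast
    have "\<forall>p. posX X j p \<longrightarrow> a \<in> can Os (dat X p) (dig X V (2 * p) + l)"
      using q(2) p(3) satisf_can[OF p(1,2) a] by blast
    moreover have "a \<notin> can Os (dat X d) (s + l)" using q(3) satisf_can[OF d a] by blast
    ultimately show "mism (dig X V) l (2 * d + 1) s" unfolding mism_def all Cd by blast
  qed
qed

lemma kk_blocks: "(k, K) \<in> blocks pth wn \<longleftrightarrow> kk pth wn k K"
  by (simp add: blocks_def kk_def)

lemma ball_PS: "(\<forall>n\<in>PS. Q n) \<longleftrightarrow> (\<forall>p\<le>len X. posX X j p \<longrightarrow> Q (2 * p))"
  unfolding PS_def posX_def using elem_at_le by blast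

lemma ball_NS: "(\<forall>n\<in>NS pth c. Q n) \<longleftrightarrow> (\<forall>d\<le>len X. negX pth X i c d \<longrightarrow> Q (2 * d + 1))"
  unfolding NS_def negX_def using elem_at_le by blast

lemma est_iff:
  "certificates.est C PS (NS pth c) (Tm X) (Bd X) (blocks pth wn) (dig X V) (dig X W) \<longleftrightarrow> estX pth wn X j i c V W"
proof -
  interpret certificates C PS "NS pth c" "Tm X" PP0 "Bd X" "blocks pth wn" named by (rule certs[OF Ncons PSne])
  show ?thesis unfolding est_def estX_def blk_def ball_PS ball_NS kk_blocks
    using mism_iff[of pth c _ V] by (intro ex_cong1 conj_cong all_cong1 imp_cong refl) auto
qed

text \<open>Certificates are functions on all indices while vertices are numbers. The transfer works
  because \<open>est\<close>, \<open>blk\<close> and the final condition depend on the indices of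
  examples only, and bounded values at these are the digits of some number.\<close>

lemma top_iff:
  "certificates.top_cert C PS (NS pth c) (Tm X) (Bd X) (blocks pth wn) \<longleftrightarrow> topX pth wn X j i c"
proof -
  interpret certificates C PS "NS pth c" "Tm X" PP0 "Bd X" "blocks pth wn" named by (rule certs[OF Ncons PSne])
  let ?R = "{(a, b). a < NB X \<and> b < NB X \<and> estX pth wn X j i c a b}"
  have bnd: "bnd (dig X V)" for V unfolding bnd_def using dig_less by blast
  have idx: "n < 2 * Suc (len X)" if "n \<in> PS \<union> NS pth c" for n
  proof -
    have "n div 2 \<le> len X" using that PS_D NS_D elem_at_le unfolding posX_def negX_def by blast
    then show ?thesis by (rule half_less)
  qed
  have code: "\<exists>V<NB X. \<forall>n\<in>PS \<union> NS pth c. dig X V n = v n" if "bnd v" for v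
  proof -
    let ?u = "\<lambda>n. if n \<in> PS \<union> NS pth c then v n else 0"
    have "?u n < Bd X" for n using that Bd_pos unfolding bnd_def by simp
    then obtain V where V: "V < NB X" "\<forall>n<2 * Suc (len X). dig X V n = ?u n"
      using ex_dig[of X ?u] by blast
    have "dig X V n = v n" if n: "n \<in> PS \<union> NS pth c" for n using V(2)[rule_format, OF idx[OF n]] n by simp
    then show ?thesis using V(1) by blast
  qed
  have cong_mism: "mism v l n s = mism w l n s" if "\<forall>n\<in>PS \<union> NS pth c. v n = w n" for v w l n s
    using that unfolding mism_def by auto
  have cong_blk: "blk v k K v' n s = blk w k K w' n s"
    if "\<forall>n\<in>PS \<union> NS pth c. v n = w n" "\<forall>n\<in>PS \<union> NS pth c. v' n = w' n" "n \<in> NS pth c" for v w v' w' k K n s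
    using cong_mism[OF that(1)] that(2,3) unfolding blk_def by auto
  have cong: "est v v' \<Longrightarrow> est w w'"
    if "\<forall>n\<in>PS \<union> NS pth c. v n = w n" "\<forall>n\<in>PS \<union> NS pth c. v' n = w' n" for v w v' w'
    unfolding est_def using that cong_blk[OF that] by (metis UnI1 UnI2)
  have 1: "(V, W) \<in> ?R\<^sup>* \<Longrightarrow> \<forall>n\<in>NS pth c. Tm X < dig X W n \<Longrightarrow> cert (dig X V)" for V W
  proof (induction rule: converse_rtrancl_induct)
    case base
    then show ?case by (intro cert.base bnd) blast
  next
    case (step V U)
    have "est (dig X V) (dig X U)" using step.hyps(1) est_iff by blast
    then show ?case using step by (intro cert.step[OF bnd]) blast+
  qed
  have 2: "cert v \<Longrightarrow> \<exists>V<NB X. (\<forall>n\<in>PS \<union> NS pth c. dig X V n = v n) \<and>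
      (\<exists>W<NB X. (V, W) \<in> ?R\<^sup>* \<and> (\<forall>n\<in>NS pth c. Tm X < dig X W n))" for v
  proof (induction rule: cert.induct)
    case (base v)
    obtain V where V: "V < NB X" "\<forall>n\<in>PS \<union> NS pth c. dig X V n = v n" using code[OF base(2)] by blast
    have "\<forall>n\<in>NS pth c. Tm X < dig X V n" using V(2) base(1) by simp
    then show ?case using V by blast
  next
    case (step v v')
    obtain U W where U: "U < NB X" "\<forall>n\<in>PS \<union> NS pth c. dig X U n = v' n" and W: "W < NB X" "(U, W) \<in> ?R\<^sup>*"
      "\<forall>n\<in>NS pth c. Tm X < dig X W n" using step.IH by blast
    obtain V where V: "V < NB X" "\<forall>n\<in>PS \<union> NS pth c. dig X V n = v n" using code[OF step.hyps(1)] by blast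
    have "est (dig X V) (dig X U)" by (rule cong[OF _ _ step.hyps(2)]) (use U(2) V(2) in auto)
    then have "(V, U) \<in> ?R" using U(1) V(1) est_iff by blast
    then have "(V, W) \<in> ?R\<^sup>*" using W(2) by (rule converse_rtrancl_into_rtrancl)
    then show ?case using V W by blast
  qed
  let ?top = "\<lambda>v. \<exists>k\<le>Bd X. \<exists>K\<le>Bd X. (k, K) \<in> blocks pth wn \<and> (\<forall>n\<in>PS. Tm X \<le> v n \<or> k < v n) \<and>
     (\<forall>n\<in>NS pth c. blk (\<lambda>_. 0) k K v n 0)"
  have top_cong: "?top v \<Longrightarrow> ?top w" if "\<forall>n\<in>PS \<union> NS pth c. v n = w n" for v w
  proof -
    have "blk (\<lambda>_. 0) k K v n 0 = blk (\<lambda>_. 0) k K w n 0" if "n \<in> NS pth c" for k K n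
      by (rule cong_blk) (use that \<open>\<forall>n\<in>PS \<union> NS pth c. v n = w n\<close> in auto)
    moreover have "v n = w n" if "n \<in> PS" for n using that \<open>\<forall>n\<in>PS \<union> NS pth c. v n = w n\<close> by blast
    ultimately show "?top v \<Longrightarrow> ?top w" by (simp cong: conj_cong)
  qed
  have "top_cert \<longleftrightarrow> (\<exists>V<NB X. (\<exists>W<NB X. (V, W) \<in> ?R\<^sup>* \<and> (\<forall>n\<in>NS pth c. Tm X < dig X W n)) \<and> ?top (dig X V))" (is "_ \<longleftrightarrow> ?E")
  proof
    assume top_cert
    then obtain v where v: "cert v" "?top v" unfolding top_cert_def by blast
    obtain V W where V: "V < NB X" "\<forall>n\<in>PS \<union> NS pth c. dig X V n = v n" "W < NB X" "(V, W) \<in> ?R\<^sup>*" "\<forall>n\<in>NS pth c. Tm X < dig X W n"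
      using 2[OF v(1)] by blast
    have "?top (dig X V)" by (rule top_cong[OF _ v(2)]) (use V(2) in auto)
    then show ?E using V by blast
  next
    assume ?E
    then obtain V where "cert (dig X V)" "?top (dig X V)" using 1 by blast
    then show top_cert unfolding top_cert_def by blast
  qed
  also have "\<dots> \<longleftrightarrow> topX pth wn X j i c"
  proof -
    have z: "(\<lambda>_. 0) = dig X 0" by (simp add: fun_eq_iff dig_0)
    show ?thesis unfolding topX_def blk_def ball_PS ball_NS kk_blocks z add_0
      using mism_iff[of pth c _ 0] by (intro ex_cong1 conj_cong all_cong1 imp_cong refl) auto
  qed
  finally show ?thesis .
qed

end

lemma sepX_iff: "separable (lang pth wn) (set Os) (set ` set Ps) (set ` set Ns) \<longleftrightarrow> sepX pth wn X j i"
proof -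
  have opsub: "ops wn \<subseteq> {Next, Eventually}" by (auto simp: ops_def)
  note P = ball_dat[OF Ps] and N = ball_dat[OF Ns]
  have ent: "entails (set Os) (set (dat X d)) \<kappa> \<longleftrightarrow> (consX X d \<longrightarrow> sat (can Os (dat X d)) 0 \<kappa>)"
    if h: "elem_at dataL X j d \<or> elem_at dataL X i d" "\<kappa> \<in> lang pth wn" for d \<kappa>
  proof (cases "consX X d")
    case True
    then obtain I where "cmodel I Os (dat X d)" using cons_iff[OF h(1)] by blast
    then show ?thesis using True entails_can[OF _ Os(2) opsub lang_queries[OF h(2)]] by blast
  next
    case False
    then show ?thesis using entails_inconsistent cons_iff[OF h(1)] by blast
  qed
  have s1: "separable (lang pth wn) (set Os) (set ` set Ps) (set ` set Ns) \<longleftrightarrow>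
    (\<exists>\<kappa>\<in>lang pth wn. (\<forall>d. posX X j d \<longrightarrow> sat (can Os (dat X d)) 0 \<kappa>) \<and>
       (\<forall>d. elem_at dataL X i d \<longrightarrow> consX X d \<and> \<not> sat (can Os (dat X d)) 0 \<kappa>))"
    unfolding separable_def P N posX_def
  proof (intro bex_cong refl)
    fix \<kappa> assume k: "\<kappa> \<in> lang pth wn"
    show "(\<forall>d. elem_at dataL X j d \<longrightarrow> entails (set Os) (set (dat X d)) \<kappa>) \<and>
        (\<forall>d. elem_at dataL X i d \<longrightarrow> \<not> entails (set Os) (set (dat X d)) \<kappa>) \<longleftrightarrow>
      (\<forall>d. elem_at dataL X j d \<and> consX X d \<longrightarrow> sat (can Os (dat X d)) 0 \<kappa>) \<and>
       (\<forall>d. elem_at dataL X i d \<longrightarrow> consX X d \<and> \<not> sat (can Os (dat X d)) 0 \<kappa>)"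
      using ent[OF disjI1 k] ent[OF disjI2 k] by blast
  qed
  show ?thesis
  proof (cases "\<forall>d\<le>len X. elem_at dataL X i d \<longrightarrow> consX X d")
    case False
    then show ?thesis unfolding s1 sepX_def by blast
  next
    case Nc: True
    then have Nc': "elem_at dataL X i d \<Longrightarrow> consX X d" for d using elem_at_le by blast
    show ?thesis
    proof (cases "PS = {}")
      case True
      then have no: "\<not> posX X j d" for d unfolding PS_def by blast
      \<comment> \<open>Canonical models contain named atoms only, so a fresh atom holds in none of
        them.\<close>
      obtain a where a: "a \<notin> named" using ex_new_if_finite[OF _ finite_named] by auto
      let ?\<kappa> = "Conj (map Atom [a])"
      have "?\<kappa> \<in> path_queries (ops wn)" by (rule path_queries_fresh)
      then have "?\<kappa> \<in> lang pth wn" unfolding lang_def using path_queries_subset by auto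
      moreover have "\<not> sat (can Os (dat X d)) 0 ?\<kappa>" if "elem_at dataL X i d" for d
        using can_named[of d 0] that Nc' a by auto
      ultimately show ?thesis unfolding s1 sepX_def using no Nc Nc' by blast
    next
      case PSne: False
      then have yes: "\<not> (\<forall>d\<le>len X. \<not> posX X j d)" unfolding PS_def posX_def using elem_at_le by blast
      let ?N = "{2 * d + 1 | d. elem_at dataL X i d}"
      have NS: "(if pth then ?N else {2 * c + 1}) = NS pth c" if "elem_at dataL X i c" for c
        using that unfolding NS_def negX_def by auto
      have "?N \<subseteq> (\<lambda>d. 2 * d + 1) ` {..len X}" using elem_at_le by blast
      then have fin: "finite ?N" by (rule finite_subset) simp
      have ce: "certificates C PS (if pth then ?N else {n}) (Tm X) PP0 (Bd X) (blocks pth wn) named" if n: "n \<in> ?N" for n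
      proof -
        obtain c where c: "n = 2 * c + 1" "elem_at dataL X i c" using n by blast
        show ?thesis unfolding c(1) NS[OF c(2)] by (rule certs[OF Nc PSne])
      qed
      have tc: "certificates.top_cert C PS (if pth then ?N else {2 * c + 1}) (Tm X) (Bd X) (blocks pth wn) \<longleftrightarrow> topX pth wn X j i c"
        if e: "elem_at dataL X i c" for c
        unfolding NS[OF e] by (rule top_iff[OF Nc PSne])
      have "(\<exists>\<kappa>\<in>lang pth wn. splits C PS ?N \<kappa>) \<longleftrightarrow>
         (\<forall>n\<in>?N. certificates.top_cert C PS (if pth then ?N else {n}) (Tm X) (Bd X) (blocks pth wn))"
        by (rule lang_separate[OF ce fin])
      also have "\<dots> \<longleftrightarrow> (\<forall>c. elem_at dataL X i c \<longrightarrow> topX pth wn X j i c)"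
        using tc by blast
      finally have t: "(\<exists>\<kappa>\<in>lang pth wn. splits C PS ?N \<kappa>) \<longleftrightarrow>
         (\<forall>c. elem_at dataL X i c \<longrightarrow> topX pth wn X j i c)" .
      have p: "(\<forall>n\<in>PS. sat (C n) 0 \<kappa>) \<longleftrightarrow> (\<forall>d. posX X j d \<longrightarrow> sat (can Os (dat X d)) 0 \<kappa>)" for \<kappa>
        unfolding PS_def C_def by auto
      have n: "(\<forall>n\<in>?N. \<not> sat (C n) 0 \<kappa>) \<longleftrightarrow> (\<forall>d. elem_at dataL X i d \<longrightarrow> \<not> sat (can Os (dat X d)) 0 \<kappa>)" for \<kappa>
        unfolding C_def by auto
      have "separable (lang pth wn) (set Os) (set ` set Ps) (set ` set Ns) \<longleftrightarrow> (\<forall>c. elem_at dataL X i c \<longrightarrow> topX pth wn X j i c)"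
        unfolding s1 t[symmetric] p n using Nc' by blast
      then show ?thesis unfolding sepX_def using yes Nc elem_at_le by blast
    qed
  qed
qed

end

section \<open>Binary coding and segmentation of the input\<close>

fun cd :: "bool list \<Rightarrow> nat" where
  "cd [] = 1"
| "cd (b # x) = of_bool b + 2 * cd x"

lemma cd_pos: "cd x \<noteq> 0"
  by (induction x) auto

lemma bin_cd: "bin (cd x) = x @ [True]"
proof (induction x)
  case (Cons b x)
  then show ?case using cd_pos[of "b # x"] by (simp add: bin_pos)
qed (simp add: bin_pos)

lemma len_cd: "len (cd x) = length x"
  by (simp add: len_def bl_def bin_cd)

lemma bit_cd: "i < length x \<Longrightarrow> bit (cd x) i = x ! i"
proof (induction x arbitrary: i)
  case (Cons b x)
  show ?case
  proof (cases i)
    case 0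
    then show ?thesis by (simp add: bit_0)
  next
    case (Suc j)
    have "(of_bool b + 2 * cd x) div 2 = cd x" by simp
    then show ?thesis using Suc Cons by (simp add: bit_Suc)
  qed
qed simp

lemma suf_cd: "suf (cd x) 0 = x"
  unfolding suf_def len_cd by (rule nth_equalityI) (simp_all add: bit_cd)

definition valid :: "nat \<Rightarrow> nat \<Rightarrow> nat \<Rightarrow> bool" where
  "valid X j i \<longleftrightarrow> lat (listL axiomL) X 0 j \<and> lat (listL dataL) X j i \<and> lat (listL dataL) X i (len X)"

lemma valid_iff: "valid (cd x) j i \<longleftrightarrow> (\<exists>Os Ps Ns. x = enc_input Os Ps Ns \<and> set Os \<subseteq> horn_axioms \<and>
    hasw (enc_list enc_ltl Os) (cd x) 0 \<and> hasw (enc_examples Ps) (cd x) j \<and> hasw (enc_examples Ns) (cd x) i \<and>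
    j = length (enc_list enc_ltl Os) \<and> i = j + length (enc_examples Ps))"
  (is "_ \<longleftrightarrow> ?R")
proof
  assume "valid (cd x) j i"
  then obtain Os Ps Ns where h: "set Os \<subseteq> horn_axioms" "hasw (enc_list enc_ltl Os) (cd x) 0" "j = 0 + length (enc_list enc_ltl Os)"
     "hasw (enc_examples Ps) (cd x) j" "i = j + length (enc_examples Ps)"
     "hasw (enc_examples Ns) (cd x) i" "len (cd x) = i + length (enc_examples Ns)"
    unfolding valid_def lat_ontology lat_examples by blast
  have "hasw (enc_input Os Ps Ns) (cd x) 0" unfolding enc_input_def hasw_append using h by simp
  then have "take (length (enc_input Os Ps Ns)) x = enc_input Os Ps Ns" unfolding hasw_def suf_cd by blast
  moreover have "length (enc_input Os Ps Ns) = length x" using h unfolding len_cd enc_input_def by simp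
  ultimately have "x = enc_input Os Ps Ns" by simp
  then show ?R using h by auto
next
  assume ?R
  then obtain Os Ps Ns where h: "x = enc_input Os Ps Ns" "set Os \<subseteq> horn_axioms"
    "hasw (enc_list enc_ltl Os) (cd x) 0" "hasw (enc_examples Ps) (cd x) j" "hasw (enc_examples Ns) (cd x) i"
    "j = length (enc_list enc_ltl Os)" "i = j + length (enc_examples Ps)" by blast
  have "lat (listL axiomL) (cd x) 0 j" unfolding lat_ontology using h by auto
  moreover have "lat (listL dataL) (cd x) j i" unfolding lat_examples using h by auto
  moreover have "len (cd x) = i + length (enc_examples Ns)"
    unfolding len_cd h(6,7) using arg_cong[OF h(1), of length] unfolding enc_input_def by simp
  then have "lat (listL dataL) (cd x) i (len (cd x))" unfolding lat_examples using h by blast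
  ultimately show "valid (cd x) j i" unfolding valid_def by blast
qed

lemma ex_valid:
  assumes "set Os \<subseteq> horn_axioms"
  shows "\<exists>j\<le>len (cd (enc_input Os Ps Ns)). \<exists>i\<le>len (cd (enc_input Os Ps Ns)). valid (cd (enc_input Os Ps Ns)) j i"
proof -
  let ?x = "enc_input Os Ps Ns" and ?j = "length (enc_list enc_ltl Os)"
  let ?i = "?j + length (enc_examples Ps)"
  have "hasw ?x (cd ?x) 0" unfolding hasw_def suf_cd by simp
  then have h: "hasw (enc_list enc_ltl Os) (cd ?x) 0" "hasw (enc_examples Ps) (cd ?x) ?j"
     "hasw (enc_examples Ns) (cd ?x) ?i"
    unfolding enc_input_def[of Os Ps Ns] hasw_append by (simp_all add: enc_input_def)
  then have "valid (cd ?x) ?j ?i" unfolding valid_iff using assms by blast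
  moreover have "?j \<le> len (cd ?x)" "?i \<le> len (cd ?x)" using hasw_le[OF h(2)] hasw_le[OF h(3)] by auto
  ultimately show ?thesis by blast
qed

section \<open>Counting the examples\<close>

definition samef :: "nat \<Rightarrow> nat \<Rightarrow> nat \<Rightarrow> bool" where
  "samef X p p' \<longleftrightarrow> same X p p' \<and> (\<exists>k\<le>len X. \<exists>m\<le>len X. \<exists>k'\<le>len X. \<exists>m'\<le>len X. lat nameL X p k \<and> lat unaryL X k m \<and>
     lat nameL X p' k' \<and> lat unaryL X k' m' \<and> m + k' = m' + k)"

lemma lat_unaryL: "lat unaryL X k m \<longleftrightarrow> (\<exists>l. hasw (enc_unary l) X k \<and> m = k + l + 1)"
  unfolding lat_def unaryL_def by (auto simp: enc_unary_def)

lemma unary_unique: "hasw (enc_unary l) X k \<Longrightarrow> hasw (enc_unary l') X k \<Longrightarrow> l = l'"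
  by (intro hasw_unique[of enc_unary]) (rule enc_unary_prefix_free)

lemma samef_iff:
  assumes "hasw (enc_fact (a, l)) X p" "hasw (enc_fact (a', l')) X p'"
  shows "samef X p p' \<longleftrightarrow> (a, l) = (a', l')"
proof -
  let ?k = "p + length (enc_name a)" and ?k' = "p' + length (enc_name a')"
  have h: "nm X p a" "hasw (enc_unary l) X ?k" "nm X p' a'" "hasw (enc_unary l') X ?k'"
    using assms unfolding enc_fact_def hasw_append by simp_all
  show ?thesis
  proof
    assume s: "samef X p p'"
    then have "same X p p'" unfolding samef_def by blast
    then have a: "a = a'" unfolding same_iff using nm_unique h(1,3) by blast
    obtain k m k' m' where k: "lat nameL X p k" "lat unaryL X k m" "lat nameL X p' k'" "lat unaryL X k' m'" "m + k' = m' + k"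
      using s unfolding samef_def by blast
    have kk: "k = ?k" "k' = ?k'" using k(1,3) nm_unique[OF h(1)] nm_unique[OF h(3)] unfolding lat_nameL by blast+
    obtain q q' where q: "hasw (enc_unary q) X k" "m = k + q + 1" "hasw (enc_unary q') X k'" "m' = k' + q' + 1"
      using k(2,4) unfolding lat_unaryL by blast
    have "q = l" using unary_unique q(1) h(2) unfolding kk by blast
    moreover have "q' = l'" using unary_unique q(3) h(4) unfolding kk by blast
    ultimately show "(a, l) = (a', l')" using a k(5) q(2,4) by simp
  next
    assume e: "(a, l) = (a', l')"
    have "same X p p'" unfolding same_iff using h(1,3) e by blast
    moreover have "lat nameL X p ?k" "lat unaryL X ?k (?k + l + 1)" "lat nameL X p' ?k'" "lat unaryL X ?k' (?k' + l' + 1)"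
      unfolding lat_nameL lat_unaryL using h by blast+
    moreover from calculation have "?k \<le> len X" "?k + l + 1 \<le> len X" "?k' \<le> len X" "?k' + l' + 1 \<le> len X" using lat_le by blast+
    moreover have "?k + l + 1 + ?k' = ?k' + l' + 1 + ?k" using e by simp
    ultimately show "samef X p p'" unfolding samef_def by blast
  qed
qed

definition subd :: "nat \<Rightarrow> nat \<Rightarrow> nat \<Rightarrow> bool" where
  "subd X d d' \<longleftrightarrow> (\<forall>p\<le>len X. elem_at factL X d p \<longrightarrow> (\<exists>p'\<le>len X. elem_at factL X d' p' \<and> samef X p p'))"

lemma elem_fact:
  assumes "hasw (enc_list enc_fact fs) X d"
  shows "elem_at factL X d p \<Longrightarrow> \<exists>f\<in>set fs. hasw (enc_fact f) X p"
    and "f \<in> set fs \<Longrightarrow> \<exists>p. elem_at factL X d p \<and> hasw (enc_fact f) X p"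
  using elem_at_sound[of enc_fact, OF enc_fact_prefix_free assms, of UNIV p] elem_at_complete[OF assms, of UNIV f]
  unfolding factL_def by blast+

lemma subd_iff:
  assumes "hasw (enc_list enc_fact fs) X d" "hasw (enc_list enc_fact gs) X d'"
  shows "subd X d d' \<longleftrightarrow> set fs \<subseteq> set gs"
proof
  assume s: "subd X d d'"
  show "set fs \<subseteq> set gs"
  proof
    fix f assume "f \<in> set fs"
    then obtain p where p: "elem_at factL X d p" "hasw (enc_fact f) X p" using elem_fact(2)[OF assms(1)] by blast
    then obtain p' where p': "elem_at factL X d' p'" "samef X p p'" using s elem_at_le unfolding subd_def by blast
    then obtain g where g: "g \<in> set gs" "hasw (enc_fact g) X p'" using elem_fact(1)[OF assms(2)] by blast
    have "f = g" using samef_iff[of "fst f" "snd f" X p "fst g" "snd g" p'] p(2) g(2) p'(2) by simp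
    then show "f \<in> set gs" using g(1) by simp
  qed
next
  assume s: "set fs \<subseteq> set gs"
  show "subd X d d'" unfolding subd_def
  proof (intro allI impI)
    fix p assume "elem_at factL X d p"
    then obtain f where f: "f \<in> set fs" "hasw (enc_fact f) X p" using elem_fact(1)[OF assms(1)] by blast
    then obtain p' where p': "elem_at factL X d' p'" "hasw (enc_fact f) X p'" using s elem_fact(2)[OF assms(2)] by blast
    have "samef X p p'" using samef_iff[of "fst f" "snd f" X p "fst f" "snd f" p'] f(2) p'(2) by simp
    then show "\<exists>p'\<le>len X. elem_at factL X d' p' \<and> samef X p p'" using p'(1) elem_at_le by blast
  qed
qed

definition dgx :: "nat \<Rightarrow> nat \<Rightarrow> nat \<Rightarrow> nat" where
  "dgx X z n = (z div powm (Suc (len X)) n (Suc z)) mod Suc (len X)"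

lemma dgx_eq: "dgx X z n = (z div Suc (len X) ^ n) mod Suc (len X)"
proof -
  have "z div min (Suc (len X) ^ n) (Suc z) = z div Suc (len X) ^ n"
    by (cases "Suc (len X) ^ n \<le> Suc z") (simp_all add: min_def)
  then show ?thesis using powm[of "Suc (len X)" n "Suc z"] unfolding dgx_def by simp
qed

text \<open>Different lists may present the same set, so examples are counted up to mutual
  inclusion. The number \<open>z\<close> guesses \<open>b\<close> representatives as digits; since
  \<open>b\<close> is a constant, the bound on \<open>z\<close> is an ordinary polynomial.\<close>

definition card_le :: "nat \<Rightarrow> nat \<Rightarrow> nat \<Rightarrow> bool" where
  "card_le b X i \<longleftrightarrow> (\<exists>z<Suc (len X) ^ b. \<forall>d\<le>len X. elem_at dataL X i d \<longrightarrow>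
     (\<exists>n<b. elem_at dataL X i (dgx X z n) \<and> subd X d (dgx X z n) \<and> subd X (dgx X z n) d))"

lemma card_le_iff:
  assumes "hasw (enc_examples Ds) X i"
  shows "card_le b X i \<longleftrightarrow> card (set ` set Ds) \<le> b"
proof -
  have dd: "subd X d d' \<longleftrightarrow> set (dat X d) \<subseteq> set (dat X d')" if "elem_at dataL X i d" "elem_at dataL X i d'" for d d'
    using subd_iff elem_dat(1)[OF assms] that by blast
  have "card (set ` set Ds) \<le> b" if cle: "card_le b X i"
  proof -
    obtain z where z: "\<And>d. elem_at dataL X i d \<Longrightarrow> \<exists>n<b. elem_at dataL X i (dgx X z n) \<and> subd X d (dgx X z n) \<and> subd X (dgx X z n) d"
      using cle elem_at_le unfolding card_le_def by blast
    have "set ` set Ds \<subseteq> (\<lambda>n. set (dat X (dgx X z n))) ` {..<b}"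
    proof
      fix D assume "D \<in> set ` set Ds"
      then obtain d where d: "elem_at dataL X i d" "D = set (dat X d)" unfolding image_dat[OF assms] by blast
      obtain n where n: "n < b" "elem_at dataL X i (dgx X z n)" "subd X d (dgx X z n)" "subd X (dgx X z n) d" using z[OF d(1)] by blast
      then have "D = set (dat X (dgx X z n))" using dd[OF d(1) n(2)] dd[OF n(2) d(1)] d(2) by blast
      then show "D \<in> (\<lambda>n. set (dat X (dgx X z n))) ` {..<b}" using n(1) by blast
    qed
    then have "card (set ` set Ds) \<le> card ((\<lambda>n. set (dat X (dgx X z n))) ` {..<b})" by (intro card_mono) auto
    also have "\<dots> \<le> b" using card_image_le[of "{..<b}" "\<lambda>n. set (dat X (dgx X z n))"] by simp
    finally show "card (set ` set Ds) \<le> b" .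
  qed
  moreover have "card_le b X i" if c: "card (set ` set Ds) \<le> b"
  proof -
  obtain Ls where Ls: "set Ls = set ` set Ds" "distinct Ls" using finite_distinct_list[of "set ` set Ds"] by auto
  have l: "length Ls \<le> b" using distinct_card[OF Ls(2)] Ls(1) c by simp
  have "\<exists>d. n < length Ls \<longrightarrow> elem_at dataL X i d \<and> set (dat X d) = Ls ! n" for n
  proof (cases "n < length Ls")
    case True
    then have "Ls ! n \<in> set ` set Ds" using Ls(1) nth_mem by blast
    then show ?thesis unfolding image_dat[OF assms] by blast
  qed simp
  then obtain u where u: "\<And>n. n < length Ls \<Longrightarrow> elem_at dataL X i (u n) \<and> set (dat X (u n)) = Ls ! n" by metis
  have ul: "(if n < length Ls then u n else 0) < Suc (len X)" for n
    using u[of n] elem_at_le[of dataL X i "u n"] by (simp add: less_Suc_eq_le)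
  obtain z where z: "z < Suc (len X) ^ b" "\<forall>n<b. (z div Suc (len X) ^ n) mod Suc (len X) = (if n < length Ls then u n else 0)"
    using ex_digits[of b "\<lambda>n. if n < length Ls then u n else 0" "Suc (len X)"] ul by blast
  show "card_le b X i" unfolding card_le_def
  proof (rule exI[of _ z], intro conjI z(1) allI impI)
    fix d assume d: "elem_at dataL X i d"
    then have "set (dat X d) \<in> set Ls" unfolding Ls(1) image_dat[OF assms] by blast
    then obtain n where n: "n < length Ls" "Ls ! n = set (dat X d)" by (auto simp: in_set_conv_nth)
    then have "dgx X z n = u n" unfolding dgx_eq using z(2) l by simp
    moreover have "subd X d (u n)" "subd X (u n) d"
      using subd_iff elem_dat(1)[OF assms] d u[OF n(1)] n(2) by blast+
    ultimately show "\<exists>n<b. elem_at dataL X i (dgx X z n) \<and> subd X d (dgx X z n) \<and> subd X (dgx X z n) d"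
      using n(1) l u[OF n(1)] by (intro exI[of _ n]) simp
  qed
  qed
  ultimately show ?thesis by blast
qed

section \<open>The problem is in polynomial space\<close>

definition QX :: "bool \<Rightarrow> bool \<Rightarrow> (nat \<times> nat) option \<Rightarrow> nat \<Rightarrow> bool" where
  "QX pth wn bd X \<longleftrightarrow> (\<exists>j\<le>len X. \<exists>i\<le>len X. valid X j i \<and> sepX pth wn X j i \<and>
     (case bd of None \<Rightarrow> True | Some (b, c) \<Rightarrow> card_le b X j \<and> card_le c X i))"

definition QBE_opt :: "bool \<Rightarrow> bool \<Rightarrow> (nat \<times> nat) option \<Rightarrow> bool list set" where
  "QBE_opt pth wn bd = {enc_input Os Ps Ns | Os Ps Ns. set Os \<in> LTL_horn \<and>
     separable (lang pth wn) (set Os) (set ` set Ps) (set ` set Ns) \<and>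
     (case bd of None \<Rightarrow> True | Some (b, c) \<Rightarrow> card (set ` set Ps) \<le> b \<and> card (set ` set Ns) \<le> c)}"

lemma QBE_opt: "QBE LTL_horn (lang pth wn) = QBE_opt pth wn None"
  "QBE_bounded b c LTL_horn (lang pth wn) = QBE_opt pth wn (Some (b, c))"
  unfolding QBE_def QBE_bounded_def QBE_opt_def by simp_all

lemma QX_cd: "QX pth wn bd (cd x) \<longleftrightarrow> x \<in> QBE_opt pth wn bd"
proof -
  have eq: "sepX pth wn (cd x) j i \<and> (case bd of None \<Rightarrow> True | Some (b, c) \<Rightarrow> card_le b (cd x) j \<and> card_le c (cd x) i) \<longleftrightarrow>
      separable (lang pth wn) (set Os) (set ` set Ps) (set ` set Ns) \<and>
     (case bd of None \<Rightarrow> True | Some (b, c) \<Rightarrow> card (set ` set Ps) \<le> b \<and> card (set ` set Ns) \<le> c)"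
    if "set Os \<subseteq> horn_axioms" "hasw (enc_list enc_ltl Os) (cd x) 0" "hasw (enc_examples Ps) (cd x) j"
      "hasw (enc_examples Ns) (cd x) i" for Os Ps Ns j i
  proof -
    interpret qbe_input "cd x" j i Os Ps Ns by unfold_locales (fact that)+
    show ?thesis unfolding sepX_iff card_le_iff[OF that(3)] card_le_iff[OF that(4)] by blast
  qed
  show ?thesis
  proof
    assume "QX pth wn bd (cd x)"
    then obtain j i where v: "valid (cd x) j i" and s: "sepX pth wn (cd x) j i \<and> (case bd of None \<Rightarrow> True | Some (b, c) \<Rightarrow> card_le b (cd x) j \<and> card_le c (cd x) i)"
      unfolding QX_def by blast
    obtain Os Ps Ns where h: "x = enc_input Os Ps Ns" "set Os \<subseteq> horn_axioms" "hasw (enc_list enc_ltl Os) (cd x) 0"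
        "hasw (enc_examples Ps) (cd x) j" "hasw (enc_examples Ns) (cd x) i"
      using v unfolding valid_iff by blast
    show "x \<in> QBE_opt pth wn bd" unfolding QBE_opt_def LTL_horn_def using s[unfolded eq[OF h(2-5)]] h(1,2) by blast
  next
    assume "x \<in> QBE_opt pth wn bd"
    then obtain Os' Ps' Ns' where q: "x = enc_input Os' Ps' Ns'" "set Os' \<subseteq> horn_axioms"
      "separable (lang pth wn) (set Os') (set ` set Ps') (set ` set Ns') \<and>
       (case bd of None \<Rightarrow> True | Some (b, c) \<Rightarrow> card (set ` set Ps') \<le> b \<and> card (set ` set Ns') \<le> c)"
      unfolding QBE_opt_def LTL_horn_def by blast
    obtain j i where ji: "j \<le> len (cd x)" "i \<le> len (cd x)" "valid (cd x) j i" using ex_valid[OF q(2), of Ps' Ns'] q(1) by blast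
    obtain Os Ps Ns where h: "x = enc_input Os Ps Ns" "set Os \<subseteq> horn_axioms" "hasw (enc_list enc_ltl Os) (cd x) 0"
        "hasw (enc_examples Ps) (cd x) j" "hasw (enc_examples Ns) (cd x) i"
      using ji(3) unfolding valid_iff by blast
    have e: "Os' = Os" "Ps' = Ps" "Ns' = Ns" using enc_input_inject q(1) h(1) by metis+
    show "QX pth wn bd (cd x)" unfolding QX_def using ji q(3)[unfolded e, folded eq[OF h(2-5)]] by blast
  qed
qed

section \<open>Separability expressed in the calculus\<close>

lemma PP_dataL[pf]: "\<lbrakk>PF A; PF B; PF C\<rbrakk> \<Longrightarrow> PP (\<lambda>e. lat dataL (A e) (B e) (C e))"
  unfolding dataL_def by (rule PP_listL[OF PP_factL])

lemma PP_elem_data[pf]: "\<lbrakk>PF A; PF B; PF C\<rbrakk> \<Longrightarrow> PP (\<lambda>e. elem_at dataL (A e) (B e) (C e))"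
  by (rule PP_elem_at[OF PP_dataL])

lemma PP_elem_fact[pf]: "\<lbrakk>PF A; PF B; PF C\<rbrakk> \<Longrightarrow> PP (\<lambda>e. elem_at factL (A e) (B e) (C e))"
  by (rule PP_elem_at[OF PP_factL])

lemma PF_Tm[pf]: "PF A \<Longrightarrow> PF (\<lambda>e. Tm (A e))"
  unfolding Tm_def by (intro pf)

lemma PF_Bd[pf]: "PF A \<Longrightarrow> PF (\<lambda>e. Bd (A e))"
  unfolding Bd_def by (intro pf)

lemma PF_NB[pf]: "PF A \<Longrightarrow> PF (\<lambda>e. NB (A e))"
  unfolding NB_def by (intro pf)

lemma PF_dig[pf]: "\<lbrakk>PF A; PF B; PF C\<rbrakk> \<Longrightarrow> PF (\<lambda>e. dig (A e) (B e) (C e))"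
  unfolding dig_def by (intro pf)

lemma PP_consX[pf]: "PF A \<Longrightarrow> PF B \<Longrightarrow> PP (\<lambda>e. consX (A e) (B e))"
  unfolding consX_def by (intro pf)

lemma PP_posX[pf]: "\<lbrakk>PF A; PF B; PF C\<rbrakk> \<Longrightarrow> PP (\<lambda>e. posX (A e) (B e) (C e))"
  unfolding posX_def by (intro pf)

lemma PP_negX[pf]: "\<lbrakk>PF A; PF B; PF C; PF D\<rbrakk> \<Longrightarrow> PP (\<lambda>e. negX pth (A e) (B e) (C e) (D e))"
  unfolding negX_def by (intro pf)

lemma PP_misX[pf]: "\<lbrakk>PF A; PF B; PF C; PF D; PF E; PF G\<rbrakk> \<Longrightarrow> PP (\<lambda>e. misX (A e) (B e) (C e) (D e) (E e) (G e))"
proof (rule PP_comp6[where f = misX])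
  show "PP (\<lambda>e. misX (e 0) (e 1) (e 2) (e 3) (e 4) (e 5))" unfolding misX_def by (intro pf)
qed

lemma PP_kk[pf]: "PF A \<Longrightarrow> PF B \<Longrightarrow> PP (\<lambda>e. kk pth wn (A e) (B e))"
  by (cases wn; cases pth; simp only: kk_def if_True if_False; intro pf; assumption)

lemma PP_estX: "\<lbrakk>PF A; PF B; PF C; PF D; PF E; PF G\<rbrakk> \<Longrightarrow> PP (\<lambda>e. estX pth wn (A e) (B e) (C e) (D e) (E e) (G e))"
proof (rule PP_comp6[where f = "estX pth wn"])
  show "PP (\<lambda>e. estX pth wn (e 0) (e 1) (e 2) (e 3) (e 4) (e 5))" unfolding estX_def by (intro pf)
qed

lemma PP_topX[pf]: "\<lbrakk>PF A; PF B; PF C; PF D\<rbrakk> \<Longrightarrow> PP (\<lambda>e. topX pth wn (A e) (B e) (C e) (D e))"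
proof (rule PP_comp4[where f = "topX pth wn"])
  have "PP (\<lambda>e. (e 4, e 5) \<in> {(a, b). a < NB (e 0) \<and> b < NB (e 0) \<and> estX pth wn (e 0) (e 1) (e 2) (e 3) a b}\<^sup>*)"
    by (rule PP_reach) (intro pf PP_estX)+
  then have r: "PP (\<lambda>e. (E e, G e) \<in> {(a, b). a < NB (A e) \<and> b < NB (A e) \<and> estX pth wn (A e) (B e) (C e) (D e) a b}\<^sup>*)"
    if "PF A" "PF B" "PF C" "PF D" "PF E" "PF G" for A B C D E G
    by (rule PP_comp6[where f = "\<lambda>x j i c v w. (v, w) \<in> {(a, b). a < NB x \<and> b < NB x \<and> estX pth wn x j i c a b}\<^sup>*", OF _ that])
  show "PP (\<lambda>e. topX pth wn (e 0) (e 1) (e 2) (e 3))" unfolding topX_def by (intro pf r)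
qed

lemma PF_power[pf]: "PF A \<Longrightarrow> PF (\<lambda>e. A e ^ b)"
proof (induction b)
  case 0
  show ?case unfolding power_0 by (intro pf)
next
  case (Suc b)
  show ?case unfolding power_Suc by (rule PF_mult[OF Suc.prems Suc.IH[OF Suc.prems]])
qed

lemma PP_subd[pf]: "\<lbrakk>PF A; PF B; PF C\<rbrakk> \<Longrightarrow> PP (\<lambda>e. subd (A e) (B e) (C e))"
proof (rule PP_comp3[where f = subd])
  show "PP (\<lambda>e. subd (e 0) (e 1) (e 2))" unfolding subd_def samef_def same_def by (intro pf)
qed

lemma PF_dgx[pf]: "\<lbrakk>PF A; PF B; PF C\<rbrakk> \<Longrightarrow> PF (\<lambda>e. dgx (A e) (B e) (C e))"
  unfolding dgx_def by (intro pf)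

lemma PP_card_le[pf]: "PF A \<Longrightarrow> PF B \<Longrightarrow> PP (\<lambda>e. card_le b (A e) (B e))"
proof (rule PP_comp2[where f = "card_le b"])
  show "PP (\<lambda>e. card_le b (e 0) (e 1))" unfolding card_le_def by (intro pf)
qed

lemma PP_QX: "PP (\<lambda>e. QX pth wn bd (e 0))"
proof -
  have l1: "PP (\<lambda>e. lat (listL dataL) (A e) (B e) (C e))" if "PF A" "PF B" "PF C" for A B C
    by (rule PP_listL[OF PP_dataL that])
  have l2: "PP (\<lambda>e. lat (listL axiomL) (A e) (B e) (C e))" if "PF A" "PF B" "PF C" for A B C
    by (rule PP_listL[OF PP_axiomL that])
  show ?thesis
  proof (cases bd)
    case None
    show ?thesis unfolding QX_def valid_def sepX_def None option.case by (intro pf l1 l2)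
  next
    case (Some p)
    obtain b c where p: "p = (b, c)" by (cases p)
    show ?thesis unfolding QX_def valid_def sepX_def Some p option.case prod.case by (intro pf l1 l2)
  qed
qed

section \<open>Programs that load the input\<close>

lemma exec_While:
  assumes "\<And>k. k < n \<Longrightarrow> topb (fst (S k) r) \<in> X" "topb (fst (S n) r) \<notin> X" "A (S n)"
    and "\<And>k. k < n \<Longrightarrow> \<exists>t\<le>T. exec A c (S k) t (S (Suc k))"
  shows "\<exists>t\<le>n * (T + 2) + 1. exec A (While r X c) (S 0) t (S n)"
  using assms
proof (induction n arbitrary: S)
  case 0
  then show ?case using exec.WhileF[of "S 0" r X A] by (intro exI[of _ 1]) simp
next
  case (Suc n)
  obtain t where t: "t \<le> T" "exec A c (S 0) t (S (Suc 0))" using Suc.prems(4)[of 0] by auto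
  have "\<exists>t\<le>n * (T + 2) + 1. exec A (While r X c) (S (Suc 0)) t (S (Suc n))"
    by (rule Suc.IH[of "\<lambda>k. S (Suc k)"]) (use Suc.prems in auto)
  then obtain u where u: "u \<le> n * (T + 2) + 1" "exec A (While r X c) (S (Suc 0)) u (S (Suc n))" by blast
  have "exec A (While r X c) (S 0) (t + u + 2) (S (Suc n))"
    by (rule exec.WhileT[OF _ t(2) u(2)]) (use Suc.prems(1) in auto)
  then show ?case using t(1) u(1) by (intro exI[of _ "t + u + 2"]) simp
qed

definition move_bit :: "nat \<Rightarrow> nat \<Rightarrow> com" where
  "move_bit r q = Cond r {Some True} (Pop r ;; Push q True) (Pop r ;; Push q False)"

lemma topb_in_nz: "topb l \<in> nz \<longleftrightarrow> l \<noteq> []"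
  by (cases l) (auto simp: nz_def)

lemma None_nz: "None \<notin> nz"
  by (simp add: nz_def)

lemma drop_hd: "k < length x \<Longrightarrow> drop k x = x ! k # drop (Suc k) x"
  by (simp add: Cons_nth_drop_Suc)

lemma exec_move_bit:
  assumes A: "bounded_st b N (s, b)" and "r \<noteq> q" "s r = x # l" "Suc (length (s q)) \<le> N"
  shows "\<exists>t\<le>5. exec (bounded_st b N) (move_bit r q) (s, b) t (s(r := l, q := x # s q), b)"
proof -
  have 1: "exec (bounded_st b N) (Pop r) (s, b) 1 (s(r := l), b)"
    using exec_Pop'[OF A, of r] assms(3) by simp
  have 2: "exec (bounded_st b N) (Push q x) (s(r := l), b) 2 (s(r := l, q := x # s q), b)"
    using exec_Push'[of b N "s(r := l)" q x] exec_inv[OF 1] assms(2,4) by simp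
  have 12: "exec (bounded_st b N) (Pop r ;; Push q x) (s, b) (1 + 2) (s(r := l, q := x # s q), b)"
    by (rule exec.Seq[OF 1 2])
  have top: "topb (fst (s, b) r) = Some x" using assms(3) by simp
  show ?thesis
  proof (cases x)
    case True
    then show ?thesis unfolding move_bit_def
      using exec.CondT[OF _ 12, of r "{Some True}"] top by (intro exI[of _ "1 + 2 + 2"]) auto
  next
    case False
    then show ?thesis unfolding move_bit_def
      using exec.CondF[OF _ 12, of r "{Some True}"] top by (intro exI[of _ "1 + 2 + 1"]) auto
  qed
qed

definition xfer :: "nat \<Rightarrow> nat \<Rightarrow> com" where "xfer r q = While r nz (move_bit r q)"

lemma exec_xfer:
  assumes "r \<noteq> q" "bounded_st b N (s, b)" "length (s r) + length (s q) \<le> N"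
  shows "\<exists>t. exec (bounded_st b N) (xfer r q) (s, b) t (s(r := [], q := rev (s r) @ s q), b)"
proof -
  let ?S = "\<lambda>k. (s(r := drop k (s r), q := rev (take k (s r)) @ s q), b)"
  have bd: "bounded_st b N (?S k)" if "k \<le> length (s r)" for k
    using assms that unfolding bounded_st_def by auto
  have "\<exists>t\<le>length (s r) * (5 + 2) + 1. exec (bounded_st b N) (While r nz (move_bit r q)) (?S 0) t (?S (length (s r)))"
  proof (rule exec_While)
    fix k assume k: "k < length (s r)"
    show "\<exists>t\<le>5. exec (bounded_st b N) (move_bit r q) (?S k) t (?S (Suc k))"
      using exec_move_bit[OF bd, of k r q "s r ! k" "drop (Suc k) (s r)"] k assms(1,3)
      by (simp add: drop_hd take_Suc_conv_app_nth fun_upd_twist)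
  next
    show "bounded_st b N (?S (length (s r)))" by (rule bd) simp
  qed (use assms(1) in \<open>auto simp: topb_in_nz None_nz\<close>)
  moreover have "?S 0 = (s, b)" by (simp add: fun_eq_iff)
  ultimately show ?thesis unfolding xfer_def by auto
qed

text \<open>Register 0 serves as the auxiliary register of the arithmetic, so that the input has to be moved.\<close>

theorem PSPACE_PP:
  assumes "PP (\<lambda>e. P (e 0))" and L: "\<And>x. P (cd x) \<longleftrightarrow> x \<in> L"
  shows "L \<in> PSPACE"
proof -
  let ?F = "\<lambda>e :: env. of_bool (P (e 0)) :: nat"
  obtain k p where F: "PFkp k p ?F" using assms(1) unfolding PP_def PF_def by blast
  obtain c where c: "impl k p ?F (\<lambda>_. 1) 2 3 c" using PFkp_impl[OF F, of 2 3 "\<lambda>_. 1"] by auto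
  \<comment> \<open>The code \<open>cd x\<close> has length \<open>length x + 1\<close>, at which
    \<open>p\<close> is taken; the rest is room for moving the input.\<close>
  define q where "q = pcompose p [:1, 1:] + [:2, 2:]"
  let ?a = "Cond 2 {Some True} (Push 0 True) Skip"
  \<comment> \<open>Pushing \<open>True\<close> first puts the leading digit of \<open>cd x\<close>
    at the bottom of register 1, and the second transfer undoes the reversal by the first.\<close>
  let ?c = "xfer 0 2 ;; Push 1 True ;; xfer 2 1 ;; c ;; ?a"
  show ?thesis
  proof (rule PSPACE_I)
    fix x :: "bool list"
    define N where "N = poly q (length x)"
    define b where "b = snd (init_st x)"
    let ?A = "bounded_st b N"
    let ?n = "length x"
    have N: "N = poly p (Suc ?n) + 2 * ?n + 2" by (simp add: N_def q_def poly_pcompose)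
    let ?s0 = "(\<lambda>_. [])(0 := x) :: nat \<Rightarrow> bool list"
    have init: "init_st x = (?s0, b)" by (simp add: b_def init_st_def)
    have A0: "?A (?s0, b)" by (simp add: bounded_st_def N)
    let ?s1 = "(\<lambda>_. [])(2 := rev x) :: nat \<Rightarrow> bool list"
    have e1: "?s0(0 := [], 2 := rev (?s0 0) @ ?s0 2) = ?s1" by (auto simp: fun_eq_iff)
    obtain t1 where 1: "exec ?A (xfer 0 2) (?s0, b) t1 (?s1, b)"
      using exec_xfer[of 0 2 b N ?s0, OF _ A0] unfolding e1 by (auto simp: N)
    let ?s2 = "?s1(1 := [True])"
    have 2: "exec ?A (Push 1 True) (?s1, b) 2 (?s2, b)"
      using exec_Push'[of b N ?s1 1 True] exec_inv[OF 1] by (simp add: N)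
    let ?s3 = "(\<lambda>_. [])(1 := x @ [True]) :: nat \<Rightarrow> bool list"
    have e3: "?s2(2 := [], 1 := rev (?s2 2) @ ?s2 1) = ?s3" by (auto simp: fun_eq_iff)
    obtain t3 where 3: "exec ?A (xfer 2 1) (?s2, b) t3 (?s3, b)"
      using exec_xfer[of 2 1 b N ?s2] exec_inv[OF 2] unfolding e3 by (auto simp: N)
    let ?v = "(\<lambda>_. 0)(1 := cd x) :: nat \<Rightarrow> nat"
    have v: "(\<lambda>r. bin (?v r)) = ?s3" by (auto simp: fun_eq_iff bin_cd)
    have bv: "bounded_v N ?v" by (simp add: bounded_v_def bl_def bin_cd N)
    have "nx b N c ?v (?v(2 := ?F (\<lambda>i. ?v 1)))"
      by (rule implD[OF c, of _ _ "Suc ?n"]) (use bv in \<open>auto simp: small_def bl_def bin_cd N\<close>)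
    then have "nx b N c ?v (?v(2 := of_bool (P (cd x))))" by simp
    then obtain t4 where 4: "exec ?A c (?s3, b) t4 (\<lambda>r. bin ((?v(2 := of_bool (P (cd x)))) r), b)"
      unfolding nx_def v by blast
    let ?s4 = "\<lambda>r. bin ((?v(2 := of_bool (P (cd x)))) r)"
    have A4: "?A (?s4, b)" using exec_inv[OF 4] by blast
    have "\<exists>t s. exec ?A ?a (?s4, b) t (s, b) \<and> (topb (s 0) = Some True \<longleftrightarrow> P (cd x))"
    proof (cases "P (cd x)")
      case True
      have "exec ?A (Push 0 True) (?s4, b) 2 (?s4(0 := True # ?s4 0), b)"
        by (rule exec_Push'[OF A4]) (simp add: N)
      moreover have "topb (fst (?s4, b) 2) \<in> {Some True}" using True by (simp add: topb_bin)
      ultimately have "exec ?A ?a (?s4, b) (2 + 2) (?s4(0 := True # ?s4 0), b)"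
        by (intro exec.CondT)
      moreover have "topb ((?s4(0 := True # ?s4 0)) 0) = Some True" by simp
      ultimately show ?thesis using True by blast
    next
      case False
      have "topb (fst (?s4, b) 2) \<notin> {Some True}" using False by (simp add: topb_bin)
      then have "exec ?A ?a (?s4, b) (0 + 1) (?s4, b)"
        using A4 by (intro exec.CondF exec.Skip)
      moreover have "topb (?s4 0) \<noteq> Some True" by simp
      ultimately show ?thesis using False by blast
    qed
    then obtain t5 s where 5: "exec ?A ?a (?s4, b) t5 (s, b)" "topb (s 0) = Some True \<longleftrightarrow> P (cd x)" by blast
    have "exec ?A ?c (init_st x) (t1 + (2 + (t3 + (t4 + t5)))) (s, b)"
      unfolding init by (rule exec.Seq[OF 1 exec.Seq[OF 2 exec.Seq[OF 3 exec.Seq[OF 4 5(1)]]]])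
    moreover have "?A = (inspace q x)"
      unfolding bounded_st_def b_def N_def by (auto simp: fun_eq_iff)
    ultimately show "\<exists>t s b. exec (inspace q x) ?c (init_st x) t (s, b) \<and>
        (topb (s 0) = Some True \<longleftrightarrow> x \<in> L)"
      using 5(2) L[of x] by auto
  qed
qed

theorem QBE_opt_PSPACE: "QBE_opt pth wn bd \<in> PSPACE"
  by (rule PSPACE_PP[OF PP_QX QX_cd])

section \<open>Programs writing polynomially long strings\<close>

abbreviation run_com :: "com \<Rightarrow> st \<Rightarrow> nat \<Rightarrow> st \<Rightarrow> bool" where
  "run_com \<equiv> exec (\<lambda>_. True)"

definition polyb :: "'a set \<Rightarrow> ('a \<Rightarrow> nat) \<Rightarrow> ('a \<Rightarrow> nat) \<Rightarrow> bool" where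
  "polyb D sz n \<longleftrightarrow> (\<exists>p :: nat poly. \<forall>a\<in>D. n a \<le> poly p (sz a))"

lemma polyb_const: "polyb D sz (\<lambda>_. m)"
  unfolding polyb_def by (intro exI[of _ "[:m:]"]) simp

lemma polyb_size: "polyb D sz sz"
  unfolding polyb_def by (intro exI[of _ "[:0, 1:]"]) simp

lemma polyb_mono: "polyb D sz n \<Longrightarrow> (\<And>a. a \<in> D \<Longrightarrow> m a \<le> n a) \<Longrightarrow> polyb D sz m"
  unfolding polyb_def by (meson order_trans)

lemma polyb_add: "polyb D sz m \<Longrightarrow> polyb D sz n \<Longrightarrow> polyb D sz (\<lambda>a. m a + n a)"
proof -
  assume "polyb D sz m" "polyb D sz n"
  then obtain p q where "\<forall>a\<in>D. m a \<le> poly p (sz a)" "\<forall>a\<in>D. n a \<le> poly q (sz a)" unfolding polyb_def by blast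
  then have "\<forall>a\<in>D. m a + n a \<le> poly (p + q) (sz a)" by (simp add: add_mono)
  then show ?thesis unfolding polyb_def by blast
qed

lemma polyb_mult: "polyb D sz m \<Longrightarrow> polyb D sz n \<Longrightarrow> polyb D sz (\<lambda>a. m a * n a)"
proof -
  assume "polyb D sz m" "polyb D sz n"
  then obtain p q where "\<forall>a\<in>D. m a \<le> poly p (sz a)" "\<forall>a\<in>D. n a \<le> poly q (sz a)" unfolding polyb_def by blast
  then have "\<forall>a\<in>D. m a * n a \<le> poly (p * q) (sz a)" by (simp add: mult_mono)
  then show ?thesis unfolding polyb_def by blast
qed

lemma polyb_power: "polyb D sz m \<Longrightarrow> polyb D sz (\<lambda>a. m a ^ k)"
  by (induction k) (simp_all add: polyb_const polyb_mult)

lemma polyb_loop: "polyb D sz n \<Longrightarrow> polyb {(a, k). a \<in> D \<and> k < n a} (\<lambda>(a, k). sz a) (\<lambda>(a, k). n a)"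
  unfolding polyb_def by auto

text \<open>A family of runs, indexed by \<open>D\<close>, with a polynomial time bound common to
  all of them. Inside a loop the index also contains the round, while the size remains that of the
  input.\<close>

definition prun :: "'a set \<Rightarrow> ('a \<Rightarrow> nat) \<Rightarrow> com \<Rightarrow> ('a \<Rightarrow> st) \<Rightarrow> ('a \<Rightarrow> st) \<Rightarrow> bool" where
  "prun D sz c S S' \<longleftrightarrow> (\<exists>t. polyb D sz t \<and> (\<forall>a\<in>D. \<exists>t'\<le>t a. run_com c (S a) t' (S' a)))"

lemma prunI: "polyb D sz t \<Longrightarrow> (\<And>a. a \<in> D \<Longrightarrow> \<exists>t'\<le>t a. run_com c (S a) t' (S' a)) \<Longrightarrow> prun D sz c S S'"
  unfolding prun_def by blast

lemma prun_poly:
  assumes "prun D sz c S S'"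
  shows "\<exists>p. \<forall>a\<in>D. \<exists>t'\<le>poly p (sz a). run_com c (S a) t' (S' a)"
proof -
  obtain t p where t: "\<forall>a\<in>D. t a \<le> poly p (sz a)" "\<forall>a\<in>D. \<exists>t'\<le>t a. run_com c (S a) t' (S' a)"
    using assms unfolding prun_def polyb_def by blast
  have "\<exists>t'\<le>poly p (sz a). run_com c (S a) t' (S' a)" if a: "a \<in> D" for a
  proof -
    obtain t' where t': "t' \<le> t a" "run_com c (S a) t' (S' a)" using t(2) a by blast
    have "t' \<le> poly p (sz a)" using t'(1) t(1) a order_trans by blast
    then show ?thesis using t'(2) by blast
  qed
  then show ?thesis by blast
qed

lemma prun_cong: "prun D sz c S S' \<Longrightarrow> (\<And>a. a \<in> D \<Longrightarrow> T a = S a) \<Longrightarrow> (\<And>a. a \<in> D \<Longrightarrow> T' a = S' a) \<Longrightarrow> prun D sz c T T'"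
  unfolding prun_def by simp

lemma prun_Skip: "(\<And>a. a \<in> D \<Longrightarrow> S a = S' a) \<Longrightarrow> prun D sz Skip S S'"
  by (rule prunI[OF polyb_const[of _ _ 0]]) (auto intro: exec.Skip)

lemma prun_Push: "(\<And>a. a \<in> D \<Longrightarrow> S' a = ((fst (S a))(r := x # fst (S a) r), snd (S a))) \<Longrightarrow> prun D sz (Push r x) S S'"
proof (rule prunI[OF polyb_const[of _ _ 2]])
  fix a assume h: "\<And>a. a \<in> D \<Longrightarrow> S' a = ((fst (S a))(r := x # fst (S a) r), snd (S a))" "a \<in> D"
  then show "\<exists>t'\<le>2. run_com (Push r x) (S a) t' (S' a)"
    using exec.Push[of "\<lambda>_. True" "fst (S a)" "snd (S a)" r x] by (intro exI[of _ 2]) simp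
qed

lemma prun_Pop':
  "(\<And>a. a \<in> D \<Longrightarrow> S' a = ((fst (S a))(r := tl (fst (S a) r)), if fst (S a) r = [] then (snd (S a))(r := snd (S a) r + 1) else snd (S a)))
   \<Longrightarrow> prun D sz (Pop r) S S'"
proof (rule prunI[OF polyb_const[of _ _ 1]])
  fix a assume h: "\<And>a. a \<in> D \<Longrightarrow> S' a = ((fst (S a))(r := tl (fst (S a) r)), if fst (S a) r = [] then (snd (S a))(r := snd (S a) r + 1) else snd (S a))" "a \<in> D"
  have "run_com (Pop r) (fst (S a), snd (S a)) 1 (S' a)"
    unfolding h(1)[OF h(2)] by (rule exec.Pop) simp_all
  then show "\<exists>t'\<le>1. run_com (Pop r) (S a) t' (S' a)" by (intro exI[of _ 1]) simp
qed

lemma prun_Pop: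
  assumes "\<And>a. a \<in> D \<Longrightarrow> fst (S a) r \<noteq> []" "\<And>a. a \<in> D \<Longrightarrow> S' a = ((fst (S a))(r := tl (fst (S a) r)), snd (S a))"
  shows "prun D sz (Pop r) S S'"
  by (rule prun_Pop') (simp add: assms)

lemma prun_Seq:
  assumes "prun D sz c S S'" "prun D sz d S' S''"
  shows "prun D sz (c ;; d) S S''"
proof -
  obtain t u where t: "polyb D sz t" "\<forall>a\<in>D. \<exists>t'\<le>t a. run_com c (S a) t' (S' a)"
    and u: "polyb D sz u" "\<forall>a\<in>D. \<exists>t'\<le>u a. run_com d (S' a) t' (S'' a)"
    using assms unfolding prun_def by blast
  show ?thesis
  proof (rule prunI[OF polyb_add[OF t(1) u(1)]])
    fix a assume "a \<in> D"
    then obtain t' u' where "t' \<le> t a" "run_com c (S a) t' (S' a)" "u' \<le> u a" "run_com d (S' a) u' (S'' a)"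
      using t(2) u(2) by blast
    then show "\<exists>t'\<le>t a + u a. run_com (c ;; d) (S a) t' (S'' a)"
      by (intro exI[of _ "t' + u'"]) (simp add: exec.Seq add_mono)
  qed
qed

lemma prun_Cond:
  assumes "prun {a \<in> D. topb (fst (S a) r) \<in> X} sz c S S'" "prun {a \<in> D. topb (fst (S a) r) \<notin> X} sz d S S'"
  shows "prun D sz (Cond r X c d) S S'"
proof -
  obtain p where p: "\<And>a. a \<in> {a \<in> D. topb (fst (S a) r) \<in> X} \<Longrightarrow> \<exists>t'\<le>poly p (sz a). run_com c (S a) t' (S' a)"
    using prun_poly[OF assms(1)] by blast
  obtain q where q: "\<And>a. a \<in> {a \<in> D. topb (fst (S a) r) \<notin> X} \<Longrightarrow> \<exists>t'\<le>poly q (sz a). run_com d (S a) t' (S' a)"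
    using prun_poly[OF assms(2)] by blast
  have b: "polyb D sz (\<lambda>a. poly (p + q + [:2:]) (sz a))" unfolding polyb_def by blast
  show ?thesis
  proof (rule prunI[OF b])
    fix a assume a: "a \<in> D"
    show "\<exists>t'\<le>poly (p + q + [:2:]) (sz a). run_com (Cond r X c d) (S a) t' (S' a)"
    proof (cases "topb (fst (S a) r) \<in> X")
      case True
      then obtain t where "t \<le> poly p (sz a)" "run_com c (S a) t (S' a)" using p[of a] a True by auto
      then show ?thesis using exec.CondT[OF True] by (intro exI[of _ "t + 2"]) simp
    next
      case False
      then obtain t where "t \<le> poly q (sz a)" "run_com d (S a) t (S' a)" using q[of a] a False by auto
      then show ?thesis using exec.CondF[OF False] by (intro exI[of _ "t + 1"]) simp
    qed
  qed
qed

text \<open>The cost of the body is measured by the size of the original input, uniformly in all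
  rounds. A bound in terms of the current state would not survive iteration.\<close>

lemma prun_While:
  assumes n: "polyb D sz n" and X: "\<And>a k. a \<in> D \<Longrightarrow> k < n a \<Longrightarrow> topb (fst (S a k) r) \<in> X" "\<And>a. a \<in> D \<Longrightarrow> topb (fst (S a (n a)) r) \<notin> X"
    and c: "prun {(a, k). a \<in> D \<and> k < n a} (\<lambda>(a, k). sz a) c (\<lambda>(a, k). S a k) (\<lambda>(a, k). S a (Suc k))"
  shows "prun D sz (While r X c) (\<lambda>a. S a 0) (\<lambda>a. S a (n a))"
proof -
  obtain p where p': "\<And>x. x \<in> {(a, k). a \<in> D \<and> k < n a} \<Longrightarrow>
      \<exists>t'\<le>poly p ((\<lambda>(a, k). sz a) x). run_com c ((\<lambda>(a, k). S a k) x) t' ((\<lambda>(a, k). S a (Suc k)) x)"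
    using prun_poly[OF c] by blast
  have p: "\<exists>t'\<le>poly p (sz a). run_com c (S a k) t' (S a (Suc k))" if "a \<in> D" "k < n a" for a k
    using p'[of "(a, k)"] that by simp
  have b: "polyb D sz (\<lambda>a. n a * (poly p (sz a) + 2) + 1)"
    by (intro polyb_add polyb_mult n polyb_const) (auto simp: polyb_def)
  show ?thesis by (rule prunI[OF b], rule exec_While) (use X p in auto)
qed

lemma prun_Push_Seq:
  "prun D sz c (\<lambda>a. ((fst (S a))(r := x # fst (S a) r), snd (S a))) S' \<Longrightarrow> prun D sz (Push r x ;; c) S S'"
  by (rule prun_Seq[OF prun_Push]) simp_all

lemma prun_Pop_Seq:
  assumes "\<And>a. a \<in> D \<Longrightarrow> fst (S a) r \<noteq> []" "prun D sz c (\<lambda>a. ((fst (S a))(r := tl (fst (S a) r)), snd (S a))) S'"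
  shows "prun D sz (Pop r ;; c) S S'"
  by (rule prun_Seq[OF prun_Pop assms(2)]) (simp_all add: assms(1))

definition mk :: "bool list list \<Rightarrow> nat \<Rightarrow> bool list" where
  "mk l r = (if r < length l then l ! r else [])"

lemma mk_upd: "r < length l \<Longrightarrow> (mk l)(r := y) = mk (l[r := y])"
  by (auto simp: mk_def fun_eq_iff nth_list_update)

text \<open>Register 0 initially holds the input, register 1 collects the output in reverse order.\<close>

definition cf :: "bool list \<Rightarrow> bool list \<Rightarrow> bool list \<Rightarrow> bool list \<Rightarrow> bool list \<Rightarrow> bool list \<Rightarrow> bool list \<Rightarrow> (nat \<Rightarrow> int) \<Rightarrow> st" where
  "cf r0 r1 r2 r3 r4 r5 r6 b = (mk [r0, r1, r2, r3, r4, r5, r6], b)"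

lemma cf_nth[simp]:
  "fst (cf r0 r1 r2 r3 r4 r5 r6 b) 0 = r0" "fst (cf r0 r1 r2 r3 r4 r5 r6 b) (Suc 0) = r1" "fst (cf r0 r1 r2 r3 r4 r5 r6 b) 2 = r2"
  "fst (cf r0 r1 r2 r3 r4 r5 r6 b) 3 = r3" "fst (cf r0 r1 r2 r3 r4 r5 r6 b) 4 = r4" "fst (cf r0 r1 r2 r3 r4 r5 r6 b) 5 = r5"
  "fst (cf r0 r1 r2 r3 r4 r5 r6 b) 6 = r6" "snd (cf r0 r1 r2 r3 r4 r5 r6 b) = b"
  by (simp_all add: cf_def mk_def eval_nat_numeral)

lemma cf_snd[simp]: "(fst (cf r0 r1 r2 r3 r4 r5 r6 b), b') = cf r0 r1 r2 r3 r4 r5 r6 b'"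
  by (simp add: cf_def)

lemma cf_upd[simp]:
  "(fst (cf r0 r1 r2 r3 r4 r5 r6 b))(0 := y) = fst (cf y r1 r2 r3 r4 r5 r6 b)"
  "(fst (cf r0 r1 r2 r3 r4 r5 r6 b))(Suc 0 := y) = fst (cf r0 y r2 r3 r4 r5 r6 b)"
  "(fst (cf r0 r1 r2 r3 r4 r5 r6 b))(2 := y) = fst (cf r0 r1 y r3 r4 r5 r6 b)"
  "(fst (cf r0 r1 r2 r3 r4 r5 r6 b))(3 := y) = fst (cf r0 r1 r2 y r4 r5 r6 b)"
  "(fst (cf r0 r1 r2 r3 r4 r5 r6 b))(4 := y) = fst (cf r0 r1 r2 r3 y r5 r6 b)"
  "(fst (cf r0 r1 r2 r3 r4 r5 r6 b))(5 := y) = fst (cf r0 r1 r2 r3 r4 y r6 b)"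
  "(fst (cf r0 r1 r2 r3 r4 r5 r6 b))(6 := y) = fst (cf r0 r1 r2 r3 r4 r5 y b)"
  by (simp_all add: cf_def mk_upd eval_nat_numeral)

abbreviation un :: "nat \<Rightarrow> bool list" where "un n \<equiv> replicate n True"

fun emit :: "bool list \<Rightarrow> com" where
  "emit [] = Skip"
| "emit (x # w) = Push 1 x ;; emit w"

lemma prun_emit:
  "prun D sz (emit w) (\<lambda>a. cf (r0 a) (r1 a) (r2 a) (r3 a) (r4 a) (r5 a) (r6 a) (b a))
    (\<lambda>a. cf (r0 a) (rev w @ r1 a) (r2 a) (r3 a) (r4 a) (r5 a) (r6 a) (b a))"
proof (induction w arbitrary: r1)
  case (Cons x w)
  show ?case unfolding emit.simps
    by (rule prun_Push_Seq) (use Cons[of "\<lambda>a. x # r1 a"] in simp)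
qed (simp add: prun_Skip)

text \<open>The code of \<open>k\<close> zero digits at the low end of a name, that is, of a factor
  \<open>2 ^ k\<close>.\<close>

definition pairs :: "nat \<Rightarrow> bool list" where "pairs k = concat (replicate k [True, False])"

lemma rev_pairs[simp]: "pairs 0 = []" "rev (pairs (Suc k)) = False # True # rev (pairs k)"
proof -
  have "concat (replicate (Suc k) [True, False]) = concat (replicate k [True, False]) @ [True, False]" by (induction k) simp_all
  then show "rev (pairs (Suc k)) = False # True # rev (pairs k)" unfolding pairs_def by simp
qed (simp add: pairs_def)

text \<open>A template for strings depending on a number \<open>i\<close>: \<open>None\<close> stands for \<open>i\<close> copies of \<open>[True, False]\<close>.\<close>

type_synonym tpl = "bool list option list"

fun inst :: "nat \<Rightarrow> tpl \<Rightarrow> bool list" where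
  "inst i [] = []"
| "inst i (None # u) = pairs i @ inst i u"
| "inst i (Some w # u) = w @ inst i u"

text \<open>The parameter is held in unary by register 3, parked on register 4 during output and put
  back.\<close>

fun emit_tpl :: "tpl \<Rightarrow> com" where
  "emit_tpl [] = Skip"
| "emit_tpl (None # u) = While 3 {Some True} (Pop 3 ;; Push 4 True ;; Push 1 True ;; Push 1 False) ;; While 4 {Some True} (Pop 4 ;; Push 3 True) ;; emit_tpl u"
| "emit_tpl (Some w # u) = emit w ;; emit_tpl u"

lemma un_minus: "k < n \<Longrightarrow> un (n - k) = True # un (n - Suc k)"
  by (metis Suc_diff_Suc replicate_Suc)

lemma prun_pairs:
  assumes "polyb D sz i"
  shows "prun D sz (While 3 {Some True} (Pop 3 ;; Push 4 True ;; Push 1 True ;; Push 1 False) ;; While 4 {Some True} (Pop 4 ;; Push 3 True))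
     (\<lambda>a. cf (r0 a) (r1 a) (r2 a) (un (i a)) [] (r5 a) (r6 a) (b a))
     (\<lambda>a. cf (r0 a) (rev (pairs (i a)) @ r1 a) (r2 a) (un (i a)) [] (r5 a) (r6 a) (b a))"
proof -
  let ?S = "\<lambda>a k. cf (r0 a) (rev (pairs k) @ r1 a) (r2 a) (un (i a - k)) (un k) (r5 a) (r6 a) (b a)"
  have 1: "prun D sz (While 3 {Some True} (Pop 3 ;; Push 4 True ;; Push 1 True ;; Push 1 False)) (\<lambda>a. ?S a 0) (\<lambda>a. ?S a (i a))"
  proof (rule prun_While[OF assms])
    show "prun {(a, k). a \<in> D \<and> k < i a} (\<lambda>(a, k). sz a) (Pop 3 ;; Push 4 True ;; Push 1 True ;; Push 1 False) (\<lambda>(a, k). ?S a k) (\<lambda>(a, k). ?S a (Suc k))"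
      by (intro prun_Pop_Seq prun_Push_Seq prun_Push) (auto simp: un_minus)
  qed (auto simp: un_minus)
  let ?U = "\<lambda>a k. cf (r0 a) (rev (pairs (i a)) @ r1 a) (r2 a) (un k) (un (i a - k)) (r5 a) (r6 a) (b a)"
  have 2: "prun D sz (While 4 {Some True} (Pop 4 ;; Push 3 True)) (\<lambda>a. ?U a 0) (\<lambda>a. ?U a (i a))"
  proof (rule prun_While[OF assms])
    show "prun {(a, k). a \<in> D \<and> k < i a} (\<lambda>(a, k). sz a) (Pop 4 ;; Push 3 True) (\<lambda>(a, k). ?U a k) (\<lambda>(a, k). ?U a (Suc k))"
      by (intro prun_Pop_Seq prun_Push) (auto simp: un_minus)
  qed (auto simp: un_minus)
  show ?thesis using prun_Seq[OF 1, of _ "\<lambda>a. ?U a (i a)"] 2 by simp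
qed

lemma prun_assoc: "prun D sz ((c ;; d) ;; e) S S' \<Longrightarrow> prun D sz (c ;; d ;; e) S S'"
proof -
  assume "prun D sz ((c ;; d) ;; e) S S'"
  then obtain t where t: "polyb D sz t" "\<forall>a\<in>D. \<exists>t'\<le>t a. run_com ((c ;; d) ;; e) (S a) t' (S' a)" unfolding prun_def by blast
  have "run_com (c ;; d ;; e) \<sigma> t' \<sigma>'" if h: "run_com ((c ;; d) ;; e) \<sigma> t' \<sigma>'" for \<sigma> t' \<sigma>'
  proof -
    obtain u v \<sigma>1 where 1: "run_com (c ;; d) \<sigma> u \<sigma>1" "run_com e \<sigma>1 v \<sigma>'" "t' = u + v"
      using h by (cases rule: exec.cases) auto
    obtain u1 u2 \<sigma>2 where 2: "run_com c \<sigma> u1 \<sigma>2" "run_com d \<sigma>2 u2 \<sigma>1" "u = u1 + u2"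
      using 1(1) by (cases rule: exec.cases) auto
    show ?thesis using exec.Seq[OF 2(1) exec.Seq[OF 2(2) 1(2)]] 1(3) 2(3) by (simp add: add.assoc)
  qed
  then show ?thesis using t unfolding prun_def by blast
qed

lemma prun_emit_tpl:
  assumes "polyb D sz i"
  shows "prun D sz (emit_tpl u)
     (\<lambda>a. cf (r0 a) (r1 a) (r2 a) (un (i a)) [] (r5 a) (r6 a) (b a))
     (\<lambda>a. cf (r0 a) (rev (inst (i a) u) @ r1 a) (r2 a) (un (i a)) [] (r5 a) (r6 a) (b a))"
proof (induction u arbitrary: r1)
  case (Cons x u)
  show ?case
  proof (cases x)
    case None
    show ?thesis unfolding None emit_tpl.simps
      by (rule prun_assoc, rule prun_Seq[OF prun_pairs[OF assms]]) (use Cons in simp)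
  next
    case (Some w)
    show ?thesis unfolding Some emit_tpl.simps by (rule prun_Seq[OF prun_emit]) (use Cons in simp)
  qed
qed (simp add: prun_Skip)

lemma prun_move_bit:
  assumes ne: "\<And>a. a \<in> D \<Longrightarrow> fst (S a) r \<noteq> []" and "r \<noteq> q"
    and S': "\<And>a. a \<in> D \<Longrightarrow> S' a = ((fst (S a))(r := tl (fst (S a) r), q := hd (fst (S a) r) # fst (S a) q), snd (S a))"
  shows "prun D sz (move_bit r q) S S'"
proof -
  let ?T = "\<lambda>a. ((fst (S a))(r := tl (fst (S a) r)), snd (S a))"
  have hd: "topb (fst (S a) r) = Some (hd (fst (S a) r))" if "a \<in> D" for a
    using ne[OF that] by (cases "fst (S a) r") auto
  show ?thesis unfolding move_bit_def
    by (intro prun_Cond prun_Seq[OF prun_Pop[where S' = ?T] prun_Push]) (use ne hd S' assms(2) in auto)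
qed

lemma take_rev_hd: "k < length x \<Longrightarrow> rev (take (length x - k) x) = x ! (length x - Suc k) # rev (take (length x - Suc k) x)"
proof -
  assume k: "k < length x"
  then have "length x - k = Suc (length x - Suc k)" by (simp add: Suc_diff_Suc)
  then have "take (length x - k) x = take (length x - Suc k) x @ [x ! (length x - Suc k)]"
    using k by (simp add: take_Suc_conv_app_nth)
  then show ?thesis by simp
qed

definition mul :: com where
  "mul = While 2 {Some True} (Pop 2 ;; While 5 {Some True} (Pop 5 ;; Push 3 True ;; Push 6 True) ;; While 3 {Some True} (Pop 3 ;; Push 5 True))
     ;; While 6 {Some True} (Pop 6 ;; Push 2 True)"

lemma prun_mul:
  assumes m: "polyb D sz m" and n: "polyb D sz n"
  shows "prun D sz mul (\<lambda>a. cf (r0 a) (r1 a) (un (m a)) [] [] (un (n a)) [] (b a)) (\<lambda>a. cf (r0 a) (r1 a) (un (m a * n a)) [] [] (un (n a)) [] (b a))"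
proof -
  let ?S = "\<lambda>a k. cf (r0 a) (r1 a) (un (m a - k)) [] [] (un (n a)) (un (k * n a)) (b a)"
  have 1: "prun D sz (While 2 {Some True} (Pop 2 ;; While 5 {Some True} (Pop 5 ;; Push 3 True ;; Push 6 True) ;; While 3 {Some True} (Pop 3 ;; Push 5 True)))
     (\<lambda>a. ?S a 0) (\<lambda>a. ?S a (m a))"
  proof (rule prun_While[OF m])
    let ?D = "{(a, k). a \<in> D \<and> k < m a}" and ?sz = "\<lambda>(a, k). sz a :: nat"
    let ?T = "\<lambda>(a, k). cf (r0 a) (r1 a) (un (m a - Suc k)) [] [] (un (n a)) (un (k * n a)) (b a)"
    let ?U = "\<lambda>(a, k) l. cf (r0 a) (r1 a) (un (m a - Suc k)) (un l) [] (un (n a - l)) (un (k * n a + l)) (b a)"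
    let ?V = "\<lambda>(a, k) l. cf (r0 a) (r1 a) (un (m a - Suc k)) (un (n a - l)) [] (un l) (un (k * n a + n a)) (b a)"
    have n': "polyb ?D ?sz (\<lambda>(a, k). n a)" using n unfolding polyb_def by auto
    have 1: "prun ?D ?sz (Pop 2) (\<lambda>(a, k). ?S a k) ?T" by (rule prun_Pop) (auto simp: un_minus)
    have 2: "prun ?D ?sz (While 5 {Some True} (Pop 5 ;; Push 3 True ;; Push 6 True)) (\<lambda>a. ?U a 0) (\<lambda>a. ?U a ((\<lambda>(a, k). n a) a))"
    proof (rule prun_While[OF n'])
      show "prun {(a, k). a \<in> ?D \<and> k < (case a of (a, k) \<Rightarrow> n a)} (\<lambda>(a, k). ?sz a) (Pop 5 ;; Push 3 True ;; Push 6 True) (\<lambda>(a, k). ?U a k) (\<lambda>(a, k). ?U a (Suc k))"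
        by (intro prun_Pop_Seq prun_Push_Seq prun_Push) (auto simp: un_minus)
    qed (auto simp: un_minus)
    have 3: "prun ?D ?sz (While 3 {Some True} (Pop 3 ;; Push 5 True)) (\<lambda>a. ?V a 0) (\<lambda>a. ?V a ((\<lambda>(a, k). n a) a))"
    proof (rule prun_While[OF n'])
      show "prun {(a, k). a \<in> ?D \<and> k < (case a of (a, k) \<Rightarrow> n a)} (\<lambda>(a, k). ?sz a) (Pop 3 ;; Push 5 True) (\<lambda>(a, k). ?V a k) (\<lambda>(a, k). ?V a (Suc k))"
        by (intro prun_Pop_Seq prun_Push) (auto simp: un_minus)
    qed (auto simp: un_minus)
    show "prun ?D ?sz (Pop 2 ;; While 5 {Some True} (Pop 5 ;; Push 3 True ;; Push 6 True) ;; While 3 {Some True} (Pop 3 ;; Push 5 True))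
        (\<lambda>(a, k). ?S a k) (\<lambda>(a, k). ?S a (Suc k))"
      by (rule prun_Seq[OF 1 prun_Seq[OF prun_cong[OF 2] prun_cong[OF 3]]]) (auto simp: add.commute)
  qed (auto simp: un_minus)
  let ?U = "\<lambda>a k. cf (r0 a) (r1 a) (un k) [] [] (un (n a)) (un (m a * n a - k)) (b a)"
  have 2: "prun D sz (While 6 {Some True} (Pop 6 ;; Push 2 True)) (\<lambda>a. ?U a 0) (\<lambda>a. ?U a (m a * n a))"
  proof (rule prun_While[OF polyb_mult[OF m n]])
    show "prun {(a, k). a \<in> D \<and> k < m a * n a} (\<lambda>(a, k). sz a) (Pop 6 ;; Push 2 True) (\<lambda>(a, k). ?U a k) (\<lambda>(a, k). ?U a (Suc k))"
      by (intro prun_Pop_Seq prun_Push) (auto simp: un_minus)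
  qed (auto simp: un_minus)
  show ?thesis unfolding mul_def using prun_Seq[OF 1, of _ "\<lambda>a. ?U a (m a * n a)"] 2 by simp
qed

fun muls :: "nat \<Rightarrow> com" where
  "muls 0 = Skip"
| "muls (Suc d) = mul ;; muls d"

lemma prun_muls:
  assumes "polyb D sz m" "polyb D sz n"
  shows "prun D sz (muls d) (\<lambda>a. cf (r0 a) (r1 a) (un (m a)) [] [] (un (n a)) [] (b a)) (\<lambda>a. cf (r0 a) (r1 a) (un (m a * n a ^ d)) [] [] (un (n a)) [] (b a))"
  using assms(1)
proof (induction d arbitrary: m)
  case (Suc d)
  have "prun D sz (muls (Suc d)) (\<lambda>a. cf (r0 a) (r1 a) (un (m a)) [] [] (un (n a)) [] (b a)) (\<lambda>a. cf (r0 a) (r1 a) (un (m a * n a * n a ^ d)) [] [] (un (n a)) [] (b a))"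
    unfolding muls.simps by (rule prun_Seq[OF prun_mul[OF Suc.prems assms(2)] Suc.IH[OF polyb_mult[OF Suc.prems assms(2)]]])
  then show ?case by (simp add: mult.assoc)
qed (simp add: prun_Skip)

text \<open>Measuring the input empties register 0, so the input is parked on register 4 and
  restored by a second reversal. Register 5 keeps \<open>length x + 2\<close>, from which
  \<open>deliver\<close> recovers the length.\<close>

definition unary_power :: "nat \<Rightarrow> com" where
  "unary_power d = While 0 nz (move_bit 0 4 ;; Push 5 True) ;; While 4 nz (move_bit 4 0) ;; Push 5 True ;; Push 5 True ;; Push 2 True ;; muls d"

lemma prun_unary_power:
  "prun UNIV length (unary_power d) (\<lambda>x. cf x [] [] [] [] [] [] (b x)) (\<lambda>x. cf x [] (un ((length x + 2) ^ d)) [] [] (un (length x + 2)) [] (b x))"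
proof -
  let ?S = "\<lambda>x k. cf (drop k x) [] [] [] (rev (take k x)) (un k) [] (b x)"
  have 1: "prun UNIV length (While 0 nz (move_bit 0 4 ;; Push 5 True)) (\<lambda>x. ?S x 0) (\<lambda>x. ?S x (length x))"
  proof (rule prun_While[OF polyb_size])
    show "prun {(x, k). x \<in> UNIV \<and> k < length x} (\<lambda>(x, k). length x) (move_bit 0 4 ;; Push 5 True) (\<lambda>(x, k). ?S x k) (\<lambda>(x, k). ?S x (Suc k))"
      by (rule prun_Seq[OF prun_move_bit[where S' = "\<lambda>(x, k). cf (drop (Suc k) x) [] [] [] (rev (take (Suc k) x)) (un k) [] (b x)"] prun_Push])
        (auto simp: drop_hd take_Suc_conv_app_nth)
  qed (auto simp: topb_in_nz None_nz)
  let ?T = "\<lambda>x k. cf (drop (length x - k) x) [] [] [] (rev (take (length x - k) x)) (un (length x)) [] (b x)"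
  have 2: "prun UNIV length (While 4 nz (move_bit 4 0)) (\<lambda>x. ?T x 0) (\<lambda>x. ?T x (length x))"
  proof (rule prun_While[OF polyb_size])
    have "drop (length x - Suc k) x = x ! (length x - Suc k) # drop (length x - k) x" if "k < length x" for x :: "bool list" and k
      using drop_hd[of "length x - Suc k" x] that by (simp add: Suc_diff_Suc)
    then show "prun {(x, k). x \<in> UNIV \<and> k < length x} (\<lambda>(x, k). length x) (move_bit 4 0) (\<lambda>(x, k). ?T x k) (\<lambda>(x, k). ?T x (Suc k))"
      by (intro prun_move_bit) (auto simp: take_rev_hd)
  qed (auto simp: topb_in_nz None_nz)
  have 3: "prun UNIV length (While 4 nz (move_bit 4 0)) (\<lambda>x. ?S x (length x)) (\<lambda>x. cf x [] [] [] [] (un (length x)) [] (b x))"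
    using 2 by simp
  have 4: "prun UNIV length (muls d) (\<lambda>x. cf x [] (un 1) [] [] (un (length x + 2)) [] (b x)) (\<lambda>x. cf x [] (un (1 * (length x + 2) ^ d)) [] [] (un (length x + 2)) [] (b x))"
    by (rule prun_muls) (intro polyb_const polyb_add polyb_size)+
  have 5: "prun UNIV length (Push 5 True ;; Push 5 True ;; Push 2 True ;; muls d) (\<lambda>x. cf x [] [] [] [] (un (length x)) [] (b x))
      (\<lambda>x. cf x [] (un (1 * (length x + 2) ^ d)) [] [] (un (length x + 2)) [] (b x))"
    by (intro prun_Push_Seq) (simp add: prun_cong[OF 4])
  show ?thesis unfolding unary_power_def
    by (rule prun_cong[OF prun_Seq[OF 1 prun_Seq[OF 3 5]]]) simp_all
qed

subsection \<open>Emitting a string given by templates\<close>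

text \<open>The shape of all outputs of the reduction: instances of \<open>A\<close> are the axioms
  for each distance from a head, instances of \<open>B\<close> the facts for each cell, which depend
  on the input symbol there or on its absence.\<close>

definition wr :: "bool list \<Rightarrow> tpl \<Rightarrow> bool list \<Rightarrow> (bool option \<Rightarrow> tpl) \<Rightarrow> bool list \<Rightarrow> nat \<Rightarrow> bool list \<Rightarrow> bool list" where
  "wr w0 A w1 B w2 N x = w0 @ concat (map (\<lambda>i. inst i A) [0..<N]) @ w1 @ concat (map (\<lambda>i. inst i (B (topb (drop i x)))) [0..<N]) @ w2"

fun tsize :: "tpl \<Rightarrow> nat" where
  "tsize [] = 0"
| "tsize (None # u) = 2 + tsize u"
| "tsize (Some w # u) = length w + tsize u"

lemma length_pairs: "length (pairs k) = 2 * k"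
  by (induction k) (simp_all add: pairs_def)

lemma length_inst: "i < N \<Longrightarrow> length (inst i u) \<le> tsize u * N"
proof (induction u rule: tsize.induct)
  case (2 u)
  then show ?case by (simp add: length_pairs add_mult_distrib add_mono)
next
  case (3 w u)
  have "length w \<le> length w * N" using 3(2) by simp
  then show ?case using 3 by (simp add: add_mult_distrib add_mono)
qed simp

lemma length_concat_le: "(\<And>i. i < N \<Longrightarrow> length (g i) \<le> m) \<Longrightarrow> length (concat (map g [0..<N])) \<le> N * m"
proof (induction N)
  case (Suc N)
  have "length (concat (map g [0..<N])) \<le> N * m" "length (g N) \<le> m" using Suc by simp_all
  then show ?case by simp
qed simp

definition emit_next :: "(bool option \<Rightarrow> tpl) \<Rightarrow> com" where
  "emit_next B = Cond 0 {Some True} (emit_tpl (B (Some True)) ;; Pop 0)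
        (Cond 0 {Some False} (emit_tpl (B (Some False)) ;; Pop 0) (emit_tpl (B None)))"

text \<open>Register 2 controls the first pass and leaves a copy in register 6 for the second;
  register 3 is the parameter of the templates in both.\<close>

definition write_com :: "bool list \<Rightarrow> tpl \<Rightarrow> bool list \<Rightarrow> (bool option \<Rightarrow> tpl) \<Rightarrow> bool list \<Rightarrow> com" where
  "write_com w0 A w1 B w2 =
    emit w0 ;; While 2 {Some True} (Pop 2 ;; Push 6 True ;; emit_tpl A ;; Push 3 True) ;; While 3 {Some True} (Pop 3) ;;
    emit w1 ;; While 6 {Some True} (Pop 6 ;;
       emit_next B ;; Push 3 True) ;; emit w2"

lemma prun_write:
  assumes N: "polyb UNIV length N" and le: "\<And>x. length x \<le> N x"
  shows "prun UNIV length (write_com w0 A w1 B w2) (\<lambda>x. cf x [] (un (N x)) [] [] (r5 x) [] (b x))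
    (\<lambda>x. cf [] (rev (wr w0 A w1 B w2 (N x) x)) [] (un (N x)) [] (r5 x) [] (b x))"
proof -
  let ?D = "{(x, k). x \<in> UNIV \<and> k < N x} :: (bool list \<times> nat) set" and ?sz = "\<lambda>(x, k). length x :: nat"
  let ?oA = "\<lambda>k. w0 @ concat (map (\<lambda>i. inst i A) [0..<k])"
  let ?S = "\<lambda>x k. cf x (rev (?oA k)) (un (N x - k)) (un k) [] (r5 x) (un k) (b x)"
  have k: "polyb ?D ?sz (\<lambda>(x, k). k)" by (rule polyb_mono[OF polyb_loop[OF N]]) auto
  have eA: "prun ?D ?sz (emit_tpl A) (\<lambda>(x, k). cf x (rev (?oA k)) (un (N x - Suc k)) (un k) [] (r5 x) (un (Suc k)) (b x))
      (\<lambda>(x, k). cf x (rev (?oA (Suc k))) (un (N x - Suc k)) (un k) [] (r5 x) (un (Suc k)) (b x))"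
    by (rule prun_cong[OF prun_emit_tpl[OF k, of _ "\<lambda>(x, k). x" "\<lambda>(x, k). rev (?oA k)" "\<lambda>(x, k). un (N x - Suc k)" "\<lambda>(x, k). r5 x"
          "\<lambda>(x, k). un (Suc k)" "\<lambda>(x, k). b x"]]) auto
  have 1: "prun UNIV length (While 2 {Some True} (Pop 2 ;; Push 6 True ;; emit_tpl A ;; Push 3 True)) (\<lambda>x. ?S x 0) (\<lambda>x. ?S x (N x))"
  proof (rule prun_While[OF N])
    show "prun ?D ?sz (Pop 2 ;; Push 6 True ;; emit_tpl A ;; Push 3 True) (\<lambda>(x, k). ?S x k) (\<lambda>(x, k). ?S x (Suc k))"
      by (rule prun_Seq[OF prun_Pop[where S' = "\<lambda>(x, k). cf x (rev (?oA k)) (un (N x - Suc k)) (un k) [] (r5 x) (un k) (b x)"]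
         prun_Seq[OF prun_Push prun_Seq[OF eA prun_Push]]]) (auto simp: un_minus)
  qed (auto simp: un_minus)
  let ?T = "\<lambda>x k. cf x (rev (?oA (N x))) [] (un (N x - k)) [] (r5 x) (un (N x)) (b x)"
  have 2: "prun UNIV length (While 3 {Some True} (Pop 3)) (\<lambda>x. ?T x 0) (\<lambda>x. ?T x (N x))"
    by (rule prun_While[OF N]) (auto simp: un_minus intro!: prun_Pop)
  let ?oB = "\<lambda>x k. ?oA (N x) @ w1 @ concat (map (\<lambda>i. inst i (B (topb (drop i x)))) [0..<k])"
  let ?U = "\<lambda>x k. cf (drop k x) (rev (?oB x k)) [] (un k) [] (r5 x) (un (N x - k)) (b x)"
  let ?V = "\<lambda>(x, k). cf (drop k x) (rev (?oB x k)) [] (un k) [] (r5 x) (un (N x - Suc k)) (b x)"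
  let ?W = "\<lambda>(x, k). cf (drop (Suc k) x) (rev (?oB x (Suc k))) [] (un k) [] (r5 x) (un (N x - Suc k)) (b x)"
  let ?Z = "\<lambda>(x, k). cf (drop k x) (rev (?oB x (Suc k))) [] (un k) [] (r5 x) (un (N x - Suc k)) (b x)"
  have kE: "polyb E ?sz (\<lambda>(x, k). k)" if "E \<subseteq> ?D" for E using k that unfolding polyb_def by blast
  have eB: "prun E ?sz (emit_tpl (B z)) ?V ?Z"
    if E: "E \<subseteq> ?D" "\<And>x k. (x, k) \<in> E \<Longrightarrow> topb (drop k x) = z" for E z
  proof (rule prun_cong[OF prun_emit_tpl[OF kE[OF E(1)], of _ "\<lambda>(x, k). drop k x" "\<lambda>(x, k). rev (?oB x k)" "\<lambda>(x, k). []" "\<lambda>(x, k). r5 x"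
          "\<lambda>(x, k). un (N x - Suc k)" "\<lambda>(x, k). b x"]], goal_cases)
    case (1 a)
    obtain x l where xl: "a = (x, l)" by (cases a)
    show ?case unfolding xl by simp
  next
    case (2 a)
    obtain x l where xl: "a = (x, l)" by (cases a)
    have "topb (drop l x) = z" using E(2) 2 xl by blast
    then show ?case unfolding xl by simp
  qed
  have ePop: "prun E ?sz (emit_tpl (B (Some z)) ;; Pop 0) ?V ?W"
    if E: "E \<subseteq> ?D" "\<And>x k. (x, k) \<in> E \<Longrightarrow> topb (drop k x) = Some z" for E z
  proof (rule prun_Seq[OF eB[OF E] prun_Pop])
    fix a assume a: "a \<in> E"
    obtain x l where xl: "a = (x, l)" by (cases a)
    have "topb (drop l x) = Some z" using E(2) a xl by blast
    then show "fst (?Z a) 0 \<noteq> []"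
      unfolding xl by (cases "drop l x") simp_all
  qed (auto simp: drop_Suc tl_drop)
  have tE: "z = None" if "z \<noteq> Some True" "z \<noteq> Some False" for z :: "bool option"
    using that by (cases z) auto
  have eN: "prun E ?sz (emit_tpl (B None)) ?V ?W"
    if E: "E \<subseteq> ?D" "\<And>x k. (x, k) \<in> E \<Longrightarrow> topb (drop k x) = None" for E
  proof -
    have e: "drop (Suc l) x = drop l x" if "(x, l) \<in> E" for x l
    proof -
      have "topb (drop l x) = None" using E(2) that by blast
      then have "drop l x = []" by (cases "drop l x") simp_all
      then show ?thesis by simp
    qed
    have w: "?W a = ?Z a" if a: "a \<in> E" for a
    proof -
      obtain x l where xl: "a = (x, l)" by (cases a)
      show ?thesis unfolding xl prod.case e[OF a[unfolded xl]] by simp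
    qed
    have p: "prun E ?sz (emit_tpl (B None)) ?V ?Z"
      by (rule eB[OF E(1)]) (rule E(2))
    show ?thesis by (rule prun_cong[OF p refl w])
  qed
  have c: "prun ?D ?sz (emit_next B) ?V ?W" unfolding emit_next_def
  proof (intro prun_Cond ePop eN)
    fix x l assume "(x, l) \<in> {a \<in> {a \<in> ?D. topb (fst (?V a) 0) \<notin> {Some True}}. topb (fst (?V a) 0) \<notin> {Some False}}"
    then show "topb (drop l x) = None" using tE by auto
  qed auto
  have 3: "prun UNIV length (While 6 {Some True} (Pop 6 ;;
       emit_next B ;; Push 3 True)) (\<lambda>x. ?U x 0) (\<lambda>x. ?U x (N x))"
  proof (rule prun_While[OF N])
    show "prun ?D ?sz (Pop 6 ;;
       emit_next B ;; Push 3 True) (\<lambda>(x, k). ?U x k) (\<lambda>(x, k). ?U x (Suc k))"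
      by (rule prun_Seq[OF prun_Pop prun_Seq[OF c prun_Push]]) (auto simp: un_minus)
  qed (auto simp: un_minus)
  note emit0 = prun_emit[of UNIV length w0 "\<lambda>x. x" "\<lambda>x. []" "\<lambda>x. un (N x)" "\<lambda>x. []" "\<lambda>x. []" r5 "\<lambda>x. []" b]
  note emit1 = prun_emit[of UNIV length w1 "\<lambda>x. x" "\<lambda>x. rev (?oA (N x))" "\<lambda>x. []" "\<lambda>x. []" "\<lambda>x. []" r5 "\<lambda>x. un (N x)" b]
  note emit2 = prun_emit[of UNIV length w2 "\<lambda>x. []" "\<lambda>x. rev (?oB x (N x))" "\<lambda>x. []" "\<lambda>x. un (N x)" "\<lambda>x. []" r5 "\<lambda>x. []" b]
  show ?thesis unfolding write_com_def
    by (rule prun_Seq[OF prun_cong[OF emit0] prun_Seq[OF prun_cong[OF 1] prun_Seq[OF prun_cong[OF 2]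
        prun_Seq[OF prun_cong[OF emit1] prun_Seq[OF prun_cong[OF 3] prun_cong[OF emit2]]]]]]) (simp_all add: le wr_def)
qed

text \<open>Popping an empty register 0 moves its bottom to the right, so popping it once per output bit
  (after filling it with as many symbols as there are input bits) makes room for the output.\<close>

definition deliver :: com where
  "deliver = Pop 5 ;; Pop 5 ;; While 5 {Some True} (Pop 5 ;; Push 0 True) ;;
     While 1 nz (Pop 0 ;; move_bit 1 4) ;; While 4 nz (move_bit 4 1) ;; While 1 nz (move_bit 1 0)"

text \<open>A stack bottom can move to the right only, so the output must not be shorter than the
  input. The first two pops reduce \<open>length x + 2\<close> in register 5 to
  \<open>length x\<close>.\<close>

lemma prun_deliver:
  assumes y: "polyb UNIV length (\<lambda>x. length (y x))" and le: "\<And>x. length x \<le> length (y x)"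
  shows "prun UNIV length deliver (\<lambda>x :: bool list. cf [] (rev (y x)) [] (r3 x) [] (un (length x + 2)) [] ((\<lambda>_. 0)(0 := int (length x))))
    (\<lambda>x. cf (y x) [] [] (r3 x) [] [] [] ((\<lambda>_. 0)(0 := int (length (y x)))))"
proof -
  let ?b = "\<lambda>n. (\<lambda>_ :: nat. 0 :: int)(0 := int n)"
  let ?S = "\<lambda>(x :: bool list) k. cf (un k) (rev (y x)) [] (r3 x) [] (un (length x - k)) [] (?b (length x))"
  have 1: "prun UNIV length (While 5 {Some True} (Pop 5 ;; Push 0 True)) (\<lambda>x. ?S x 0) (\<lambda>x. ?S x (length x))"
  proof (rule prun_While[OF polyb_size])
    show "prun {(x, k). x \<in> UNIV \<and> k < length x} (\<lambda>(x, k). length x) (Pop 5 ;; Push 0 True) (\<lambda>(x, k). ?S x k) (\<lambda>(x, k). ?S x (Suc k))"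
      by (intro prun_Pop_Seq prun_Push) (auto simp: un_minus)
  qed (auto simp: un_minus)
  let ?m = "\<lambda>x. length (y x)"
  have y': "drop (?m x - Suc k) (y x) = y x ! (?m x - Suc k) # drop (?m x - k) (y x)" if "k < ?m x" for x k
    using drop_hd[of "?m x - Suc k" "y x"] that by (simp add: Suc_diff_Suc)
  \<comment> \<open>As long as filler is left, pops do not shift the bottom; afterwards each one
    does. After \<open>k\<close> pops it is at \<open>max (length x) k\<close>.\<close>
  let ?T = "\<lambda>x k. cf (un (length x - k)) (rev (take (?m x - k) (y x))) [] (r3 x) (drop (?m x - k) (y x)) [] [] (?b (max (length x) k))"
  have 2: "prun UNIV length (While 1 nz (Pop 0 ;; move_bit 1 4)) (\<lambda>x. ?T x 0) (\<lambda>x. ?T x (?m x))"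
  proof (rule prun_While[OF y])
    let ?D = "{(x, k). x \<in> UNIV \<and> k < ?m x}"
    let ?T' = "\<lambda>(x, k). cf (un (length x - Suc k)) (rev (take (?m x - k) (y x))) [] (r3 x) (drop (?m x - k) (y x)) [] [] (?b (max (length x) (Suc k)))"
    have p: "prun ?D (\<lambda>(x, k). length x) (Pop 0) (\<lambda>(x, k). ?T x k) ?T'"
    proof (rule prun_Pop')
      fix a assume "a \<in> ?D"
      obtain x k where a: "a = (x, k)" by (cases a)
      show "?T' a = ((fst ((\<lambda>(x, k). ?T x k) a))(0 := tl (fst ((\<lambda>(x, k). ?T x k) a) 0)),
          if fst ((\<lambda>(x, k). ?T x k) a) 0 = [] then (snd ((\<lambda>(x, k). ?T x k) a))(0 := snd ((\<lambda>(x, k). ?T x k) a) 0 + 1) else snd ((\<lambda>(x, k). ?T x k) a))"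
      proof (cases "k < length x")
        case True
        then have "max (length x) k = length x" "max (length x) (Suc k) = length x" by auto
        then show ?thesis unfolding a using True by (simp add: un_minus)
      next
        case False
        then have "max (length x) k = k" "max (length x) (Suc k) = Suc k" by auto
        then show ?thesis unfolding a using False by (simp add: add.commute)
      qed
    qed
    show "prun ?D (\<lambda>(x, k). length x) (Pop 0 ;; move_bit 1 4) (\<lambda>(x, k). ?T x k) (\<lambda>(x, k). ?T x (Suc k))"
      by (rule prun_Seq[OF p prun_move_bit]) (auto simp: take_rev_hd y')
  qed (auto simp: topb_in_nz None_nz)
  let ?U = "\<lambda>x k. cf [] (rev (take k (y x))) [] (r3 x) (drop k (y x)) [] [] (?b (?m x))"
  have 3: "prun UNIV length (While 4 nz (move_bit 4 1)) (\<lambda>x. ?U x 0) (\<lambda>x. ?U x (?m x))"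
  proof (rule prun_While[OF y])
    show "prun {(x, k). x \<in> UNIV \<and> k < ?m x} (\<lambda>(x, k). length x) (move_bit 4 1) (\<lambda>(x, k). ?U x k) (\<lambda>(x, k). ?U x (Suc k))"
      by (rule prun_move_bit) (auto simp: drop_hd take_Suc_conv_app_nth)
  qed (auto simp: topb_in_nz None_nz)
  let ?V = "\<lambda>x k. cf (drop (?m x - k) (y x)) (rev (take (?m x - k) (y x))) [] (r3 x) [] [] [] (?b (?m x))"
  have 4: "prun UNIV length (While 1 nz (move_bit 1 0)) (\<lambda>x. ?V x 0) (\<lambda>x. ?V x (?m x))"
  proof (rule prun_While[OF y])
    show "prun {(x, k). x \<in> UNIV \<and> k < ?m x} (\<lambda>(x, k). length x) (move_bit 1 0) (\<lambda>(x, k). ?V x k) (\<lambda>(x, k). ?V x (Suc k))"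
      by (rule prun_move_bit) (auto simp: take_rev_hd y')
  qed (auto simp: topb_in_nz None_nz)
  show ?thesis unfolding deliver_def
    by (rule prun_Seq[OF prun_Pop[where S' = "\<lambda>x :: bool list. cf [] (rev (y x)) [] (r3 x) [] (un (length x + 1)) [] (?b (length x))"]
      prun_Seq[OF prun_Pop[where S' = "\<lambda>x. ?S x 0"] prun_Seq[OF 1 prun_Seq[OF prun_cong[OF 2] prun_Seq[OF prun_cong[OF 3] prun_cong[OF 4]]]]]])
      (use le in \<open>auto simp: max_def\<close>)
qed

theorem polytime_write:
  assumes "1 \<le> d" and le: "\<And>x. length x \<le> length (wr w0 A w1 B w2 ((length x + 2) ^ d) x)"
  shows "polytime_computable (\<lambda>x. wr w0 A w1 B w2 ((length x + 2) ^ d) x)"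
proof -
  let ?N = "\<lambda>x :: bool list. (length x + 2) ^ d"
  let ?f = "\<lambda>x. wr w0 A w1 B w2 (?N x) x"
  let ?b = "\<lambda>x :: bool list. (\<lambda>_ :: nat. 0 :: int)(0 := int (length x))"
  let ?c = "unary_power d ;; write_com w0 A w1 B w2 ;; deliver"
  let ?S = "\<lambda>x. cf (?f x) [] [] (un (?N x)) [] [] [] ((\<lambda>_. 0)(0 := int (length (?f x))))"
  have N: "polyb UNIV length ?N" by (intro polyb_power polyb_add polyb_size polyb_const)
  have nN: "length x \<le> ?N x" for x
    using self_le_power[of "length x + 2" d] assms(1) by simp
  let ?m = "\<lambda>x. length w0 + ?N x * (tsize A * ?N x) + length w1 + ?N x * ((tsize (B None) + tsize (B (Some True)) + tsize (B (Some False))) * ?N x) + length w2"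
  have B: "tsize (B z) \<le> tsize (B None) + tsize (B (Some True)) + tsize (B (Some False))" for z
    by (cases z rule: option.exhaust; cases "the z") auto
  have len: "length (?f x) \<le> ?m x" for x
  proof -
    have a: "length (concat (map (\<lambda>i. inst i A) [0..<?N x])) \<le> ?N x * (tsize A * ?N x)"
      by (rule length_concat_le) (rule length_inst)
    have b: "length (concat (map (\<lambda>i. inst i (B (topb (drop i x)))) [0..<?N x])) \<le> ?N x * ((tsize (B None) + tsize (B (Some True)) + tsize (B (Some False))) * ?N x)"
      by (rule length_concat_le) (meson length_inst B mult_le_mono1 order_trans)
    show ?thesis using a b unfolding wr_def length_append by linarith
  qed
  have y: "polyb UNIV length (\<lambda>x. length (?f x))"
    by (rule polyb_mono[of _ _ ?m]) (intro polyb_add polyb_mult polyb_const N, rule len)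
  have r: "prun UNIV length ?c (\<lambda>x. cf x [] [] [] [] [] [] (?b x))
     (\<lambda>x. ?S x)"
    by (rule prun_Seq[OF prun_unary_power prun_Seq[OF prun_write[OF N nN] prun_deliver[OF y le]]])
  obtain q where q: "\<And>x. \<exists>t\<le>poly q (length x). run_com ?c (cf x [] [] [] [] [] [] (?b x)) t
     (?S x)"
    using prun_poly[OF r] by blast
  have init: "init_st x = cf x [] [] [] [] [] [] (?b x)" for x
    unfolding init_st_def cf_def by (auto simp: mk_def fun_eq_iff nth_Cons split: nat.split)
  show ?thesis
  proof (rule polytime_computable_I)
    fix x
    obtain t where t: "t \<le> poly q (length x)" "run_com ?c (init_st x) t
      (?S x)"
      using q[of x] unfolding init by blast
    then show "\<exists>t s b. run_com ?c (init_st x) t (s, b) \<and> s 0 = ?f x \<and> b 0 = int (length (?f x)) \<and> t \<le> poly q (length x)"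
      unfolding cf_def by (intro exI conjI) (assumption | simp add: mk_def)+
  qed
qed

section \<open>Describing computations by Horn ontologies\<close>

text \<open>The exponent of 2 shows in the binary name as a run of zero digits, which a template can
  vary with the distance; everything else is put into the odd factor.\<close>

definition aid :: "nat \<Rightarrow> nat \<Rightarrow> nat \<Rightarrow> nat \<Rightarrow> nat" where
  "aid j g k s = 2 ^ j * (2 * prod_encode (g, prod_encode (k, s)) + 1)"

lemma power2_odd_inject: "2 ^ i * (2 * a + 1) = 2 ^ j * (2 * b + 1) \<longleftrightarrow> i = j \<and> a = (b :: nat)"
proof (induction i arbitrary: j)
  case 0
  show ?case by (cases j) (auto, presburger+)
next
  case (Suc i)
  show ?case
  proof (cases j)
    case 0
    have "2 ^ Suc i * (2 * a + 1) \<noteq> 2 ^ 0 * (2 * b + 1)"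
    proof
      assume e: "2 ^ Suc i * (2 * a + 1) = 2 ^ 0 * (2 * b + 1)"
      have "even (2 ^ Suc i * (2 * a + 1))" "odd (2 ^ 0 * (2 * b + 1))" by simp_all
      then show False unfolding e by blast
    qed
    then show ?thesis unfolding 0 by blast
  next
    case (Suc l)
    have e: "2 ^ Suc n * c = 2 * (2 ^ n * c)" for n c :: nat by simp
    show ?thesis unfolding Suc e mult_cancel1 Suc.IH by simp
  qed
qed

lemma aid_inject: "aid j g k s = aid j' g' k' s' \<longleftrightarrow> j = j' \<and> g = g' \<and> k = k' \<and> s = s'"
  unfolding aid_def power2_odd_inject by (auto simp: prod_encode_eq)

lemma aid_nonzero: "aid j g k s \<noteq> 0"
  unfolding aid_def by simp

lemma enc_name_power: "n \<noteq> 0 \<Longrightarrow> enc_name (2 ^ i * n) = pairs i @ enc_name n"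
proof (induction i)
  case (Suc i)
  have "enc_name (2 ^ Suc i * n) = True # False # enc_name (2 ^ i * n)"
    by (subst enc_name.simps) (use Suc.prems in simp)
  then show ?case using Suc by (simp add: pairs_def)
qed simp

text \<open>In an atom \<open>(v, j, g, k, s)\<close>, the Boolean \<open>v\<close> tells whether the template parameter is added to \<open>j\<close>.\<close>

type_synonym patom = "bool \<times> nat \<times> nat \<times> nat \<times> nat"

fun aname :: "nat \<Rightarrow> patom \<Rightarrow> nat" where
  "aname i (v, j, g, k, s) = aid ((if v then i else 0) + j) g k s"

fun tpl_atom :: "patom \<Rightarrow> tpl" where
  "tpl_atom (v, j, g, k, s) = (if v then [None] else []) @ [Some (enc_name (aid j g k s))]"

lemma inst_append: "inst i (u @ v) = inst i u @ inst i v"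
  by (induction u rule: tsize.induct) simp_all

lemma inst_atom: "inst i (tpl_atom a) = enc_name (aname i a)"
proof (cases a)
  case (fields v j g k s)
  have "aid (i + j) g k s = 2 ^ i * aid j g k s" unfolding aid_def power_add by (rule mult.assoc)
  then show ?thesis using enc_name_power[OF aid_nonzero] fields by simp
qed

datatype phead = HA patom | HX patom | HB

fun hfml :: "nat \<Rightarrow> phead \<Rightarrow> ltl" where
  "hfml i (HA a) = Atom (aname i a)"
| "hfml i (HX a) = Next (Atom (aname i a))"
| "hfml i HB = Bot"

definition fml :: "nat \<Rightarrow> patom list \<times> phead \<Rightarrow> ltl" where
  "fml i r = Imp (Conj (map (\<lambda>a. Atom (aname i a)) (fst r))) (hfml i (snd r))"

fun tpl_conj :: "patom list \<Rightarrow> tpl" where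
  "tpl_conj [] = [Some [False, False, True]]"
| "tpl_conj (a # as) = Some [True, False, False, False, False, False] # tpl_atom a @ tpl_conj as"

fun tpl_head :: "phead \<Rightarrow> tpl" where
  "tpl_head (HA a) = Some [False, False, False] # tpl_atom a"
| "tpl_head (HX a) = Some [True, False, True, False, True, False, False, False, False] # tpl_atom a"
| "tpl_head HB = [Some [False, True, False]]"

text \<open>The first bit is the mark by which \<open>enc_list\<close> announces another element;
  the others encode \<open>Neg\<close> and \<open>And\<close>, the outer constructors of an
  implication.\<close>

definition tpl_ax :: "patom list \<times> phead \<Rightarrow> tpl" where
  "tpl_ax r = Some [True, False, True, True, True, False, False] # tpl_conj (fst r) @ Some [False, True, True] # tpl_head (snd r)"

lemma inst_ax: "inst i (tpl_ax r) = True # enc_ltl (fml i r)"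
proof -
  have c: "inst i (tpl_conj as) = enc_ltl (Conj (map (\<lambda>a. Atom (aname i a)) as))" for as
    by (induction as) (simp_all add: inst_append inst_atom)
  have h: "inst i (tpl_head h) = enc_ltl (hfml i h)" for h by (cases h) (simp_all add: inst_atom)
  show ?thesis unfolding tpl_ax_def fml_def by (simp add: inst_append c h)
qed

lemma inst_concat: "inst i (concat us) = concat (map (inst i) us)"
  by (induction us) (simp_all add: inst_append)

lemma enc_list_concat_map: "enc_list enc xs = concat (map (\<lambda>x. True # enc x) xs) @ [False]"
  by (induction xs) simp_all

definition rules :: "(patom list \<times> phead) list \<Rightarrow> (patom list \<times> phead) list \<Rightarrow> nat \<Rightarrow> ltl list" where
  "rules F S N = map (fml 0) F @ concat (map (\<lambda>i. map (fml i) S) [0..<N])"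

definition facts :: "patom \<Rightarrow> (bool option \<Rightarrow> patom list) \<Rightarrow> nat \<Rightarrow> bool list \<Rightarrow> (nat \<times> nat) list" where
  "facts a G N x = (aname 0 a, 0) # concat (map (\<lambda>i. map (\<lambda>a. (aname i a, 0)) (G (topb (drop i x)))) [0..<N])"

lemma concat_map_concat: "concat (map f (concat xss)) = concat (map (\<lambda>xs. concat (map f xs)) xss)"
  by (induction xss) simp_all

lemma polytime_rules:
  assumes "1 \<le> d" and ne: "\<And>z. G z \<noteq> []"
  shows "polytime_computable (\<lambda>x. enc_input (rules F S ((length x + 2) ^ d)) [] [facts a G ((length x + 2) ^ d) x])"
proof -
  let ?w0 = "concat (map (\<lambda>r. True # enc_ltl (fml 0 r)) F)"
  let ?A = "concat (map tpl_ax S)"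
  \<comment> \<open>The bits end the ontology, give the empty list of positive examples, open the
    only negative example and announce its first fact. The two bits of \<open>?w2\<close> close this
    example and the list.\<close>
  let ?w1 = "[False, False, True, True] @ enc_fact (aname 0 a, 0)"
  let ?B = "\<lambda>z. concat (map (\<lambda>a. Some [True] # tpl_atom a @ [Some [False]]) (G z))"
  let ?w2 = "[False, False]"
  have A: "inst i ?A = concat (map (\<lambda>r. True # enc_ltl (fml i r)) S)" for i
    unfolding inst_concat by (simp add: inst_ax comp_def)
  have B: "inst i (?B z) = concat (map (\<lambda>a. True # enc_fact (aname i a, 0)) (G z))" for i z
    unfolding inst_concat by (simp add: inst_append inst_atom enc_fact_def enc_unary_def comp_def)
  have eq: "enc_input (rules F S N) [] [facts a G N x] = wr ?w0 ?A ?w1 ?B ?w2 N x" for N x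
    unfolding wr_def A B enc_input_def rules_def facts_def
    by (simp add: enc_list_concat_map concat_map_concat comp_def)
  \<comment> \<open>Every round of the second pass writes at least one bit, and there are no fewer
    rounds than input bits; thus the output is long enough for \<open>deliver\<close>.\<close>
  have "length x \<le> length (wr ?w0 ?A ?w1 ?B ?w2 ((length x + 2) ^ d) x)" for x
  proof -
    have "N \<le> length (concat (map g [0..<N]))" if "\<And>i. g i \<noteq> []" for N and g :: "nat \<Rightarrow> bool list"
    proof (induction N)
      case (Suc N)
      have "length (concat (map g [0..<Suc N])) = length (concat (map g [0..<N])) + length (g N)" by simp
      moreover have "length (g N) > 0" using that by simp
      ultimately show ?case using Suc by linarith
    qed simp
    then have "N \<le> length (concat (map (\<lambda>i. inst i (?B (topb (drop i x)))) [0..<N]))" for N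
      unfolding B using ne by (metis (no_types, lifting) concat_eq_Nil_conv list.set_map list.simps(3) imageI last_in_set)
    then have "(length x + 2) ^ d \<le> length (concat (map (\<lambda>i. inst i (?B (topb (drop i x)))) [0..<(length x + 2) ^ d]))" .
    moreover have "length x \<le> (length x + 2) ^ d" using self_le_power[of "length x + 2" d] assms(1) by simp
    ultimately show ?thesis unfolding wr_def by simp
  qed
  from polytime_write[OF assms(1) this] show ?thesis unfolding eq .
qed

text \<open>The base is at least 2, so that coefficients are absorbed by a larger exponent.\<close>

lemma poly_le_power: "\<exists>d\<ge>1. \<forall>n. poly p n \<le> (n + 2) ^ d" for p :: "nat poly"
proof (induction p)
  case (pCons a p)
  then obtain d where d: "\<And>n. poly p n \<le> (n + 2) ^ d" by blast
  have "poly (pCons a p) n \<le> (n + 2) ^ (a + d + 2)" for n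
  proof -
    have "a \<le> (n + 2) ^ a" using less_exp[of a] power_mono[of 2 "n + 2" a] by simp
    also have "\<dots> \<le> (n + 2) ^ (a + d + 1)" by (rule power_increasing) simp_all
    finally have 1: "a \<le> (n + 2) ^ (a + d + 1)" .
    have "n * poly p n \<le> (n + 2) * (n + 2) ^ d" using d[of n] by (intro mult_mono) simp_all
    also have "\<dots> = (n + 2) ^ Suc d" by simp
    also have "\<dots> \<le> (n + 2) ^ (a + d + 1)" by (rule power_increasing) simp_all
    finally have "a + n * poly p n \<le> 2 * (n + 2) ^ (a + d + 1)" using 1 by linarith
    also have "\<dots> \<le> (n + 2) * (n + 2) ^ (a + d + 1)" by (rule mult_right_mono) simp_all
    finally show ?thesis by simp
  qed
  then show ?case by (intro exI[of _ "a + d + 2"]) simp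
qed (auto intro: exI[of _ 1])

definition holds :: "interp \<Rightarrow> nat \<Rightarrow> nat \<Rightarrow> patom list \<times> phead \<Rightarrow> bool" where
  "holds I n i r \<longleftrightarrow> ((\<forall>a\<in>set (fst r). aname i a \<in> I n) \<longrightarrow>
     (case snd r of HA a \<Rightarrow> aname i a \<in> I n | HX a \<Rightarrow> aname i a \<in> I (Suc n) | HB \<Rightarrow> False))"

lemma sat_fml: "sat I n (fml i r) \<longleftrightarrow> holds I n i r"
  unfolding fml_def holds_def sat_Imp sat_Conj by (cases "snd r") (auto simp: sat_Next simp del: sat.simps(6))

lemma model_rules: "model I (set (rules F S N)) \<longleftrightarrow> (\<forall>n. (\<forall>r\<in>set F. holds I n 0 r) \<and> (\<forall>i<N. \<forall>r\<in>set S. holds I n i r))"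
proof -
  have "set (rules F S N) = fml 0 ` set F \<union> (\<Union>i\<in>{..<N}. fml i ` set S)" unfolding rules_def by auto
  show ?thesis unfolding model_def sat_fml[symmetric] \<open>set (rules F S N) = _\<close> by blast
qed

lemma rules_horn: "set (rules F S N) \<in> LTL_horn"
proof -
  have "fml i r \<in> horn_axioms" for i r
    unfolding fml_def horn_axioms_def
    by (cases "snd r") (fastforce intro: horn_literals.intros)+
  then show ?thesis unfolding LTL_horn_def rules_def by auto
qed

section \<open>Runs of Turing machines\<close>

definition scan :: "tm \<Rightarrow> config \<Rightarrow> nat list" where
  "scan M c = map (\<lambda>i. tape c i (head c i)) [0..<num_tapes M]"

definition acts :: "tm \<Rightarrow> config \<Rightarrow> nat \<Rightarrow> nat \<times> move" where
  "acts M c k = snd (delta M (state c) (scan M c)) ! k"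

lemma step_nonhalted:
  assumes "\<not> halted M c"
  shows "state (step M c) = fst (delta M (state c) (scan M c))"
    "k < num_tapes M \<Longrightarrow> tape (step M c) k = (tape c k)(head c k := fst (acts M c k))"
    "k < num_tapes M \<Longrightarrow> head (step M c) k = head c k + offset (snd (acts M c k))"
  using assms unfolding step_def acts_def scan_def by (simp_all add: case_prod_beta)

lemma run_Suc: "run M x (Suc t) = step M (run M x t)"
  by (simp add: run_def)

lemma run_halted: "halted M (run M x t) \<Longrightarrow> run M x (t + n) = run M x t"
  by (induction n) (simp_all add: run_Suc step_def)

lemma run_symbols:
  assumes "wf_tm M"
  shows "state (run M x t) < num_states M \<and> (\<forall>k<num_tapes M. \<forall>p. tape (run M x t) k p < num_symbols M)"
proof (induction t)
  case 0
  show ?case using assms unfolding run_def init_config_def wf_tm_def tape_of_def by auto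
next
  case (Suc t)
  show ?case
  proof (cases "halted M (run M x t)")
    case True
    then show ?thesis using Suc by (simp add: run_Suc step_def)
  next
    case False
    let ?c = "run M x t"
    have "length (scan M ?c) = num_tapes M" "set (scan M ?c) \<subseteq> {..<num_symbols M}" using Suc unfolding scan_def by auto
    then have d: "fst (delta M (state ?c) (scan M ?c)) < num_states M" "length (snd (delta M (state ?c) (scan M ?c))) = num_tapes M"
        "fst ` set (snd (delta M (state ?c) (scan M ?c))) \<subseteq> {..<num_symbols M}"
      using assms Suc unfolding wf_tm_def by blast+
    have "fst (acts M ?c k) < num_symbols M" if "k < num_tapes M" for k
      using d(2,3) that unfolding acts_def by force
    then show ?thesis using Suc d(1) step_nonhalted[OF False] by (simp add: run_Suc)
  qed
qed

text \<open>A discrete intermediate value argument: a head starts at 0 and moves by at most one cell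
  per step. Space bounds therefore limit the distance from the origin.\<close>

lemma head_between:
  assumes "k < num_tapes M" "min 0 (head (run M x t) k) \<le> z" "z \<le> max 0 (head (run M x t) k)"
  shows "\<exists>u. head (run M x u) k = z"
  using assms(2,3)
proof (induction t)
  case 0
  have "head (run M x 0) k = 0" by (simp add: run_def init_config_def)
  then show ?case using 0 by (intro exI[of _ 0]) simp
next
  case (Suc t)
  show ?case
  proof (cases "head (run M x (Suc t)) k = z")
    case False
    have o: "\<bar>offset d\<bar> \<le> 1" for d by (cases d) simp_all
    have "\<bar>head (run M x (Suc t)) k - head (run M x t) k\<bar> \<le> 1"
      using step_nonhalted(3)[of M "run M x t" k] assms(1) o
      by (cases "halted M (run M x t)") (simp_all add: run_Suc step_def)
    then have "min 0 (head (run M x t) k) \<le> z" "z \<le> max 0 (head (run M x t) k)" using Suc.prems False by linarith+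
    then show ?thesis by (rule Suc.IH)
  qed blast
qed

lemma head_bound:
  assumes "finite (visited_cells M x)" "card (visited_cells M x) \<le> B" "k < num_tapes M"
  shows "\<bar>head (run M x t) k\<bar> < int B"
proof -
  let ?h = "head (run M x t) k"
  have "Pair k ` {min 0 ?h..max 0 ?h} \<subseteq> visited_cells M x"
    using head_between[OF assms(3)] assms(3) unfolding visited_cells_def by fastforce
  then have "card (Pair k ` {min 0 ?h..max 0 ?h}) \<le> B" using card_mono[OF assms(1)] assms(2) order_trans by blast
  moreover have "card (Pair k ` {min 0 ?h..max 0 ?h}) = card {min 0 ?h..max 0 ?h}" by (rule card_image) (simp add: inj_on_def)
  ultimately show ?thesis by simp
qed

text \<open>Kinds of atoms: 0 the state; 2 the moves of the heads; 3 and 4 the symbol \<open>j\<close> cells to the right and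
  to the left of a head. The tapes move below the heads.\<close>

fun mcode :: "move \<Rightarrow> nat" where
  "mcode Go_Left = 0" | "mcode Stay = 1" | "mcode Go_Right = 2"

lemma mcode: "int (mcode d) = 1 + offset d"
  by (cases d) simp_all

text \<open>After a move to the left, the symbol just written is one cell to the right of the head,
  and conversely.\<close>

fun written :: "nat \<Rightarrow> nat \<times> move \<Rightarrow> patom" where
  "written k (s, Go_Left) = (False, 1, 3, k, s)"
| "written k (s, Stay) = (False, 0, 3, k, s)"
| "written k (s, Go_Right) = (False, 1, 4, k, s)"

definition body :: "tm \<Rightarrow> nat \<Rightarrow> nat list \<Rightarrow> patom list" where
  "body M q ss = (False, 0, 0, 0, q) # map (\<lambda>k. (False, 0, 3, k, ss ! k)) [0..<num_tapes M]"

text \<open>A cell that comes under the head from the left arrives as kind 4 at distance 0, which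
  the second group of rules turns into kind 3. The accepting state has no transition rules, so
  acceptance leads to no contradiction.\<close>

definition fixed_rules :: "tm \<Rightarrow> (patom list \<times> phead) list" where
  "fixed_rules M = ([(False, 0, 0, 0, reject_state M)], HB)
     # concat (map (\<lambda>k. map (\<lambda>s. ([(False, 0, 4, k, s)], HA (False, 0, 3, k, s))) [0..<num_symbols M]) [0..<num_tapes M])
     @ concat (map (\<lambda>q. concat (map (\<lambda>ss.
         (body M q ss, HX (False, 0, 0, 0, fst (delta M q ss)))
         # concat (map (\<lambda>k. [(body M q ss, HA (False, 0, 2, k, mcode (snd (snd (delta M q ss) ! k)))),
                             (body M q ss, HX (written k (snd (delta M q ss) ! k)))]) [0..<num_tapes M]))
       (List.n_lists (num_tapes M) [0..<num_symbols M])))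
       (filter (\<lambda>q. q \<noteq> accept_state M \<and> q \<noteq> reject_state M) [0..<num_states M]))"

text \<open>With move code \<open>d\<close> the head advances by \<open>d - 1\<close>: distance
  \<open>i + 1\<close> on the right becomes \<open>i + 2 - d\<close> and on the left
  \<open>i + d\<close>. Starting from \<open>i + 1\<close> keeps both of them sums of
  \<open>i\<close> and a constant, as the templates require.\<close>

definition shift_rules :: "tm \<Rightarrow> (patom list \<times> phead) list" where
  "shift_rules M = concat (map (\<lambda>k. concat (map (\<lambda>s. concat (map (\<lambda>d.
       [([(True, 1, 3, k, s), (False, 0, 2, k, d)], HX (True, 2 - d, 3, k, s)),
        ([(True, 1, 4, k, s), (False, 0, 2, k, d)], HX (True, d, 4, k, s))]) [0..<3])) [0..<num_symbols M])) [0..<num_tapes M])"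

definition cells :: "tm \<Rightarrow> bool option \<Rightarrow> patom list" where
  "cells M z = (True, 0, 3, 0, case z of None \<Rightarrow> 0 | Some b \<Rightarrow> if b then 2 else 1)
     # map (\<lambda>k. (True, 0, 3, k, 0)) [1..<num_tapes M] @ map (\<lambda>k. (True, 1, 4, k, 0)) [0..<num_tapes M]"

lemma tape_of_drop: "tape_of x (int i) = (case topb (drop i x) of None \<Rightarrow> 0 | Some b \<Rightarrow> if b then 2 else 1)"
proof (cases "i < length x")
  case True
  then show ?thesis unfolding tape_of_def drop_hd[OF True] by simp
qed (simp add: tape_of_def)

lemma holds_clause:
  "holds I n i (as, HA a) \<longleftrightarrow> ((\<forall>a\<in>set as. aname i a \<in> I n) \<longrightarrow> aname i a \<in> I n)"
  "holds I n i (as, HX a) \<longleftrightarrow> ((\<forall>a\<in>set as. aname i a \<in> I n) \<longrightarrow> aname i a \<in> I (Suc n))"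
  "holds I n i (as, HB) \<longleftrightarrow> \<not> (\<forall>a\<in>set as. aname i a \<in> I n)"
  by (simp_all add: holds_def)

lemma body_iff: "(\<forall>a\<in>set (body M q ss). aname i a \<in> J) \<longleftrightarrow> aid 0 0 0 q \<in> J \<and> (\<forall>k<num_tapes M. aid 0 3 k (ss ! k) \<in> J)"
  unfolding body_def by auto

definition words :: "tm \<Rightarrow> nat list set" where
  "words M = {ss. length ss = num_tapes M \<and> set ss \<subseteq> {..<num_symbols M}}"

lemma Ball_lists:
  "(\<forall>x\<in>set (concat (map g l)). R x) \<longleftrightarrow> (\<forall>y\<in>set l. \<forall>x\<in>set (g y). R x)"
  "(\<forall>x\<in>set (map h l). R x) \<longleftrightarrow> (\<forall>y\<in>set l. R (h y))"
  "(\<forall>x\<in>set (u # m). R x) \<longleftrightarrow> R u \<and> (\<forall>x\<in>set m. R x)"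
  "(\<forall>x\<in>set (m @ m'). R x) \<longleftrightarrow> (\<forall>x\<in>set m. R x) \<and> (\<forall>x\<in>set m'. R x)"
  "(\<forall>x\<in>set []. R x) \<longleftrightarrow> True"
  "(\<forall>i\<in>set [0..<n]. T i) \<longleftrightarrow> (\<forall>i<n. T i)"
  "(\<forall>i\<in>set (filter (\<lambda>i. U i \<and> V i) [0..<n]). T i) \<longleftrightarrow> (\<forall>i<n. U i \<longrightarrow> V i \<longrightarrow> T i)"
  "(A \<and> True) = A"
  by auto

lemma fixed_rules_iff: "(\<forall>r\<in>set (fixed_rules M). P r) \<longleftrightarrow>
   P ([(False, 0, 0, 0, reject_state M)], HB) \<and>
   (\<forall>k<num_tapes M. \<forall>s<num_symbols M. P ([(False, 0, 4, k, s)], HA (False, 0, 3, k, s))) \<and>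
   (\<forall>q<num_states M. q \<noteq> accept_state M \<longrightarrow> q \<noteq> reject_state M \<longrightarrow> (\<forall>ss\<in>words M.
      P (body M q ss, HX (False, 0, 0, 0, fst (delta M q ss))) \<and> (\<forall>k<num_tapes M.
        P (body M q ss, HA (False, 0, 2, k, mcode (snd (snd (delta M q ss) ! k)))) \<and>
        P (body M q ss, HX (written k (snd (delta M q ss) ! k))))))"
proof -
  have w: "words M = set (List.n_lists (num_tapes M) [0..<num_symbols M])" unfolding words_def set_n_lists by auto
  show ?thesis unfolding fixed_rules_def w by (simp only: Ball_lists)
qed

lemma shift_rules_iff: "(\<forall>r\<in>set (shift_rules M). P r) \<longleftrightarrow> (\<forall>k<num_tapes M. \<forall>s<num_symbols M. \<forall>d<3.
   P ([(True, 1, 3, k, s), (False, 0, 2, k, d)], HX (True, 2 - d, 3, k, s)) \<and>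
   P ([(True, 1, 4, k, s), (False, 0, 2, k, d)], HX (True, d, 4, k, s)))"
  unfolding shift_rules_def by (simp only: Ball_lists)

subsection \<open>The intended model\<close>

text \<open>Distances are not bounded here, so one interpretation serves for every number of rules.
  In a halted configuration there are no moves, and hence no rule shifts the tapes.\<close>

definition atom_true :: "tm \<Rightarrow> config \<Rightarrow> nat \<Rightarrow> nat \<Rightarrow> nat \<Rightarrow> nat \<Rightarrow> bool" where
  "atom_true M c j g k s \<longleftrightarrow> g = 0 \<and> j = 0 \<and> k = 0 \<and> s = state c \<or>
     g = 2 \<and> j = 0 \<and> k < num_tapes M \<and> \<not> halted M c \<and> s = mcode (snd (acts M c k)) \<or>
     g = 3 \<and> k < num_tapes M \<and> s = tape c k (head c k + int j) \<or>
     g = 4 \<and> k < num_tapes M \<and> s = tape c k (head c k - int j)"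

definition intended :: "tm \<Rightarrow> bool list \<Rightarrow> interp" where
  "intended M x t = {aid j g k s | j g k s. atom_true M (run M x t) j g k s}"

lemma aid_intended: "aid j g k s \<in> intended M x t \<longleftrightarrow> atom_true M (run M x t) j g k s"
  unfolding intended_def by (auto simp: aid_inject)

lemma written_true:
  assumes "\<not> halted M c" "k < num_tapes M"
  shows "case written k (acts M c k) of (v, j, g, k, s) \<Rightarrow> v = False \<and> atom_true M (step M c) j g k s"
proof -
  obtain s d where a: "acts M c k = (s, d)" by (cases "acts M c k")
  show ?thesis using step_nonhalted(2,3)[OF assms] assms(2) a unfolding atom_true_def by (cases d) simp_all
qed

abbreviation tm_ont :: "tm \<Rightarrow> nat \<Rightarrow> ontology" where
  "tm_ont M N \<equiv> set (rules (fixed_rules M) (shift_rules M) N)"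

lemma intended_model:
  assumes never: "\<And>t. state (run M x t) \<noteq> reject_state M"
  shows "model (intended M x) (tm_ont M N)"
  unfolding model_rules fixed_rules_iff shift_rules_iff
proof (intro allI impI conjI ballI)
  fix n
  show "holds (intended M x) n 0 ([(False, 0, 0, 0, reject_state M)], HB)"
    using never[of n] by (simp add: holds_clause aid_intended atom_true_def)
  fix k s
  show "holds (intended M x) n 0 ([(False, 0, 4, k, s)], HA (False, 0, 3, k, s))"
    by (simp add: holds_clause aid_intended atom_true_def)
next
  fix n q ss
  assume q: "q \<noteq> accept_state M" "q \<noteq> reject_state M" and ss: "ss \<in> words M"
  let ?c = "run M x n"
  have b: "state ?c = q \<and> scan M ?c = ss \<and> \<not> halted M ?c" if "\<forall>a\<in>set (body M q ss). aname 0 a \<in> intended M x n"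
  proof -
    have "state ?c = q" "\<forall>k<num_tapes M. ss ! k = tape ?c k (head ?c k)"
      using that unfolding body_iff aid_intended atom_true_def by auto
    moreover from this have "scan M ?c = ss" using ss unfolding scan_def words_def by (intro nth_equalityI) auto
    ultimately show ?thesis using q unfolding halted_def by simp
  qed
  show "holds (intended M x) n 0 (body M q ss, HX (False, 0, 0, 0, fst (delta M q ss)))"
    unfolding holds_clause using b step_nonhalted(1)[of M ?c] by (auto simp: aid_intended atom_true_def run_Suc)
  fix k assume k: "k < num_tapes M"
  have act: "acts M ?c k = snd (delta M q ss) ! k" if "state ?c = q \<and> scan M ?c = ss \<and> \<not> halted M ?c"
    using that unfolding acts_def by simp
  show "holds (intended M x) n 0 (body M q ss, HA (False, 0, 2, k, mcode (snd (snd (delta M q ss) ! k))))"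
    unfolding holds_clause using b act k by (simp add: aid_intended atom_true_def)
  show "holds (intended M x) n 0 (body M q ss, HX (written k (snd (delta M q ss) ! k)))"
    unfolding holds_clause
  proof
    assume "\<forall>a\<in>set (body M q ss). aname 0 a \<in> intended M x n"
    then have h: "state ?c = q \<and> scan M ?c = ss \<and> \<not> halted M ?c" by (rule b)
    then have nh: "\<not> halted M ?c" by simp
    have "case written k (snd (delta M q ss) ! k) of (v, j, g, k, s) \<Rightarrow> v = False \<and> atom_true M (step M ?c) j g k s"
      using written_true[OF nh k] unfolding act[OF h] .
    then show "aname 0 (written k (snd (delta M q ss) ! k)) \<in> intended M x (Suc n)"
      by (cases "written k (snd (delta M q ss) ! k)") (simp add: aid_intended run_Suc)
  qed
next
  fix n i k s d :: nat
  assume k: "k < num_tapes M" and d: "d < 3"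
  let ?c = "run M x n"
  have mv: "\<not> halted M ?c \<and> int d = 1 + offset (snd (acts M ?c k))" if "aid 0 2 k d \<in> intended M x n"
    using that mcode unfolding aid_intended atom_true_def by auto
  have tp: "tape (run M x (Suc n)) k p = tape ?c k p" if "\<not> halted M ?c" "p \<noteq> head ?c k" for p
    using step_nonhalted(2)[OF that(1) k] that(2) by (simp add: run_Suc)
  have hd: "head (run M x (Suc n)) k = head ?c k + int d - 1" if "aid 0 2 k d \<in> intended M x n"
    using mv[OF that] step_nonhalted(3)[of M ?c k] k by (simp add: run_Suc)
  have i: "int (i + (2 - d)) = int i + 2 - int d" "int (i + d) = int i + int d" using d by auto
  show "holds (intended M x) n i ([(True, 1, 3, k, s), (False, 0, 2, k, d)], HX (True, 2 - d, 3, k, s))"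
    unfolding holds_clause
  proof
    assume "\<forall>a\<in>set [(True, 1, 3, k, s), (False, 0, 2, k, d)]. aname i a \<in> intended M x n"
    then have h: "aid 0 2 k d \<in> intended M x n" "s = tape ?c k (head ?c k + int (i + 1))" by (auto simp: aid_intended atom_true_def)
    have e: "head (run M x (Suc n)) k + int (i + (2 - d)) = head ?c k + int (i + 1)" unfolding hd[OF h(1)] i by simp
    have "tape (run M x (Suc n)) k (head (run M x (Suc n)) k + int (i + (2 - d))) = s"
      unfolding e h(2) by (rule tp) (use mv[OF h(1)] in simp_all)
    then show "aname i (True, 2 - d, 3, k, s) \<in> intended M x (Suc n)" using k by (simp add: aid_intended atom_true_def)
  qed
  show "holds (intended M x) n i ([(True, 1, 4, k, s), (False, 0, 2, k, d)], HX (True, d, 4, k, s))"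
    unfolding holds_clause
  proof
    assume "\<forall>a\<in>set [(True, 1, 4, k, s), (False, 0, 2, k, d)]. aname i a \<in> intended M x n"
    then have h: "aid 0 2 k d \<in> intended M x n" "s = tape ?c k (head ?c k - int (i + 1))" by (auto simp: aid_intended atom_true_def)
    have e: "head (run M x (Suc n)) k - int (i + d) = head ?c k - int (i + 1)" unfolding hd[OF h(1)] i by simp
    have "tape (run M x (Suc n)) k (head (run M x (Suc n)) k - int (i + d)) = s"
      unfolding e h(2) by (rule tp) (use mv[OF h(1)] in simp_all)
    then show "aname i (True, d, 4, k, s) \<in> intended M x (Suc n)" using k by (simp add: aid_intended atom_true_def)
  qed
qed

definition start :: "tm \<Rightarrow> patom" where "start M = (False, 0, 0, 0, start_state M)"

lemma satisfies_facts: "satisfies_data I (set (facts a G N x)) \<longleftrightarrow> aname 0 a \<in> I 0 \<and> (\<forall>i<N. \<forall>a\<in>set (G (topb (drop i x))). aname i a \<in> I 0)"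
  unfolding satisfies_data_def facts_def by auto

lemma cells_iff: "(\<forall>a\<in>set (cells M (topb (drop i x))). aname i a \<in> J) \<longleftrightarrow>
   aid i 3 0 (tape_of x (int i)) \<in> J \<and> (\<forall>k<num_tapes M. k \<noteq> 0 \<longrightarrow> aid i 3 k 0 \<in> J) \<and> (\<forall>k<num_tapes M. aid (i + 1) 4 k 0 \<in> J)"
proof -
  have u: "(\<forall>k\<in>set [1..<n]. T k) \<longleftrightarrow> (\<forall>k<n. k \<noteq> 0 \<longrightarrow> T k)" for n and T :: "nat \<Rightarrow> bool" by auto
  show ?thesis unfolding tape_of_drop cells_def by (simp only: Ball_lists u aname.simps if_True add_0_right)
qed

abbreviation tm_data :: "tm \<Rightarrow> nat \<Rightarrow> bool list \<Rightarrow> data_instance" where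
  "tm_data M N x \<equiv> set (facts (start M) (cells M) N x)"

lemma intended_facts:
  assumes "wf_tm M"
  shows "satisfies_data (intended M x) (tm_data M N x)"
proof -
  have "1 \<le> num_tapes M" using assms unfolding wf_tm_def by blast
  then show ?thesis unfolding satisfies_facts cells_iff aid_intended
    by (simp add: start_def aid_intended atom_true_def run_def init_config_def tape_of_def)
qed

subsection \<open>Every model follows the computation\<close>

definition follows :: "tm \<Rightarrow> nat \<Rightarrow> config \<Rightarrow> nat set \<Rightarrow> bool" where
  "follows M B c J \<longleftrightarrow> aid 0 0 0 (state c) \<in> J \<and> (\<forall>k<num_tapes M. \<forall>p. \<bar>p\<bar> < int B \<longrightarrow>
     (if head c k \<le> p then aid (nat (p - head c k)) 3 k (tape c k p) \<in> J else aid (nat (head c k - p)) 4 k (tape c k p) \<in> J))"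

text \<open>Two positions of absolute value below \<open>B\<close> are less than
  \<open>2 * B\<close> apart, so the shift rule for the distance between head and cell is among the
  \<open>N\<close> rules.\<close>

lemma follows_step:
  assumes J: "model J (tm_ont M N)" and N: "2 * B \<le> N"
    and h: "\<And>k. k < num_tapes M \<Longrightarrow> \<bar>head c k\<bar> < int B" "\<And>k. k < num_tapes M \<Longrightarrow> \<bar>head (step M c) k\<bar> < int B"
    and s: "state c < num_states M" "\<And>k p. k < num_tapes M \<Longrightarrow> tape c k p < num_symbols M"
    and nh: "\<not> halted M c" and f: "follows M B c (J t)"
  shows "follows M B (step M c) (J (Suc t))"
proof -
  note R = J[unfolded model_rules fixed_rules_iff shift_rules_iff]
  have merge: "aid 0 3 k z \<in> J n" if "aid 0 4 k z \<in> J n" "k < num_tapes M" "z < num_symbols M" for k z n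
  proof -
    have "holds J n 0 ([(False, 0, 4, k, z)], HA (False, 0, 3, k, z))" using R that(2,3) by blast
    then show ?thesis using that(1) unfolding holds_clause by simp
  qed
  have w: "scan M c \<in> words M" unfolding words_def scan_def using s(2) by auto
  have b: "\<forall>a\<in>set (body M (state c) (scan M c)). aname 0 a \<in> J t"
  proof -
    have "aid 0 3 k (tape c k (head c k)) \<in> J t" if "k < num_tapes M" for k
      using f h(1)[OF that] that unfolding follows_def by (auto dest!: spec[of _ k] spec[of _ "head c k"])
    then show ?thesis using f unfolding body_iff follows_def scan_def by simp
  qed
  have T: "holds J t 0 (body M (state c) (scan M c), HX (False, 0, 0, 0, fst (delta M (state c) (scan M c))))"
    "\<And>k. k < num_tapes M \<Longrightarrow> holds J t 0 (body M (state c) (scan M c), HA (False, 0, 2, k, mcode (snd (acts M c k))))"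
    "\<And>k. k < num_tapes M \<Longrightarrow> holds J t 0 (body M (state c) (scan M c), HX (written k (acts M c k)))"
    using R w s(1) nh unfolding halted_def acts_def by blast+
  have st: "aid 0 0 0 (state (step M c)) \<in> J (Suc t)"
    using T(1) b unfolding holds_clause step_nonhalted(1)[OF nh] by simp
  have "if head (step M c) k \<le> p then aid (nat (p - head (step M c) k)) 3 k (tape (step M c) k p) \<in> J (Suc t)
      else aid (nat (head (step M c) k - p)) 4 k (tape (step M c) k p) \<in> J (Suc t)"
    if k: "k < num_tapes M" and p: "\<bar>p\<bar> < int B" for k p
  proof -
    obtain y d where a: "acts M c k = (y, d)" by (cases "acts M c k")
    note st = step_nonhalted(2,3)[OF nh k] a
    have mv: "aid 0 2 k (mcode d) \<in> J t" using T(2)[OF k] b a unfolding holds_clause by simp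
    have wr: "aname 0 (written k (y, d)) \<in> J (Suc t)" using T(3)[OF k] b a unfolding holds_clause by simp
    have d3: "mcode d < 3" by (cases d) simp_all
    show ?thesis
    proof (cases p "head c k" rule: linorder_cases)
      case equal
      then show ?thesis using wr st by (cases d) simp_all
    next
      case greater
      define i where "i = nat (p - head c k - 1)"
      have i: "int i = p - head c k - 1" unfolding i_def using greater by simp
      have iN: "i < N" using i N p h(1)[OF k] by linarith
      have "aid (i + 1) 3 k (tape c k p) \<in> J t"
      proof -
        have "nat (p - head c k) = i + 1" using i by linarith
        then show ?thesis using f k p greater unfolding follows_def by force
      qed
      moreover have "holds J t i ([(True, 1, 3, k, tape c k p), (False, 0, 2, k, mcode d)], HX (True, 2 - mcode d, 3, k, tape c k p))"
        using R iN k s(2)[OF k] d3 by blast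
      ultimately have m: "aid (i + (2 - mcode d)) 3 k (tape c k p) \<in> J (Suc t)" using mv unfolding holds_clause by simp
      have "head (step M c) k \<le> p" "nat (p - head (step M c) k) = i + (2 - mcode d)"
        using st i mcode[of d] d3 by auto
      then show ?thesis using m st greater by simp
    next
      case less
      define i where "i = nat (head c k - p - 1)"
      have i: "int i = head c k - p - 1" unfolding i_def using less by simp
      have iN: "i < N" using i N p h(1)[OF k] by linarith
      have "aid (i + 1) 4 k (tape c k p) \<in> J t"
      proof -
        have "nat (head c k - p) = i + 1" using i by linarith
        then show ?thesis using f k p less unfolding follows_def by force
      qed
      moreover have "holds J t i ([(True, 1, 4, k, tape c k p), (False, 0, 2, k, mcode d)], HX (True, mcode d, 4, k, tape c k p))"
        using R iN k s(2)[OF k] d3 by blast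
      ultimately have m: "aid (i + mcode d) 4 k (tape c k p) \<in> J (Suc t)" using mv unfolding holds_clause by simp
      have e: "head (step M c) k - p = int (i + mcode d)" using st i mcode[of d] by simp
      have tp: "tape (step M c) k p = tape c k p" using st less by simp
      show ?thesis
      \<comment> \<open>At distance 0 the cell has come under the head, and the symbol must be
        available as kind 3.\<close>
      proof (cases "i + mcode d = 0")
        case True
        then show ?thesis using e m merge[OF _ k s(2)[OF k]] tp by simp
      next
        case False
        then have "\<not> head (step M c) k \<le> p" "nat (head (step M c) k - p) = i + mcode d" using e by auto
        then show ?thesis using m tp by simp
      qed
    qed
  qed
  then show ?thesis using st unfolding follows_def by blast
qed

lemma no_model:
  assumes "wf_tm M" and B: "finite (visited_cells M x)" "card (visited_cells M x) \<le> B" "2 * B \<le> N"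
    and rej: "state (run M x T) = reject_state M"
    and J: "model J (tm_ont M N)" "satisfies_data J (tm_data M N x)"
  shows False
proof -
  have hl: "halted M (run M x T)" using rej unfolding halted_def by simp
  \<comment> \<open>Before the first halting time every step is a genuine transition, which the
    rules enforce; from there on the configuration is constant.\<close>
  define U where "U = (LEAST t. halted M (run M x t))"
  have U: "halted M (run M x U)" "U \<le> T" unfolding U_def using hl by (auto intro: LeastI Least_le)
  have nh: "\<not> halted M (run M x t)" if "t < U" for t using not_less_Least[of t] that unfolding U_def by blast
  have rejU: "state (run M x U) = reject_state M" using run_halted[OF U(1), of "T - U"] U(2) rej by simp
  have h: "\<bar>head (run M x t) k\<bar> < int B" if "k < num_tapes M" for t k by (rule head_bound[OF B(1,2) that])
  have "follows M B (run M x t) (J t)" if "t \<le> U" for t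
    using that
  proof (induction t)
    case 0
    have c: "aid i 3 0 (tape_of x (int i)) \<in> J 0" "k < num_tapes M \<Longrightarrow> k \<noteq> 0 \<Longrightarrow> aid i 3 k 0 \<in> J 0" "k < num_tapes M \<Longrightarrow> aid (i + 1) 4 k 0 \<in> J 0"
      if "i < N" for i k using J(2) that unfolding satisfies_facts cells_iff by blast+
    have "if 0 \<le> p then aid (nat p) 3 k (tape (run M x 0) k p) \<in> J 0 else aid (nat (- p)) 4 k (tape (run M x 0) k p) \<in> J 0"
      if k: "k < num_tapes M" and p: "\<bar>p\<bar> < int B" for k p
    proof (cases "0 \<le> p")
      case True
      then have "nat p < N" "int (nat p) = p" using p B(3) by auto
      then show ?thesis using c(1,2)[of "nat p"] k True by (cases "k = 0") (simp_all add: run_def init_config_def)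
    next
      case False
      then have n: "nat (- p) - 1 < N" "nat (- p) - 1 + 1 = nat (- p)" using p B(3) by auto
      have "tape (run M x 0) k p = 0" using False by (simp add: run_def init_config_def tape_of_def)
      then show ?thesis using c(3)[OF n(1) k] n(2) False by simp
    qed
    moreover have "aid 0 0 0 (state (run M x 0)) \<in> J 0" using J(2) unfolding satisfies_facts by (simp add: start_def run_def init_config_def)
    moreover have "head (run M x 0) k = 0" for k by (simp add: run_def init_config_def)
    ultimately show ?case unfolding follows_def by simp
  next
    case (Suc t)
    show ?case unfolding run_Suc
      by (rule follows_step[OF J(1) B(3)])
        (use h[of _ t] h[of _ "Suc t"] run_symbols[OF assms(1), of x t] nh[of t] Suc in \<open>simp_all add: run_Suc\<close>)
  qed
  then have "aid 0 0 0 (reject_state M) \<in> J U" using rejU unfolding follows_def by fastforce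
  moreover have "holds J U 0 ([(False, 0, 0, 0, reject_state M)], HB)" using J(1) unfolding model_rules fixed_rules_iff by blast
  ultimately show False unfolding holds_clause by simp
qed

text \<open>Without positive examples, a single negative example is separable exactly if it is consistent with the
  ontology: atom 0 is not used by the encoding.\<close>

lemma separable_iff:
  assumes "wf_tm M" "decides M A" "finite (visited_cells M x)" "card (visited_cells M x) \<le> B" "2 * B \<le> N"
    and Q: "Conj (map Atom [0]) \<in> Q"
  shows "separable Q (tm_ont M N) {} {tm_data M N x} \<longleftrightarrow> x \<in> A"
proof
  assume "separable Q (tm_ont M N) {} {tm_data M N x}"
  then obtain J where J: "model J (tm_ont M N)" "satisfies_data J (tm_data M N x)"
    unfolding separable_def entails_def by blast
  show "x \<in> A"
  proof (rule ccontr)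
    assume "x \<notin> A"
    then obtain T where "state (run M x T) = reject_state M" using assms(2) unfolding decides_def by metis
    then show False by (rule no_model[OF assms(1,3-5) _ J])
  qed
next
  assume "x \<in> A"
  then obtain T where T: "state (run M x T) = accept_state M" using assms(2) unfolding decides_def by metis
  have "state (run M x t) \<noteq> reject_state M" for t
  proof
    assume t: "state (run M x t) = reject_state M"
    have "run M x (T + t) = run M x T" "run M x (t + T) = run M x t"
      by (rule run_halted; simp add: halted_def T t)+
    then show False using T t assms(1) unfolding wf_tm_def by (simp add: add.commute)
  qed
  note m = intended_model[OF this, of N]
  have "0 \<notin> intended M x 0"
  proof
    assume "0 \<in> intended M x 0"
    then obtain j g k s where "0 = aid j g k s" unfolding intended_def by blast
    then show False using aid_nonzero[of j g k s] by simp
  qed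
  then have "\<not> sat (intended M x) 0 (Conj (map Atom [0]))" by simp
  then have "\<not> entails (tm_ont M N) (tm_data M N x) (Conj (map Atom [0]))"
    unfolding entails_def using m intended_facts[OF assms(1)] by blast
  then show "separable Q (tm_ont M N) {} {tm_data M N x}"
    unfolding separable_def using Q by blast
qed

lemma QBE_enc_input:
  "enc_input Os Ps Ns \<in> QBE L Q \<longleftrightarrow> set Os \<in> L \<and> separable Q (set Os) (set ` set Ps) (set ` set Ns)"
  "enc_input Os Ps Ns \<in> QBE_bounded b c L Q \<longleftrightarrow> set Os \<in> L \<and> separable Q (set Os) (set ` set Ps) (set ` set Ns) \<and>
     card (set ` set Ps) \<le> b \<and> card (set ` set Ns) \<le> c"
  unfolding QBE_def QBE_bounded_def by (auto dest: enc_input_inject)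

theorem QBE_hard:
  assumes Q: "Conj (map Atom [0]) \<in> Q" and A: "A \<in> PSPACE"
  shows "polytime_reducible A (QBE LTL_horn Q)" "1 \<le> c \<Longrightarrow> polytime_reducible A (QBE_bounded b c LTL_horn Q)"
proof -
  obtain M p where M: "wf_tm M" "decides M A" "\<And>x. finite (visited_cells M x)" "\<And>x. card (visited_cells M x) \<le> poly p (length x)"
    using A unfolding PSPACE_def by blast
  \<comment> \<open>The polynomial is doubled because heads may be on either side of the origin, as
    far away as the space bound.\<close>
  obtain d where d: "1 \<le> d" "\<And>n. poly (p + p) n \<le> (n + 2) ^ d" using poly_le_power[of "p + p"] by blast
  let ?O = "\<lambda>x :: bool list. rules (fixed_rules M) (shift_rules M) ((length x + 2) ^ d)"
  let ?D = "\<lambda>x. facts (start M) (cells M) ((length x + 2) ^ d) x"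
  have pt: "polytime_computable (\<lambda>x. enc_input (?O x) [] [?D x])"
    by (rule polytime_rules[OF d(1)]) (simp add: cells_def)
  have "2 * poly p (length x) \<le> (length x + 2) ^ d" for x :: "bool list" using d(2)[of "length x"] by simp
  note sep = separable_iff[OF M(1,2,3) M(4) this Q]
  have c: "card (set ` set [?D x]) = 1" for x by simp
  have "x \<in> A \<longleftrightarrow> enc_input (?O x) [] [?D x] \<in> QBE LTL_horn Q" for x
    using sep[of x] rules_horn unfolding QBE_enc_input by simp
  then show "polytime_reducible A (QBE LTL_horn Q)" unfolding polytime_reducible_def using pt by blast
  show "polytime_reducible A (QBE_bounded b c LTL_horn Q)" if "1 \<le> c"
  proof -
    have "x \<in> A \<longleftrightarrow> enc_input (?O x) [] [?D x] \<in> QBE_bounded b c LTL_horn Q" for x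
      using sep[of x] rules_horn that unfolding QBE_enc_input by simp
    then show ?thesis unfolding polytime_reducible_def using pt by blast
  qed
qed

theorem theorem4:
  fixes Q :: "ltl set"
  assumes "Q \<in> {queries {Next, Eventually}, queries {Eventually},
                 path_queries {Next, Eventually}, path_queries {Eventually}}"
  shows "PSPACE_complete (QBE LTL_horn Q) \<and>
         (\<forall>bpos bneg. 1 \<le> bneg \<longrightarrow> PSPACE_complete (QBE_bounded bpos bneg LTL_horn Q))"
proof -
  have "lang False True = queries {Next, Eventually}" "lang False False = queries {Eventually}"
    "lang True True = path_queries {Next, Eventually}" "lang True False = path_queries {Eventually}"
    unfolding lang_def ops_def by simp_all
  then obtain pth wn where Q: "Q = lang pth wn" using assms by (elim insertE emptyE) metis+
  have "Conj (map Atom [0]) \<in> queries \<Phi>" for \<Phi>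
    using queries.intros(4)[OF queries.intros(1) queries.intros(2)] by simp
  moreover have "Conj (map Atom [0]) \<in> path_queries \<Phi>" for \<Phi> by (rule path_queries.intros(1))
  ultimately have a: "Conj (map Atom [0]) \<in> Q" unfolding Q lang_def by presburger
  show ?thesis unfolding PSPACE_complete_def using QBE_hard[OF a] unfolding Q QBE_opt using QBE_opt_PSPACE by blast
qed

end
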